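(* Let $\Gamma$ be a finite group and $\xi$ a self-dual virtual character of $\Gamma$. For any $\gamma\in R(\Gamma)$, $$\mathrm{ch}\big(H_+(\gamma,z)\big)=\exp\Big(\sum_{n\ge1,\ n\ \mathrm{odd}}\frac2n\,a_{-n}(\gamma)z^n\Big),\qquad \mathrm{ch}\big(H_-(\gamma,z)\big)=\exp\Big(\sum_{n\ge1,\ n\ \mathrm{odd}}\frac2n\,a_n(\gamma)z^{-n}\Big)$$ as formal series of operators on $S_\Gamma^-$, where for $f\in\mathrm{End}(R_\Gamma^-)$ the operator $\mathrm{ch}(f)\in\mathrm{End}(S_\Gamma^-)$ is defined by $\mathrm{ch}(f).\mathrm{ch}(v)=\mathrm{ch}(f.v)$ for $v\in R_\Gamma^-$.
   Context: Groups. $\Gamma^*$ is the set of irreducible complex characters of $\Gamma$, $\Gamma_*$ the set of conjugacy classes, $\zeta_c$ the order of the centralizer of an element of $c\in\Gamma_*$, $c^{-1}=\{x^{-1}:x\in c\}$, $R(\Gamma)$ the complex class functions. $\xi$ self-dual means $\xi(c)=\xi(c^{-1})$. For $n\ge0$, $\widetilde S_n$ is the group generated by $z,t_1,\dots,t_{n-1}$ with relations $z^2=1$, $zt_i=t_iz$, $t_i^2=(t_it_{i+1})^3=z$, $t_it_j=zt_jt_i$ for $i>j+1$; it maps onto $S_n$ by $t_i\mapsto(i,i+1)$, $z\mapsto1$. It acts on $\Gamma^n$ through $S_n$ by $s(g_1,\dots,g_n)=(g_{s^{-1}(1)},\dots,g_{s^{-1}(n)})$, and $\widetilde\Gamma_n=\Gamma^n\rtimes\widetilde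 S_n$ with $(g,t)(h,s)=(g\,t(h),ts)$; $\Gamma_n=\Gamma\wr S_n=\widetilde\Gamma_n/\{1,z\}$. The parity is the homomorphism $d:\widetilde\Gamma_n\to\mathbb Z/2$ with $d(g,t_i)=1$, $d(g,z)=0$. Types. For a partition-valued function $\rho=(\rho(c))_{c\in\Gamma_*}$, $l(\rho)=\sum_cl(\rho(c))$. The type of $(g,\sigma)\in\Gamma_n$ is the $\rho$ obtained by letting each cycle $(i_1\cdots i_k)$ of $\sigma$ with $g_{i_k}\cdots g_{i_1}\in c$ contribute a part $k$ to $\rho(c)$. $\mathcal{OP}_n(\Gamma_* )$ is the set of $\rho$ with $\sum_c|\rho(c)|=n$ and all parts odd. $Z_\rho=\prod_cz_{\rho(c)}\zeta_c^{l(\rho(c))}$ with $z_\lambda=\prod_ii^{m_i}m_i!$ for $\lambda=(1^{m_1}2^{m_2}\cdots)$. Fix an order $c^0=\{1\},\dots,c^r$ of $\Gamma_*$. For $\rho\in\mathcal{OP}_n(\Gamma_* )$ cut $1,\dots,n$ into consecutive intervals whose lengths are the parts of $\rho(c^0)$ (decreasing), then of $\rho(c^1)$, etc.; $t^\rho$ is the product in this order of $t_at_{a+1}\cdots t_{b-1}$ over the intervals $\{a,\dots,b\}$ ($1$ if $a=b$). $D_\rho^+$ is the conjugacy class of $(g,t^\rho)$, where the cycle product of $g$ over each interval coming from $\rho(c^i)$ lies in $c^i$. Write $f(\rho)=f(D_\rho^+)$. The space. $R^-(\widetilde\Gamma_n)$ is the space of class functions $f$ on $\widetilde\Gamma_n$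 with $f(zx)=-f(x)$ vanishing on odd elements (determined by the $f(\rho)$); $R_\Gamma^-=\bigoplus_{n\ge0}R^-(\widetilde\Gamma_n)$. Let $\widetilde\Gamma_n\hat\times\widetilde\Gamma_m\subset\widetilde\Gamma_{n+m}$ be the preimage of $\Gamma_n\times\Gamma_m$; its elements are products $xy$, $x\in\widetilde\Gamma_n$ (using $t_1,\dots,t_{n-1}$), $y\in\widetilde\Gamma_m$ (using $t_{n+1},\dots,t_{n+m-1}$). Let $\phi(f\otimes g)(xy)=f(x)g(y)$ if $x,y$ are both even and $0$ otherwise, an isomorphism onto the class functions on $\widetilde\Gamma_n\hat\times\widetilde\Gamma_m$ changing sign under $z$ and vanishing on odd elements. The product is $f\cdot g=\mathrm{Ind}\,\phi(f\otimes g)$ and $\Delta=\bigoplus\phi^{-1}\mathrm{Res}$. Forms: $\langle f,g\rangle_\xi=\frac1{|\Gamma|}\sum_x\xi(x)f(x)g(x^{-1})$ on $R(\Gamma)$; on $R^-(\widetilde\Gamma_n)$, $\langle f,g\rangle_\xi=\frac1{|\widetilde\Gamma_n|}\sum_x\eta_n(\xi)(x)f(x)g(x^{-1})$, with $\eta_n(\xi)=\prod_c\xi(c)^{l(\rho(c))}$ on elements of type $\rho$. Operators. For $\gamma\in R(\Gamma)$, $\chi_n(\gamma)\in R^-(\widetilde\Gamma_n)$ has values $\chi_n(\gamma)(\rho)=2^{(l(\rho)-\overline n)/2}\prod_c\gamma(c)^{l(\rho(c))}$, $\overline n\in\{0,1\}$ the parity of $n$. For $n\ge0$, $H_{-n}(\gamma)f=2^{\overline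 n/2}\chi_n(\gamma)\cdot f$; for $f\in R^-(\widetilde\Gamma_m)$, $H_n(\gamma)f$ is obtained by applying $\langle2^{\overline n/2}\chi_n(\gamma),\cdot\rangle_\xi$ to the first factor of the component of $\Delta f$ in $R^-(\widetilde\Gamma_n)\otimes R^-(\widetilde\Gamma_{m-n})$ (zero if $n>m$). $H_+(\gamma,z)=\sum_{n\ge0}H_{-n}(\gamma)z^n$, $H_-(\gamma,z)=\sum_{n\ge0}H_n(\gamma)z^{-n}$. Fock space. $S_\Gamma^-$ is the polynomial algebra over $\mathbb C$ on $a_{-n}(\gamma)$, $n>0$ odd, $\gamma\in\Gamma^*$, with $a_{\pm n}(\gamma)$ extended linearly to $\gamma\in R(\Gamma)$; $a_{-n}(\gamma)$ acts by multiplication and, for odd $n>0$, $a_n(\gamma)$ acts as the derivation with $a_n(\gamma).a_{-m}(\beta)=\frac n2\delta_{n,m}\langle\gamma,\beta\rangle_\xi$. For $c\in\Gamma_*$, $a_{-n}(c)=\sum_{\gamma\in\Gamma^*}\gamma(c^{-1})a_{-n}(\gamma)$; $a'_{-\rho}=\prod_c\prod_ia_{-\rho_i(c)}(c)$. The characteristic map $\mathrm{ch}:R_\Gamma^-\to S_\Gamma^-$ is the linear isomorphism $\mathrm{ch}(f)=\sum_{\rho\in\mathcal{OP}_n(\Gamma_* )}\frac{2^{l(\rho)/2}}{Z_\rho}f(\rho)a'_{-\rho}$ for $f\in R^-(\widetilde\Gamma_n)$. *)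

theory Defs
  imports
    "Jordan_Normal_Form.Matrix"
    "HOL-Library.Poly_Mapping"
    "HOL-Library.Multiset"
    "HOL-Library.FuncSet"
    "HOL-Combinatorics.Orbits"
    Complex_Main
begin

section \<open>Finite groups: classes, class functions, characters\<close>

definition conj_class :: "('a, 'b) monoid_scheme \<Rightarrow> 'a \<Rightarrow> 'a set" where
  "conj_class G x = {y \<otimes>\<^bsub>G\<^esub> x \<otimes>\<^bsub>G\<^esub> inv\<^bsub>G\<^esub> y | y. y \<in> carrier G}"

definition conj_classes :: "('a, 'b) monoid_scheme \<Rightarrow> 'a set set" where
  "conj_classes G = conj_class G ` carrier G"

definition class_inv :: "('a, 'b) monoid_scheme \<Rightarrow> 'a set \<Rightarrow> 'a set" where
  "class_inv G c = (\<lambda>x. inv\<^bsub>G\<^esub> x) ` c"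

definition centralizer_order :: "('a, 'b) monoid_scheme \<Rightarrow> 'a set \<Rightarrow> nat" where
  "centralizer_order G c =
     (let x = (SOME x. x \<in> c) in card {y \<in> carrier G. y \<otimes>\<^bsub>G\<^esub> x = x \<otimes>\<^bsub>G\<^esub> y})"

text \<open>Functions on a group are total functions that are 0 off the carrier.\<close>

definition class_functions :: "('a, 'b) monoid_scheme \<Rightarrow> ('a \<Rightarrow> complex) set" where
  "class_functions G =
     {f. (\<forall>x. x \<notin> carrier G \<longrightarrow> f x = 0) \<and>
         (\<forall>x\<in>carrier G. \<forall>y\<in>carrier G. f (y \<otimes>\<^bsub>G\<^esub> x \<otimes>\<^bsub>G\<^esub> inv\<^bsub>G\<^esub> y) = f x)}"

definition at_class :: "('a \<Rightarrow> complex) \<Rightarrow> 'a set \<Rightarrow> complex" where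
  "at_class f c = f (SOME x. x \<in> c)"

definition matrix_rep :: "('a, 'b) monoid_scheme \<Rightarrow> nat \<Rightarrow> ('a \<Rightarrow> complex mat) \<Rightarrow> bool" where
  "matrix_rep G d R \<longleftrightarrow>
     (\<forall>x\<in>carrier G. R x \<in> carrier_mat d d) \<and> R \<one>\<^bsub>G\<^esub> = 1\<^sub>m d \<and>
     (\<forall>x\<in>carrier G. \<forall>y\<in>carrier G. R (x \<otimes>\<^bsub>G\<^esub> y) = R x * R y)"

definition invariant_subspace ::
  "('a, 'b) monoid_scheme \<Rightarrow> nat \<Rightarrow> ('a \<Rightarrow> complex mat) \<Rightarrow> complex vec set \<Rightarrow> bool" where
  "invariant_subspace G d R W \<longleftrightarrow>
     W \<subseteq> carrier_vec d \<and> 0\<^sub>v d \<in> W \<and>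
     (\<forall>u\<in>W. \<forall>v\<in>W. u + v \<in> W) \<and> (\<forall>a. \<forall>v\<in>W. a \<cdot>\<^sub>v v \<in> W) \<and>
     (\<forall>x\<in>carrier G. \<forall>v\<in>W. R x *\<^sub>v v \<in> W)"

definition irreducible_rep :: "('a, 'b) monoid_scheme \<Rightarrow> nat \<Rightarrow> ('a \<Rightarrow> complex mat) \<Rightarrow> bool" where
  "irreducible_rep G d R \<longleftrightarrow>
     matrix_rep G d R \<and> 0 < d \<and>
     (\<forall>W. invariant_subspace G d R W \<longrightarrow> W = {0\<^sub>v d} \<or> W = carrier_vec d)"

definition mat_trace :: "complex mat \<Rightarrow> complex" where
  "mat_trace A = (\<Sum>i<dim_row A. A $$ (i, i))"

definition irr_chars :: "('a, 'b) monoid_scheme \<Rightarrow> ('a \<Rightarrow> complex) set" where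
  "irr_chars G =
     {(\<lambda>x. if x \<in> carrier G then mat_trace (R x) else 0) | d R. irreducible_rep G d R}"

definition virtual_character :: "('a, 'b) monoid_scheme \<Rightarrow> ('a \<Rightarrow> complex) \<Rightarrow> bool" where
  "virtual_character G f \<longleftrightarrow>
     (\<exists>k :: ('a \<Rightarrow> complex) \<Rightarrow> int. f = (\<lambda>x. \<Sum>\<beta>\<in>irr_chars G. of_int (k \<beta>) * \<beta> x))"

definition self_dual :: "('a, 'b) monoid_scheme \<Rightarrow> ('a \<Rightarrow> complex) \<Rightarrow> bool" where
  "self_dual G f \<longleftrightarrow> (\<forall>c\<in>conj_classes G. at_class f c = at_class f (class_inv G c))"

definition base_form ::
  "('a, 'b) monoid_scheme \<Rightarrow> ('a \<Rightarrow> complex) \<Rightarrow> ('a \<Rightarrow> complex) \<Rightarrow> ('a \<Rightarrow> complex) \<Rightarrow> complex" where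
  "base_form G \<xi> f g =
     (1 / of_nat (card (carrier G))) * (\<Sum>x\<in>carrier G. \<xi> x * f x * g (inv\<^bsub>G\<^esub> x))"

text \<open>Coordinates of a class function in the basis of irreducible characters, through which
  assignments on irreducible characters are extended linearly.\<close>

definition irr_coords :: "('a, 'b) monoid_scheme \<Rightarrow> ('a \<Rightarrow> complex) \<Rightarrow> ('a \<Rightarrow> complex) \<Rightarrow> complex" where
  "irr_coords G f = (SOME k. f = (\<lambda>x. \<Sum>\<beta>\<in>irr_chars G. k \<beta> * \<beta> x))"


section \<open>Groups given by generators and relations\<close>

text \<open>A letter \<open>(x, b)\<close> is the generator \<open>x\<close> if \<open>b\<close> is false, and its formal inverse otherwise.\<close>

type_synonym 'x gword = "('x \<times> bool) list"

definition gwords :: "'x set \<Rightarrow> 'x gword set" where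
  "gwords X = lists (X \<times> UNIV)"

inductive word_eq :: "'x set \<Rightarrow> ('x gword \<times> 'x gword) set \<Rightarrow> 'x gword \<Rightarrow> 'x gword \<Rightarrow> bool"
  for X R where
  refl: "w \<in> gwords X \<Longrightarrow> word_eq X R w w"
| sym: "word_eq X R u v \<Longrightarrow> word_eq X R v u"
| trans: "word_eq X R u v \<Longrightarrow> word_eq X R v w \<Longrightarrow> word_eq X R u w"
| append: "word_eq X R u u' \<Longrightarrow> word_eq X R v v' \<Longrightarrow> word_eq X R (u @ v) (u' @ v')"
| cancel: "x \<in> X \<Longrightarrow> word_eq X R [(x, b), (x, \<not> b)] []"
| relation: "(u, v) \<in> R \<Longrightarrow> u \<in> gwords X \<Longrightarrow> v \<in> gwords X \<Longrightarrow> word_eq X R u v"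

definition word_class :: "'x set \<Rightarrow> ('x gword \<times> 'x gword) set \<Rightarrow> 'x gword \<Rightarrow> 'x gword set" where
  "word_class X R w = {v. word_eq X R w v}"

definition presented_group :: "'x set \<Rightarrow> ('x gword \<times> 'x gword) set \<Rightarrow> 'x gword set monoid" where
  "presented_group X R =
     \<lparr> carrier = word_class X R ` gwords X,
       mult = (\<lambda>A B. \<Union>u\<in>A. \<Union>v\<in>B. word_class X R (u @ v)),
       one = word_class X R [] \<rparr>"


section \<open>The double cover of the symmetric group\<close>

datatype spin_gen = Zgen | Tgen nat

type_synonym spin_word = "spin_gen gword"

abbreviation zl :: "spin_gen \<times> bool" where "zl \<equiv> (Zgen, False)"
abbreviation tl_at :: "nat \<Rightarrow> spin_gen \<times> bool" where "tl_at i \<equiv> (Tgen i, False)"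

definition spin_gens :: "nat \<Rightarrow> spin_gen set" where
  "spin_gens n = insert Zgen {Tgen i | i. 1 \<le> i \<and> i < n}"

definition spin_rels :: "nat \<Rightarrow> (spin_word \<times> spin_word) set" where
  "spin_rels n =
     {([zl, zl], [])}
   \<union> {([zl, tl_at i], [tl_at i, zl]) | i. 1 \<le> i \<and> i < n}
   \<union> {([tl_at i, tl_at i], [zl]) | i. 1 \<le> i \<and> i < n}
   \<union> {(concat (replicate 3 [tl_at i, tl_at (i + 1)]), [zl]) | i. 1 \<le> i \<and> i + 1 < n}
   \<union> {([tl_at i, tl_at j], [zl, tl_at j, tl_at i]) | i j. 1 \<le> j \<and> j + 1 < i \<and> i < n}"

definition spin_class :: "nat \<Rightarrow> spin_word \<Rightarrow> spin_word set" where
  "spin_class n = word_class (spin_gens n) (spin_rels n)"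

definition spin_sym :: "nat \<Rightarrow> spin_word set monoid" where
  "spin_sym n = presented_group (spin_gens n) (spin_rels n)"

text \<open>Permutations are multiplied as functions.\<close>

fun letter_perm :: "spin_gen \<times> bool \<Rightarrow> nat \<Rightarrow> nat" where
  "letter_perm (Zgen, b) = id"
| "letter_perm (Tgen i, b) = transpose i (i + 1)"

definition word_perm :: "spin_word \<Rightarrow> nat \<Rightarrow> nat" where
  "word_perm w = foldr (\<lambda>l p. letter_perm l \<circ> p) w id"

definition word_even :: "spin_word \<Rightarrow> bool" where
  "word_even w \<longleftrightarrow> even (length (filter (\<lambda>l. fst l \<noteq> Zgen) w))"

text \<open>The values on any representing word agree, since both respect the relations.\<close>

definition spin_perm :: "spin_word set \<Rightarrow> nat \<Rightarrow> nat" where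
  "spin_perm A = word_perm (SOME w. w \<in> A)"

definition spin_even :: "spin_word set \<Rightarrow> bool" where
  "spin_even A = word_even (SOME w. w \<in> A)"


section \<open>The spin wreath products\<close>

type_synonym 'a wr_elt = "(nat \<Rightarrow> 'a) \<times> spin_word set"

definition spin_wreath :: "('a, 'b) monoid_scheme \<Rightarrow> nat \<Rightarrow> 'a wr_elt monoid" where
  "spin_wreath G n =
     \<lparr> carrier = ({1..n} \<rightarrow>\<^sub>E carrier G) \<times> carrier (spin_sym n),
       mult = (\<lambda>(g, t) (h, s).
         ((\<lambda>i\<in>{1..n}. g i \<otimes>\<^bsub>G\<^esub> h (inv_into UNIV (spin_perm t) i)), t \<otimes>\<^bsub>spin_sym n\<^esub> s)),
       one = ((\<lambda>i\<in>{1..n}. \<one>\<^bsub>G\<^esub>), \<one>\<^bsub>spin_sym n\<^esub>) \<rparr>"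

definition wr_even :: "'a wr_elt \<Rightarrow> bool" where
  "wr_even x = spin_even (snd x)"

definition wr_z :: "('a, 'b) monoid_scheme \<Rightarrow> nat \<Rightarrow> 'a wr_elt" where
  "wr_z G n = ((\<lambda>i\<in>{1..n}. \<one>\<^bsub>G\<^esub>), spin_class n [zl])"

text \<open>For a cycle \<open>(i\<^sub>1 \<dots> i\<^sub>k)\<close> given as a list, the product \<open>g i\<^sub>k \<cdots> g i\<^sub>1\<close>.\<close>

definition cycle_product :: "('a, 'b) monoid_scheme \<Rightarrow> (nat \<Rightarrow> 'a) \<Rightarrow> nat list \<Rightarrow> 'a" where
  "cycle_product G g is = foldr (\<lambda>i p. g i \<otimes>\<^bsub>G\<^esub> p) (rev is) \<one>\<^bsub>G\<^esub>"

definition cycle_from :: "(nat \<Rightarrow> nat) \<Rightarrow> nat \<Rightarrow> nat list" where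
  "cycle_from \<sigma> i = map (\<lambda>j. (\<sigma> ^^ j) i) [0..<card (orbit \<sigma> i)]"

text \<open>Partitions are multisets of positive integers. Changing the starting point of a cycle
  conjugates its cycle product, so any point of the orbit may be used.\<close>

definition wr_type :: "('a, 'b) monoid_scheme \<Rightarrow> nat \<Rightarrow> 'a wr_elt \<Rightarrow> 'a set \<Rightarrow> nat multiset" where
  "wr_type G n x c =
     (let \<sigma> = spin_perm (snd x)
      in image_mset card (mset_set
           {C \<in> orbit \<sigma> ` {1..n}. \<exists>i\<in>C. cycle_product G (fst x) (cycle_from \<sigma> i) \<in> c}))"


section \<open>Partition-valued functions and the classes \<open>D\<^sub>\<rho>\<^sup>+\<close>\<close>

definition OP :: "('a, 'b) monoid_scheme \<Rightarrow> nat \<Rightarrow> ('a set \<Rightarrow> nat multiset) set" where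
  "OP G n =
     {\<rho>. (\<forall>c. c \<notin> conj_classes G \<longrightarrow> \<rho> c = {#}) \<and>
         (\<forall>c\<in>conj_classes G. \<forall>k\<in>#\<rho> c. odd k) \<and>
         (\<Sum>c\<in>conj_classes G. sum_mset (\<rho> c)) = n}"

definition pv_length :: "('a, 'b) monoid_scheme \<Rightarrow> ('a set \<Rightarrow> nat multiset) \<Rightarrow> nat" where
  "pv_length G \<rho> = (\<Sum>c\<in>conj_classes G. size (\<rho> c))"

definition part_z :: "nat multiset \<Rightarrow> nat" where
  "part_z p = (\<Prod>i\<in>set_mset p. i ^ count p i * fact (count p i))"

definition pv_Z :: "('a, 'b) monoid_scheme \<Rightarrow> ('a set \<Rightarrow> nat multiset) \<Rightarrow> nat" where
  "pv_Z G \<rho> = (\<Prod>c\<in>conj_classes G. part_z (\<rho> c) * centralizer_order G c ^ size (\<rho> c))"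

definition class_order :: "('a, 'b) monoid_scheme \<Rightarrow> 'a set list \<Rightarrow> bool" where
  "class_order G cs \<longleftrightarrow> distinct cs \<and> set cs = conj_classes G \<and> hd cs = {\<one>\<^bsub>G\<^esub>}"

text \<open>The consecutive intervals attached to \<open>\<rho>\<close>, as a list of pairs (class, length); the
  \<open>j\<close>-th interval starts at \<^term>\<open>block_start ks j\<close> where \<open>ks\<close> is the list of lengths.\<close>

definition blocks :: "'a set list \<Rightarrow> ('a set \<Rightarrow> nat multiset) \<Rightarrow> ('a set \<times> nat) list" where
  "blocks cs \<rho> = concat (map (\<lambda>c. map (Pair c) (rev (sorted_list_of_multiset (\<rho> c)))) cs)"

definition block_start :: "nat list \<Rightarrow> nat \<Rightarrow> nat" where
  "block_start ks j = 1 + sum_list (take j ks)"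

definition block_word :: "nat list \<Rightarrow> spin_word" where
  "block_word ks =
     concat (map (\<lambda>j. map tl_at [block_start ks j ..< block_start ks j + ks ! j - 1]) [0..<length ks])"

definition D_plus ::
  "('a, 'b) monoid_scheme \<Rightarrow> 'a set list \<Rightarrow> nat \<Rightarrow> ('a set \<Rightarrow> nat multiset) \<Rightarrow> 'a wr_elt set" where
  "D_plus G cs n \<rho> =
     (let bs = blocks cs \<rho>; ks = map snd bs
      in \<Union> {conj_class (spin_wreath G n) (g, spin_class n (block_word ks)) | g.
            g \<in> {1..n} \<rightarrow>\<^sub>E carrier G \<and>
            (\<forall>j<length bs. cycle_product G g
               [block_start ks j ..< block_start ks j + ks ! j] \<in> fst (bs ! j))})"

definition at_D :: "('a, 'b) monoid_scheme \<Rightarrow> 'a set list \<Rightarrow> nat \<Rightarrow>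
    ('a wr_elt \<Rightarrow> complex) \<Rightarrow> ('a set \<Rightarrow> nat multiset) \<Rightarrow> complex" where
  "at_D G cs n f \<rho> = at_class f (D_plus G cs n \<rho>)"


section \<open>The space \<open>R\<^sub>\<Gamma>\<^sup>-\<close>, its product and coproduct\<close>

definition R_minus :: "('a, 'b) monoid_scheme \<Rightarrow> nat \<Rightarrow> ('a wr_elt \<Rightarrow> complex) set" where
  "R_minus G n =
     {f \<in> class_functions (spin_wreath G n).
        (\<forall>x\<in>carrier (spin_wreath G n). f (wr_z G n \<otimes>\<^bsub>spin_wreath G n\<^esub> x) = - f x) \<and>
        (\<forall>x\<in>carrier (spin_wreath G n). \<not> wr_even x \<longrightarrow> f x = 0)}"

type_synonym 'a graded = "nat \<Rightarrow> 'a wr_elt \<Rightarrow> complex"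

definition R_total :: "('a, 'b) monoid_scheme \<Rightarrow> 'a graded set" where
  "R_total G = {F. (\<forall>n. F n \<in> R_minus G n) \<and> finite {n. F n \<noteq> (\<lambda>x. 0)}}"

text \<open>\<^term>\<open>embed_left\<close> and \<^term>\<open>embed_right\<close> are the maps of the \<open>n\<close>-th and the \<open>m\<close>-th group
  into the \<open>(n+m)\<close>-th one, the latter shifting \<open>t\<^sub>i\<close> to \<open>t\<^bsub>n+i\<^esub>\<close>.\<close>

definition shift_word :: "nat \<Rightarrow> spin_word \<Rightarrow> spin_word" where
  "shift_word n = map (\<lambda>(x, b). (case x of Zgen \<Rightarrow> Zgen | Tgen i \<Rightarrow> Tgen (n + i), b))"

definition embed_left :: "('a, 'b) monoid_scheme \<Rightarrow> nat \<Rightarrow> nat \<Rightarrow> 'a wr_elt \<Rightarrow> 'a wr_elt" where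
  "embed_left G n m = (\<lambda>(g, A).
     ((\<lambda>i\<in>{1..n + m}. if i \<le> n then g i else \<one>\<^bsub>G\<^esub>),
      \<Union>w\<in>A. spin_class (n + m) w))"

definition embed_right :: "('a, 'b) monoid_scheme \<Rightarrow> nat \<Rightarrow> nat \<Rightarrow> 'a wr_elt \<Rightarrow> 'a wr_elt" where
  "embed_right G n m = (\<lambda>(g, A).
     ((\<lambda>i\<in>{1..n + m}. if i \<le> n then \<one>\<^bsub>G\<^esub> else g (i - n)),
      \<Union>w\<in>A. spin_class (n + m) (shift_word n w)))"

definition young_sub :: "('a, 'b) monoid_scheme \<Rightarrow> nat \<Rightarrow> nat \<Rightarrow> 'a wr_elt set" where
  "young_sub G n m =
     {w \<in> carrier (spin_wreath G (n + m)). spin_perm (snd w) ` {1..n} = {1..n}}"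

text \<open>The tensor product of two spaces of functions is realised as a space of functions of two
  variables, \<open>f \<otimes> g\<close> being \<open>(x, y) \<mapsto> f x * g y\<close>.\<close>

type_synonym 'a tensor = "'a wr_elt \<times> 'a wr_elt \<Rightarrow> complex"

definition tens :: "('a wr_elt \<Rightarrow> complex) \<Rightarrow> ('a wr_elt \<Rightarrow> complex) \<Rightarrow> 'a tensor" where
  "tens f g = (\<lambda>(x, y). f x * g y)"

definition R_tensor :: "('a, 'b) monoid_scheme \<Rightarrow> nat \<Rightarrow> nat \<Rightarrow> 'a tensor set" where
  "R_tensor G n m =
     {(\<lambda>p. \<Sum>i<k. tens (f i) (g i) p) | (k :: nat) f g.
        \<forall>i<k. f i \<in> R_minus G n \<and> g i \<in> R_minus G m}"

definition phi :: "('a, 'b) monoid_scheme \<Rightarrow> nat \<Rightarrow> nat \<Rightarrow> 'a tensor \<Rightarrow> 'a wr_elt \<Rightarrow> complex" where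
  "phi G n m T w =
     (if w \<in> young_sub G n m then
        (let (x, y) = (SOME (x, y). x \<in> carrier (spin_wreath G n) \<and> y \<in> carrier (spin_wreath G m) \<and>
                w = embed_left G n m x \<otimes>\<^bsub>spin_wreath G (n + m)\<^esub> embed_right G n m y)
         in if wr_even x \<and> wr_even y then T (x, y) else 0)
      else 0)"

definition res_fun :: "'g set \<Rightarrow> ('g \<Rightarrow> complex) \<Rightarrow> 'g \<Rightarrow> complex" where
  "res_fun H f x = (if x \<in> H then f x else 0)"

definition ind_fun :: "('g, 'b) monoid_scheme \<Rightarrow> 'g set \<Rightarrow> ('g \<Rightarrow> complex) \<Rightarrow> 'g \<Rightarrow> complex" where
  "ind_fun K H f x =
     (if x \<in> carrier K
      then (1 / of_nat (card H)) *
           (\<Sum>y\<in>carrier K. res_fun H f (inv\<^bsub>K\<^esub> y \<otimes>\<^bsub>K\<^esub> x \<otimes>\<^bsub>K\<^esub> y))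
      else 0)"

definition R_mult :: "('a, 'b) monoid_scheme \<Rightarrow> 'a graded \<Rightarrow> 'a graded \<Rightarrow> 'a graded" where
  "R_mult G F F' = (\<lambda>N x. \<Sum>i\<le>N.
     ind_fun (spin_wreath G N) (young_sub G i (N - i)) (phi G i (N - i) (tens (F i) (F' (N - i)))) x)"

definition coproduct ::
  "('a, 'b) monoid_scheme \<Rightarrow> nat \<Rightarrow> nat \<Rightarrow> ('a wr_elt \<Rightarrow> complex) \<Rightarrow> 'a tensor" where
  "coproduct G n m f = inv_into (R_tensor G n m) (phi G n m) (res_fun (young_sub G n m) f)"

definition eta :: "('a, 'b) monoid_scheme \<Rightarrow> ('a \<Rightarrow> complex) \<Rightarrow> nat \<Rightarrow> 'a wr_elt \<Rightarrow> complex" where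
  "eta G \<xi> n x = (\<Prod>c\<in>conj_classes G. at_class \<xi> c ^ size (wr_type G n x c))"

definition wr_form :: "('a, 'b) monoid_scheme \<Rightarrow> ('a \<Rightarrow> complex) \<Rightarrow> nat \<Rightarrow>
    ('a wr_elt \<Rightarrow> complex) \<Rightarrow> ('a wr_elt \<Rightarrow> complex) \<Rightarrow> complex" where
  "wr_form G \<xi> n f g =
     (let K = spin_wreath G n
      in (1 / of_nat (card (carrier K))) *
         (\<Sum>x\<in>carrier K. eta G \<xi> n x * f x * g (inv\<^bsub>K\<^esub> x)))"


section \<open>The operators \<open>H\<^sub>\<plusminus>\<close>\<close>

definition chi :: "('a, 'b) monoid_scheme \<Rightarrow> 'a set list \<Rightarrow> nat \<Rightarrow> ('a \<Rightarrow> complex) \<Rightarrow>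
    'a wr_elt \<Rightarrow> complex" where
  "chi G cs n \<gamma> =
     (THE f. f \<in> R_minus G n \<and>
        (\<forall>\<rho>\<in>OP G n. at_D G cs n f \<rho> =
           of_real (2 powr ((real (pv_length G \<rho>) - real (n mod 2)) / 2)) *
           (\<Prod>c\<in>conj_classes G. at_class \<gamma> c ^ size (\<rho> c))))"

definition scaled_chi :: "('a, 'b) monoid_scheme \<Rightarrow> 'a set list \<Rightarrow> nat \<Rightarrow> ('a \<Rightarrow> complex) \<Rightarrow>
    'a wr_elt \<Rightarrow> complex" where
  "scaled_chi G cs n \<gamma> = (\<lambda>x. of_real (2 powr (real (n mod 2) / 2)) * chi G cs n \<gamma> x)"

text \<open>\<^term>\<open>H_plus G cs \<gamma> n\<close> is \<open>H\<^bsub>-n\<^esub>(\<gamma>)\<close>, the coefficient of \<open>z\<^sup>n\<close> in \<open>H\<^sub>+(\<gamma>, z)\<close>.\<close>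

definition H_plus :: "('a, 'b) monoid_scheme \<Rightarrow> 'a set list \<Rightarrow> ('a \<Rightarrow> complex) \<Rightarrow> nat \<Rightarrow>
    'a graded \<Rightarrow> 'a graded" where
  "H_plus G cs \<gamma> n F = R_mult G (\<lambda>k. if k = n then scaled_chi G cs n \<gamma> else (\<lambda>x. 0)) F"

text \<open>\<^term>\<open>H_minus G cs \<xi> \<gamma> n\<close> is \<open>H\<^sub>n(\<gamma>)\<close>, the coefficient of \<open>z\<^bsup>-n\<^esup>\<close> in \<open>H\<^sub>-(\<gamma>, z)\<close>. In terms of
  functions of two variables, applying a functional to the first tensor factor means applying it
  for each fixed value of the second variable.\<close>

definition H_minus :: "('a, 'b) monoid_scheme \<Rightarrow> 'a set list \<Rightarrow> ('a \<Rightarrow> complex) \<Rightarrow>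
    ('a \<Rightarrow> complex) \<Rightarrow> nat \<Rightarrow> 'a graded \<Rightarrow> 'a graded" where
  "H_minus G cs \<xi> \<gamma> n F = (\<lambda>k y.
     wr_form G \<xi> n (scaled_chi G cs n \<gamma>) (\<lambda>x. coproduct G n k (F (n + k)) (x, y)))"


section \<open>Fock space and characteristic map\<close>

text \<open>The variable \<open>(n, \<gamma>)\<close> stands for \<open>a\<^bsub>-n\<^esub>(\<gamma>)\<close>; polynomials are finitely supported
  coefficient functions on exponent vectors.\<close>

type_synonym 'a fvar = "nat \<times> ('a \<Rightarrow> complex)"
type_synonym 'a fpoly = "('a fvar \<Rightarrow>\<^sub>0 nat) \<Rightarrow>\<^sub>0 complex"

definition fconst :: "complex \<Rightarrow> 'a fpoly" where
  "fconst c = Poly_Mapping.single 0 c"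

definition fvar :: "'a fvar \<Rightarrow> 'a fpoly" where
  "fvar v = Poly_Mapping.single (Poly_Mapping.single v 1) 1"

definition fock_space :: "('a, 'b) monoid_scheme \<Rightarrow> 'a fpoly set" where
  "fock_space G = {p. \<forall>\<mu>\<in>Poly_Mapping.keys p. \<forall>(n, \<beta>)\<in>Poly_Mapping.keys \<mu>. odd n \<and> \<beta> \<in> irr_chars G}"

definition a_neg :: "('a, 'b) monoid_scheme \<Rightarrow> nat \<Rightarrow> ('a \<Rightarrow> complex) \<Rightarrow> 'a fpoly" where
  "a_neg G n \<gamma> = (\<Sum>\<beta>\<in>irr_chars G. fconst (irr_coords G \<gamma> \<beta>) * fvar (n, \<beta>))"

text \<open>The derivation with prescribed values on the variables, \<open>p \<mapsto> \<Sum>\<^sub>v (\<partial>p/\<partial>v) * d v\<close>.\<close>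

definition derivation_of :: "('a fvar \<Rightarrow> 'a fpoly) \<Rightarrow> 'a fpoly \<Rightarrow> 'a fpoly" where
  "derivation_of d p =
     (\<Sum>\<mu>\<in>Poly_Mapping.keys p. \<Sum>v\<in>Poly_Mapping.keys \<mu>.
        Poly_Mapping.single (\<mu> - Poly_Mapping.single v 1)
          (Poly_Mapping.lookup p \<mu> * of_nat (Poly_Mapping.lookup \<mu> v)) * d v)"

definition a_pos :: "('a, 'b) monoid_scheme \<Rightarrow> ('a \<Rightarrow> complex) \<Rightarrow> nat \<Rightarrow> ('a \<Rightarrow> complex) \<Rightarrow>
    'a fpoly \<Rightarrow> 'a fpoly" where
  "a_pos G \<xi> n \<gamma> = derivation_of (\<lambda>(m, \<beta>).
     fconst (if n = m then (of_nat n / 2) * base_form G \<xi> \<gamma> \<beta> else 0))"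

definition a_neg_class :: "('a, 'b) monoid_scheme \<Rightarrow> nat \<Rightarrow> 'a set \<Rightarrow> 'a fpoly" where
  "a_neg_class G n c =
     (\<Sum>\<beta>\<in>irr_chars G. fconst (at_class \<beta> (class_inv G c)) * fvar (n, \<beta>))"

definition a_neg_pv :: "('a, 'b) monoid_scheme \<Rightarrow> ('a set \<Rightarrow> nat multiset) \<Rightarrow> 'a fpoly" where
  "a_neg_pv G \<rho> = (\<Prod>c\<in>conj_classes G. prod_mset (image_mset (\<lambda>k. a_neg_class G k c) (\<rho> c)))"

definition ch_deg :: "('a, 'b) monoid_scheme \<Rightarrow> 'a set list \<Rightarrow> nat \<Rightarrow> ('a wr_elt \<Rightarrow> complex) \<Rightarrow> 'a fpoly" where
  "ch_deg G cs n f =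
     (\<Sum>\<rho>\<in>OP G n.
        fconst (of_real (2 powr (real (pv_length G \<rho>) / 2)) / of_nat (pv_Z G \<rho>) * at_D G cs n f \<rho>)
        * a_neg_pv G \<rho>)"

definition ch :: "('a, 'b) monoid_scheme \<Rightarrow> 'a set list \<Rightarrow> 'a graded \<Rightarrow> 'a fpoly" where
  "ch G cs F = (\<Sum>n | F n \<noteq> (\<lambda>x. 0). ch_deg G cs n (F n))"

text \<open>Transport of operators along the linear isomorphism \<^term>\<open>ch G cs\<close>.\<close>

definition ch_op :: "('a, 'b) monoid_scheme \<Rightarrow> 'a set list \<Rightarrow> ('a graded \<Rightarrow> 'a graded) \<Rightarrow>
    'a fpoly \<Rightarrow> 'a fpoly" where
  "ch_op G cs T p = ch G cs (T (inv_into (R_total G) (ch G cs) p))"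


section \<open>Formal series of operators on polynomials\<close>

text \<open>A series is its sequence of coefficients in one formal variable (\<open>z\<close> or \<open>z\<^bsup>-1\<^esup>\<close>).\<close>

type_synonym 'a opseries = "nat \<Rightarrow> 'a fpoly \<Rightarrow> 'a fpoly"

definition ops_mult :: "'a opseries \<Rightarrow> 'a opseries \<Rightarrow> 'a opseries" where
  "ops_mult A B = (\<lambda>N p. \<Sum>i\<le>N. A i (B (N - i) p))"

fun ops_power :: "'a opseries \<Rightarrow> nat \<Rightarrow> 'a opseries" where
  "ops_power A 0 = (\<lambda>N p. if N = 0 then p else 0)"
| "ops_power A (Suc k) = ops_mult A (ops_power A k)"

text \<open>Meant for series without constant term: then the \<open>k\<close>-th power has no coefficient in
  degrees below \<open>k\<close>, and the sum may stop at \<open>N\<close>.\<close>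

definition ops_exp :: "'a opseries \<Rightarrow> 'a opseries" where
  "ops_exp A = (\<lambda>N p. \<Sum>k\<le>N. fconst (1 / fact k) * ops_power A k N p)"

end

(* The characteristic map becomes computable once R^- is read off from types: an element of the
   double cover whose cycles all have odd length has an intrinsic sign (of its lift of odd order,
   detected in a Clifford module), a class function in R^- is this sign times a function of the
   type, and it vanishes elsewhere because an even element with a cycle of even length is conjugate
   to its product with z. So R^- of degree n is the space of functions on multisets of labels
   (class, odd length), and ch f is the average of f against one class function Psi with values in
   Fock space. Psi is multiplicative on Young subgroups, hence Frobenius reciprocity makes ch
   multiplicative, and H_+ becomes multiplication by E_N = ch(chi_N); the operator H_N becomes
   u -> sum over sigma of wt(sigma) S^sigma u(sigma + .). Both families satisfy the recursion
   N X_N = sum_n n A_n X_(N-n) that characterises the exponential of sum_n A_n z^n, because the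
   weights of multisets do. The orthonormality and completeness of the irreducible characters
   translate between the variables a_(-n)(gamma) and a_(-n)(c). *)

theory Submission
  imports Defs "Jordan_Normal_Form.Spectral_Radius" "HOL-Library.Function_Algebras"
begin

text \<open>A presentation bounds a group only from above: that \<open>z\<close> differs from 1, and
  more generally when two words are equal, needs a representation in which \<open>z\<close> acts as
  -1. The Clifford module supplies it; together with the permutation it separates words completely,
  and all later arguments use only these two invariants and parity. The sign of a lift is defined
  through its order and not by a formula, because order visibly survives conjugation, inversion,
  commuting products and shifts of the points. The price is a correction by the signs of standard
  cycles, since t^\<rho> itself need not have odd order. The factor 1/Z is met as the proportion of
  group elements of a given type, which is counted by inserting points one at a time. In H_+ one
  factor sqrt 2 per part comes from \<open>chi\<close> and one from \<open>ch\<close>; together they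
  give the 2 in the exponent. In H_- the single factor from \<open>chi\<close> completes the
  normalisation of the argument. Operators are transported through some preimage under
  \<open>ch\<close>. The identities are proved for every element of \<open>R_total\<close>, so what
  remains is that preimages exist, that is, that the class variables generate Fock space.\<close>

lemmas sum_cong = sum.cong[OF HOL.refl]

section \<open>A Clifford model of the double cover\<close>

text \<open>The Clifford algebra acts on functions of finite sets \<open>S\<close> (monomials in the generators):
  the \<open>i\<close>-th generator adds or removes \<open>i\<close>, with the sign of moving it into place. The element
  \<open>t\<^sub>i\<close> acts as the normalised difference of two neighbouring generators.\<close>

definition clif_sgn :: "nat \<Rightarrow> nat set \<Rightarrow> real" where
  "clif_sgn i S = (- 1) ^ card {j \<in> S. j < i} * (if i \<in> S then 1 else - 1)"

definition clif :: "nat \<Rightarrow> (nat set \<Rightarrow> real) \<Rightarrow> nat set \<Rightarrow> real" where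
  "clif i f S = clif_sgn i S * f (sym_diff S {i})"

lemma sym_diff_twice [simp]: "sym_diff (sym_diff S A) A = S"
  by auto

lemma clif_sgn_flip:
  "clif_sgn i (sym_diff S {i}) = - clif_sgn i S"
proof -
  have "{j \<in> sym_diff S {i}. j < i} = {j \<in> S. j < i}" by auto
  thus ?thesis by (auto simp: clif_sgn_def)
qed

lemma clif_sgn_less:
  assumes "i < j" shows "clif_sgn i (sym_diff S {j}) = clif_sgn i S"
proof -
  have "{k \<in> sym_diff S {j}. k < i} = {k \<in> S. k < i}" using assms by auto
  thus ?thesis using assms by (auto simp: clif_sgn_def)
qed

text \<open>The sign of \<open>j\<close> counts the smaller elements of the set, so it feels
  \<open>i\<close>, while the sign of \<open>i\<close> does not feel \<open>j\<close>
  (\<open>clif_sgn_less\<close>). This asymmetry is the source of anticommutation.\<close>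

lemma clif_sgn_greater:
  assumes "i < j" shows "clif_sgn j (sym_diff S {i}) = - clif_sgn j S"
proof (cases "i \<in> S")
  case True
  have e: "{k \<in> S. k < j} = insert i {k \<in> sym_diff S {i}. k < j}" using assms True by auto
  have "card {k \<in> S. k < j} = Suc (card {k \<in> sym_diff S {i}. k < j})"
    unfolding e using True by (subst card_insert_disjoint) auto
  thus ?thesis using assms by (auto simp: clif_sgn_def)
next
  case False
  have e: "{k \<in> sym_diff S {i}. k < j} = insert i {k \<in> S. k < j}" using assms False by auto
  have "card {k \<in> sym_diff S {i}. k < j} = Suc (card {k \<in> S. k < j})"
    unfolding e using False by (subst card_insert_disjoint) auto
  thus ?thesis using assms by (auto simp: clif_sgn_def)
qed

lemma clif_sgn_square [simp]: "clif_sgn i S * clif_sgn i S = 1"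
  by (auto simp: clif_sgn_def simp flip: power_add mult_2)

lemma clif_sgn_square_left [simp]: "clif_sgn i S * (clif_sgn i S * x) = x"
  by (simp flip: mult.assoc)

lemma clif_square: "clif i (clif i f) = (\<lambda>S. - f S)"
  unfolding clif_def by (rule ext) (simp add: clif_sgn_flip)

lemma clif_anticommute_less:
  assumes "i < j" shows "clif i (clif j f) S = - clif j (clif i f) S"
proof -
  have "sym_diff (sym_diff S {i}) {j} = sym_diff (sym_diff S {j}) {i}" using assms by auto
  thus ?thesis using clif_sgn_less[OF assms, of S] clif_sgn_greater[OF assms, of S]
    by (simp add: clif_def)
qed

lemma clif_anticommute:
  assumes "i \<noteq> j" shows "clif i (clif j f) = (\<lambda>S. - clif j (clif i f) S)"
  using clif_anticommute_less[of i j f] clif_anticommute_less[of j i f] assms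
  by (cases "i < j") (auto simp: fun_eq_iff)

text \<open>The difference of two anticommuting square roots of -1 has square -2; the factor
  \<open>sqrt 2\<close> brings this to -1, the action required of \<open>z\<close>.\<close>

definition clif_gen :: "nat \<Rightarrow> (nat set \<Rightarrow> real) \<Rightarrow> nat set \<Rightarrow> real" where
  "clif_gen i f = (\<lambda>S. (clif i f S - clif (i + 1) f S) / sqrt 2)"

fun clif_letter :: "spin_gen \<times> bool \<Rightarrow> (nat set \<Rightarrow> real) \<Rightarrow> nat set \<Rightarrow> real" where
  "clif_letter (Zgen, b) f = (\<lambda>S. - f S)"
| "clif_letter (Tgen i, False) f = clif_gen i f"
| "clif_letter (Tgen i, True) f = (\<lambda>S. - clif_gen i f S)"

definition clif_word :: "spin_word \<Rightarrow> (nat set \<Rightarrow> real) \<Rightarrow> nat set \<Rightarrow> real" where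
  "clif_word w = foldr (\<lambda>l p. clif_letter l \<circ> p) w id"

lemma clif_add: "clif i (\<lambda>S. f S + g S) = (\<lambda>S. clif i f S + clif i g S)"
  by (simp add: clif_def fun_eq_iff algebra_simps)
lemma clif_diff: "clif i (\<lambda>S. f S - g S) = (\<lambda>S. clif i f S - clif i g S)"
  by (simp add: clif_def fun_eq_iff algebra_simps)
lemma clif_minus: "clif i (\<lambda>S. - f S) = (\<lambda>S. - clif i f S)"
  by (simp add: clif_def fun_eq_iff)
lemma clif_divide: "clif i (\<lambda>S. f S / c) = (\<lambda>S. clif i f S / c)"
  by (simp add: clif_def fun_eq_iff)

lemmas clif_linear = clif_add clif_diff clif_minus clif_divide

lemma clif_gen_minus: "clif_gen i (\<lambda>S. - f S) = (\<lambda>S. - clif_gen i f S)"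
  by (simp add: clif_gen_def clif_minus fun_eq_iff diff_divide_distrib)
lemma clif_gen_diff: "clif_gen i (\<lambda>S. f S - g S) = (\<lambda>S. clif_gen i f S - clif_gen i g S)"
  by (simp add: clif_gen_def clif_diff fun_eq_iff diff_divide_distrib)
lemma clif_gen_add: "clif_gen i (\<lambda>S. f S + g S) = (\<lambda>S. clif_gen i f S + clif_gen i g S)"
  by (simp add: clif_gen_def clif_add fun_eq_iff diff_divide_distrib add_divide_distrib)

lemma clif_gen_square: "clif_gen i (clif_gen i f) = (\<lambda>S. - f S)"
  by (simp add: clif_gen_def clif_linear clif_square clif_anticommute[of "Suc i" i] fun_eq_iff field_simps)

lemma clif_gen_anticommute:
  assumes "j + 1 < i"
  shows "clif_gen i (clif_gen j f) = (\<lambda>S. - clif_gen j (clif_gen i f) S)"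
  using assms
  by (simp add: clif_gen_def clif_linear clif_anticommute[of i j] clif_anticommute[of "Suc i" j]
      clif_anticommute[of i "Suc j"] clif_anticommute[of "Suc i" "Suc j"] fun_eq_iff field_simps)

lemma clif_gen_braid_sum:
  "clif_gen i (clif_gen (i + 1) f) = (\<lambda>S. f S - clif_gen (i + 1) (clif_gen i f) S)"
  by (simp add: clif_gen_def clif_linear clif_square clif_anticommute[of "Suc i" i]
      clif_anticommute[of "Suc (Suc i)" i] clif_anticommute[of "Suc (Suc i)" "Suc i"] fun_eq_iff field_simps)

text \<open>The two generators a, b satisfy ab + ba = 1 (\<open>clif_gen_braid_sum\<close>), so T =
  ab is a root of X^2 - X + 1, which divides X^3 + 1.\<close>

lemma clif_gen_order_three:
  "clif_gen i (clif_gen (i + 1) (clif_gen i (clif_gen (i + 1) (clif_gen i (clif_gen (i + 1) f)))))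
    = (\<lambda>S. - f S)"
proof -
  define T where "T = (\<lambda>f. clif_gen i (clif_gen (i + 1) f))"
  have *: "T (T f) = (\<lambda>S. T f S - f S)" for f
  proof -
    have "T (T f) = T (\<lambda>S. f S - clif_gen (i + 1) (clif_gen i f) S)"
      by (simp only: T_def clif_gen_braid_sum)
    also have "\<dots> = (\<lambda>S. T f S - f S)"
      by (simp add: T_def clif_gen_diff clif_gen_add clif_gen_square clif_gen_minus)
    finally show ?thesis .
  qed
  have "T (T (T f)) = (\<lambda>S. - f S)" by (subst *) (simp add: * fun_eq_iff)
  thus ?thesis by (simp add: T_def)
qed

lemma clif_word_Nil [simp]: "clif_word [] = id"
  and clif_word_Cons [simp]: "clif_word (l # w) = clif_letter l \<circ> clif_word w"
  by (simp_all add: clif_word_def)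

lemma clif_word_append [simp]: "clif_word (u @ v) = clif_word u \<circ> clif_word v"
  by (induction u) (simp_all add: o_assoc)

lemma word_perm_Nil [simp]: "word_perm [] = id"
  and word_perm_Cons [simp]: "word_perm (l # w) = letter_perm l \<circ> word_perm w"
  by (simp_all add: word_perm_def)

lemma word_perm_append [simp]: "word_perm (u @ v) = word_perm u \<circ> word_perm v"
  by (induction u) (simp_all add: o_assoc)

lemma word_even_Nil [simp]: "word_even []"
  and word_even_Cons [simp]: "word_even (l # w) \<longleftrightarrow> (if fst l = Zgen then word_even w else \<not> word_even w)"
  by (simp_all add: word_even_def)

lemma word_even_append [simp]: "word_even (u @ v) \<longleftrightarrow> (word_even u \<longleftrightarrow> word_even v)"
  by (induction u) auto

section \<open>Words modulo the relations, and modulo the central element\<close>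

abbreviation spin_eq :: "nat \<Rightarrow> spin_word \<Rightarrow> spin_word \<Rightarrow> bool" where
  "spin_eq n \<equiv> word_eq (spin_gens n) (spin_rels n)"

abbreviation spin_words :: "nat \<Rightarrow> spin_word set" where
  "spin_words n \<equiv> gwords (spin_gens n)"

lemma spin_words_Nil [simp]: "[] \<in> spin_words n"
  and spin_words_Cons [simp]: "l # w \<in> spin_words n \<longleftrightarrow> fst l \<in> spin_gens n \<and> w \<in> spin_words n"
  and spin_words_append [simp]: "u @ v \<in> spin_words n \<longleftrightarrow> u \<in> spin_words n \<and> v \<in> spin_words n"
  by (auto simp: gwords_def lists_eq_set mem_Times_iff)

lemma Zgen_in_spin_gens [simp]: "Zgen \<in> spin_gens n"
  and Tgen_in_spin_gens [simp]: "Tgen i \<in> spin_gens n \<longleftrightarrow> 1 \<le> i \<and> i < n"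
  by (auto simp: spin_gens_def)

lemma letter_perm_flip [simp]: "letter_perm (x, b) \<circ> letter_perm (x, \<not> b) = id"
  by (cases x) (simp_all add: fun_eq_iff)

lemma letter_perm_flip' [simp]: "letter_perm (x, b) (letter_perm (x, \<not> b) y) = y"
  by (cases x) simp_all

lemma clif_letter_flip: "clif_letter (x, b) \<circ> clif_letter (x, \<not> b) = id"
  by (cases x; cases b) (auto simp: fun_eq_iff clif_gen_square clif_gen_minus)

lemma clif_letter_flip' [simp]: "clif_letter (x, b) (clif_letter (x, \<not> b) f) = f"
  using clif_letter_flip[of x b] by (simp add: fun_eq_iff)

lemma spin_rels_invariants:
  assumes "(u, v) \<in> spin_rels n"
  shows "word_perm u = word_perm v \<and> clif_word u = clif_word v \<and> (word_even u = word_even v)"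
  using assms unfolding spin_rels_def
  apply (elim UnE)
  subgoal by (auto simp: fun_eq_iff)
  subgoal by (auto simp: fun_eq_iff clif_gen_minus)
  subgoal by (auto simp: fun_eq_iff clif_gen_square)
  subgoal
    apply (clarsimp simp: numeral_3_eq_3 o_def fun_eq_iff clif_gen_order_three[simplified] )
    apply (auto simp: transpose_def)
    done
  subgoal by (auto simp: fun_eq_iff clif_gen_anticommute transpose_def)
  done

lemma spin_eq_invariants:
  assumes "spin_eq n u v"
  shows "u \<in> spin_words n \<and> v \<in> spin_words n \<and> word_perm u = word_perm v \<and>
    clif_word u = clif_word v \<and> (word_even u = word_even v)"
  using assms
proof (induction rule: word_eq.induct)
  case (cancel x b)
  then show ?case by (auto simp: fun_eq_iff)
next
  case (relation u v)
  then show ?case using spin_rels_invariants by blast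
qed auto

text \<open>Equality up to the central element, that is, equality in the symmetric group. Rewriting
  is done here, where the signs in the relations disappear; the sign is recovered afterwards from
  the Clifford action.\<close>

definition spin_sim :: "nat \<Rightarrow> spin_word \<Rightarrow> spin_word \<Rightarrow> bool" where
  "spin_sim n u v \<longleftrightarrow> spin_eq n u v \<or> spin_eq n u (zl # v)"

lemma spin_eq_words: "spin_eq n u v \<Longrightarrow> u \<in> spin_words n \<and> v \<in> spin_words n"
  using spin_eq_invariants by blast

lemma spin_eq_ctx:
  assumes "spin_eq n u v" "a \<in> spin_words n" "b \<in> spin_words n"
  shows "spin_eq n (a @ u @ b) (a @ v @ b)"
  by (intro word_eq.append word_eq.refl assms)

lemma spin_eq_zz: "spin_eq n [zl, zl] []"
  by (rule word_eq.relation) (auto simp: spin_rels_def)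

lemma spin_eq_tt: "1 \<le> i \<Longrightarrow> i < n \<Longrightarrow> spin_eq n [tl_at i, tl_at i] [zl]"
  by (rule word_eq.relation) (auto simp: spin_rels_def)

text \<open>The relations let \<open>z\<close> pass the generators only. For an inverse letter l of
  t the word l z t l is read in two ways: as l z by t l = 1, and as z l by z t = t z and l t =
  1.\<close>

lemma spin_eq_z_letter:
  assumes "fst l \<in> spin_gens n"
  shows "spin_eq n [zl, l] [l, zl]"
proof -
  obtain x b where l: "l = (x, b)" by force
  show ?thesis
  proof (cases x)
    case Zgen
    show ?thesis
    proof (cases b)
      case True
      have "spin_eq n [zl, l] []" using word_eq.cancel[of Zgen "spin_gens n" _ False] by (simp add: l Zgen True)
      moreover have "spin_eq n [l, zl] []"
        using word_eq.cancel[of Zgen "spin_gens n" _ True] by (simp add: l Zgen True)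
      ultimately show ?thesis by (rule word_eq.trans[OF _ word_eq.sym])
    next
      case False thus ?thesis by (auto simp: l Zgen intro!: word_eq.refl)
    qed
  next
    case (Tgen i)
    have i: "1 \<le> i" "i < n" using assms by (auto simp: l Tgen)
    have zt: "spin_eq n [zl, tl_at i] [tl_at i, zl]"
      using i by (intro word_eq.relation) (auto simp: spin_rels_def)
    show ?thesis
    proof (cases b)
      case True
      have c1: "spin_eq n [l, tl_at i] []"
        using word_eq.cancel[of "Tgen i" "spin_gens n" _ True] i by (simp add: l Tgen True)
      have c2: "spin_eq n [tl_at i, l] []"
        using word_eq.cancel[of "Tgen i" "spin_gens n" _ False] i by (simp add: l Tgen True)
      have w: "[l] \<in> spin_words n" "[zl, l] \<in> spin_words n" "[l, zl] \<in> spin_words n"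
        using i by (auto simp: l Tgen)
      have "spin_eq n [l, zl, tl_at i, l] [l, tl_at i, zl, l]"
        using spin_eq_ctx[OF zt w(1,1)] by simp
      moreover have "spin_eq n [l, tl_at i, zl, l] [zl, l]"
        using spin_eq_ctx[OF c1 spin_words_Nil w(2)] by simp
      moreover have "spin_eq n [l, zl, tl_at i, l] [l, zl]" using spin_eq_ctx[OF c2 w(3) spin_words_Nil] by simp
      ultimately show ?thesis by (rule word_eq.trans[OF word_eq.sym[OF word_eq.trans]])
    next
      case False thus ?thesis using zt by (simp add: l Tgen)
    qed
  qed
qed

lemma spin_eq_z_word:
  assumes "u \<in> spin_words n"
  shows "spin_eq n (zl # u) (u @ [zl])"
  using assms
proof (induction u)
  case Nil thus ?case by (auto intro!: word_eq.refl)
next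
  case (Cons l u)
  have l: "[l] \<in> spin_words n" using Cons.prems by simp
  have u: "u \<in> spin_words n" using Cons.prems by simp
  have "spin_eq n (zl # l # u) (l # zl # u)"
    using spin_eq_ctx[OF spin_eq_z_letter spin_words_Nil u] Cons.prems by simp
  moreover have "spin_eq n (l # zl # u) (l # u @ [zl])"
    using spin_eq_ctx[OF Cons.IH[OF u] l spin_words_Nil] by simp
  ultimately have "spin_eq n (zl # l # u) (l # u @ [zl])" by (rule word_eq.trans)
  thus ?case by simp
qed

lemma spin_eq_zz_word:
  assumes "u \<in> spin_words n" shows "spin_eq n (zl # zl # u) u"
  using spin_eq_ctx[OF spin_eq_zz spin_words_Nil assms] by simp

lemma spin_eq_z_cong:
  assumes "spin_eq n u v" shows "spin_eq n (zl # u) (zl # v)"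
  using spin_eq_ctx[OF assms, of "[zl]" "[]"] by simp

lemma spin_sim_refl: "u \<in> spin_words n \<Longrightarrow> spin_sim n u u"
  by (simp add: spin_sim_def word_eq.refl)

lemma spin_sim_words: "spin_sim n u v \<Longrightarrow> u \<in> spin_words n \<and> v \<in> spin_words n"
  using spin_eq_words by (fastforce simp: spin_sim_def)

lemma spin_sim_sym:
  assumes "spin_sim n u v" shows "spin_sim n v u"
  using assms unfolding spin_sim_def
proof
  assume *: "spin_eq n u (zl # v)"
  have "v \<in> spin_words n" using spin_eq_words[OF *] by simp
  hence "spin_eq n (zl # u) v"
    by (rule word_eq.trans[OF spin_eq_z_cong[OF *] spin_eq_zz_word])
  thus "spin_eq n v u \<or> spin_eq n v (zl # u)" by (rule disjI2[OF word_eq.sym])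
next
  assume "spin_eq n u v"
  thus "spin_eq n v u \<or> spin_eq n v (zl # u)" by (rule disjI1[OF word_eq.sym])
qed

lemma spin_sim_trans:
  assumes "spin_sim n u v" "spin_sim n v w" shows "spin_sim n u w"
proof -
  have w: "w \<in> spin_words n" using assms spin_sim_words by blast
  from assms show ?thesis unfolding spin_sim_def
  proof (elim disjE)
    assume "spin_eq n u (zl # v)" "spin_eq n v (zl # w)"
    thus "spin_eq n u w \<or> spin_eq n u (zl # w)"
      by (rule disjI1[OF word_eq.trans[OF _ word_eq.trans[OF spin_eq_z_cong spin_eq_zz_word[OF w]]]])
  next
    assume "spin_eq n u (zl # v)" "spin_eq n v w"
    thus "spin_eq n u w \<or> spin_eq n u (zl # w)"
      by (rule disjI2[OF word_eq.trans[OF _ spin_eq_z_cong]])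
  next
    assume "spin_eq n u v" "spin_eq n v w"
    thus "spin_eq n u w \<or> spin_eq n u (zl # w)" by (rule disjI1[OF word_eq.trans])
  next
    assume "spin_eq n u v" "spin_eq n v (zl # w)"
    thus "spin_eq n u w \<or> spin_eq n u (zl # w)" by (rule disjI2[OF word_eq.trans])
  qed
qed

lemma spin_sim_append:
  assumes "spin_sim n u u'" "spin_sim n v v'" shows "spin_sim n (u @ v) (u' @ v')"
proof -
  have ws: "u \<in> spin_words n" "u' \<in> spin_words n" "v \<in> spin_words n" "v' \<in> spin_words n"
    using assms spin_sim_words by blast+
  have m: "spin_eq n (u' @ zl # v') (zl # u' @ v')"
    using word_eq.sym[OF spin_eq_ctx[OF spin_eq_z_word[OF ws(2)] spin_words_Nil ws(4)]] by simp
  have *: "spin_sim n (u @ v) (u' @ v)" if "spin_sim n u u'" "v \<in> spin_words n" for u u' v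
    using that spin_eq_ctx[of n u u' "[]" v] spin_eq_ctx[of n u "zl # u'" "[]" v] unfolding spin_sim_def by auto
  have "spin_sim n (u' @ v) (u' @ v')"
    using assms(2) unfolding spin_sim_def
  proof (elim disjE)
    assume "spin_eq n v v'"
    from spin_eq_ctx[OF this ws(2) spin_words_Nil]
    show "spin_eq n (u' @ v) (u' @ v') \<or> spin_eq n (u' @ v) (zl # u' @ v')" by simp
  next
    assume "spin_eq n v (zl # v')"
    from spin_eq_ctx[OF this ws(2) spin_words_Nil]
    have "spin_eq n (u' @ v) (u' @ zl # v')" by simp
    from word_eq.trans[OF this m]
    show "spin_eq n (u' @ v) (u' @ v') \<or> spin_eq n (u' @ v) (zl # u' @ v')" by simp
  qed
  with *[OF assms(1) ws(3)] show ?thesis by (rule spin_sim_trans)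
qed

lemma spin_sim_ctx:
  assumes "spin_sim n u v" "a \<in> spin_words n" "b \<in> spin_words n"
  shows "spin_sim n (a @ u @ b) (a @ v @ b)"
  by (intro spin_sim_append spin_sim_refl assms)

lemma spin_sim_Zletter: "spin_sim n [(Zgen, b)] []"
proof (cases b)
  case False thus ?thesis by (auto simp: spin_sim_def intro!: word_eq.refl)
next
  case True
  have c: "spin_eq n [(Zgen, True), zl] []" using word_eq.cancel[of Zgen "spin_gens n" _ True] by simp
  have "spin_eq n [(Zgen, True), zl, zl] [zl]" using spin_eq_ctx[OF c spin_words_Nil, of "[zl]"] by simp
  moreover have "spin_eq n [(Zgen, True), zl, zl] [(Zgen, True)]"
    using spin_eq_ctx[OF spin_eq_zz _ spin_words_Nil, of "[(Zgen, True)]"] by simp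
  ultimately have "spin_eq n [(Zgen, True)] [zl]" by (rule word_eq.trans[OF word_eq.sym, rotated])
  thus ?thesis by (simp add: spin_sim_def True)
qed

lemma spin_sim_tt: "1 \<le> i \<Longrightarrow> i < n \<Longrightarrow> spin_sim n [tl_at i, tl_at i] []"
  using spin_eq_tt by (simp add: spin_sim_def)

lemma spin_sim_Tletter:
  assumes "1 \<le> i" "i < n" shows "spin_sim n [(Tgen i, b)] [tl_at i]"
proof (cases b)
  case False thus ?thesis using assms by (auto simp: spin_sim_def intro!: word_eq.refl)
next
  case True
  have c: "spin_sim n [(Tgen i, True), tl_at i] []"
    using word_eq.cancel[of "Tgen i" "spin_gens n" _ True] assms by (simp add: spin_sim_def)
  have "spin_sim n [(Tgen i, True), tl_at i, tl_at i] [tl_at i]"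
    using spin_sim_ctx[OF c, of "[]" "[tl_at i]"] assms by simp
  moreover have "spin_sim n [(Tgen i, True), tl_at i, tl_at i] [(Tgen i, True)]"
    using spin_sim_ctx[OF spin_sim_tt[OF assms], of "[(Tgen i, True)]" "[]"] assms by simp
  ultimately have "spin_sim n [(Tgen i, True)] [tl_at i]"
    by (rule spin_sim_trans[OF spin_sim_sym, rotated])
  thus ?thesis using True by simp
qed

lemma spin_sim_commute:
  assumes "1 \<le> i" "i < n" "1 \<le> j" "j < n" "i + 1 < j \<or> j + 1 < i"
  shows "spin_sim n [tl_at i, tl_at j] [tl_at j, tl_at i]"
proof -
  have *: "spin_sim n [tl_at i, tl_at j] [tl_at j, tl_at i]" if "i < n" "1 \<le> j" "j + 1 < i" for i j
    unfolding spin_sim_def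
    by (rule disjI2, rule word_eq.relation) (use that in \<open>auto simp: spin_rels_def\<close>)
  show ?thesis using *[of i j] spin_sim_sym[OF *[of j i]] assms by auto
qed

lemma spin_sim_braid:
  assumes "1 \<le> i" "i + 1 < n"
  shows "spin_sim n [tl_at i, tl_at (i + 1), tl_at i] [tl_at (i + 1), tl_at i, tl_at (i + 1)]"
proof -
  let ?a = "tl_at i" and ?b = "tl_at (i + 1)"
  have aa: "spin_sim n [?a, ?a] []" and bb: "spin_sim n [?b, ?b] []"
    using assms by (auto intro: spin_sim_tt)
  have "spin_eq n (concat (replicate 3 [?a, ?b])) [zl]"
    by (rule word_eq.relation) (use assms in \<open>auto simp: spin_rels_def numeral_3_eq_3\<close>)
  hence 6: "spin_sim n [?a, ?b, ?a, ?b, ?a, ?b] []" by (simp add: spin_sim_def numeral_3_eq_3)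
  \<comment> \<open>Modulo \<open>z\<close> the word bab is an involution, so aba = aba (bab)(bab) =
    (ab)^3 bab = bab.\<close>
  have "spin_sim n [?b, ?a, ?b, ?b, ?a, ?b] [?b, ?a, ?a, ?b]"
    using spin_sim_ctx[OF bb, of "[?b, ?a]" "[?a, ?b]"] assms by auto
  moreover
  have "spin_sim n [?b, ?a, ?a, ?b] [?b, ?b]"
    using spin_sim_ctx[OF aa, of "[?b]" "[?b]"] assms by auto
  ultimately have b6: "spin_sim n [?b, ?a, ?b, ?b, ?a, ?b] []" using bb by (rule spin_sim_trans[OF spin_sim_trans])
  have "spin_sim n [?a, ?b, ?a, ?b, ?a, ?b, ?b, ?a, ?b] [?a, ?b, ?a]"
    using spin_sim_ctx[OF b6, of "[?a, ?b, ?a]" "[]"] assms by auto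
  moreover have "spin_sim n [?a, ?b, ?a, ?b, ?a, ?b, ?b, ?a, ?b] [?b, ?a, ?b]"
    using spin_sim_ctx[OF 6, of "[]" "[?b, ?a, ?b]"] assms by auto
  ultimately show ?thesis by (rule spin_sim_trans[OF spin_sim_sym])
qed

lemma spin_sim_commute_list:
  assumes "1 \<le> i" "i < n" "\<And>k. k \<in> set ks \<Longrightarrow> 1 \<le> k \<and> k < n \<and> (i + 1 < k \<or> k + 1 < i)"
  shows "spin_sim n (map tl_at ks @ [tl_at i]) (tl_at i # map tl_at ks)"
  using assms(3)
proof (induction ks)
  case Nil thus ?case using assms by (auto intro: spin_sim_refl)
next
  case (Cons k ks)
  have k: "1 \<le> k" "k < n" "i + 1 < k \<or> k + 1 < i" using Cons.prems by auto
  have ks: "map tl_at ks \<in> spin_words n" using Cons.prems by (auto simp: gwords_def)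
  have "spin_sim n (tl_at k # map tl_at ks @ [tl_at i]) (tl_at k # tl_at i # map tl_at ks)"
    using spin_sim_ctx[OF Cons.IH, of "[tl_at k]" "[]"] Cons.prems k by auto
  moreover have "spin_sim n (tl_at k # tl_at i # map tl_at ks) (tl_at i # tl_at k # map tl_at ks)"
    using spin_sim_ctx[OF spin_sim_commute[of k n i] spin_words_Nil ks] k assms by auto
  ultimately have "spin_sim n (tl_at k # map tl_at ks @ [tl_at i]) (tl_at i # tl_at k # map tl_at ks)"
    by (rule spin_sim_trans)
  thus ?case by simp
qed

section \<open>Coset normal forms and the word problem\<close>

definition desc :: "nat \<Rightarrow> nat \<Rightarrow> spin_word" where
  "desc n j = map tl_at (rev [j..<n])"

lemma desc_words: "1 \<le> j \<Longrightarrow> desc n j \<in> spin_words n"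
  by (auto simp: desc_def gwords_def)

lemma desc_step: "j < n \<Longrightarrow> desc n j = desc n (j + 1) @ [tl_at j]"
  by (simp add: desc_def upt_rec)

text \<open>The words \<open>desc n j\<close>, that is t_(n-1) ... t_j, represent the right cosets
  of the subgroup on n - 1 points. A further letter t_i extends the word, cancels its last letter,
  commutes to the front, or, if it equals an earlier letter, passes by one braid move and leaves at
  the front as t_(i-1).\<close>

lemma desc_append_gen:
  assumes "1 \<le> i" "i < n" "1 \<le> j" "j \<le> n"
  shows "\<exists>w j'. w \<in> spin_words (n - 1) \<and> 1 \<le> j' \<and> j' \<le> n \<and>
    spin_sim n (desc n j @ [tl_at i]) (w @ desc n j')"
proof -
  consider "i + 1 = j" | "i = j" | "i + 1 < j" | "j < i" by linarith
  thus ?thesis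
  proof cases
    case 1
    have "desc n j @ [tl_at i] = [] @ desc n i" using desc_step[of i n] 1 assms by simp
    thus ?thesis using assms spin_sim_refl[OF desc_words[of i n]]
      by (intro exI[of _ "[]"] exI[of _ i]) auto
  next
    case 2
    have "spin_sim n (desc n j @ [tl_at i]) ([] @ desc n (j + 1))"
      using spin_sim_ctx[OF spin_sim_tt[of i n] desc_words[of "j + 1" n] spin_words_Nil] assms 2
      by (simp add: desc_step[of j n])
    thus ?thesis using assms 2 by (intro exI[of _ "[]"] exI[of _ "j + 1"]) auto
  next
    case 3
    have "spin_sim n (desc n j @ [tl_at i]) ([tl_at i] @ desc n j)"
      using spin_sim_commute_list[of i n "rev [j..<n]"] 3 assms by (auto simp: desc_def)
    thus ?thesis using assms 3 by (intro exI[of _ "[tl_at i]"] exI[of _ j]) auto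
  next
    case 4
    obtain k where k: "i = Suc k" using assms(1) by (cases i) auto
    have kj: "j \<le> k" "1 \<le> k" using 4 k assms by auto
    define P where "P = map tl_at (rev [i + 1..<n])"
    define Q where "Q = map tl_at (rev [j..<k])"
    have "[j..<n] = [j..<k] @ [k, i] @ [i + 1..<n]"
    proof -
      have "[j..<n] = [j..<k] @ [k..<n]" using kj k assms using upt_add_eq_append[of j k "n - k"] by simp
      moreover have "[k..<n] = k # [i..<n]" using k assms by (subst upt_conv_Cons) auto
      moreover have "[i..<n] = i # [i + 1..<n]" using assms by (subst upt_conv_Cons) auto
      ultimately show ?thesis by simp
    qed
    hence d: "desc n j = P @ [tl_at i, tl_at k] @ Q" by (simp add: desc_def P_def Q_def)
    have PQ: "P \<in> spin_words n" "Q \<in> spin_words n" using assms k kj by (auto simp: P_def Q_def gwords_def)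
    have g: "[tl_at i] \<in> spin_words n" "[tl_at k] \<in> spin_words n" using k kj assms by auto
    have "spin_sim n (Q @ [tl_at i]) ([tl_at i] @ Q)"
      using spin_sim_commute_list[of i n "rev [j..<k]"] k assms by (auto simp: Q_def)
    from spin_sim_ctx[OF this, of "P @ [tl_at i, tl_at k]" "[]"]
    have 1: "spin_sim n (desc n j @ [tl_at i]) (P @ [tl_at i, tl_at k, tl_at i] @ Q)"
      using PQ g by (simp add: d)
    have 2: "spin_sim n (P @ [tl_at i, tl_at k, tl_at i] @ Q) (P @ [tl_at k, tl_at i, tl_at k] @ Q)"
      by (rule spin_sim_ctx[OF spin_sim_sym PQ]) (use spin_sim_braid[of k n] k assms kj in auto)
    have "spin_sim n (P @ [tl_at k]) ([tl_at k] @ P)"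
      using spin_sim_commute_list[of k n "rev [i + 1..<n]"] k kj assms by (auto simp: P_def)
    from spin_sim_ctx[OF this spin_words_Nil, of "[tl_at i, tl_at k] @ Q"]
    have 3: "spin_sim n (P @ [tl_at k, tl_at i, tl_at k] @ Q) ([tl_at k] @ desc n j)"
      using PQ g by (simp add: d)
    have "spin_sim n (desc n j @ [tl_at i]) ([tl_at k] @ desc n j)"
      by (rule spin_sim_trans[OF 1 spin_sim_trans[OF 2 3]])
    thus ?thesis using assms k kj by (intro exI[of _ "[tl_at k]"] exI[of _ j]) auto
  qed
qed

lemma spin_eq_mono:
  assumes "spin_eq m u v" "m \<le> n" shows "spin_eq n u v"
  using assms(1)
proof (induction rule: word_eq.induct)
  case (refl w)
  moreover have "spin_words m \<subseteq> spin_words n" using assms(2) by (auto simp: gwords_def spin_gens_def)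
  ultimately show ?case by (blast intro: word_eq.refl)
next
  case (cancel x b)
  hence "x \<in> spin_gens n" using assms(2) by (auto simp: spin_gens_def)
  thus ?case by (rule word_eq.cancel)
next
  case (relation u v)
  have "spin_words m \<subseteq> spin_words n" using assms(2) by (auto simp: gwords_def spin_gens_def)
  moreover have "spin_rels m \<subseteq> spin_rels n"
    unfolding spin_rels_def using assms(2)
    by (intro Un_mono order_refl subsetI; elim CollectE exE conjE; force)
  ultimately show ?case using relation by (intro word_eq.relation) auto
next
  case (sym u v) show ?case by (rule word_eq.sym[OF sym.IH])
next
  case (trans u v w) show ?case by (rule word_eq.trans[OF trans.IH])
next
  case (append u u' v v') show ?case by (rule word_eq.append[OF append.IH])
qed

lemma spin_words_mono: "m \<le> n \<Longrightarrow> u \<in> spin_words m \<Longrightarrow> u \<in> spin_words n"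
  by (auto simp: gwords_def spin_gens_def)

lemma spin_sim_mono: "spin_sim m u v \<Longrightarrow> m \<le> n \<Longrightarrow> spin_sim n u v"
  using spin_eq_mono unfolding spin_sim_def by blast

lemma spin_normal_form:
  assumes "u \<in> spin_words n" "1 \<le> n"
  shows "\<exists>w j. w \<in> spin_words (n - 1) \<and> 1 \<le> j \<and> j \<le> n \<and> spin_sim n u (w @ desc n j)"
  using assms(1)
proof (induction u rule: rev_induct)
  case Nil
  show ?case using assms by (intro exI[of _ "[]"] exI[of _ n]) (auto simp: desc_def spin_sim_refl)
next
  case (snoc l u)
  then obtain w j where wj: "w \<in> spin_words (n - 1)" "1 \<le> j" "j \<le> n" "spin_sim n u (w @ desc n j)" by auto
  have w: "w \<in> spin_words n" using spin_words_mono[OF _ wj(1), of n] by simp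
  obtain x b where l: "l = (x, b)" by force
  show ?case
  proof (cases x)
    case Zgen
    have "spin_sim n (u @ [l]) ((w @ desc n j) @ [])"
      unfolding l Zgen by (intro spin_sim_append wj spin_sim_Zletter)
    thus ?thesis using wj by auto
  next
    case (Tgen i)
    have i: "1 \<le> i" "i < n" using snoc.prems by (auto simp: l Tgen)
    have 1: "spin_sim n (u @ [l]) (w @ desc n j @ [tl_at i])"
      unfolding l Tgen append_assoc[symmetric] by (intro spin_sim_append wj spin_sim_Tletter i)
    obtain w' j' where w': "w' \<in> spin_words (n - 1)" "1 \<le> j'" "j' \<le> n"
      "spin_sim n (desc n j @ [tl_at i]) (w' @ desc n j')"
      using desc_append_gen[OF i wj(2,3)] by blast
    have "spin_sim n (w @ desc n j @ [tl_at i]) (w @ w' @ desc n j')"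
      by (intro spin_sim_append spin_sim_refl w w')
    from spin_sim_trans[OF 1 this] show ?thesis using w' wj
      by (intro exI[of _ "w @ w'"] exI[of _ j']) auto
  qed
qed

lemma word_perm_permutes: "u \<in> spin_words n \<Longrightarrow> word_perm u permutes {1..n}"
proof (induction u)
  case (Cons l u)
  obtain x b where l: "l = (x, b)" by force
  have "letter_perm l permutes {1..n}"
    using Cons.prems by (cases x) (auto simp: l intro!: permutes_swap_id permutes_id)
  moreover have "word_perm u permutes {1..n}" using Cons by simp
  ultimately show ?case unfolding word_perm_Cons by (intro permutes_compose)
qed (auto simp: permutes_id)

lemma spin_sim_perm: "spin_sim n u v \<Longrightarrow> word_perm u = word_perm v"
  unfolding spin_sim_def using spin_eq_invariants[of n u v] spin_eq_invariants[of n u "zl # v"] by auto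

lemma word_perm_desc: "1 \<le> j \<Longrightarrow> j \<le> n \<Longrightarrow> word_perm (desc n j) j = n"
proof (induction "n - j" arbitrary: j)
  case 0 thus ?case by (simp add: desc_def)
next
  case (Suc m)
  have "word_perm (desc n (j + 1)) (j + 1) = n" using Suc.hyps(1)[of "j + 1"] Suc.hyps(2) Suc.prems by auto
  thus ?case using Suc.hyps(2) Suc.prems by (simp add: desc_step)
qed

text \<open>In the normal form the first factor fixes the largest point and the second sends j to
  it. A word acting trivially therefore has an empty second factor, and what remains is a word on
  fewer points.\<close>

lemma spin_kernel: "u \<in> spin_words n \<Longrightarrow> word_perm u = id \<Longrightarrow> spin_sim n u []"
proof (induction n arbitrary: u)
  case 0
  thus ?case
  proof (induction u)
    case (Cons l u)
    obtain x b where l: "l = (x, b)" by force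
    have "fst l \<in> spin_gens 0" using Cons.prems by simp
    hence "l = (Zgen, b)" by (auto simp: l spin_gens_def)
    thus ?case using spin_sim_append[OF spin_sim_Zletter[of 0 b] Cons.IH] Cons.prems by simp
  qed (auto simp: spin_sim_refl)
next
  case (Suc n)
  obtain w j where wj: "w \<in> spin_words n" "1 \<le> j" "j \<le> Suc n" "spin_sim (Suc n) u (w @ desc (Suc n) j)"
    using spin_normal_form[OF Suc.prems(1)] by auto
  have p: "word_perm w \<circ> word_perm (desc (Suc n) j) = id"
    using spin_sim_perm[OF wj(4)] Suc.prems(2) by (metis word_perm_append)
  have "word_perm w (Suc n) = Suc n"
    using word_perm_permutes[OF wj(1)] by (auto simp: permutes_def)
  hence "j = Suc n" using word_perm_desc[OF wj(2,3)] fun_cong[OF p, of j] by simp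
  hence "desc (Suc n) j = []" by (simp add: desc_def)
  with p wj have "word_perm w = id" "spin_sim (Suc n) u w" by auto
  thus ?case using spin_sim_trans[OF _ spin_sim_mono[OF Suc.IH[OF wj(1)]]] by simp
qed

definition inv_word :: "spin_word \<Rightarrow> spin_word" where
  "inv_word w = rev (map (\<lambda>(x, b). (x, \<not> b)) w)"

lemma inv_word_simps [simp]: "inv_word [] = []" "inv_word (l # w) = inv_word w @ [(fst l, \<not> snd l)]"
  by (simp_all add: inv_word_def split_beta)

lemma inv_word_words [simp]: "inv_word w \<in> spin_words n \<longleftrightarrow> w \<in> spin_words n"
  by (induction w) auto

lemma spin_eq_inv_left: "w \<in> spin_words n \<Longrightarrow> spin_eq n (inv_word w @ w) []"
proof (induction w)
  case Nil thus ?case by (simp add: word_eq.refl)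
next
  case (Cons l w)
  have "spin_eq n [(fst l, \<not> snd l), l] []"
    using word_eq.cancel[of "fst l" "spin_gens n" _ "\<not> snd l"] Cons.prems by simp
  from spin_eq_ctx[OF this, of "inv_word w" w] Cons.prems
  have "spin_eq n (inv_word w @ [(fst l, \<not> snd l), l] @ w) (inv_word w @ w)" by simp
  from word_eq.trans[OF this Cons.IH] Cons.prems show ?case by simp
qed

lemma spin_eq_inv_right: "w \<in> spin_words n \<Longrightarrow> spin_eq n (w @ inv_word w) []"
proof (induction w rule: rev_induct)
  case Nil thus ?case by (simp add: word_eq.refl)
next
  case (snoc l w)
  have i: "inv_word (w @ [l]) = (fst l, \<not> snd l) # inv_word w"
    by (simp add: inv_word_def split_beta)
  have "spin_eq n [l, (fst l, \<not> snd l)] []"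
    using word_eq.cancel[of "fst l" "spin_gens n" _ "snd l"] snoc.prems by simp
  from spin_eq_ctx[OF this, of w "inv_word w"] snoc.prems
  have "spin_eq n (w @ [l, (fst l, \<not> snd l)] @ inv_word w) (w @ inv_word w)" by simp
  from word_eq.trans[OF this snoc.IH] snoc.prems show ?case by (simp add: i)
qed

lemma spin_sim_iff:
  "spin_sim n u v \<longleftrightarrow> u \<in> spin_words n \<and> v \<in> spin_words n \<and> word_perm u = word_perm v"
proof
  assume "spin_sim n u v"
  from spin_sim_words[OF this] spin_sim_perm[OF this]
  show "u \<in> spin_words n \<and> v \<in> spin_words n \<and> word_perm u = word_perm v" by simp
next
  assume *: "u \<in> spin_words n \<and> v \<in> spin_words n \<and> word_perm u = word_perm v"
  have r: "spin_sim n (v @ inv_word v) []" "spin_sim n (inv_word v @ v) []"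
    using spin_eq_inv_right[of v n] spin_eq_inv_left[of v n] * by (simp_all add: spin_sim_def)
  have "word_perm (u @ inv_word v) = word_perm (v @ inv_word v)" using * by simp
  hence "word_perm (u @ inv_word v) = id" using spin_sim_perm[OF r(1)] by simp
  moreover have "u @ inv_word v \<in> spin_words n" using * by simp
  ultimately have 1: "spin_sim n (u @ inv_word v) []" by (metis spin_kernel)
  have v: "spin_sim n v v" and u: "spin_sim n u u" using * by (simp_all add: spin_sim_refl)
  have 2: "spin_sim n (u @ inv_word v @ v) v" using spin_sim_append[OF 1 v] by simp
  have 3: "spin_sim n (u @ inv_word v @ v) u" using spin_sim_append[OF u r(2)] by simp
  show "spin_sim n u v" by (rule spin_sim_trans[OF spin_sim_sym[OF 3] 2])
qed

lemma spin_sim_clif: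
  assumes "spin_sim n u v"
  shows "clif_word u = clif_word v \<or> clif_word u = clif_word (zl # v)"
proof -
  from assms have "spin_eq n u v \<or> spin_eq n u (zl # v)" by (simp add: spin_sim_def)
  thus ?thesis using spin_eq_invariants[of n u v] spin_eq_invariants[of n u "zl # v"] by argo
qed

lemma clif_word_inv: "clif_word v (clif_word (inv_word v) f) = f"
proof (induction v arbitrary: f)
  case (Cons l v)
  obtain x b where l: "l = (x, b)" by force
  show ?case by (simp add: l Cons.IH)
qed simp

text \<open>Every word acts invertibly, so some function is sent to the constant 1; on it the two
  actions differ in sign.\<close>

lemma clif_word_zl_neq: "clif_word (zl # v) \<noteq> clif_word v"
proof
  assume *: "clif_word (zl # v) = clif_word v"
  define g where "g = clif_word (inv_word v) (\<lambda>S. 1)"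
  have "clif_word v g {} = 1" by (simp add: g_def clif_word_inv)
  moreover have "clif_word (zl # v) g {} = - clif_word v g {}" by simp
  ultimately show False unfolding * by simp
qed

text \<open>The normal forms determine a word up to \<open>z\<close> by its permutation, and the
  Clifford action tells the two candidates apart. From here on equality in the double cover is
  checked on these two invariants.\<close>

theorem spin_eq_iff:
  "spin_eq n u v \<longleftrightarrow> u \<in> spin_words n \<and> v \<in> spin_words n \<and>
     word_perm u = word_perm v \<and> clif_word u = clif_word v"
proof
  assume *: "u \<in> spin_words n \<and> v \<in> spin_words n \<and>
     word_perm u = word_perm v \<and> clif_word u = clif_word v"
  hence "spin_sim n u v" by (simp add: spin_sim_iff)
  hence "spin_eq n u v \<or> spin_eq n u (zl # v)" by (simp add: spin_sim_def)
  moreover have "\<not> spin_eq n u (zl # v)"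
  proof
    assume "spin_eq n u (zl # v)"
    hence "clif_word u = clif_word (zl # v)" using spin_eq_invariants by blast
    thus False using * clif_word_zl_neq[of v] by argo
  qed
  ultimately show "spin_eq n u v" by simp
next
  assume "spin_eq n u v"
  from spin_eq_invariants[OF this] show "u \<in> spin_words n \<and> v \<in> spin_words n \<and>
     word_perm u = word_perm v \<and> clif_word u = clif_word v" by simp
qed

lemma word_perm_surj:
  "\<sigma> permutes {1..n} \<Longrightarrow> \<exists>u\<in>spin_words n. word_perm u = \<sigma>"
proof (induction n arbitrary: \<sigma>)
  case 0 thus ?case by (intro bexI[of _ "[]"]) auto
next
  case (Suc n)
  define j where "j = inv_into UNIV \<sigma> (Suc n)"
  have j: "\<sigma> j = Suc n" "1 \<le> j" "j \<le> Suc n"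
    using permutes_inverses(1)[OF Suc.prems] permutes_in_image[OF permutes_inv[OF Suc.prems], of "Suc n"]
    by (auto simp: j_def)
  define d where "d = word_perm (desc (Suc n) j)"
  have d: "d permutes {1..Suc n}" "d j = Suc n"
    using word_perm_permutes[OF desc_words] word_perm_desc j by (auto simp: d_def)
  define p where "p = \<sigma> \<circ> inv_into UNIV d"
  have p: "p permutes {1..Suc n}" using d Suc.prems by (simp add: p_def permutes_compose permutes_inv)
  have "inv_into UNIV d (Suc n) = j" using permutes_inverses(2)[OF d(1), of j] d(2) by simp
  hence pn: "p (Suc n) = Suc n" using j by (simp add: p_def)
  have "p permutes {1..n}"
    by (rule permutes_superset[OF p]) (use pn in \<open>auto simp: le_Suc_eq\<close>)
  from Suc.IH[OF this] obtain u where u: "u \<in> spin_words n" "word_perm u = p" by blast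
  have "word_perm (u @ desc (Suc n) j) = \<sigma>"
    using permutes_inv_o(2)[OF d(1)] by (simp add: u p_def flip: d_def o_assoc)
  moreover have "u @ desc (Suc n) j \<in> spin_words (Suc n)"
    using spin_words_mono[OF _ u(1)] desc_words[OF j(2)] by simp
  ultimately show ?case by blast
qed

section \<open>Irreducible characters form an orthonormal basis\<close>

lemma mat_trace_mult_commute:
  assumes "A \<in> carrier_mat n m" "B \<in> carrier_mat m n"
  shows "mat_trace (A * B) = mat_trace (B * A)"
proof -
  have "mat_trace (A * B) = (\<Sum>i<n. \<Sum>j<m. A $$ (i, j) * B $$ (j, i))"
    using assms by (auto simp: mat_trace_def scalar_prod_def lessThan_atLeast0 intro!: sum.cong)
  also have "\<dots> = (\<Sum>j<m. \<Sum>i<n. B $$ (j, i) * A $$ (i, j))"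
    by (subst sum.swap) (simp add: mult.commute)
  also have "\<dots> = mat_trace (B * A)"
    using assms by (auto simp: mat_trace_def scalar_prod_def lessThan_atLeast0 intro!: sum.cong)
  finally show ?thesis .
qed

lemma mat_eq_by_vec:
  assumes A: "(A :: complex mat) \<in> carrier_mat n m" and B: "B \<in> carrier_mat n m"
    and eq: "\<And>v. v \<in> carrier_vec m \<Longrightarrow> A *\<^sub>v v = B *\<^sub>v v"
  shows "A = B"
proof (rule eq_matI)
  fix i j assume ij: "i < dim_row B" "j < dim_col B"
  hence "(A *\<^sub>v unit_vec m j) $ i = (B *\<^sub>v unit_vec m j) $ i" using eq by simp
  thus "A $$ (i, j) = B $$ (i, j)" using ij A B by simp
qed (use A B in auto)

lemma vec_minus_zero_imp_eq:
  assumes "(u :: complex vec) \<in> carrier_vec n" "v \<in> carrier_vec n" "u - v = 0\<^sub>v n"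
  shows "u = v"
proof (rule eq_vecI)
  fix i assume "i < dim_vec v"
  hence i: "i < n" using assms by simp
  have "(u - v) $ i = 0" using i by (simp add: assms(3))
  thus "u $ i = v $ i" using i assms(1,2) by simp
qed (use assms in auto)

locale finite_grp = group G for G (structure) +
  assumes finite_carrier: "finite (carrier G)"
begin

section \<open>Schur's lemma\<close>

lemma rep_carrier: "matrix_rep G d R \<Longrightarrow> x \<in> carrier G \<Longrightarrow> R x \<in> carrier_mat d d"
  and rep_mult: "matrix_rep G d R \<Longrightarrow> x \<in> carrier G \<Longrightarrow> y \<in> carrier G \<Longrightarrow> R (x \<otimes> y) = R x * R y"
  and rep_one: "matrix_rep G d R \<Longrightarrow> R \<one> = 1\<^sub>m d"
  by (auto simp: matrix_rep_def)

lemma irrD: "irreducible_rep G d R \<Longrightarrow> matrix_rep G d R" "irreducible_rep G d R \<Longrightarrow> 0 < d"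
  "irreducible_rep G d R \<Longrightarrow> invariant_subspace G d R W \<Longrightarrow> W = {0\<^sub>v d} \<or> W = carrier_vec d"
  by (auto simp: irreducible_rep_def)

text \<open>Kernel and image of an intertwiner are invariant, so a nonzero one is invertible and the
  two representations are conjugate. The conclusion is stated for traces because
  \<open>irr_chars\<close> collects characters, not representations.\<close>

lemma schur:
  assumes R: "irreducible_rep G d R" and S: "irreducible_rep G e S"
    and T: "T \<in> carrier_mat d e"
    and TR: "\<And>y. y \<in> carrier G \<Longrightarrow> R y * T = T * S y"
  shows "T = 0\<^sub>m d e \<or> (\<forall>y\<in>carrier G. mat_trace (R y) = mat_trace (S y))"
proof (cases "T = 0\<^sub>m d e")
  case False
  note cR = rep_carrier[OF irrD(1)[OF R]] and cS = rep_carrier[OF irrD(1)[OF S]]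
  have comm: "R y *\<^sub>v (T *\<^sub>v v) = T *\<^sub>v (S y *\<^sub>v v)" if "y \<in> carrier G" "v \<in> carrier_vec e" for y v
  proof -
    have "R y *\<^sub>v (T *\<^sub>v v) = (R y * T) *\<^sub>v v"
      by (rule assoc_mult_mat_vec[OF cR[OF that(1)] T that(2), symmetric])
    also have "\<dots> = T *\<^sub>v (S y *\<^sub>v v)"
      unfolding TR[OF that(1)] by (rule assoc_mult_mat_vec[OF T cS[OF that(1)] that(2)])
    finally show ?thesis .
  qed
  define K where "K = {v \<in> carrier_vec e. T *\<^sub>v v = 0\<^sub>v d}"
  have "invariant_subspace G e S K"
    unfolding invariant_subspace_def K_def
  proof (intro conjI ballI allI; (elim CollectE conjE)?)
    show "0\<^sub>v e \<in> {v \<in> carrier_vec e. T *\<^sub>v v = 0\<^sub>v d}" using T by auto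
  next
    fix u v assume "u \<in> carrier_vec e" "v \<in> carrier_vec e" "T *\<^sub>v u = 0\<^sub>v d" "T *\<^sub>v v = 0\<^sub>v d"
    thus "u + v \<in> {v \<in> carrier_vec e. T *\<^sub>v v = 0\<^sub>v d}"
      by (auto simp: mult_add_distrib_mat_vec[OF T])
  next
    fix a u assume "u \<in> carrier_vec e" "T *\<^sub>v u = 0\<^sub>v d"
    thus "a \<cdot>\<^sub>v u \<in> {v \<in> carrier_vec e. T *\<^sub>v v = 0\<^sub>v d}"
      by (auto simp: mult_mat_vec[OF T])
  next
    fix x u assume xu: "x \<in> carrier G" "u \<in> carrier_vec e" "T *\<^sub>v u = 0\<^sub>v d"
    have "T *\<^sub>v (S x *\<^sub>v u) = R x *\<^sub>v 0\<^sub>v d" using comm[OF xu(1,2)] xu(3) by simp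
    also have "\<dots> = 0\<^sub>v d" using cR[OF xu(1)] by auto
    finally show "S x *\<^sub>v u \<in> {v \<in> carrier_vec e. T *\<^sub>v v = 0\<^sub>v d}"
      using mult_mat_vec_carrier[OF cS[OF xu(1)] xu(2)] by simp
  qed auto
  hence "K = {0\<^sub>v e} \<or> K = carrier_vec e" by (rule irrD(3)[OF S])
  moreover have "K \<noteq> carrier_vec e"
  proof
    assume "K = carrier_vec e"
    hence "T *\<^sub>v v = 0\<^sub>m d e *\<^sub>v v" if "v \<in> carrier_vec e" for v
    proof -
      have "T *\<^sub>v v = 0\<^sub>v d" using that \<open>K = carrier_vec e\<close> unfolding K_def by blast
      also have "0\<^sub>v d = 0\<^sub>m d e *\<^sub>v v" using that by (intro eq_vecI) auto
      finally show ?thesis .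
    qed
    hence "T = 0\<^sub>m d e" by (intro mat_eq_by_vec[OF T]) auto
    with False show False by simp
  qed
  ultimately have K: "K = {0\<^sub>v e}" by simp
  define I where "I = (\<lambda>v. T *\<^sub>v v) ` carrier_vec e"
  have "invariant_subspace G d R I"
    unfolding invariant_subspace_def I_def
  proof (intro conjI ballI allI)
    show "(*\<^sub>v) T ` carrier_vec e \<subseteq> carrier_vec d" using T by auto
    have "T *\<^sub>v 0\<^sub>v e = 0\<^sub>v d" using T by auto
    thus "0\<^sub>v d \<in> (*\<^sub>v) T ` carrier_vec e" by (rule image_eqI[OF HOL.sym]) simp
  next
    fix u v assume "u \<in> (*\<^sub>v) T ` carrier_vec e" "v \<in> (*\<^sub>v) T ` carrier_vec e"
    thus "u + v \<in> (*\<^sub>v) T ` carrier_vec e"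
      by (auto simp flip: mult_add_distrib_mat_vec[OF T])
  next
    fix a u assume "u \<in> (*\<^sub>v) T ` carrier_vec e"
    thus "a \<cdot>\<^sub>v u \<in> (*\<^sub>v) T ` carrier_vec e" by (auto simp flip: mult_mat_vec[OF T])
  next
    fix x u assume "x \<in> carrier G" "u \<in> (*\<^sub>v) T ` carrier_vec e"
    thus "R x *\<^sub>v u \<in> (*\<^sub>v) T ` carrier_vec e"
      using mult_mat_vec_carrier[OF cS] by (auto simp: comm)
  qed
  hence "I = {0\<^sub>v d} \<or> I = carrier_vec d" by (rule irrD(3)[OF R])
  moreover have "I \<noteq> {0\<^sub>v d}"
  proof
    assume "I = {0\<^sub>v d}"
    hence "T *\<^sub>v v = 0\<^sub>v d" if "v \<in> carrier_vec e" for v using that unfolding I_def by blast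
    hence "K = carrier_vec e" unfolding K_def by blast
    with \<open>K \<noteq> carrier_vec e\<close> show False by simp
  qed
  ultimately have I: "I = carrier_vec d" by simp
  have "\<exists>u. u \<in> carrier_vec e \<and> T *\<^sub>v u = w" if "w \<in> carrier_vec d" for w
  proof -
    have "w \<in> I" using I that by simp
    thus ?thesis unfolding I_def by (elim imageE) auto
  qed
  then obtain u where u: "\<And>w. w \<in> carrier_vec d \<Longrightarrow> u w \<in> carrier_vec e \<and> T *\<^sub>v u w = w" by metis
  \<comment> \<open>The columns are preimages of the unit vectors, which makes \<open>U\<close> a
    right inverse of \<open>T\<close>. It is a left inverse too, because U(Tv) - v lies in the
    kernel, which is zero.\<close>
  define U where "U = mat_of_cols e (map (\<lambda>j. u (unit_vec d j)) [0..<d])"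
  have U: "U \<in> carrier_mat e d" by (auto simp: U_def)
  have TU: "T * U = 1\<^sub>m d"
  proof (rule eq_matI)
    fix i j assume ij: "i < dim_row (1\<^sub>m d)" "j < dim_col (1\<^sub>m d)"
    have "(T * U) $$ (i, j) = (T *\<^sub>v col U j) $ i" using ij T U by simp
    also have "col U j = u (unit_vec d j)" using ij u by (simp add: U_def)
    finally show "(T * U) $$ (i, j) = 1\<^sub>m d $$ (i, j)" using u ij by (simp add: unit_vec_def)
  qed (use T U in auto)
  have UT: "U * T = 1\<^sub>m e"
  proof (rule mat_eq_by_vec)
    fix v :: "complex vec" assume v: "v \<in> carrier_vec e"
    have "T *\<^sub>v (U *\<^sub>v (T *\<^sub>v v)) = (T * U) *\<^sub>v (T *\<^sub>v v)"
      using assoc_mult_mat_vec[OF T U mult_mat_vec_carrier[OF T v]] by simp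
    also have "\<dots> = T *\<^sub>v v" using T v by (simp add: TU)
    finally have TUT: "T *\<^sub>v (U *\<^sub>v (T *\<^sub>v v)) = T *\<^sub>v v" .
    have c: "U *\<^sub>v (T *\<^sub>v v) \<in> carrier_vec e" by (intro mult_mat_vec_carrier[OF U] mult_mat_vec_carrier[OF T] v)
    have "T *\<^sub>v (U *\<^sub>v (T *\<^sub>v v) - v) = T *\<^sub>v v - T *\<^sub>v v"
      using mult_minus_distrib_mat_vec[OF T c v] TUT by simp
    also have "\<dots> = 0\<^sub>v d" using mult_mat_vec_carrier[OF T v] by simp
    finally have "U *\<^sub>v (T *\<^sub>v v) - v \<in> K" using c v by (simp add: K_def)
    hence "U *\<^sub>v (T *\<^sub>v v) - v = 0\<^sub>v e" by (simp add: K)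
    hence "U *\<^sub>v (T *\<^sub>v v) = v" by (rule vec_minus_zero_imp_eq[OF c v])
    thus "(U * T) *\<^sub>v v = 1\<^sub>m e *\<^sub>v v" using assoc_mult_mat_vec[OF U T v] v by simp
  qed (use T U in auto)
  have "mat_trace (R y) = mat_trace (S y)" if y: "y \<in> carrier G" for y
  proof -
    have "S y = U * T * S y" using cS[OF y] by (simp add: UT)
    also have "\<dots> = U * (R y * T)" unfolding TR[OF y] by (rule assoc_mult_mat[OF U T cS[OF y]])
    finally have "mat_trace (S y) = mat_trace ((R y * T) * U)"
      using mat_trace_mult_commute[OF U, of "R y * T"] T cR[OF y] by simp
    also have "(R y * T) * U = R y * (T * U)" by (rule assoc_mult_mat[OF cR[OF y] T U])
    also have "\<dots> = R y" using cR[OF y] by (simp add: TU)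
    finally show ?thesis by simp
  qed
  thus ?thesis by blast
qed simp

text \<open>The spectrum is nonempty because the dimension is positive; the eigenspace of a spectral
  value is invariant and not zero, hence everything.\<close>

lemma schur_scalar:
  assumes R: "irreducible_rep G d R" and T: "T \<in> carrier_mat d d"
    and TR: "\<And>y. y \<in> carrier G \<Longrightarrow> R y * T = T * R y"
  shows "\<exists>l. T = l \<cdot>\<^sub>m 1\<^sub>m d"
proof -
  note cR = rep_carrier[OF irrD(1)[OF R]]
  obtain l where "l \<in> spectrum T" using spectrum_non_empty[OF T irrD(2)[OF R]] by auto
  then obtain v0 where v0: "v0 \<in> carrier_vec d" "v0 \<noteq> 0\<^sub>v d" "T *\<^sub>v v0 = l \<cdot>\<^sub>v v0"
    using T by (auto simp: spectrum_def eigenvalue_def eigenvector_def)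
  have comm: "R y *\<^sub>v (T *\<^sub>v v) = T *\<^sub>v (R y *\<^sub>v v)" if "y \<in> carrier G" "v \<in> carrier_vec d" for y v
  proof -
    have "R y *\<^sub>v (T *\<^sub>v v) = (R y * T) *\<^sub>v v"
      by (rule assoc_mult_mat_vec[OF cR[OF that(1)] T that(2), symmetric])
    also have "\<dots> = T *\<^sub>v (R y *\<^sub>v v)"
      unfolding TR[OF that(1)] by (rule assoc_mult_mat_vec[OF T cR[OF that(1)] that(2)])
    finally show ?thesis .
  qed
  define K where "K = {v \<in> carrier_vec d. T *\<^sub>v v = l \<cdot>\<^sub>v v}"
  have "invariant_subspace G d R K"
    unfolding invariant_subspace_def K_def
  proof (intro conjI ballI allI; (elim CollectE conjE)?)
    show "0\<^sub>v d \<in> {v \<in> carrier_vec d. T *\<^sub>v v = l \<cdot>\<^sub>v v}" using T by auto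
  next
    fix u v assume "u \<in> carrier_vec d" "v \<in> carrier_vec d" "T *\<^sub>v u = l \<cdot>\<^sub>v u" "T *\<^sub>v v = l \<cdot>\<^sub>v v"
    thus "u + v \<in> {v \<in> carrier_vec d. T *\<^sub>v v = l \<cdot>\<^sub>v v}"
      by (auto simp: mult_add_distrib_mat_vec[OF T] smult_add_distrib_vec)
  next
    fix a u assume "u \<in> carrier_vec d" "T *\<^sub>v u = l \<cdot>\<^sub>v u"
    thus "a \<cdot>\<^sub>v u \<in> {v \<in> carrier_vec d. T *\<^sub>v v = l \<cdot>\<^sub>v v}"
      by (auto simp: mult_mat_vec[OF T] smult_smult_assoc mult.commute)
  next
    fix x u assume xu: "x \<in> carrier G" "u \<in> carrier_vec d" "T *\<^sub>v u = l \<cdot>\<^sub>v u"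
    have "T *\<^sub>v (R x *\<^sub>v u) = R x *\<^sub>v (l \<cdot>\<^sub>v u)" using comm[OF xu(1,2)] xu(3) by simp
    also have "\<dots> = l \<cdot>\<^sub>v (R x *\<^sub>v u)" by (rule mult_mat_vec[OF cR[OF xu(1)] xu(2)])
    finally show "R x *\<^sub>v u \<in> {v \<in> carrier_vec d. T *\<^sub>v v = l \<cdot>\<^sub>v v}"
      using mult_mat_vec_carrier[OF cR[OF xu(1)] xu(2)] by simp
  qed auto
  hence "K = carrier_vec d" using irrD(3)[OF R, of K] v0 unfolding K_def by blast
  hence "T *\<^sub>v v = (l \<cdot>\<^sub>m 1\<^sub>m d) *\<^sub>v v" if "v \<in> carrier_vec d" for v
  proof -
    have "T *\<^sub>v v = l \<cdot>\<^sub>v v" using that \<open>K = carrier_vec d\<close> unfolding K_def by blast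
    also have "\<dots> = (l \<cdot>\<^sub>m 1\<^sub>m d) *\<^sub>v v"
    proof (rule eq_vecI)
      fix i assume "i < dim_vec ((l \<cdot>\<^sub>m 1\<^sub>m d) *\<^sub>v v)"
      hence i: "i < d" by simp
      hence "((l \<cdot>\<^sub>m 1\<^sub>m d) *\<^sub>v v) $ i = (\<Sum>j\<in>{0..<d}. l * (if j = i then 1 else 0) * v $ j)"
        using that by (simp add: scalar_prod_def)
      also have "\<dots> = (\<Sum>j\<in>{0..<d}. if j = i then l * v $ j else 0)" by (rule sum.cong) auto
      also have "\<dots> = l * v $ i" using i by simp
      finally show "(l \<cdot>\<^sub>v v) $ i = ((l \<cdot>\<^sub>m 1\<^sub>m d) *\<^sub>v v) $ i" using that i by simp
    qed (use that in auto)
    finally show ?thesis .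
  qed
  hence "T = l \<cdot>\<^sub>m 1\<^sub>m d" using T by (intro mat_eq_by_vec[OF T]) auto
  thus ?thesis ..
qed

section \<open>Orthogonality relations\<close>

lemma sum_translate:
  assumes "y \<in> carrier G"
  shows "(\<Sum>x\<in>carrier G. F (y \<otimes> x)) = (\<Sum>x\<in>carrier G. F x)"
  by (rule sum.reindex_bij_witness[of _ "\<lambda>x. inv y \<otimes> x" "\<lambda>x. y \<otimes> x"])
     (use assms in \<open>auto simp: m_assoc[symmetric]\<close>)

lemma sum_translate_right:
  assumes "y \<in> carrier G"
  shows "(\<Sum>x\<in>carrier G. F (x \<otimes> y)) = (\<Sum>x\<in>carrier G. F x)"
  by (rule sum.reindex_bij_witness[of _ "\<lambda>x. x \<otimes> inv y" "\<lambda>x. x \<otimes> y"])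
     (use assms in \<open>auto simp: m_assoc\<close>)

lemma sum_conj:
  assumes "y \<in> carrier G"
  shows "(\<Sum>x\<in>carrier G. F (y \<otimes> x \<otimes> inv y)) = (\<Sum>x\<in>carrier G. F x)"
  using sum_translate[OF assms, of "\<lambda>x. F (x \<otimes> inv y)"] sum_translate_right[of "inv y" F] assms by simp

text \<open>The group sum of R(x) E S(x^-1), where E is the matrix unit in position (k, l): the
  standard intertwiner obtained by averaging.\<close>

definition avg_mat :: "('a \<Rightarrow> complex mat) \<Rightarrow> ('a \<Rightarrow> complex mat) \<Rightarrow> nat \<Rightarrow> nat \<Rightarrow> nat \<Rightarrow> nat \<Rightarrow> complex mat" where
  "avg_mat R S d e k l = mat d e (\<lambda>(i, j). \<Sum>x\<in>carrier G. R x $$ (i, k) * S (inv x) $$ (l, j))"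

lemma avg_mat_commute:
  assumes R: "matrix_rep G d R" and S: "matrix_rep G e S" and "k < d" "l < e" and y: "y \<in> carrier G"
  shows "R y * avg_mat R S d e k l = avg_mat R S d e k l * S y"
proof (rule eq_matI)
  note cR = rep_carrier[OF R] and cS = rep_carrier[OF S]
  fix i j assume "i < dim_row (avg_mat R S d e k l * S y)" "j < dim_col (avg_mat R S d e k l * S y)"
  hence ij: "i < d" "j < e" using cS[OF y] by (auto simp: avg_mat_def)
  have "(R y * avg_mat R S d e k l) $$ (i, j) =
      (\<Sum>m<d. R y $$ (i, m) * (\<Sum>x\<in>carrier G. R x $$ (m, k) * S (inv x) $$ (l, j)))"
    using ij cR[OF y] by (simp add: avg_mat_def scalar_prod_def lessThan_atLeast0)
  also have "\<dots> = (\<Sum>x\<in>carrier G. (\<Sum>m<d. R y $$ (i, m) * R x $$ (m, k)) * S (inv x) $$ (l, j))"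
    by (simp add: sum_distrib_left sum_distrib_right mult.assoc) (rule sum.swap)
  also have "\<dots> = (\<Sum>x\<in>carrier G. R (y \<otimes> x) $$ (i, k) * S (inv x) $$ (l, j))" (is "sum ?l _ = sum ?r _")
  proof (rule sum.cong)
    fix x assume x: "x \<in> carrier G"
    have "R (y \<otimes> x) $$ (i, k) = (\<Sum>m<d. R y $$ (i, m) * R x $$ (m, k))"
      using cR[OF y] cR[OF x] ij \<open>k < d\<close> by (simp add: rep_mult[OF R y x] scalar_prod_def lessThan_atLeast0)
    thus "?l x = ?r x" by simp
  qed simp
  \<comment> \<open>The inverse of x is rewritten as (yx)^-1 y, so that yx can become the summation
    variable.\<close>
  also have "\<dots> = (\<Sum>x\<in>carrier G. R (y \<otimes> x) $$ (i, k) * S (inv (y \<otimes> x) \<otimes> y) $$ (l, j))"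
    by (rule sum.cong) (use y in \<open>auto simp: inv_mult_group m_assoc\<close>)
  also have "\<dots> = (\<Sum>x\<in>carrier G. R x $$ (i, k) * S (inv x \<otimes> y) $$ (l, j))"
    by (rule sum_translate[OF y])
  also have "\<dots> = (\<Sum>x\<in>carrier G. R x $$ (i, k) * (\<Sum>m<e. S (inv x) $$ (l, m) * S y $$ (m, j)))" (is "sum ?l _ = sum ?r _")
  proof (rule sum.cong)
    fix x assume x: "x \<in> carrier G"
    have "S (inv x \<otimes> y) $$ (l, j) = (\<Sum>m<e. S (inv x) $$ (l, m) * S y $$ (m, j))"
      using cS[OF y] cS[of "inv x"] x ij \<open>l < e\<close>
      by (simp add: rep_mult[OF S _ y] scalar_prod_def lessThan_atLeast0)
    thus "?l x = ?r x" by simp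
  qed simp
  also have "\<dots> = (\<Sum>m<e. (\<Sum>x\<in>carrier G. R x $$ (i, k) * S (inv x) $$ (l, m)) * S y $$ (m, j))"
    by (simp add: sum_distrib_left sum_distrib_right mult.assoc) (rule sum.swap)
  also have "\<dots> = (avg_mat R S d e k l * S y) $$ (i, j)"
    using ij cS[OF y] by (simp add: avg_mat_def scalar_prod_def lessThan_atLeast0)
  finally show "(R y * avg_mat R S d e k l) $$ (i, j) = (avg_mat R S d e k l * S y) $$ (i, j)" .
qed (use rep_carrier[OF R y] rep_carrier[OF S y] in \<open>auto simp: avg_mat_def\<close>)

lemma irr_chars_rep:
  assumes "\<beta> \<in> irr_chars G"
  shows "\<exists>d R. irreducible_rep G d R \<and> (\<forall>x\<in>carrier G. \<beta> x = mat_trace (R x)) \<and>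
    (\<forall>x. x \<notin> carrier G \<longrightarrow> \<beta> x = 0)"
proof -
  from assms obtain d R where "irreducible_rep G d R"
    "\<beta> = (\<lambda>x. if x \<in> carrier G then mat_trace (R x) else 0)" unfolding irr_chars_def by auto
  thus ?thesis by (intro exI[of _ d] exI[of _ R]) simp
qed

lemma trace_product_sum:
  assumes R: "matrix_rep G d R" and S: "matrix_rep G e S"
  shows "(\<Sum>x\<in>carrier G. mat_trace (R x) * mat_trace (S (inv x))) =
     (\<Sum>i<d. \<Sum>j<e. avg_mat R S d e i j $$ (i, j))"
proof -
  have "(\<Sum>x\<in>carrier G. mat_trace (R x) * mat_trace (S (inv x))) =
     (\<Sum>x\<in>carrier G. \<Sum>i<d. \<Sum>j<e. R x $$ (i, i) * S (inv x) $$ (j, j))" (is "sum ?l _ = sum ?r _")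
  proof (rule sum.cong)
    fix x assume x: "x \<in> carrier G"
    show "?l x = ?r x"
      using rep_carrier[OF R x] rep_carrier[OF S, of "inv x"] x by (simp add: mat_trace_def sum_product)
  qed simp
  also have "\<dots> = (\<Sum>i<d. \<Sum>j<e. \<Sum>x\<in>carrier G. R x $$ (i, i) * S (inv x) $$ (j, j))"
    by (subst sum.swap) (rule sum_cong, rule sum.swap)
  finally show ?thesis by (simp add: avg_mat_def)
qed

lemma irr_orthogonal:
  assumes "\<beta> \<in> irr_chars G" "\<beta>' \<in> irr_chars G" "\<beta> \<noteq> \<beta>'"
  shows "(\<Sum>x\<in>carrier G. \<beta> x * \<beta>' (inv x)) = 0"
proof -
  obtain d R where R: "irreducible_rep G d R" "\<forall>x\<in>carrier G. \<beta> x = mat_trace (R x)"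
    "\<forall>x. x \<notin> carrier G \<longrightarrow> \<beta> x = 0" using irr_chars_rep[OF assms(1)] by auto
  obtain e S where S: "irreducible_rep G e S" "\<forall>x\<in>carrier G. \<beta>' x = mat_trace (S x)"
    "\<forall>x. x \<notin> carrier G \<longrightarrow> \<beta>' x = 0" using irr_chars_rep[OF assms(2)] by auto
  have ne: "\<not> (\<forall>y\<in>carrier G. mat_trace (R y) = mat_trace (S y))"
    proof
    assume eq: "\<forall>y\<in>carrier G. mat_trace (R y) = mat_trace (S y)"
    have "\<beta> x = \<beta>' x" for x using R(2,3) S(2,3) eq by (cases "x \<in> carrier G") auto
    thus False using assms(3) by auto
  qed
  have "avg_mat R S d e k l = 0\<^sub>m d e" if "k < d" "l < e" for k l
    using schur[OF R(1) S(1) _ avg_mat_commute[OF irrD(1)[OF R(1)] irrD(1)[OF S(1)] that]] ne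
    by (auto simp: avg_mat_def)
  thus ?thesis using trace_product_sum[OF irrD(1)[OF R(1)] irrD(1)[OF S(1)]]
    by (simp add: R S)
qed

lemma irr_normal:
  assumes "\<beta> \<in> irr_chars G"
  shows "(\<Sum>x\<in>carrier G. \<beta> x * \<beta> (inv x)) = of_nat (card (carrier G))"
proof -
  obtain d R where R: "irreducible_rep G d R" "\<forall>x\<in>carrier G. \<beta> x = mat_trace (R x)"
    "\<forall>x. x \<notin> carrier G \<longrightarrow> \<beta> x = 0" using irr_chars_rep[OF assms(1)] by auto
  note rep = irrD(1)[OF R(1)]
  let ?g = "of_nat (card (carrier G)) :: complex"
  have *: "of_nat d * avg_mat R R d d k l $$ (k, l) = (if k = l then ?g else 0)" if kl: "k < d" "l < d" for k l
  proof -
    obtain c where c: "avg_mat R R d d k l = c \<cdot>\<^sub>m 1\<^sub>m d"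
      using schur_scalar[OF R(1) _ avg_mat_commute[OF rep rep kl]] by (auto simp: avg_mat_def)
    \<comment> \<open>The scalar is found from the trace: summing the diagonal turns each term into
      the (l, k) entry of R(x^-1) R(x) = 1.\<close>
    have "of_nat d * c = (\<Sum>i<d. avg_mat R R d d k l $$ (i, i))" by (simp add: c)
    also have "\<dots> = (\<Sum>i<d. \<Sum>x\<in>carrier G. R (inv x) $$ (l, i) * R x $$ (i, k))"
      by (simp add: avg_mat_def mult.commute)
    also have "\<dots> = (\<Sum>x\<in>carrier G. \<Sum>i<d. R (inv x) $$ (l, i) * R x $$ (i, k))" by (rule sum.swap)
    also have "\<dots> = (\<Sum>x\<in>carrier G. if k = l then 1 else 0)" (is "sum ?l _ = sum ?r _")
    proof (rule sum.cong)
      fix x assume x: "x \<in> carrier G"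
      have "(\<Sum>i<d. R (inv x) $$ (l, i) * R x $$ (i, k)) = (R (inv x) * R x) $$ (l, k)"
        using rep_carrier[OF rep x] rep_carrier[OF rep, of "inv x"] x kl
        by (simp add: scalar_prod_def lessThan_atLeast0)
      also have "R (inv x) * R x = 1\<^sub>m d" using rep_mult[OF rep, of "inv x" x] rep_one[OF rep] x by simp
      finally show "?l x = ?r x" using kl by simp
    qed simp
    finally show ?thesis using kl by (simp add: c split: if_splits)
  qed
  have "of_nat d * (\<Sum>x\<in>carrier G. \<beta> x * \<beta> (inv x)) = (\<Sum>i<d. \<Sum>j<d. of_nat d * avg_mat R R d d i j $$ (i, j))"
    using trace_product_sum[OF rep rep] by (simp add: R sum_distrib_left)
  also have "\<dots> = (\<Sum>i<d. \<Sum>j<d. if i = j then ?g else 0)" using * by (intro sum.cong) auto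
  also have "\<dots> = of_nat d * ?g" by simp
  finally show ?thesis using irrD(2)[OF R(1)] by simp
qed

lemma irr_class_function:
  assumes "\<beta> \<in> irr_chars G" shows "\<beta> \<in> class_functions G"
proof -
  obtain d R where R: "irreducible_rep G d R" "\<forall>x\<in>carrier G. \<beta> x = mat_trace (R x)"
    "\<forall>x. x \<notin> carrier G \<longrightarrow> \<beta> x = 0" using irr_chars_rep[OF assms(1)] by auto
  note rep = irrD(1)[OF R(1)]
  have "\<beta> (y \<otimes> x \<otimes> inv y) = \<beta> x" if xy: "x \<in> carrier G" "y \<in> carrier G" for x y
  proof -
    have "mat_trace (R (y \<otimes> x \<otimes> inv y)) = mat_trace ((R y * R x) * R (inv y))"
      using xy by (simp add: rep_mult[OF rep])
    also have "\<dots> = mat_trace (R (inv y) * (R y * R x))"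
      using xy by (intro mat_trace_mult_commute[of _ d d]) (auto intro!: mult_carrier_mat[of _ d d] rep_carrier[OF rep])
    also have "R (inv y) * (R y * R x) = R (inv y \<otimes> (y \<otimes> x))" using xy by (simp add: rep_mult[OF rep])
    finally show ?thesis using xy by (simp add: R m_assoc[symmetric])
  qed
  thus ?thesis using R by (auto simp: class_functions_def)
qed

end

section \<open>Completeness: a class function orthogonal to all irreducible characters
  vanishes\<close>

interpretation fun_vs: vector_space "\<lambda>c (f :: 'a \<Rightarrow> complex). (\<lambda>x. c * f x)"
  by unfold_locales (auto simp: fun_eq_iff algebra_simps)

context finite_grp
begin

definition fun_space :: "('a \<Rightarrow> complex) set" where
  "fun_space = {f. \<forall>x. x \<notin> carrier G \<longrightarrow> f x = 0}"

definition ltrans :: "'a \<Rightarrow> ('a \<Rightarrow> complex) \<Rightarrow> 'a \<Rightarrow> complex" where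
  "ltrans x f = (\<lambda>y. if y \<in> carrier G then f (inv x \<otimes> y) else 0)"

definition fun_delta :: "'a \<Rightarrow> 'a \<Rightarrow> complex" where
  "fun_delta x = (\<lambda>y. if y = x then 1 else 0)"

lemma sum_fun_apply: "(\<Sum>i\<in>I. f i) x = (\<Sum>i\<in>I. f i x)" for f :: "'i \<Rightarrow> 'x \<Rightarrow> complex"
  by (induction I rule: infinite_finite_induct) auto

lemma fun_space_span: "fun_space \<subseteq> fun_vs.span (fun_delta ` carrier G)"
proof
  fix f :: "'a \<Rightarrow> complex" assume f: "f \<in> fun_space"
  have "f = (\<Sum>x\<in>carrier G. (\<lambda>y. f x * fun_delta x y))" (is "?u = ?v")
  proof
    fix y
    have "(\<Sum>x\<in>carrier G. f x * fun_delta x y) = (\<Sum>x\<in>carrier G. if x = y then f x else 0)"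
      by (rule sum.cong) (auto simp: fun_delta_def)
    also have "\<dots> = f y" using f finite_carrier by (simp add: fun_space_def)
    finally show "?u y = ?v y" by (simp add: sum_fun_apply)
  qed
  also have "\<dots> \<in> fun_vs.span (fun_delta ` carrier G)"
    by (intro fun_vs.span_sum fun_vs.span_scale fun_vs.span_base imageI)
  finally show "f \<in> fun_vs.span (fun_delta ` carrier G)" .
qed

lemma fun_space_independent_finite:
  assumes "fun_vs.independent B" "B \<subseteq> fun_space"
  shows "finite B"
  using fun_vs.independent_span_bound[OF finite_imageI[OF finite_carrier] assms(1)] assms(2) fun_space_span
  by blast

lemma irr_independent:
  assumes "finite B" "B \<subseteq> irr_chars G" "(\<Sum>\<beta>\<in>B. (\<lambda>x. k \<beta> * \<beta> x)) = 0" "\<beta> \<in> B"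
  shows "k \<beta> = 0"
proof -
  have "0 = (\<Sum>x\<in>carrier G. (\<Sum>\<beta>'\<in>B. k \<beta>' * \<beta>' x) * \<beta> (inv x))"
    using assms(3) by (simp add: fun_eq_iff sum_fun_apply)
  also have "\<dots> = (\<Sum>\<beta>'\<in>B. k \<beta>' * (\<Sum>x\<in>carrier G. \<beta>' x * \<beta> (inv x)))"
    by (simp add: sum_distrib_left sum_distrib_right mult.assoc) (rule sum.swap)
  also have "\<dots> = (\<Sum>\<beta>'\<in>B. if \<beta>' = \<beta> then k \<beta> * of_nat (card (carrier G)) else 0)"
    using assms irr_orthogonal[of _ \<beta>] irr_normal[of \<beta>] by (intro sum.cong) auto
  also have "\<dots> = k \<beta> * of_nat (card (carrier G))" using assms by simp
  finally show ?thesis using finite_carrier by auto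
qed

text \<open>\<open>irr_chars\<close> quantifies over all representations of all dimensions; it is
  finite because orthogonality makes it independent in the finite-dimensional space of functions on
  the group.\<close>

lemma finite_irr_chars: "finite (irr_chars G)"
proof (rule fun_space_independent_finite)
  show "fun_vs.independent (irr_chars G)"
    unfolding fun_vs.independent_explicit_module using irr_independent by blast
  show "irr_chars G \<subseteq> fun_space" using irr_class_function by (auto simp: class_functions_def fun_space_def)
qed

definition inv_space :: "('a \<Rightarrow> complex) set \<Rightarrow> bool" where
  "inv_space W \<longleftrightarrow> fun_vs.subspace W \<and> W \<subseteq> fun_space \<and> (\<forall>x\<in>carrier G. \<forall>f\<in>W. ltrans x f \<in> W)"

lemma ltrans_linear:
  "ltrans x (\<Sum>i\<in>I. (\<lambda>y. c i * f i y)) = (\<Sum>i\<in>I. (\<lambda>y. c i * ltrans x (f i) y))"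
  by (auto simp: ltrans_def fun_eq_iff sum_fun_apply)

lemma ltrans_mult:
  assumes "x \<in> carrier G" "y \<in> carrier G"
  shows "ltrans (x \<otimes> y) f = ltrans x (ltrans y f)"
  using assms by (auto simp: ltrans_def fun_eq_iff inv_mult_group m_assoc)

lemma ltrans_one: "f \<in> fun_space \<Longrightarrow> ltrans \<one> f = f"
  by (auto simp: ltrans_def fun_eq_iff fun_space_def)

text \<open>Irreducibility is defined for matrices, so a minimal translation-invariant space is
  given coordinates in a basis: \<phi> reads the coordinates and \<psi> recombines them. The
  functions \<open>b\<close> are exposed so that translates can be written through matrix
  entries.\<close>

lemma minimal_space_irr:
  assumes W: "inv_space W" and ne: "W \<noteq> {0}"
    and min: "\<forall>W'. inv_space W' \<longrightarrow> W' \<subseteq> W \<longrightarrow> W' = {0} \<or> W' = W"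
  shows "\<exists>d R \<phi> \<psi> (b :: nat \<Rightarrow> 'a \<Rightarrow> complex). irreducible_rep G d R \<and> (\<forall>w. \<phi> w \<in> carrier_vec d) \<and>
    (\<forall>w\<in>W. \<forall>x\<in>carrier G. ltrans x w = \<psi> (R x *\<^sub>v \<phi> w)) \<and>
    (\<forall>v. \<psi> v = (\<Sum>i<d. (\<lambda>y. v $ i * b i y)))"
proof -
  have sub: "fun_vs.subspace W" using W by (simp add: inv_space_def)
  obtain B where B: "B \<subseteq> W" "fun_vs.independent B" "W \<subseteq> fun_vs.span B"
    using fun_vs.maximal_independent_subset by blast
  have spB: "fun_vs.span B = W" using B fun_vs.span_minimal[OF B(1) sub] by blast
  have fB: "finite B" using fun_space_independent_finite[OF B(2)] B(1) W by (auto simp: inv_space_def)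
  obtain bs where bs: "set bs = B" "distinct bs" using finite_distinct_list[OF fB] by blast
  define d where "d = length bs"
  define \<phi> where "\<phi> = (\<lambda>w. vec d (\<lambda>i. fun_vs.representation B w (bs ! i)))"
  define \<psi> where "\<psi> = (\<lambda>v :: complex vec. \<Sum>i<d. (\<lambda>y. v $ i * (bs ! i) y))"
  define R where "R = (\<lambda>x. mat d d (\<lambda>(i, j). fun_vs.representation B (ltrans x (bs ! j)) (bs ! i)))"
  have bsW: "bs ! i \<in> W" if "i < d" for i using that B(1) bs by (auto simp: d_def)
  have ltW: "ltrans x w \<in> W" if "x \<in> carrier G" "w \<in> W" for x w using W that by (auto simp: inv_space_def)
  have psiW: "\<psi> v \<in> W" for v
    unfolding \<psi>_def by (intro fun_vs.subspace_sum[OF sub] fun_vs.subspace_scale[OF sub] bsW) auto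
  have phi_c: "\<phi> w \<in> carrier_vec d" for w by (simp add: \<phi>_def)
  have bij: "bij_betw (\<lambda>i. bs ! i) {..<d} B" using bs by (simp add: d_def bij_betw_nth)
  have psi_phi: "\<psi> (\<phi> w) = w" if "w \<in> W" for w
  proof -
    have "\<psi> (\<phi> w) = (\<Sum>i<d. (\<lambda>y. fun_vs.representation B w (bs ! i) * (bs ! i) y))"
      unfolding \<psi>_def by (rule sum.cong) (auto simp: \<phi>_def)
    also have "\<dots> = (\<Sum>b\<in>B. (\<lambda>y. fun_vs.representation B w b * b y))"
      by (rule sum.reindex_bij_betw[OF bij])
    also have "\<dots> = w" using fun_vs.sum_representation_eq[OF B(2) _ fB order_refl, of w] that spB by simp
    finally show ?thesis .
  qed
  have rep_sum: "fun_vs.representation B (\<Sum>j\<in>J. (\<lambda>y. c j * f j y)) b = (\<Sum>j\<in>J. c j * fun_vs.representation B (f j) b)"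
    if "\<And>j. j \<in> J \<Longrightarrow> f j \<in> W" for J :: "nat set" and c f b
  proof -
    have "fun_vs.representation B (\<Sum>j\<in>J. (\<lambda>y. c j * f j y)) = (\<lambda>b. \<Sum>j\<in>J. fun_vs.representation B (\<lambda>y. c j * f j y) b)"
      using that spB by (intro fun_vs.representation_sum B(2)) (auto intro!: fun_vs.span_scale)
    thus ?thesis using fun_vs.representation_scale[OF B(2)] that spB by (auto intro!: sum.cong)
  qed
  have phi_psi: "\<phi> (\<psi> v) = v" if v: "v \<in> carrier_vec d" for v
  proof (rule eq_vecI)
    fix i assume "i < dim_vec v"
    hence i: "i < d" using v by simp
    have "\<phi> (\<psi> v) $ i = (\<Sum>j<d. v $ j * fun_vs.representation B (bs ! j) (bs ! i))"
      using i rep_sum[of "{..<d}" "\<lambda>j. bs ! j" "\<lambda>j. v $ j" "bs ! i"] bsW by (simp add: \<phi>_def \<psi>_def)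
    also have "\<dots> = (\<Sum>j<d. if j = i then v $ j else 0)" (is "sum ?l _ = sum ?r _")
    proof (rule sum.cong)
      fix j assume "j \<in> {..<d}"
      hence j: "j < d" by simp
      have "bs ! j \<in> B" using j bs by (auto simp: d_def)
      thus "?l j = ?r j"
        using fun_vs.representation_basis[OF B(2), of "bs ! j"] i j bs
        by (auto simp: d_def nth_eq_iff_index_eq)
    qed simp
    also have "\<dots> = v $ i" using i by simp
    finally show "\<phi> (\<psi> v) $ i = v $ i" .
  qed (use v in \<open>simp add: \<phi>_def\<close>)
  have key: "R x *\<^sub>v v = \<phi> (ltrans x (\<psi> v))" if x: "x \<in> carrier G" and v: "v \<in> carrier_vec d" for x v
  proof (rule eq_vecI)
    fix i assume "i < dim_vec (\<phi> (ltrans x (\<psi> v)))"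
    hence i: "i < d" by (simp add: \<phi>_def)
    have "\<phi> (ltrans x (\<psi> v)) $ i = (\<Sum>j<d. v $ j * fun_vs.representation B (ltrans x (bs ! j)) (bs ! i))"
      using i rep_sum[of "{..<d}" "\<lambda>j. ltrans x (bs ! j)" "\<lambda>j. v $ j" "bs ! i"] bsW ltW[OF x]
      by (simp add: \<phi>_def \<psi>_def ltrans_linear)
    also have "\<dots> = (R x *\<^sub>v v) $ i"
      using i v by (simp add: R_def scalar_prod_def lessThan_atLeast0 mult.commute)
    finally show "(R x *\<^sub>v v) $ i = \<phi> (ltrans x (\<psi> v)) $ i" by simp
  qed (simp add: R_def \<phi>_def)
  have Rc: "R x \<in> carrier_mat d d" for x by (simp add: R_def)
  have rep: "matrix_rep G d R"
    unfolding matrix_rep_def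
  proof (intro conjI ballI Rc)
    have psW: "\<psi> v \<in> fun_space" for v using psiW W by (auto simp: inv_space_def)
    show "R \<one> = 1\<^sub>m d"
      by (rule mat_eq_by_vec[OF Rc]) (auto simp: key ltrans_one psW phi_psi)
    fix x y assume xy: "x \<in> carrier G" "y \<in> carrier G"
    show "R (x \<otimes> y) = R x * R y"
    proof (rule mat_eq_by_vec[OF Rc mult_carrier_mat[OF Rc Rc]])
      fix v :: "complex vec" assume v: "v \<in> carrier_vec d"
      have "R (x \<otimes> y) *\<^sub>v v = \<phi> (ltrans x (ltrans y (\<psi> v)))" using xy v by (simp add: key ltrans_mult)
      also have "\<dots> = \<phi> (ltrans x (\<psi> (\<phi> (ltrans y (\<psi> v)))))" using xy psiW ltW by (simp add: psi_phi)
      also have "\<dots> = R x *\<^sub>v (R y *\<^sub>v v)" using xy v phi_c by (simp add: key)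
      also have "\<dots> = R x * R y *\<^sub>v v" by (rule assoc_mult_mat_vec[OF Rc Rc v, symmetric])
      finally show "R (x \<otimes> y) *\<^sub>v v = R x * R y *\<^sub>v v" .
    qed
  qed
  have d0: "0 < d"
  proof (rule ccontr)
    assume "\<not> 0 < d"
    hence "B = {}" using bs by (simp add: d_def)
    hence "W = {0}" using spB by simp
    with ne show False by simp
  qed
  have psi_lin: "\<psi> (u + v) = \<psi> u + \<psi> v" if "u \<in> carrier_vec d" "v \<in> carrier_vec d" for u v
  proof
    fix y
    have "(\<Sum>i<d. (u + v) $ i * (bs ! i) y) = (\<Sum>i<d. u $ i * (bs ! i) y + v $ i * (bs ! i) y)"
      by (rule sum.cong) (use that in \<open>auto simp: distrib_right\<close>)
    thus "\<psi> (u + v) y = (\<psi> u + \<psi> v) y" by (simp add: \<psi>_def sum_fun_apply sum.distrib)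
  qed
  have psi_smult: "\<psi> (c \<cdot>\<^sub>v u) = (\<lambda>y. c * \<psi> u y)" if "u \<in> carrier_vec d" for u c
  proof
    fix y
    have "(\<Sum>i<d. (c \<cdot>\<^sub>v u) $ i * (bs ! i) y) = (\<Sum>i<d. c * (u $ i * (bs ! i) y))"
      by (rule sum.cong) (use that in \<open>auto simp: mult.assoc\<close>)
    thus "\<psi> (c \<cdot>\<^sub>v u) y = c * \<psi> u y" by (simp add: \<psi>_def sum_fun_apply sum_distrib_left)
  qed
  have irr: "irreducible_rep G d R"
    unfolding irreducible_rep_def
  proof (intro conjI allI impI rep d0)
    fix X assume X: "invariant_subspace G d R X"
    have Xc: "X \<subseteq> carrier_vec d" using X by (simp add: invariant_subspace_def)
    have psi0: "\<psi> (0\<^sub>v d) = 0" by (auto simp: \<psi>_def fun_eq_iff sum_fun_apply)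
    have "inv_space (\<psi> ` X)"
      unfolding inv_space_def fun_vs.subspace_def
    proof (intro conjI ballI allI)
      have "0\<^sub>v d \<in> X" using X by (simp add: invariant_subspace_def)
      thus "0 \<in> \<psi> ` X" by (intro image_eqI[of _ _ "0\<^sub>v d"]) (simp_all add: psi0)
    next
      fix f g assume "f \<in> \<psi> ` X" "g \<in> \<psi> ` X"
      then obtain u v where uv: "u \<in> X" "v \<in> X" "f = \<psi> u" "g = \<psi> v" by blast
      have "u + v \<in> X" using X uv by (simp add: invariant_subspace_def)
      moreover have "u \<in> carrier_vec d" "v \<in> carrier_vec d" using Xc uv by blast+
      ultimately show "f + g \<in> \<psi> ` X"
        by (simp add: uv(3,4) psi_lin[symmetric])
    next
      fix c f assume "f \<in> \<psi> ` X"
      then obtain u where u: "u \<in> X" "f = \<psi> u" by blast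
      have "c \<cdot>\<^sub>v u \<in> X" using X u by (simp add: invariant_subspace_def)
      moreover have "u \<in> carrier_vec d" using Xc u by blast
      ultimately show "(\<lambda>x. c * f x) \<in> \<psi> ` X"
        by (simp add: u(2) psi_smult[symmetric])
    next
      show "\<psi> ` X \<subseteq> fun_space" using psiW W by (auto simp: inv_space_def)
    next
      fix x f assume x: "x \<in> carrier G" and "f \<in> \<psi> ` X"
      then obtain u where u: "u \<in> X" "f = \<psi> u" by blast
      have "R x *\<^sub>v u \<in> X" using X u x by (simp add: invariant_subspace_def)
      moreover have "\<psi> (R x *\<^sub>v u) = ltrans x f"
        using key[OF x, of u] Xc u psi_phi[OF ltW[OF x psiW]] by auto
      ultimately show "ltrans x f \<in> \<psi> ` X" by (intro image_eqI[of _ _ "R x *\<^sub>v u"]) simp_all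
    qed
    moreover have "\<psi> ` X \<subseteq> W" using psiW by auto
    ultimately consider "\<psi> ` X = {0}" | "\<psi> ` X = W" using min by blast
    thus "X = {0\<^sub>v d} \<or> X = carrier_vec d"
    proof cases
      case 1
      have "v = 0\<^sub>v d" if "v \<in> X" for v
      proof -
        have "\<psi> v = \<psi> (0\<^sub>v d)" using 1 that psi0 by auto
        hence "\<phi> (\<psi> v) = \<phi> (\<psi> (0\<^sub>v d))" by simp
        thus ?thesis using phi_psi[of v] phi_psi[of "0\<^sub>v d"] that Xc by auto
      qed
      moreover have "0\<^sub>v d \<in> X" using X by (simp add: invariant_subspace_def)
      ultimately show ?thesis by blast
    next
      case 2
      have "v \<in> X" if v: "v \<in> carrier_vec d" for v
      proof -
        have "\<psi> v \<in> \<psi> ` X" using 2 psiW by simp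
        then obtain u where u: "u \<in> X" "\<psi> v = \<psi> u" by (elim imageE)
        hence "\<phi> (\<psi> u) = \<phi> (\<psi> v)" by simp
        hence "u = v" using phi_psi[of u] phi_psi[OF v] Xc u by auto
        thus ?thesis using u by simp
      qed
      thus ?thesis using Xc by blast
    qed
  qed
  show ?thesis
  proof (intro exI conjI ballI allI)
    show "irreducible_rep G d R" by (rule irr)
    show "\<phi> w \<in> carrier_vec d" for w by (rule phi_c)
    show "ltrans x w = \<psi> (R x *\<^sub>v \<phi> w)" if "w \<in> W" "x \<in> carrier G" for w x
      using key[OF that(2) phi_c] psi_phi[OF that(1)] psi_phi[OF ltW[OF that(2,1)]] by simp
    show "\<psi> v = (\<Sum>i<d. (\<lambda>y. v $ i * (bs ! i) y))" for v by (simp add: \<psi>_def)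
  qed
qed

text \<open>An invariant space of least dimension is minimal: a basis of a subspace extends to one
  of the whole, and bases of equal finite cardinality, one inside the other, coincide.\<close>

lemma exists_minimal_space:
  assumes U: "inv_space U" "U \<noteq> {0}"
  shows "\<exists>W. inv_space W \<and> W \<subseteq> U \<and> W \<noteq> {0} \<and>
    (\<forall>W'. inv_space W' \<longrightarrow> W' \<subseteq> W \<longrightarrow> W' = {0} \<or> W' = W)"
proof -
  define P where "P = (\<lambda>W. inv_space W \<and> W \<subseteq> U \<and> W \<noteq> {0})"
  define W where "W = (ARG_MIN fun_vs.dim W. P W)"
  have "P U" using U by (simp add: P_def)
  hence W: "P W" and least: "\<And>W'. P W' \<Longrightarrow> fun_vs.dim W \<le> fun_vs.dim W'"
    unfolding W_def using arg_min_nat_lemma[of P U fun_vs.dim] by auto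
  show ?thesis
  proof (intro exI[of _ W] conjI allI impI)
    fix W' assume W': "inv_space W'" "W' \<subseteq> W"
    show "W' = {0} \<or> W' = W"
    proof (rule disjCI)
      assume ne: "W' \<noteq> W"
      show "W' = {0}"
      proof (rule ccontr)
        assume "W' \<noteq> {0}"
        hence le: "fun_vs.dim W \<le> fun_vs.dim W'" using least[of W'] W W' by (auto simp: P_def)
        have sub: "fun_vs.subspace W" "fun_vs.subspace W'" "W \<subseteq> fun_space"
          using W W' by (auto simp: P_def inv_space_def)
        obtain B' where B': "B' \<subseteq> W'" "fun_vs.independent B'" "W' \<subseteq> fun_vs.span B'"
          using fun_vs.maximal_independent_subset by blast
        have "B' \<subseteq> W" using B' W' by blast
        then obtain B where B: "B' \<subseteq> B" "B \<subseteq> W" "fun_vs.independent B" "W \<subseteq> fun_vs.span B"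
          using fun_vs.maximal_independent_subset_extend[OF _ B'(2), of W] by blast
        have s: "fun_vs.span B' = W'" "fun_vs.span B = W"
          using fun_vs.span_minimal[OF B'(1) sub(2)] fun_vs.span_minimal[OF B(2) sub(1)] B B' by auto
        have "fun_vs.dim W' = card B'" "fun_vs.dim W = card B"
          using s fun_vs.dim_span_eq_card_independent[OF B'(2)] fun_vs.dim_span_eq_card_independent[OF B(3)] by auto
        moreover have "finite B" using fun_space_independent_finite[OF B(3)] B(2) sub(3) by blast
        ultimately have "B' = B" using le B(1) card_seteq by metis
        thus False using ne s by simp
      qed
    qed
  qed (use W in \<open>auto simp: P_def\<close>)
qed

text \<open>The sum of \<phi>(x) R(x^-1) commutes with the representation because \<phi> is a class
  function, so it is scalar, and its trace is the pairing assumed to vanish.\<close>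

lemma class_sum_irr_zero:
  assumes \<phi>: "\<phi> \<in> class_functions G"
    and orth: "\<And>\<beta>. \<beta> \<in> irr_chars G \<Longrightarrow> (\<Sum>x\<in>carrier G. \<phi> x * \<beta> (inv x)) = 0"
    and R: "irreducible_rep G d R" and ij: "i < d" "j < d"
  shows "(\<Sum>x\<in>carrier G. \<phi> x * R (inv x) $$ (i, j)) = 0"
proof -
  note rep = irrD(1)[OF R] and d = irrD(2)[OF R]
  note cR = rep_carrier[OF rep]
  define M where "M = mat d d (\<lambda>(i, j). \<Sum>x\<in>carrier G. \<phi> x * R (inv x) $$ (i, j))"
  have Mc: "M \<in> carrier_mat d d" by (simp add: M_def)
  have "R y * M = M * R y" if y: "y \<in> carrier G" for y
  proof (rule eq_matI)
    fix i j assume "i < dim_row (M * R y)" "j < dim_col (M * R y)"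
    hence ij: "i < d" "j < d" using cR[OF y] by (auto simp: M_def)
    have e1: "(\<Sum>m<d. R a $$ (i, m) * R b $$ (m, j)) = R (a \<otimes> b) $$ (i, j)"
      if "a \<in> carrier G" "b \<in> carrier G" for a b
      using cR[OF that(1)] cR[OF that(2)] ij rep_mult[OF rep that]
      by (simp add: scalar_prod_def lessThan_atLeast0)
    have "(R y * M) $$ (i, j) = (\<Sum>m<d. R y $$ (i, m) * (\<Sum>x\<in>carrier G. \<phi> x * R (inv x) $$ (m, j)))"
      using ij cR[OF y] by (simp add: M_def scalar_prod_def lessThan_atLeast0)
    also have "\<dots> = (\<Sum>m<d. \<Sum>x\<in>carrier G. \<phi> x * (R y $$ (i, m) * R (inv x) $$ (m, j)))"
      by (simp add: sum_distrib_left mult.left_commute)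
    also have "\<dots> = (\<Sum>x\<in>carrier G. \<Sum>m<d. \<phi> x * (R y $$ (i, m) * R (inv x) $$ (m, j)))" by (rule sum.swap)
    also have "\<dots> = (\<Sum>x\<in>carrier G. \<phi> x * R (y \<otimes> inv x) $$ (i, j))"
      using y by (intro sum.cong) (auto simp flip: sum_distrib_left simp: e1)
    also have "\<dots> = (\<Sum>x\<in>carrier G. \<phi> (inv y \<otimes> x \<otimes> inv (inv y)) * R (y \<otimes> inv (inv y \<otimes> x \<otimes> inv (inv y))) $$ (i, j))"
      using y by (intro sum_conj[symmetric]) simp
    also have "\<dots> = (\<Sum>x\<in>carrier G. \<phi> x * R (inv x \<otimes> y) $$ (i, j))" (is "sum ?l _ = sum ?r _")
    proof (rule sum.cong)
      fix x assume x: "x \<in> carrier G"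
      have "y \<otimes> inv (inv y \<otimes> x \<otimes> inv (inv y)) = inv x \<otimes> y"
        using x y by (simp add: inv_mult_group m_assoc[symmetric])
      moreover have "\<phi> (inv y \<otimes> x \<otimes> inv (inv y)) = \<phi> x"
        using \<phi> x inv_closed[OF y] unfolding class_functions_def by blast
      ultimately show "?l x = ?r x" by simp
    qed simp
    also have "\<dots> = (\<Sum>x\<in>carrier G. \<Sum>m<d. \<phi> x * (R (inv x) $$ (i, m) * R y $$ (m, j)))"
      using y by (intro sum.cong) (auto simp flip: sum_distrib_left simp: e1)
    also have "\<dots> = (\<Sum>m<d. \<Sum>x\<in>carrier G. \<phi> x * (R (inv x) $$ (i, m) * R y $$ (m, j)))" by (rule sum.swap)
    also have "\<dots> = (M * R y) $$ (i, j)"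
      using ij cR[OF y] by (simp add: M_def scalar_prod_def lessThan_atLeast0 sum_distrib_right mult.assoc)
    finally show "(R y * M) $$ (i, j) = (M * R y) $$ (i, j)" .
  qed (use cR[OF y] Mc in auto)
  then obtain c where c: "M = c \<cdot>\<^sub>m 1\<^sub>m d" using schur_scalar[OF R Mc] by blast
  obtain \<beta> where \<beta>: "\<beta> = (\<lambda>x. if x \<in> carrier G then mat_trace (R x) else 0)" by simp
  have \<beta>i: "\<beta> \<in> irr_chars G" unfolding irr_chars_def \<beta> using R by blast
  have "of_nat d * c = (\<Sum>i<d. M $$ (i, i))" by (simp add: c)
  also have "\<dots> = (\<Sum>i<d. \<Sum>x\<in>carrier G. \<phi> x * R (inv x) $$ (i, i))" by (simp add: M_def)
  also have "\<dots> = (\<Sum>x\<in>carrier G. \<Sum>i<d. \<phi> x * R (inv x) $$ (i, i))" by (rule sum.swap)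
  also have "\<dots> = (\<Sum>x\<in>carrier G. \<phi> x * \<beta> (inv x))" (is "sum ?l _ = sum ?r _")
  proof (rule sum.cong)
    fix x assume x: "x \<in> carrier G"
    show "?l x = ?r x"
      using x cR[of "inv x"] by (simp add: \<beta> mat_trace_def sum_distrib_left)
  qed simp
  finally have "c = 0" using orth[OF \<beta>i] d by simp
  hence "M $$ (i, j) = 0" using ij by (simp add: c)
  thus ?thesis using ij by (simp add: M_def)
qed

lemma class_function_zero:
  assumes \<phi>: "\<phi> \<in> class_functions G"
    and orth: "\<And>\<beta>. \<beta> \<in> irr_chars G \<Longrightarrow> (\<Sum>x\<in>carrier G. \<phi> x * \<beta> (inv x)) = 0"
  shows "\<phi> x = 0"
proof (rule ccontr)
  assume "\<phi> x \<noteq> 0"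
  hence x: "x \<in> carrier G" using \<phi> by (auto simp: class_functions_def)
  \<comment> \<open>\<open>A\<close> is convolution by the conjugate of \<phi>. Its adjoint, the sum
    of \<phi>(a) w(a y), kills irreducible pieces by \<open>class_sum_irr_zero\<close>. A vector in
    the range of \<open>A\<close> and in the kernel of the adjoint has norm zero; yet the range is
    not zero, since \<open>A\<close> sends the delta function at 1 to a function with value cnj
    \<phi>(x) at x.\<close>
  define A where "A = (\<lambda>v y. if y \<in> carrier G then \<Sum>a\<in>carrier G. cnj (\<phi> a) * v (inv a \<otimes> y) else 0)"
  define U where "U = A ` fun_space"
  have A_lt: "ltrans z (A v) = A (ltrans z v)" if z: "z \<in> carrier G" for z v
  proof
    fix y
    show "ltrans z (A v) y = A (ltrans z v) y"
    proof (cases "y \<in> carrier G")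
      case y: True
      have "A (ltrans z v) y = (\<Sum>a\<in>carrier G. cnj (\<phi> a) * v (inv z \<otimes> (inv a \<otimes> y)))"
        using y by (simp add: A_def ltrans_def)
      also have "\<dots> = (\<Sum>a\<in>carrier G. cnj (\<phi> (z \<otimes> a \<otimes> inv z)) * v (inv z \<otimes> (inv (z \<otimes> a \<otimes> inv z) \<otimes> y)))"
        by (rule sum_conj[OF z, symmetric])
      also have "\<dots> = (\<Sum>a\<in>carrier G. cnj (\<phi> a) * v (inv a \<otimes> (inv z \<otimes> y)))" (is "sum ?l _ = sum ?r _")
      proof (rule sum.cong)
        fix a assume a: "a \<in> carrier G"
        have "inv z \<otimes> (inv (z \<otimes> a \<otimes> inv z) \<otimes> y) = inv a \<otimes> (inv z \<otimes> y)"
          using a y z by (simp add: inv_mult_group m_assoc[symmetric])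
        moreover have "\<phi> (z \<otimes> a \<otimes> inv z) = \<phi> a" using \<phi> a z unfolding class_functions_def by blast
        ultimately show "?l a = ?r a" by simp
      qed simp
      also have "\<dots> = ltrans z (A v) y" using y z by (simp add: A_def ltrans_def)
      finally show ?thesis by simp
    qed (simp add: A_def ltrans_def)
  qed
  have "inv_space U"
    unfolding inv_space_def fun_vs.subspace_def
  proof (intro conjI ballI allI)
    have "A 0 = 0" by (auto simp: A_def fun_eq_iff)
    moreover have "0 \<in> fun_space" by (simp add: fun_space_def)
    ultimately show "0 \<in> U" unfolding U_def by (intro image_eqI[of _ _ 0]) simp_all
  next
    fix f g assume "f \<in> U" "g \<in> U"
    then obtain u v where uv: "u \<in> fun_space" "v \<in> fun_space" "f = A u" "g = A v" unfolding U_def by blast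
    have "A u + A v = A (u + v)" by (auto simp: A_def fun_eq_iff sum.distrib distrib_left)
    moreover have "u + v \<in> fun_space" using uv by (auto simp: fun_space_def)
    ultimately show "f + g \<in> U" by (simp add: U_def uv)
  next
    fix c f assume "f \<in> U"
    then obtain u where u: "u \<in> fun_space" "f = A u" unfolding U_def by blast
    have "(\<lambda>x. c * A u x) = A (\<lambda>x. c * u x)" by (auto simp: A_def fun_eq_iff sum_distrib_left mult.left_commute)
    moreover have "(\<lambda>x. c * u x) \<in> fun_space" using u by (auto simp: fun_space_def)
    ultimately show "(\<lambda>x. c * f x) \<in> U" by (simp add: U_def u)
  next
    show "U \<subseteq> fun_space" by (auto simp: U_def A_def fun_space_def)
  next
    fix z f assume z: "z \<in> carrier G" and "f \<in> U"
    then obtain u where u: "u \<in> fun_space" "f = A u" unfolding U_def by blast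
    have "ltrans z u \<in> fun_space" by (simp add: ltrans_def fun_space_def)
    thus "ltrans z f \<in> U" by (simp add: U_def u A_lt z)
  qed
  moreover have "U \<noteq> {0}"
  proof -
    have "A (fun_delta \<one>) x = (\<Sum>a\<in>carrier G. if a = x then cnj (\<phi> x) else 0)"
    proof -
      have "inv a \<otimes> x = \<one> \<longleftrightarrow> a = x" if "a \<in> carrier G" for a
        using that x by (metis inv_closed inv_equality inv_inv l_inv)
      thus ?thesis unfolding A_def using x by (auto simp: fun_delta_def intro!: sum.cong)
    qed
    also have "\<dots> = cnj (\<phi> x)" using x finite_carrier by simp
    finally have e: "A (fun_delta \<one>) x \<noteq> 0" using \<open>\<phi> x \<noteq> 0\<close> by simp
    have "fun_delta \<one> \<in> fun_space" by (auto simp: fun_delta_def fun_space_def)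
    hence "A (fun_delta \<one>) \<in> U" by (simp add: U_def)
    moreover have "A (fun_delta \<one>) \<noteq> 0"
    proof
      assume "A (fun_delta \<one>) = 0"
      hence "A (fun_delta \<one>) x = 0" by simp
      with e show False by simp
    qed
    ultimately show ?thesis by auto
  qed
  ultimately have "\<exists>W. inv_space W \<and> W \<subseteq> U \<and> W \<noteq> {0} \<and>
    (\<forall>W'. inv_space W' \<longrightarrow> W' \<subseteq> W \<longrightarrow> W' = {0} \<or> W' = W)" by (rule exists_minimal_space)
  then obtain W where W: "inv_space W" "W \<subseteq> U" "W \<noteq> {0}"
    "\<forall>W'. inv_space W' \<longrightarrow> W' \<subseteq> W \<longrightarrow> W' = {0} \<or> W' = W"
    by (elim exE conjE) (rule that)
  from minimal_space_irr[OF W(1,3,4)]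
  obtain d R \<alpha> \<psi> and b :: "nat \<Rightarrow> 'a \<Rightarrow> complex" where R: "irreducible_rep G d R" and \<alpha>': "\<forall>w. \<alpha> w \<in> carrier_vec d"
    and lt': "\<forall>w\<in>W. \<forall>x\<in>carrier G. ltrans x w = \<psi> (R x *\<^sub>v \<alpha> w)"
    and \<psi>': "\<forall>v. \<psi> v = (\<Sum>i<d. (\<lambda>y. v $ i * b i y))"
    by (elim exE conjE) (rule that)
  have \<alpha>: "\<alpha> w \<in> carrier_vec d" and \<psi>: "\<psi> v = (\<Sum>i<d. (\<lambda>y. v $ i * b i y))" for w v
    using \<alpha>' \<psi>' by simp_all
  have lt: "ltrans x w = \<psi> (R x *\<^sub>v \<alpha> w)" if "w \<in> W" "x \<in> carrier G" for w x using lt' that by simp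
  note cR = rep_carrier[OF irrD(1)[OF R]]
  have zero: "(\<Sum>a\<in>carrier G. \<phi> a * w (a \<otimes> y)) = 0" if w: "w \<in> W" and y: "y \<in> carrier G" for w y
  proof -
    have "(\<Sum>a\<in>carrier G. \<phi> a * w (a \<otimes> y)) = (\<Sum>a\<in>carrier G. \<phi> a * ltrans (inv a) w y)"
      using y by (simp add: ltrans_def)
    also have "\<dots> = (\<Sum>a\<in>carrier G. \<phi> a * (\<Sum>i<d. (\<Sum>j<d. R (inv a) $$ (i, j) * \<alpha> w $ j) * b i y))" (is "sum ?l _ = sum ?r _")
    proof (rule sum.cong)
      fix a assume a: "a \<in> carrier G"
      have c: "R (inv a) *\<^sub>v \<alpha> w \<in> carrier_vec d"
        using mult_mat_vec_carrier[OF cR \<alpha>[of w], of "inv a"] a by simp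
      have "ltrans (inv a) w y = (\<Sum>i<d. (R (inv a) *\<^sub>v \<alpha> w) $ i * b i y)"
        using lt[OF w, of "inv a"] a \<psi>[of "R (inv a) *\<^sub>v \<alpha> w"] by (simp add: sum_fun_apply)
      also have "\<dots> = (\<Sum>i<d. (\<Sum>j<d. R (inv a) $$ (i, j) * \<alpha> w $ j) * b i y)"
        using cR[of "inv a"] a \<alpha>[of w] by (intro sum.cong) (auto simp: scalar_prod_def lessThan_atLeast0)
      finally show "?l a = ?r a" by simp
    qed simp
    also have "\<dots> = (\<Sum>a\<in>carrier G. \<Sum>i<d. \<Sum>j<d. \<phi> a * R (inv a) $$ (i, j) * (\<alpha> w $ j * b i y))"
      by (simp add: sum_distrib_left sum_distrib_right mult.assoc)
    also have "\<dots> = (\<Sum>i<d. \<Sum>a\<in>carrier G. \<Sum>j<d. \<phi> a * R (inv a) $$ (i, j) * (\<alpha> w $ j * b i y))"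
      by (rule sum.swap)
    also have "\<dots> = (\<Sum>i<d. \<Sum>j<d. \<Sum>a\<in>carrier G. \<phi> a * R (inv a) $$ (i, j) * (\<alpha> w $ j * b i y))"
      by (intro sum.cong HOL.refl sum.swap)
    also have "\<dots> = 0"
      by (auto simp: class_sum_irr_zero[OF \<phi> orth R] simp flip: sum_distrib_right intro!: sum.neutral)
    finally show ?thesis .
  qed
  have "0 \<in> W" using W(1) by (auto simp: inv_space_def fun_vs.subspace_def)
  then obtain w where w: "w \<in> W" "w \<noteq> 0" using W(3) by blast
  then obtain v where v: "v \<in> fun_space" "w = A v" using W(2) by (auto simp: U_def)
  have w0: "w y = 0" if "y \<notin> carrier G" for y using that by (simp add: v A_def)
  have "0 = (\<Sum>y\<in>carrier G. (\<Sum>a\<in>carrier G. \<phi> a * w (a \<otimes> y)) * cnj (v y))"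
    using zero[OF w(1)] by simp
  also have "\<dots> = (\<Sum>a\<in>carrier G. \<Sum>y\<in>carrier G. \<phi> a * w (a \<otimes> y) * cnj (v y))"
    by (simp add: sum_distrib_right) (rule sum.swap)
  also have "\<dots> = (\<Sum>a\<in>carrier G. \<Sum>y\<in>carrier G. \<phi> a * w y * cnj (v (inv a \<otimes> y)))" (is "sum ?l _ = sum ?r _")
  proof (rule sum.cong)
    fix a assume a: "a \<in> carrier G"
    have "(\<Sum>y\<in>carrier G. \<phi> a * w (a \<otimes> y) * cnj (v y)) =
      (\<Sum>y\<in>carrier G. \<phi> a * w (a \<otimes> y) * cnj (v (inv a \<otimes> (a \<otimes> y))))"
      using a by (intro sum.cong) (auto simp: m_assoc[symmetric])
    also have "\<dots> = (\<Sum>y\<in>carrier G. \<phi> a * w y * cnj (v (inv a \<otimes> y)))"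
      by (rule sum_translate[OF a])
    finally show "?l a = ?r a" .
  qed simp
  also have "\<dots> = (\<Sum>y\<in>carrier G. \<Sum>a\<in>carrier G. \<phi> a * w y * cnj (v (inv a \<otimes> y)))" by (rule sum.swap)
  also have "\<dots> = (\<Sum>y\<in>carrier G. w y * cnj (w y))" (is "sum ?l _ = sum ?r _")
  proof (rule sum.cong)
    fix y assume y: "y \<in> carrier G"
    have "cnj (w y) = (\<Sum>a\<in>carrier G. \<phi> a * cnj (v (inv a \<otimes> y)))" using y by (simp add: v A_def)
    thus "?l y = ?r y"
      by (simp add: sum_distrib_left mult_ac)
  qed simp
  also have "\<dots> = of_real (\<Sum>y\<in>carrier G. (cmod (w y))\<^sup>2)" by (simp only: of_real_sum complex_norm_square)
  finally have "complex_of_real (\<Sum>y\<in>carrier G. (cmod (w y))\<^sup>2) = 0" by (rule HOL.sym)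
  hence "(\<Sum>y\<in>carrier G. (cmod (w y))\<^sup>2) = 0" by (simp only: of_real_eq_0_iff)
  hence "\<forall>y\<in>carrier G. w y = 0" using finite_carrier by (subst (asm) sum_nonneg_eq_0_iff) auto
  hence "w = 0" using w0 by (auto simp: fun_eq_iff)
  with w show False by simp
qed

definition inner :: "('a \<Rightarrow> complex) \<Rightarrow> ('a \<Rightarrow> complex) \<Rightarrow> complex" where
  "inner f g = (1 / of_nat (card (carrier G))) * (\<Sum>x\<in>carrier G. f x * g (inv x))"

lemma inner_irr:
  assumes "\<beta> \<in> irr_chars G" "\<beta>' \<in> irr_chars G"
  shows "inner \<beta> \<beta>' = (if \<beta> = \<beta>' then 1 else 0)"
proof -
  have "card (carrier G) \<noteq> 0" using finite_carrier by auto
  thus ?thesis using irr_normal[OF assms(1)] irr_orthogonal[OF assms] by (auto simp: inner_def)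
qed

lemma inner_sum_left: "inner (\<lambda>x. \<Sum>i\<in>I. k i * f i x) g = (\<Sum>i\<in>I. k i * inner (f i) g)"
proof -
  have "(\<Sum>x\<in>carrier G. (\<Sum>i\<in>I. k i * f i x) * g (inv x)) = (\<Sum>i\<in>I. k i * (\<Sum>x\<in>carrier G. f i x * g (inv x)))"
    by (simp add: sum_distrib_left sum_distrib_right mult.assoc) (rule sum.swap)
  thus ?thesis by (simp add: inner_def sum_distrib_left mult.left_commute)
qed

lemma inner_diff_left: "inner (\<lambda>x. f x - h x) g = inner f g - inner h g"
  by (simp add: inner_def left_diff_distrib sum_subtractf right_diff_distrib)

text \<open>The difference of f and its projection is a class function orthogonal to every
  irreducible character, so \<open>class_function_zero\<close> applies to it.\<close>

theorem irr_expansion: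
  assumes f: "f \<in> class_functions G"
  shows "f = (\<lambda>x. \<Sum>\<beta>\<in>irr_chars G. inner f \<beta> * \<beta> x)"
proof -
  define g where "g = (\<lambda>x. f x - (\<Sum>\<beta>\<in>irr_chars G. inner f \<beta> * \<beta> x))"
  have cf: "\<beta> x = 0" if "\<beta> \<in> irr_chars G" "x \<notin> carrier G" for \<beta> x
    using irr_class_function[OF that(1)] that(2) by (auto simp: class_functions_def)
  have cc: "\<beta> (y \<otimes> x \<otimes> inv y) = \<beta> x" if "\<beta> \<in> irr_chars G" "x \<in> carrier G" "y \<in> carrier G" for \<beta> x y
    using irr_class_function[OF that(1)] that(2,3) by (auto simp: class_functions_def)
  have g: "g \<in> class_functions G"
    using f by (auto simp: class_functions_def g_def cf cc intro!: sum.cong sum.neutral)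
  have "(\<Sum>x\<in>carrier G. g x * \<beta> (inv x)) = 0" if b: "\<beta> \<in> irr_chars G" for \<beta>
  proof -
    have "inner (\<lambda>x. \<Sum>\<beta>\<in>irr_chars G. inner f \<beta> * \<beta> x) \<beta> = (\<Sum>\<beta>'\<in>irr_chars G. inner f \<beta>' * inner \<beta>' \<beta>)"
      by (rule inner_sum_left)
    also have "\<dots> = (\<Sum>\<beta>'\<in>irr_chars G. if \<beta>' = \<beta> then inner f \<beta> else 0)"
      using b by (intro sum.cong) (auto simp: inner_irr)
    also have "\<dots> = inner f \<beta>" using b finite_irr_chars by simp
    finally have "inner g \<beta> = 0" unfolding g_def inner_diff_left by simp
    thus ?thesis using finite_carrier by (auto simp: inner_def)
  qed
  from class_function_zero[OF g this] show ?thesis by (auto simp: g_def fun_eq_iff)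
qed

text \<open>\<open>irr_coords\<close> is an arbitrary choice of coefficients. Its values off the
  irreducible characters are undetermined; on them orthonormality fixes it.\<close>

lemma irr_coords_inner:
  assumes f: "f \<in> class_functions G" and b: "\<beta> \<in> irr_chars G"
  shows "irr_coords G f \<beta> = inner f \<beta>"
proof -
  define P where "P = (\<lambda>k. f = (\<lambda>x. \<Sum>\<beta>\<in>irr_chars G. k \<beta> * \<beta> x))"
  have "P (inner f)" unfolding P_def by (rule irr_expansion[OF f])
  hence "P (SOME k. P k)" by (rule someI[of P "inner f"])
  hence "f = (\<lambda>x. \<Sum>\<beta>\<in>irr_chars G. irr_coords G f \<beta> * \<beta> x)"
    unfolding P_def irr_coords_def .
  hence "inner f \<beta> = inner (\<lambda>x. \<Sum>\<beta>\<in>irr_chars G. irr_coords G f \<beta> * \<beta> x) \<beta>" by simp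
  also have "\<dots> = (\<Sum>\<beta>'\<in>irr_chars G. irr_coords G f \<beta>' * inner \<beta>' \<beta>)" by (rule inner_sum_left)
  also have "\<dots> = (\<Sum>\<beta>'\<in>irr_chars G. if \<beta>' = \<beta> then irr_coords G f \<beta> else 0)"
    using b by (intro sum.cong) (auto simp: inner_irr)
  also have "\<dots> = irr_coords G f \<beta>" using b finite_irr_chars by simp
  finally show ?thesis by simp
qed

end

section \<open>Polynomials and exponentials of series of operators\<close>

lemma fconst_simps [simp]:
  "fconst 0 = 0" "fconst 1 = 1" "fconst (of_nat n) = of_nat n"
  by (simp_all add: fconst_def)

lemma fconst_mult: "fconst (x * y) = fconst x * fconst y"
  and fconst_add: "fconst (x + y) = fconst x + fconst y"
  by (simp_all add: fconst_def mult_single single_add)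

lemma fconst_sum: "fconst (\<Sum>i\<in>I. f i) = (\<Sum>i\<in>I. fconst (f i))"
  by (induction I rule: infinite_finite_induct) (simp_all add: fconst_add)

lemma of_nat_cancel_fpoly:
  assumes "0 < N" "of_nat N * p = of_nat N * (q :: 'a fpoly)" shows "p = q"
proof -
  have "fconst (1 / of_nat N) * of_nat N = (1 :: 'a fpoly)"
    using assms(1) by (simp flip: fconst_mult fconst_simps(3))
  hence "fconst (1 / of_nat N) * (of_nat N * r) = r" for r :: "'a fpoly"
    by (simp flip: mult.assoc)
  thus ?thesis using arg_cong[OF assms(2), of "\<lambda>x. fconst (1 / of_nat N) * x"] by simp
qed

lemma triangle_swap: "(\<Sum>i\<le>N. \<Sum>n\<le>N - i. f i n) = (\<Sum>n\<le>N. \<Sum>i\<le>N - n. f i n)" for N :: nat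
proof -
  have "(\<Sum>i\<le>N. \<Sum>n\<le>N - i. f i n) = (\<Sum>i\<in>{..N}. \<Sum>n\<in>{n. n \<in> {..N} \<and> i + n \<le> N}. f i n)"
    by (rule sum_cong, rule sum.cong) auto
  also have "\<dots> = (\<Sum>n\<in>{..N}. \<Sum>i\<in>{i. i \<in> {..N} \<and> i + n \<le> N}. f i n)" by (rule sum.swap_restrict) auto
  also have "\<dots> = (\<Sum>n\<le>N. \<Sum>i\<le>N - n. f i n)"
    by (rule sum_cong, rule sum.cong) auto
  finally show ?thesis .
qed

section \<open>Exponentials of commuting operator series\<close>

locale commuting_series =
  fixes A :: "'a opseries"
  assumes A_0: "A 0 p = 0"
    and A_add: "A n (p + q) = A n p + A n q"
    and A_scale: "A n (fconst c * p) = fconst c * A n p"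
    and A_comm: "A n (A m p) = A m (A n p)"
begin

lemma A_zero: "A n 0 = 0"
  using A_scale[of n 0 0] by simp

lemma A_sum: "A n (\<Sum>i\<in>I. f i) = (\<Sum>i\<in>I. A n (f i))"
  by (induction I rule: infinite_finite_induct) (simp_all add: A_zero A_add)

lemma A_of_nat: "A n (of_nat k * p) = of_nat k * A n p"
  using A_scale[of n "of_nat k" p] by simp

lemma power_vanish: "N < k \<Longrightarrow> ops_power A k N p = 0"
proof (induction k arbitrary: N)
  case (Suc k)
  have "A i (ops_power A k (N - i) p) = 0" if "i \<le> N" for i
  proof (cases "i = 0")
    case False
    thus ?thesis using Suc that by (simp add: A_zero)
  qed (simp add: A_0)
  thus ?case by (simp add: ops_mult_def)
qed simp

text \<open>The coefficient form of z d/dz A^(k+1) = (k+1) (z dA/dz) A^k; commutativity of the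
  coefficients lets the differentiated factor move to the front. The exponents of both formulas fit:
  multiplications commute, and so do derivations that are constant on the variables.\<close>

lemma power_recursion:
  "of_nat N * ops_power A (Suc k) N p = of_nat (Suc k) * (\<Sum>n\<le>N. of_nat n * A n (ops_power A k (N - n) p))"
proof (induction k arbitrary: N)
  case 0
  have "(\<Sum>n\<le>N. A n (if N - n = 0 then p else 0)) = A N p"
    by (subst sum.remove[of _ N]) (auto simp: A_zero intro!: sum.neutral)
  moreover have "(\<Sum>n\<le>N. of_nat n * A n (if N - n = 0 then p else 0)) = of_nat N * A N p"
    by (subst sum.remove[of _ N]) (auto simp: A_zero intro!: sum.neutral)
  ultimately show ?case by (simp add: ops_mult_def)
next
  case (Suc k)
  let ?P = "\<lambda>k N. ops_power A k N p"
  \<comment> \<open>Leibniz rule: the degree N is split into the degree i of the first factor and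
    the degree N - i of the rest, to which the induction hypothesis applies.\<close>
  have "of_nat N * ?P (Suc (Suc k)) N = (\<Sum>i\<le>N. of_nat i * A i (?P (Suc k) (N - i)) + A i (of_nat (N - i) * ?P (Suc k) (N - i)))"
    unfolding ops_power.simps(2)[of A "Suc k"] ops_mult_def sum_distrib_left
  proof (rule sum_cong)
    fix i assume "i \<in> {..N}"
    hence "of_nat N = (of_nat i + of_nat (N - i) :: 'a fpoly)" by (simp flip: of_nat_add)
    thus "of_nat N * A i (?P (Suc k) (N - i)) = of_nat i * A i (?P (Suc k) (N - i)) + A i (of_nat (N - i) * ?P (Suc k) (N - i))"
      by (simp only: A_of_nat distrib_right)
  qed
  also have "\<dots> = (\<Sum>i\<le>N. of_nat i * A i (?P (Suc k) (N - i))) +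
      (\<Sum>i\<le>N. \<Sum>n\<le>N - i. of_nat (Suc k) * (of_nat n * A n (A i (?P k (N - i - n)))))"
    unfolding Suc.IH sum.distrib by (simp only: A_of_nat A_sum sum_distrib_left A_comm)
  also have "(\<Sum>i\<le>N. \<Sum>n\<le>N - i. of_nat (Suc k) * (of_nat n * A n (A i (?P k (N - i - n))))) =
      (\<Sum>n\<le>N. \<Sum>i\<le>N - n. of_nat (Suc k) * (of_nat n * A n (A i (?P k (N - n - i)))))"
    by (subst triangle_swap) (simp only: diff_commute)
  also have "\<dots> = of_nat (Suc k) * (\<Sum>n\<le>N. of_nat n * A n (?P (Suc k) (N - n)))"
    by (simp only: ops_power.simps(2) ops_mult_def A_sum sum_distrib_left)
  finally show ?case by (simp add: algebra_simps)
qed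

lemma exp_recursion:
  "of_nat N * ops_exp A N p = (\<Sum>n\<le>N. of_nat n * A n (ops_exp A (N - n) p))"
proof (cases N)
  case (Suc M)
  let ?P = "\<lambda>k N. ops_power A k N p"
  \<comment> \<open>The sum up to \<open>M\<close> may stand for the sum up to N - n: powers beyond
    the degree vanish, and for n = 0, where the bound would be too small, both sides are killed by
    \<open>A 0\<close>.\<close>
  have ex: "A n (\<Sum>k\<le>M. fconst (1 / fact k) * ?P k (N - n)) = A n (ops_exp A (N - n) p)" for n
  proof (cases "n = 0")
    case False
    have "(\<Sum>k\<le>M. fconst (1 / fact k) * ?P k (N - n)) = (\<Sum>k\<le>N - n. fconst (1 / fact k) * ?P k (N - n))"
      by (rule sum.mono_neutral_right) (use False Suc power_vanish in auto)
    thus ?thesis by (simp add: ops_exp_def)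
  qed (simp add: A_0)
  have "of_nat N * ops_exp A N p = (\<Sum>k\<le>Suc M. fconst (1 / fact k) * (of_nat N * ?P k N))"
    unfolding ops_exp_def Suc sum_distrib_left by (simp only: mult.left_commute)
  also have "\<dots> = (\<Sum>k\<le>M. fconst (1 / fact (Suc k)) * (of_nat N * ?P (Suc k) N))"
    by (subst sum.atMost_Suc_shift) (simp add: Suc)
  also have "\<dots> = (\<Sum>k\<le>M. \<Sum>n\<le>N. of_nat n * A n (fconst (1 / fact k) * ?P k (N - n)))" (is "sum ?l _ = sum ?r _")
  proof (rule sum_cong)
    fix k
    have "fconst (1 / fact (Suc k)) * of_nat (Suc k) = (fconst (1 / fact k) :: 'a fpoly)"
      unfolding fconst_simps(3)[symmetric] fconst_mult[symmetric] by (simp add: divide_simps del: of_nat_Suc)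
    thus "?l k = ?r k"
      unfolding power_recursion by (simp only: mult.assoc[symmetric] sum_distrib_left A_scale) (simp only: mult_ac)
  qed
  also have "\<dots> = (\<Sum>n\<le>N. of_nat n * A n (\<Sum>k\<le>M. fconst (1 / fact k) * ?P k (N - n)))"
    by (subst sum.swap) (simp only: A_sum sum_distrib_left)
  also have "\<dots> = (\<Sum>n\<le>N. of_nat n * A n (ops_exp A (N - n) p))" by (simp only: ex)
  finally show ?thesis .
qed simp

text \<open>This differential equation characterises the exponential.\<close>

lemma ops_exp_unique:
  assumes "X 0 = p" "\<And>N. of_nat N * X N = (\<Sum>n\<le>N. of_nat n * A n (X (N - n)))"
  shows "X N = ops_exp A N p"
proof (induction N rule: less_induct)
  case (less N)
  show ?case
  proof (cases "N = 0")
    case False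
    have "of_nat n * A n (X (N - n)) = of_nat n * A n (ops_exp A (N - n) p)" if "n \<le> N" for n
      using less.IH[of "N - n"] False by (cases "n = 0") auto
    hence "of_nat N * X N = of_nat N * ops_exp A N p" unfolding assms(2) exp_recursion by (intro sum.cong) auto
    thus ?thesis by (rule of_nat_cancel_fpoly[rotated]) (use False in simp)
  qed (simp add: assms(1) ops_exp_def)
qed

end

section \<open>Monomials and derivations of the polynomial ring\<close>

abbreviation "mkeys \<equiv> Poly_Mapping.keys"
abbreviation "psing \<equiv> Poly_Mapping.single"
abbreviation "coef \<equiv> Poly_Mapping.lookup"

lemma fpoly_monomials: "p = (\<Sum>\<mu>\<in>mkeys p. psing \<mu> (coef p \<mu>))" for p :: "'a fpoly"
proof (rule poly_mapping_eqI)
  fix \<nu>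
  show "coef p \<nu> = coef (\<Sum>\<mu>\<in>mkeys p. psing \<mu> (coef p \<mu>)) \<nu>"
    by (auto simp: lookup_sum lookup_single when_def in_keys_iff)
qed

text \<open>The cases are limited to monomials of \<open>p\<close>, and those of
  \<open>monomial_induct\<close> to variables of the monomial, so that a restriction on the
  variables of \<open>p\<close>, as in \<open>fock_space\<close>, is at hand during the
  induction.\<close>

lemma fpoly_add_induct:
  assumes "P 0" "\<And>p q. P p \<Longrightarrow> P q \<Longrightarrow> P (p + q)" "\<And>\<mu> c. \<mu> \<in> mkeys p \<Longrightarrow> P (psing \<mu> c)"
  shows "P (p :: 'a fpoly)"
proof -
  have "P (\<Sum>\<mu>\<in>S. psing \<mu> (coef p \<mu>))" if "finite S" "S \<subseteq> mkeys p" for S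
    using that by (induction S rule: finite_induct) (use assms in auto)
  thus ?thesis by (subst fpoly_monomials) simp
qed

lemma monomial_induct:
  assumes "P (fconst c)"
    and "\<And>v p. v \<in> mkeys \<mu> \<Longrightarrow> P p \<Longrightarrow> P (fvar v * p)"
  shows "P (psing \<mu> c :: 'a fpoly)"
proof -
  have "P (psing \<nu> c)" if "n = (\<Sum>v\<in>mkeys \<nu>. coef \<nu> v)" "mkeys \<nu> \<subseteq> mkeys \<mu>" for n \<nu>
    using that
  proof (induction n arbitrary: \<nu>)
    case 0
    hence "\<nu> = 0" by (auto intro!: poly_mapping_eqI simp: in_keys_iff)
    thus ?case using assms(1) by (simp add: fconst_def)
  next
    case (Suc n)
    hence "\<nu> \<noteq> 0" by auto
    hence "mkeys \<nu> \<noteq> {}" by simp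
    then obtain v where v: "v \<in> mkeys \<nu>" by blast
    define \<kappa> where "\<kappa> = \<nu> - psing v 1"
    have l: "coef \<kappa> w = (if w = v then coef \<nu> v - 1 else coef \<nu> w)" for w
      by (simp add: \<kappa>_def lookup_minus lookup_single when_def)
    have pos: "0 < coef \<nu> v" using v by (simp add: in_keys_iff)
    have e: "\<nu> = psing v 1 + \<kappa>"
      by (rule poly_mapping_eqI) (use pos in \<open>simp add: l lookup_add lookup_single when_def\<close>)
    have k: "mkeys \<kappa> \<subseteq> mkeys \<nu>" by (auto simp: in_keys_iff l split: if_splits)
    have "(\<Sum>w\<in>mkeys \<kappa>. coef \<kappa> w) = (\<Sum>w\<in>mkeys \<nu>. coef \<kappa> w)"
      by (rule sum.mono_neutral_left[OF finite_keys k]) (auto simp: in_keys_iff)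
    moreover have "(\<Sum>w\<in>mkeys \<nu>. coef \<nu> w) = coef \<nu> v + (\<Sum>w\<in>mkeys \<nu> - {v}. coef \<nu> w)"
      "(\<Sum>w\<in>mkeys \<nu>. coef \<kappa> w) = coef \<kappa> v + (\<Sum>w\<in>mkeys \<nu> - {v}. coef \<kappa> w)"
      by (rule sum.remove[OF finite_keys v])+
    moreover have "(\<Sum>w\<in>mkeys \<nu> - {v}. coef \<kappa> w) = (\<Sum>w\<in>mkeys \<nu> - {v}. coef \<nu> w)"
      by (rule sum.cong) (auto simp: l)
    ultimately have "n = (\<Sum>w\<in>mkeys \<kappa>. coef \<kappa> w)" using Suc.prems(1) pos l[of v] by simp
    hence "P (psing \<kappa> c)" using k Suc.prems(2) by (intro Suc.IH) auto
    hence "P (fvar v * psing \<kappa> c)" using v Suc.prems(2) by (intro assms(2)) auto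
    thus ?case by (subst e) (simp add: fvar_def mult_single)
  qed
  thus ?thesis by blast
qed

text \<open>The supports over which \<open>derivation_of\<close> sums change under addition; fixed
  larger index sets turn additivity into a termwise identity.\<close>

lemma derivation_superset:
  assumes "finite S" "mkeys p \<subseteq> S" "finite V" "\<And>\<mu>. \<mu> \<in> mkeys p \<Longrightarrow> mkeys \<mu> \<subseteq> V"
  shows "derivation_of d p = (\<Sum>\<mu>\<in>S. \<Sum>v\<in>V. psing (\<mu> - psing v 1)
          (coef p \<mu> * of_nat (coef \<mu> v)) * d v)"
proof -
  have "derivation_of d p = (\<Sum>\<mu>\<in>mkeys p. \<Sum>v\<in>V. psing (\<mu> - psing v 1)
          (coef p \<mu> * of_nat (coef \<mu> v)) * d v)"
    unfolding derivation_of_def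
    by (rule sum_cong, rule sum.mono_neutral_left) (use assms in \<open>auto simp: in_keys_iff\<close>)
  also have "\<dots> = (\<Sum>\<mu>\<in>S. \<Sum>v\<in>V. psing (\<mu> - psing v 1)
          (coef p \<mu> * of_nat (coef \<mu> v)) * d v)"
    by (rule sum.mono_neutral_left) (use assms in \<open>auto simp: in_keys_iff\<close>)
  finally show ?thesis .
qed

lemma derivation_add: "derivation_of d (p + q) = derivation_of d p + derivation_of d q"
proof -
  let ?S = "mkeys p \<union> mkeys q" and ?V = "\<Union>\<mu>\<in>mkeys p \<union> mkeys q. mkeys \<mu>"
  have f: "finite ?S" "finite ?V" by auto
  have k: "mkeys (p + q) \<subseteq> ?S" by (rule Poly_Mapping.keys_add)
  have "derivation_of d r = (\<Sum>\<mu>\<in>?S. \<Sum>v\<in>?V. psing (\<mu> - psing v 1)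
          (coef r \<mu> * of_nat (coef \<mu> v)) * d v)" if "mkeys r \<subseteq> ?S" for r
    by (rule derivation_superset[OF f(1) that f(2)]) (use that in blast)
  from this[OF k] this[of p] this[of q] show ?thesis
    by (simp add: lookup_add single_add distrib_right sum.distrib)
qed

lemma derivation_zero [simp]: "derivation_of d 0 = 0"
  by (simp add: derivation_of_def)

lemma derivation_single: "derivation_of d (psing \<mu> a) =
  (\<Sum>v\<in>mkeys \<mu>. psing (\<mu> - psing v 1) (a * of_nat (coef \<mu> v)) * d v)"
  by (subst derivation_superset[of "{\<mu>}" _ "mkeys \<mu>"]) (auto split: if_splits)

lemma derivation_fconst [simp]: "derivation_of d (fconst c) = 0"
  by (simp add: fconst_def derivation_single)

lemma derivation_fvar [simp]: "derivation_of d (fvar v) = d v"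
  by (simp add: fvar_def derivation_single)

lemma derivation_mult_single:
  "derivation_of d (psing \<mu> a * psing \<nu> b) =
   derivation_of d (psing \<mu> a) * psing \<nu> b + psing \<mu> a * derivation_of d (psing \<nu> b)"
proof -
  let ?V = "mkeys \<mu> \<union> mkeys \<nu>"
  have e: "derivation_of d (psing \<kappa> c) =
    (\<Sum>v\<in>?V. psing (\<kappa> - psing v 1) (c * of_nat (coef \<kappa> v)) * d v)"
    if "mkeys \<kappa> \<subseteq> ?V" for \<kappa> c
    unfolding derivation_single by (rule sum.mono_neutral_left) (use that in \<open>auto simp: in_keys_iff\<close>)
  have 1: "psing (\<mu> + \<nu> - psing v 1) (a * b * of_nat (coef \<mu> v)) =
    psing (\<mu> - psing v 1) (a * of_nat (coef \<mu> v)) * psing \<nu> b"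
    if "True" for \<mu> \<nu> :: "'a fvar \<Rightarrow>\<^sub>0 nat" and a b :: complex and v
  proof (cases "coef \<mu> v = 0")
    case False
    hence "\<mu> + \<nu> - psing v 1 = (\<mu> - psing v 1) + \<nu>"
      by (intro poly_mapping_eqI) (auto simp: lookup_add lookup_minus lookup_single when_def)
    thus ?thesis by (simp add: mult_single mult_ac add_ac)
  qed simp
  have "derivation_of d (psing \<mu> a * psing \<nu> b) =
    (\<Sum>v\<in>?V. (psing (\<mu> + \<nu> - psing v 1) (a * b * of_nat (coef \<mu> v)) +
       psing (\<nu> + \<mu> - psing v 1) (b * a * of_nat (coef \<nu> v))) * d v)"
    unfolding mult_single
    by (subst e) (auto simp: keys_add lookup_add distrib_left single_add add.commute[of \<nu> \<mu>] mult.commute[of b a] intro!: sum.cong subsetD[OF keys_add])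
  also have "\<dots> = derivation_of d (psing \<mu> a) * psing \<nu> b + psing \<mu> a * derivation_of d (psing \<nu> b)"
    unfolding 1[OF TrueI] e[of \<mu>, OF Un_upper1] e[of \<nu>, OF Un_upper2]
    by (simp only: sum_distrib_left sum_distrib_right distrib_right distrib_left sum.distrib mult_ac)
  finally show ?thesis .
qed

lemma derivation_mult: "derivation_of d (p * q) = derivation_of d p * q + p * derivation_of d q"
proof (rule fpoly_add_induct[where p = p and P = "\<lambda>p. derivation_of d (p * q) = derivation_of d p * q + p * derivation_of d q"])
  fix \<mu> c
  show "derivation_of d (psing \<mu> c * q) = derivation_of d (psing \<mu> c) * q + psing \<mu> c * derivation_of d q"
    by (rule fpoly_add_induct[where p = q]) (simp_all add: derivation_mult_single derivation_add algebra_simps)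
qed (simp_all add: derivation_add algebra_simps)

lemma derivation_scale: "derivation_of d (fconst c * p) = fconst c * derivation_of d p"
  by (simp add: derivation_mult)

lemma derivation_sum: "derivation_of d (\<Sum>i\<in>I. f i) = (\<Sum>i\<in>I. derivation_of d (f i))"
  by (induction I rule: infinite_finite_induct) (simp_all add: derivation_add)

text \<open>Multiplying by one variable at a time, the values on the variable are constants, which
  the other derivation kills; the cross terms that remain are symmetric in the two
  derivations.\<close>

lemma derivation_comm:
  assumes "\<And>v. \<exists>c. d v = fconst c" "\<And>v. \<exists>c. d' v = fconst c"
  shows "derivation_of d (derivation_of d' p) = derivation_of d' (derivation_of d p)"
proof (rule fpoly_add_induct[where p = p])
  fix \<mu> c
  show "derivation_of d (derivation_of d' (psing \<mu> c)) = derivation_of d' (derivation_of d (psing \<mu> c))"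
  proof (rule monomial_induct)
    fix v p assume IH: "derivation_of d (derivation_of d' p) = derivation_of d' (derivation_of d p)"
    obtain a b where "d v = fconst a" "d' v = fconst b" using assms by blast
    thus "derivation_of d (derivation_of d' (fvar v * p)) = derivation_of d' (derivation_of d (fvar v * p))"
      by (simp add: derivation_mult derivation_add IH algebra_simps)
  qed simp
qed (simp_all add: derivation_add)

lemma derivation_prod_mset:
  "derivation_of d (\<Prod>b\<in>#M. f b) = (\<Sum>b\<in>#M. derivation_of d (f b) * (\<Prod>b\<in>#M - {#b#}. f b))"
proof (induction M)
  case (add x M)
  have "(\<Sum>b\<in>#M. derivation_of d (f b) * (\<Prod>b\<in>#add_mset x M - {#b#}. f b)) =
    (\<Sum>b\<in>#M. f x * (derivation_of d (f b) * (\<Prod>b\<in>#M - {#b#}. f b)))"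
  proof (rule arg_cong[of _ _ sum_mset], rule image_mset_cong)
    fix b assume "b \<in># M"
    hence "add_mset x M - {#b#} = add_mset x (M - {#b#})" by simp
    thus "derivation_of d (f b) * (\<Prod>b\<in>#add_mset x M - {#b#}. f b) = f x * (derivation_of d (f b) * (\<Prod>b\<in>#M - {#b#}. f b))"
      by (simp add: mult_ac)
  qed
  thus ?case by (simp add: derivation_mult add.IH sum_mset_distrib_left image_mset.compositionality comp_def)
qed (use derivation_fconst[of d 1] in simp)

section \<open>Weighted sums over multisets\<close>

lemma image_mset_eq_bij:
  assumes "finite X" "finite Y" "image_mset f (mset_set X) = image_mset g (mset_set Y)"
  shows "\<exists>F. bij_betw F X Y \<and> (\<forall>x\<in>X. g (F x) = f x)"
  using assms
proof (induction X arbitrary: Y rule: finite_induct)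
  case empty
  hence "mset_set Y = {#}" by simp
  hence "set_mset (mset_set Y) = {}" by simp
  hence "Y = {}" using empty.prems(1) by (simp del: set_mset_eq_empty_iff)
  thus ?case by (auto simp: bij_betw_def)
next
  case (insert x X)
  have "f x \<in># image_mset g (mset_set Y)" using insert by (simp flip: insert.prems(2))
  then obtain y where y: "y \<in> Y" "g y = f x" using insert.prems(1) by auto
  define Z where "Z = Y - {y}"
  have Y: "Y = insert y Z" "y \<notin> Z" "finite Z" using y insert.prems(1) by (auto simp: Z_def)
  have "image_mset f (mset_set X) = image_mset g (mset_set Z)"
    using insert.prems(2) insert.hyps Y y by simp
  from insert.IH[OF Y(3) this] obtain F where F: "bij_betw F X Z" "\<forall>x\<in>X. g (F x) = f x" by blast
  define F' where "F' = (\<lambda>w. if w = x then y else F w)"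
  have "bij_betw F' X Z" using F(1) insert.hyps by (subst bij_betw_cong[of _ _ F]) (auto simp: F'_def)
  moreover have "bij_betw F' {x} {y}" by (simp add: F'_def)
  ultimately have "bij_betw F' ({x} \<union> X) ({y} \<union> Z)" using Y by (intro bij_betw_combine) auto
  moreover have "\<forall>w\<in>insert x X. g (F' w) = f w" using F y insert.hyps by (auto simp: F'_def)
  ultimately show ?case using Y by (intro exI[of _ F']) simp
qed

text \<open>The labels will be pairs (class, part). Positive sizes and finitely many labels of
  bounded size leave finitely many multisets of given weight; nonzero \<open>r\<close> lets a label
  be removed by division.\<close>

locale weighted_labels =
  fixes B :: "'b set" and k :: "'b \<Rightarrow> nat" and r :: "'b \<Rightarrow> complex"
  assumes finite_labels: "\<And>N. finite {b \<in> B. k b \<le> N}"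
    and size_pos: "\<And>b. b \<in> B \<Longrightarrow> 0 < k b"
    and r_nz: "\<And>b. b \<in> B \<Longrightarrow> r b \<noteq> 0"
begin

definition weight :: "'b multiset \<Rightarrow> nat" where
  "weight \<mu> = (\<Sum>b\<in>#\<mu>. k b)"

definition msets :: "nat \<Rightarrow> 'b multiset set" where
  "msets N = {\<mu>. set_mset \<mu> \<subseteq> B \<and> weight \<mu> = N}"

text \<open>The coefficient of the monomial \<mu> in exp (sum over b of x_b / r b). When r b is the
  part times the centralizer order this is 1/Z.\<close>

definition wt :: "'b multiset \<Rightarrow> complex" where
  "wt \<mu> = (\<Prod>b\<in>set_mset \<mu>. 1 / (fact (count \<mu> b) * r b ^ count \<mu> b))"

lemma weight_add [simp]: "weight (add_mset b \<mu>) = k b + weight \<mu>"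
  and weight_empty [simp]: "weight {#} = 0"
  and weight_union [simp]: "weight (\<mu> + \<nu>) = weight \<mu> + weight \<nu>"
  by (simp_all add: weight_def)

lemma weight_ge: "b \<in># \<mu> \<Longrightarrow> k b \<le> weight \<mu>"
  by (auto simp: weight_def dest!: multi_member_split)

lemma size_le_weight: "set_mset \<mu> \<subseteq> B \<Longrightarrow> size \<mu> \<le> weight \<mu>"
proof (induction \<mu>)
  case (add b \<mu>)
  thus ?case using size_pos[of b] by auto
qed simp

lemma msets_finite: "finite (msets N)"
proof -
  have "msets N \<subseteq> (\<Union>n\<le>N. {\<mu>. set_mset \<mu> \<subseteq> {b \<in> B. k b \<le> N} \<and> size \<mu> = n})"
  proof
    fix \<mu> assume "\<mu> \<in> msets N"
    hence \<mu>: "set_mset \<mu> \<subseteq> B" "weight \<mu> = N" by (auto simp: msets_def)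
    have "set_mset \<mu> \<subseteq> {b \<in> B. k b \<le> N}" using weight_ge \<mu> by auto
    moreover have "size \<mu> \<le> N" using size_le_weight \<mu> by auto
    ultimately show "\<mu> \<in> (\<Union>n\<le>N. {\<mu>. set_mset \<mu> \<subseteq> {b \<in> B. k b \<le> N} \<and> size \<mu> = n})" by auto
  qed
  moreover have "finite (\<Union>n\<le>N. {\<mu>. set_mset \<mu> \<subseteq> {b \<in> B. k b \<le> N} \<and> size \<mu> = n})"
    using finite_multisets_of_size[OF finite_labels] by (auto simp: multisets_of_size_def)
  ultimately show ?thesis by (rule finite_subset)
qed

lemma weight_count:
  assumes "set_mset \<mu> \<subseteq> B" "weight \<mu> \<le> N"
  shows "weight \<mu> = (\<Sum>b\<in>{b \<in> B. k b \<le> N}. count \<mu> b * k b)"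
  using assms
proof (induction \<mu>)
  case (add b \<mu>)
  have b: "b \<in> {b \<in> B. k b \<le> N}" using add.prems by auto
  have "(\<Sum>b'\<in>{b \<in> B. k b \<le> N}. count (add_mset b \<mu>) b' * k b') =
      (\<Sum>b'\<in>{b \<in> B. k b \<le> N}. count \<mu> b' * k b' + (if b' = b then k b else 0))"
    by (rule sum.cong) auto
  also have "\<dots> = weight \<mu> + k b" using add b finite_labels[of N] by (simp add: sum.distrib)
  finally show ?case by simp
qed simp

lemma wt_add:
  assumes "b \<in> B"
  shows "wt (add_mset b \<mu>) * (of_nat (Suc (count \<mu> b)) * r b) = wt \<mu>"
proof -
  define g where "g = (\<lambda>\<mu> b. 1 / (fact (count \<mu> b) * r b ^ count \<mu> b))"
  have w: "wt \<mu> = (\<Prod>b\<in>insert b (set_mset \<mu>). g \<mu> b)" for \<mu>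
    unfolding wt_def g_def by (rule prod.mono_neutral_left) (auto simp: not_in_iff)
  have "wt (add_mset b \<mu>) = g (add_mset b \<mu>) b * (\<Prod>a\<in>set_mset \<mu> - {b}. g (add_mset b \<mu>) a)"
    using w[of "add_mset b \<mu>"] by (simp add: prod.insert_remove)
  also have "(\<Prod>a\<in>set_mset \<mu> - {b}. g (add_mset b \<mu>) a) = (\<Prod>a\<in>set_mset \<mu> - {b}. g \<mu> a)"
    by (rule prod.cong) (auto simp: g_def)
  finally have 1: "wt (add_mset b \<mu>) = g (add_mset b \<mu>) b * (\<Prod>a\<in>set_mset \<mu> - {b}. g \<mu> a)" .
  have 2: "wt \<mu> = g \<mu> b * (\<Prod>a\<in>set_mset \<mu> - {b}. g \<mu> a)"
    using w[of \<mu>] by (simp add: prod.insert_remove)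
  have c: "1 + (of_nat (count \<mu> b) :: complex) \<noteq> 0"
    by (metis of_nat_Suc of_nat_eq_0_iff nat.simps(3))
  have 3: "g (add_mset b \<mu>) b * (of_nat (Suc (count \<mu> b)) * r b) = g \<mu> b"
    using r_nz[OF assms] c by (simp add: g_def divide_simps)
  have "(g (add_mset b \<mu>) b * (\<Prod>a\<in>set_mset \<mu> - {b}. g \<mu> a)) * (of_nat (Suc (count \<mu> b)) * r b) =
      (g (add_mset b \<mu>) b * (of_nat (Suc (count \<mu> b)) * r b)) * (\<Prod>a\<in>set_mset \<mu> - {b}. g \<mu> a)"
    by (simp only: mult_ac)
  thus ?thesis by (simp only: 1 2 3)
qed

lemma wt_empty [simp]: "wt {#} = 1"
  by (simp add: wt_def)

lemma msets_zero: "msets 0 = {{#}}"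
proof -
  have "\<mu> = {#}" if "\<mu> \<in> msets 0" for \<mu>
    using that size_le_weight[of \<mu>] by (auto simp: msets_def)
  thus ?thesis by (auto simp: msets_def)
qed

text \<open>Removing one copy of \<open>b\<close> is a bijection from the multisets containing it,
  and \<open>wt_add\<close> compares the weights. The map \<open>e\<close> carries complex weights
  into the ring of values: the identity for numbers, \<open>fconst\<close> for polynomials.\<close>

lemma msets_shift:
  fixes e :: "complex \<Rightarrow> 'v :: comm_ring_1" and \<phi> :: "'b multiset \<Rightarrow> 'v"
  assumes e_nat: "\<And>n. e (of_nat n) = of_nat n" and b: "b \<in> {b \<in> B. k b \<le> N}"
  shows "(\<Sum>\<mu>\<in>msets N. e (of_nat (count \<mu> b * k b) * wt \<mu>) * \<phi> \<mu>) =
      (\<Sum>\<mu>\<in>msets (N - k b). e (of_nat (k b) / r b * wt \<mu>) * \<phi> (add_mset b \<mu>))"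
proof -
  have e0: "e 0 = 0" using e_nat[of 0] by simp
  have "(\<Sum>\<mu>\<in>msets N. e (of_nat (count \<mu> b * k b) * wt \<mu>) * \<phi> \<mu>) =
      (\<Sum>\<mu>\<in>{\<mu> \<in> msets N. b \<in># \<mu>}. e (of_nat (count \<mu> b * k b) * wt \<mu>) * \<phi> \<mu>)"
    by (rule sum.mono_neutral_right) (auto simp: msets_finite not_in_iff e0)
  also have "\<dots> = (\<Sum>\<mu>\<in>msets (N - k b). e (of_nat (k b) / r b * wt \<mu>) * \<phi> (add_mset b \<mu>))"
  proof (rule sum.reindex_bij_witness[of _ "add_mset b" "\<lambda>\<mu>. \<mu> - {#b#}"])
    fix \<mu> assume "\<mu> \<in> {\<mu> \<in> msets N. b \<in># \<mu>}"
    then obtain \<nu> where \<nu>: "\<mu> = add_mset b \<nu>" "\<mu> \<in> msets N" by (auto dest!: multi_member_split)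
    show "add_mset b (\<mu> - {#b#}) = \<mu>" by (simp add: \<nu>)
    show "\<mu> - {#b#} \<in> msets (N - k b)" using \<nu> by (auto simp: msets_def)
    have "of_nat (count \<mu> b * k b) * wt \<mu> =
        of_nat (k b) / r b * (wt (add_mset b \<nu>) * (of_nat (Suc (count \<nu> b)) * r b))"
      using r_nz[of b] b by (simp add: \<nu> ring_distribs)
    also have "\<dots> = of_nat (k b) / r b * wt \<nu>" using b by (subst wt_add) auto
    finally show "e (of_nat (k b) / r b * wt (\<mu> - {#b#})) * \<phi> (add_mset b (\<mu> - {#b#})) =
        e (of_nat (count \<mu> b * k b) * wt \<mu>) * \<phi> \<mu>" by (simp add: \<nu>)
  qed (use b in \<open>auto simp: msets_def\<close>)
  finally show ?thesis .
qed

text \<open>N is the total size of \<mu>, written as a sum over labels, and in each term one copy of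
  the label is removed. This is z d/dz applied to the exponential whose coefficients are
  \<open>wt\<close>.\<close>

lemma msets_recursion:
  fixes e :: "complex \<Rightarrow> 'v :: comm_ring_1" and \<phi> :: "'b multiset \<Rightarrow> 'v"
  assumes e_mult: "\<And>x y. e (x * y) = e x * e y" and e_nat: "\<And>n. e (of_nat n) = of_nat n"
  shows "of_nat N * (\<Sum>\<mu>\<in>msets N. e (wt \<mu>) * \<phi> \<mu>) =
    (\<Sum>b\<in>{b \<in> B. k b \<le> N}. e (of_nat (k b) / r b) * (\<Sum>\<mu>\<in>msets (N - k b). e (wt \<mu>) * \<phi> (add_mset b \<mu>)))"
proof -
  let ?B = "{b \<in> B. k b \<le> N}"
  have "of_nat N * (\<Sum>\<mu>\<in>msets N. e (wt \<mu>) * \<phi> \<mu>) =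
      (\<Sum>\<mu>\<in>msets N. \<Sum>b\<in>?B. e (of_nat (count \<mu> b * k b) * wt \<mu>) * \<phi> \<mu>)"
    unfolding sum_distrib_left
  proof (rule sum.cong)
    fix \<mu> assume "\<mu> \<in> msets N"
    hence "N = (\<Sum>b\<in>?B. count \<mu> b * k b)" using weight_count[of \<mu> N] by (simp add: msets_def)
    hence "of_nat N = (of_nat (\<Sum>b\<in>?B. count \<mu> b * k b) :: 'v)" by (rule arg_cong)
    hence "of_nat N = (\<Sum>b\<in>?B. of_nat (count \<mu> b * k b) :: 'v)" by (simp only: of_nat_sum)
    thus "of_nat N * (e (wt \<mu>) * \<phi> \<mu>) = (\<Sum>b\<in>?B. e (of_nat (count \<mu> b * k b) * wt \<mu>) * \<phi> \<mu>)"
      by (simp only: sum_distrib_right e_mult e_nat mult.assoc)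
  qed simp
  also have "\<dots> = (\<Sum>b\<in>?B. \<Sum>\<mu>\<in>msets N. e (of_nat (count \<mu> b * k b) * wt \<mu>) * \<phi> \<mu>)" by (rule sum.swap)
  also have "\<dots> = (\<Sum>b\<in>?B. \<Sum>\<mu>\<in>msets (N - k b). e (of_nat (k b) / r b * wt \<mu>) * \<phi> (add_mset b \<mu>))"
    by (rule sum_cong) (rule msets_shift[OF e_nat])
  finally show ?thesis by (simp only: sum_distrib_left e_mult mult.assoc)
qed

end

section \<open>Cycle types in wreath products\<close>

lemma bij_betw_funpow_mem:
  assumes "bij_betw \<sigma> A A" "i \<in> A" shows "(\<sigma> ^^ n) i \<in> A"
  using assms by (induction n) (auto simp: bij_betw_def)

text \<open>A self-bijection of a finite set need not be the identity outside, so that one permutation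
  can be studied on each of its invariant subsets.\<close>

lemma orbit_bij:
  assumes A: "finite A" "bij_betw \<sigma> A A" "i \<in> A"
  shows "0 < card (orbit \<sigma> i)" "(\<sigma> ^^ card (orbit \<sigma> i)) i = i"
    "orbit \<sigma> i = (\<lambda>j. (\<sigma> ^^ j) i) ` {..<card (orbit \<sigma> i)}"
    "inj_on (\<lambda>j. (\<sigma> ^^ j) i) {..<card (orbit \<sigma> i)}"
    "orbit \<sigma> i \<subseteq> A" "i \<in> orbit \<sigma> i"
proof -
  \<comment> \<open>Extended by the identity, \<sigma> becomes a permutation with the same powers at
    i, and the theory of orbits of permutations applies.\<close>
  define \<rho> where "\<rho> = (\<lambda>x. if x \<in> A then \<sigma> x else x)"
  have "bij_betw \<rho> A A" using A(2) by (subst bij_betw_cong[of _ _ \<sigma>]) (auto simp: \<rho>_def)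
  hence "\<rho> permutes A" by (intro bij_imp_permutes) (auto simp: \<rho>_def)
  hence perm: "permutation \<rho>" using A(1) by (auto simp: permutation_permutes)
  have pw: "(\<rho> ^^ n) i = (\<sigma> ^^ n) i" for n
    by (induction n) (use bij_betw_funpow_mem[OF A(2,3)] in \<open>auto simp: \<rho>_def\<close>)
  have "i \<in> orbit \<rho> i" by (rule permutation_self_in_orbit[OF perm])
  then obtain n where "0 < n" "(\<sigma> ^^ n) i = i" by (auto simp: orbit_altdef pw)
  hence self: "i \<in> orbit \<sigma> i" by (auto simp: orbit_altdef intro!: exI[of _ n])
  define K where "K = funpow_dist1 \<sigma> i i"
  have o: "orbit \<sigma> i = (\<lambda>j. (\<sigma> ^^ j) i) ` {..<K}"
    using orbit_conv_funpow_dist1[OF self] by (simp add: K_def lessThan_atLeast0)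
  have inj: "inj_on (\<lambda>j. (\<sigma> ^^ j) i) {..<K}"
    using inj_on_funpow_dist1[OF self] by (simp add: K_def lessThan_atLeast0)
  have K: "card (orbit \<sigma> i) = K" using inj by (simp add: o card_image)
  have "(\<sigma> ^^ K) i = i" using funpow_dist1_prop[OF self] by (simp add: K_def)
  thus "(\<sigma> ^^ card (orbit \<sigma> i)) i = i" by (simp add: K)
  show "0 < card (orbit \<sigma> i)" by (simp add: K K_def)
  show "orbit \<sigma> i = (\<lambda>j. (\<sigma> ^^ j) i) ` {..<card (orbit \<sigma> i)}" using o K by simp
  show "inj_on (\<lambda>j. (\<sigma> ^^ j) i) {..<card (orbit \<sigma> i)}" using inj K by simp
  show "orbit \<sigma> i \<subseteq> A" using bij_betw_funpow_mem[OF A(2,3)] by (auto simp: o)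
  show "i \<in> orbit \<sigma> i" by (rule self)
qed

lemma orbit_bij_power:
  assumes A: "finite A" "bij_betw \<sigma> A A" "i \<in> A" "j \<in> orbit \<sigma> i"
  obtains m where "m < card (orbit \<sigma> i)" "j = (\<sigma> ^^ m) i"
proof -
  from A(4) have "j \<in> (\<lambda>j. (\<sigma> ^^ j) i) ` {..<card (orbit \<sigma> i)}"
    by (rule subsetD[OF equalityD1[OF orbit_bij(3)[OF A(1-3)]]])
  thus ?thesis using that by auto
qed

lemma orbit_bij_eq:
  assumes A: "finite A" "bij_betw \<sigma> A A" "i \<in> A" "j \<in> orbit \<sigma> i"
  shows "orbit \<sigma> j = orbit \<sigma> i"
proof -
  have 1: "orbit \<sigma> j \<subseteq> orbit \<sigma> i" using orbit_trans[OF _ A(4)] by (rule subsetI)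
  obtain m where m: "m < card (orbit \<sigma> i)" "j = (\<sigma> ^^ m) i" using A by (rule orbit_bij_power)
  have "(\<sigma> ^^ (card (orbit \<sigma> i) - m)) j = i"
  proof -
    have "(\<sigma> ^^ (card (orbit \<sigma> i) - m)) ((\<sigma> ^^ m) i) = (\<sigma> ^^ (card (orbit \<sigma> i) - m + m)) i"
      by (simp only: funpow_add o_apply)
    thus ?thesis using orbit_bij(2)[OF A(1-3)] m by simp
  qed
  hence "i \<in> orbit \<sigma> j" using m by (auto simp: orbit_altdef intro!: exI[of _ "card (orbit \<sigma> i) - m"])
  have "orbit \<sigma> i \<subseteq> orbit \<sigma> j" using orbit_trans[OF _ \<open>i \<in> orbit \<sigma> j\<close>] by (rule subsetI)
  with 1 show ?thesis by simp
qed

context finite_grp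
begin

section \<open>Cycle products, labels and types\<close>

abbreviation Cls :: "'a set set" where "Cls \<equiv> conj_classes G"

definition path_prod :: "(nat \<Rightarrow> 'a) \<Rightarrow> (nat \<Rightarrow> nat) \<Rightarrow> nat \<Rightarrow> nat \<Rightarrow> 'a" where
  "path_prod g \<sigma> i n = cycle_product G g (map (\<lambda>j. (\<sigma> ^^ j) i) [0..<n])"

definition cyc_label :: "(nat \<Rightarrow> 'a) \<Rightarrow> (nat \<Rightarrow> nat) \<Rightarrow> nat \<Rightarrow> 'a set \<times> nat" where
  "cyc_label g \<sigma> i = (conj_class G (cycle_product G g (cycle_from \<sigma> i)), card (orbit \<sigma> i))"

text \<open>The partition-valued type as one multiset of pairs (class, length). It is taken relative
  to an invariant set \<open>A\<close>, so that types of invariant pieces add up; by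
  \<open>cyc_label_orbit\<close> the point chosen in an orbit does not matter.\<close>

definition ctype :: "nat set \<Rightarrow> (nat \<Rightarrow> 'a) \<Rightarrow> (nat \<Rightarrow> nat) \<Rightarrow> ('a set \<times> nat) multiset" where
  "ctype A g \<sigma> = image_mset (\<lambda>C. cyc_label g \<sigma> (SOME i. i \<in> C)) (mset_set (orbit \<sigma> ` A))"

lemma path_prod_0 [simp]: "path_prod g \<sigma> i 0 = \<one>"
  and path_prod_Suc [simp]: "path_prod g \<sigma> i (Suc n) = g ((\<sigma> ^^ n) i) \<otimes> path_prod g \<sigma> i n"
  by (simp_all add: path_prod_def cycle_product_def)

lemma cyc_label_path: "cyc_label g \<sigma> i = (conj_class G (path_prod g \<sigma> i (card (orbit \<sigma> i))), card (orbit \<sigma> i))"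
  by (simp add: cyc_label_def path_prod_def cycle_from_def)

lemma path_prod_closed:
  assumes "bij_betw \<sigma> A A" "i \<in> A" "g \<in> A \<rightarrow> carrier G"
  shows "path_prod g \<sigma> i n \<in> carrier G"
  by (induction n) (use bij_betw_funpow_mem[OF assms(1,2)] assms(3) in \<open>auto simp: Pi_iff\<close>)

lemma path_prod_shift:
  assumes "bij_betw \<sigma> A A" "i \<in> A" "g \<in> A \<rightarrow> carrier G"
  shows "path_prod g \<sigma> (\<sigma> i) n \<otimes> g i = path_prod g \<sigma> i (Suc n)"
proof (induction n)
  case 0
  thus ?case using assms by (auto simp: Pi_iff)
next
  case (Suc n)
  have i: "\<sigma> i \<in> A" using assms by (auto simp: bij_betw_def)
  have c: "g ((\<sigma> ^^ n) (\<sigma> i)) \<in> carrier G" "g i \<in> carrier G"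
    using bij_betw_funpow_mem[OF assms(1) i] assms(2,3) by auto
  have e: "(\<sigma> ^^ n) (\<sigma> i) = (\<sigma> ^^ Suc n) i" by (simp add: funpow_swap1)
  have "path_prod g \<sigma> (\<sigma> i) (Suc n) \<otimes> g i = g ((\<sigma> ^^ n) (\<sigma> i)) \<otimes> (path_prod g \<sigma> (\<sigma> i) n \<otimes> g i)"
    using c path_prod_closed[OF assms(1) i assms(3)] by (simp add: m_assoc)
  also have "\<dots> = path_prod g \<sigma> i (Suc (Suc n))" unfolding Suc.IH e by (simp only: path_prod_Suc)
  finally show ?case .
qed

lemma conj_class_self: "x \<in> carrier G \<Longrightarrow> x \<in> conj_class G x"
  unfolding conj_class_def by (rule CollectI, rule exI[of _ \<one>]) simp

lemma conj_class_subset: "x \<in> carrier G \<Longrightarrow> conj_class G x \<subseteq> carrier G"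
  by (auto simp: conj_class_def)

lemma conj_class_conj_subset:
  assumes "x \<in> carrier G" "y \<in> carrier G"
  shows "conj_class G (y \<otimes> x \<otimes> inv y) \<subseteq> conj_class G x"
proof
  fix w assume "w \<in> conj_class G (y \<otimes> x \<otimes> inv y)"
  then obtain v where v: "v \<in> carrier G" "w = v \<otimes> (y \<otimes> x \<otimes> inv y) \<otimes> inv v" by (auto simp: conj_class_def)
  have "w = (v \<otimes> y) \<otimes> x \<otimes> inv (v \<otimes> y)" using v assms by (simp add: m_assoc inv_mult_group)
  moreover have "v \<otimes> y \<in> carrier G" using v assms by simp
  ultimately show "w \<in> conj_class G x" unfolding conj_class_def by blast
qed

lemma conj_class_eqI:
  assumes "x \<in> carrier G" "y \<in> carrier G"
  shows "conj_class G (y \<otimes> x \<otimes> inv y) = conj_class G x"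
proof
  show "conj_class G (y \<otimes> x \<otimes> inv y) \<subseteq> conj_class G x" by (rule conj_class_conj_subset[OF assms])
  have "inv y \<otimes> (y \<otimes> x \<otimes> inv y) \<otimes> inv (inv y) = x" using assms by (simp add: m_assoc) (simp add: m_assoc[symmetric])
  thus "conj_class G x \<subseteq> conj_class G (y \<otimes> x \<otimes> inv y)"
    using conj_class_conj_subset[of "y \<otimes> x \<otimes> inv y" "inv y"] assms by simp
qed

lemma conj_class_eq:
  assumes "x \<in> carrier G" "y \<in> conj_class G x"
  shows "conj_class G y = conj_class G x"
proof -
  obtain v where "v \<in> carrier G" "y = v \<otimes> x \<otimes> inv v" using assms(2) by (auto simp: conj_class_def)
  thus ?thesis using conj_class_eqI[OF assms(1)] by simp
qed

lemma orbit_card_ne: "finite A \<Longrightarrow> bij_betw \<sigma> A A \<Longrightarrow> i \<in> A \<Longrightarrow> card (orbit \<sigma> (\<sigma> i)) = card (orbit \<sigma> i)"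
  using orbit_bij_eq[of A \<sigma> i "\<sigma> i"] by (simp add: orbit.base)

text \<open>Starting the cycle one step later conjugates its product by \<open>g i\<close>.\<close>

lemma cyc_label_step:
  assumes A: "finite A" "bij_betw \<sigma> A A" "i \<in> A" "g \<in> A \<rightarrow> carrier G"
  shows "cyc_label g \<sigma> (\<sigma> i) = cyc_label g \<sigma> i"
proof -
  let ?k = "card (orbit \<sigma> i)"
  have i: "\<sigma> i \<in> A" using A by (auto simp: bij_betw_def)
  have c: "g i \<in> carrier G" "path_prod g \<sigma> i ?k \<in> carrier G" "path_prod g \<sigma> (\<sigma> i) ?k \<in> carrier G"
    using A path_prod_closed[OF A(2) _ A(4)] i by (auto simp: Pi_iff)
  have "path_prod g \<sigma> (\<sigma> i) ?k \<otimes> g i = g i \<otimes> path_prod g \<sigma> i ?k"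
    using path_prod_shift[OF A(2-4), of ?k] orbit_bij(2)[OF A(1-3)] by simp
  hence "path_prod g \<sigma> (\<sigma> i) ?k = g i \<otimes> path_prod g \<sigma> i ?k \<otimes> inv (g i)"
    using c by (metis inv_solve_right' m_closed)
  thus ?thesis using c orbit_card_ne[OF A(1-3)] by (simp add: cyc_label_path conj_class_eqI)
qed

lemma cyc_label_orbit:
  assumes A: "finite A" "bij_betw \<sigma> A A" "i \<in> A" "g \<in> A \<rightarrow> carrier G" and j: "j \<in> orbit \<sigma> i"
  shows "cyc_label g \<sigma> j = cyc_label g \<sigma> i"
proof -
  have "cyc_label g \<sigma> ((\<sigma> ^^ n) i) = cyc_label g \<sigma> i" for n
    by (induction n) (use cyc_label_step[OF A(1,2) _ A(4)] bij_betw_funpow_mem[OF A(2,3)] in auto)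
  moreover obtain m where "m < card (orbit \<sigma> i)" "j = (\<sigma> ^^ m) i" using A(1-3) j by (rule orbit_bij_power)
  ultimately show ?thesis by simp
qed

lemma ctype_transport:
  assumes A: "finite A" "bij_betw \<sigma> A A" "g \<in> A \<rightarrow> carrier G"
    and \<tau>: "bij_betw \<tau> A B" and eq: "\<And>i. i \<in> A \<Longrightarrow> \<sigma>' (\<tau> i) = \<tau> (\<sigma> i)"
    and lab: "\<And>i. i \<in> A \<Longrightarrow> cyc_label g' \<sigma>' (\<tau> i) = cyc_label g \<sigma> i"
  shows "ctype B g' \<sigma>' = ctype A g \<sigma>"
proof -
  have pw: "(\<sigma>' ^^ n) (\<tau> i) = \<tau> ((\<sigma> ^^ n) i)" if "i \<in> A" for i n
    by (induction n) (use bij_betw_funpow_mem[OF A(2) that] eq in auto)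
  have orb: "orbit \<sigma>' (\<tau> i) = \<tau> ` orbit \<sigma> i" if "i \<in> A" for i
    using pw[OF that] by (auto simp: orbit_altdef)
  have im: "orbit \<sigma>' ` B = image \<tau> ` (orbit \<sigma> ` A)"
  proof -
    have "orbit \<sigma>' ` B = (\<lambda>i. orbit \<sigma>' (\<tau> i)) ` A"
      unfolding bij_betw_imp_surj_on[OF \<tau>, symmetric] by (rule image_image)
    also have "\<dots> = (\<lambda>i. \<tau> ` orbit \<sigma> i) ` A" by (rule image_cong) (simp_all add: orb)
    finally show ?thesis by (simp only: image_image)
  qed
  have inj: "inj_on (image \<tau>) (orbit \<sigma> ` A)"
  proof (rule inj_onI)
    fix C D assume CD: "C \<in> orbit \<sigma> ` A" "D \<in> orbit \<sigma> ` A" "\<tau> ` C = \<tau> ` D"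
    have "C \<subseteq> A" "D \<subseteq> A" using CD orbit_bij(5)[OF A(1,2)] by auto
    with CD(3) show "C = D" using bij_betw_imp_inj_on[OF \<tau>] by (simp add: inj_on_image_eq_iff)
  qed
  have "ctype B g' \<sigma>' = image_mset (\<lambda>C. cyc_label g' \<sigma>' (SOME i. i \<in> \<tau> ` C)) (mset_set (orbit \<sigma> ` A))"
    unfolding ctype_def im image_mset_mset_set[OF inj, symmetric] by (simp add: image_mset.compositionality o_def)
  also have "\<dots> = ctype A g \<sigma>"
    unfolding ctype_def
  proof (rule image_mset_cong)
    fix C assume "C \<in># mset_set (orbit \<sigma> ` A)"
    then obtain i where i: "i \<in> A" "C = orbit \<sigma> i" using A(1) by auto
    have iC: "i \<in> C" using orbit_bij(6)[OF A(1,2) i(1)] i by simp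
    have "(SOME x. x \<in> \<tau> ` C) \<in> \<tau> ` C" using iC by (intro someI_ex[of "\<lambda>x. x \<in> \<tau> ` C"]) auto
    then obtain j where j: "j \<in> C" "(SOME x. x \<in> \<tau> ` C) = \<tau> j" by auto
    have "(SOME x. x \<in> C) \<in> C" using iC by (rule someI[of "\<lambda>x. x \<in> C"])
    hence "cyc_label g \<sigma> (SOME x. x \<in> C) = cyc_label g \<sigma> i"
      using cyc_label_orbit[OF A(1,2) i(1) A(3)] i by simp
    moreover have "j \<in> A" using j i orbit_bij(5)[OF A(1,2) i(1)] by auto
    moreover have "cyc_label g \<sigma> j = cyc_label g \<sigma> i"
      using cyc_label_orbit[OF A(1,2) i(1) A(3)] i j by simp
    ultimately show "cyc_label g' \<sigma>' (SOME i. i \<in> \<tau> ` C) = cyc_label g \<sigma> (SOME i. i \<in> C)"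
      using lab j by simp
  qed
  finally show ?thesis .
qed

section \<open>The type as a complete invariant of conjugacy\<close>

lemma conj_telescope:
  assumes "a \<in> carrier G" "b \<in> carrier G" "c \<in> carrier G" "d \<in> carrier G" "e \<in> carrier G"
  shows "(a \<otimes> b \<otimes> inv c) \<otimes> (c \<otimes> d \<otimes> inv e) = a \<otimes> (b \<otimes> d) \<otimes> inv e"
proof -
  have "inv c \<otimes> (c \<otimes> (d \<otimes> inv e)) = d \<otimes> inv e" using assms by (simp add: m_assoc[symmetric])
  thus ?thesis using assms by (simp add: m_assoc)
qed

text \<open>In consecutive factors an inverse of h meets h at the same point, so the product
  telescopes. With the start at \<sigma> i the element at the right end is \<open>h i\<close>, and
  after a full turn the one at the left end is \<open>h i\<close> too.\<close>

lemma path_prod_conj: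
  assumes A: "bij_betw \<sigma> A A" "g \<in> A \<rightarrow> carrier G" "h \<in> A \<rightarrow> carrier G" "i \<in> A"
    and eq: "\<And>i. i \<in> A \<Longrightarrow> \<sigma>' (\<tau> i) = \<tau> (\<sigma> i)"
    and conj: "\<And>i. i \<in> A \<Longrightarrow> g' (\<tau> (\<sigma> i)) = h (\<sigma> i) \<otimes> g (\<sigma> i) \<otimes> inv (h i)"
  shows "path_prod g' \<sigma>' (\<tau> (\<sigma> i)) n = h ((\<sigma> ^^ n) i) \<otimes> path_prod g \<sigma> (\<sigma> i) n \<otimes> inv (h i)"
proof (induction n)
  case 0
  thus ?case using A by (auto simp: Pi_iff)
next
  case (Suc n)
  have m: "(\<sigma> ^^ n) i \<in> A" for n using bij_betw_funpow_mem[OF A(1,4)] .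
  have i: "\<sigma> i \<in> A" using m[of 1] by simp
  have pw: "(\<sigma>' ^^ n) (\<tau> (\<sigma> i)) = \<tau> (\<sigma> ((\<sigma> ^^ n) i))"
  proof (induction n)
    case (Suc n) thus ?case using eq[of "\<sigma> ((\<sigma> ^^ n) i)"] m[of "Suc n"] by simp
  qed simp
  have c: "h ((\<sigma> ^^ n) i) \<in> carrier G" "g ((\<sigma> ^^ n) i) \<in> carrier G" for n using m A by auto
  have c2: "path_prod g \<sigma> (\<sigma> i) n \<in> carrier G" "h i \<in> carrier G"
    using path_prod_closed[OF A(1) i A(2)] A by auto
  have "path_prod g' \<sigma>' (\<tau> (\<sigma> i)) (Suc n) =
     (h (\<sigma> ((\<sigma> ^^ n) i)) \<otimes> g (\<sigma> ((\<sigma> ^^ n) i)) \<otimes> inv (h ((\<sigma> ^^ n) i))) \<otimes>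
     (h ((\<sigma> ^^ n) i) \<otimes> path_prod g \<sigma> (\<sigma> i) n \<otimes> inv (h i))"
    by (simp only: path_prod_Suc Suc.IH pw conj[OF m])
  also have "\<dots> = h (\<sigma> ((\<sigma> ^^ n) i)) \<otimes> (g (\<sigma> ((\<sigma> ^^ n) i)) \<otimes> path_prod g \<sigma> (\<sigma> i) n) \<otimes> inv (h i)"
    using conj_telescope[of "h (\<sigma> ((\<sigma> ^^ n) i))" "g (\<sigma> ((\<sigma> ^^ n) i))" "h ((\<sigma> ^^ n) i)"] c[of n] c[of "Suc n"] c2
    by simp
  also have "g (\<sigma> ((\<sigma> ^^ n) i)) \<otimes> path_prod g \<sigma> (\<sigma> i) n = path_prod g \<sigma> (\<sigma> i) (Suc n)"
    by (simp add: funpow_swap1)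
  finally show ?case by simp
qed

text \<open>The one invariance statement behind the later ones: conjugation in the wreath product,
  shifting the points, and mere agreement on \<open>A\<close> (with h = 1) are special
  cases.\<close>

lemma ctype_conj:
  assumes A: "finite A" "bij_betw \<sigma> A A" "g \<in> A \<rightarrow> carrier G" "h \<in> A \<rightarrow> carrier G"
    and \<tau>: "bij_betw \<tau> A B" and eq: "\<And>i. i \<in> A \<Longrightarrow> \<sigma>' (\<tau> i) = \<tau> (\<sigma> i)"
    and conj: "\<And>i. i \<in> A \<Longrightarrow> g' (\<tau> (\<sigma> i)) = h (\<sigma> i) \<otimes> g (\<sigma> i) \<otimes> inv (h i)"
  shows "ctype B g' \<sigma>' = ctype A g \<sigma>"
proof (rule ctype_transport[OF A(1-3) \<tau> eq])
  fix i assume "i \<in> A"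
  have "i \<in> \<sigma> ` A" using A(2) \<open>i \<in> A\<close> by (simp add: bij_betw_def)
  then obtain j where j: "j \<in> A" "\<sigma> j = i" by auto
  have pw: "(\<sigma>' ^^ n) (\<tau> i) = \<tau> ((\<sigma> ^^ n) i)" for n
    by (induction n) (use bij_betw_funpow_mem[OF A(2) \<open>i \<in> A\<close>] eq in auto)
  have "orbit \<sigma>' (\<tau> i) = \<tau> ` orbit \<sigma> i" using pw by (auto simp: orbit_altdef)
  moreover have "inj_on \<tau> (orbit \<sigma> i)" 
    using \<tau> orbit_bij(5)[OF A(1,2) \<open>i \<in> A\<close>] by (auto simp: bij_betw_def intro: inj_on_subset)
  ultimately have k: "card (orbit \<sigma>' (\<tau> i)) = card (orbit \<sigma> i)" by (simp add: card_image)
  let ?k = "card (orbit \<sigma> i)"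
  have kj: "?k = card (orbit \<sigma> j)" using orbit_card_ne[OF A(1,2) j(1)] j by simp
  have "path_prod g' \<sigma>' (\<tau> i) ?k = h j \<otimes> path_prod g \<sigma> i ?k \<otimes> inv (h j)"
    using path_prod_conj[OF A(2-4) j(1) eq conj, of ?k] orbit_bij(2)[OF A(1,2) j(1)] kj j by simp
  moreover have "path_prod g \<sigma> i ?k \<in> carrier G" "h j \<in> carrier G"
    using path_prod_closed[OF A(2) \<open>i \<in> A\<close> A(3)] A(4) j by auto
  ultimately show "cyc_label g' \<sigma>' (\<tau> i) = cyc_label g \<sigma> i"
    by (simp add: cyc_label_path k conj_class_eqI)
qed

lemma ctype_cong:
  assumes A: "finite A" "bij_betw \<sigma> A A" "g \<in> A \<rightarrow> carrier G"
    and "\<And>i. i \<in> A \<Longrightarrow> \<sigma>' i = \<sigma> i" "\<And>i. i \<in> A \<Longrightarrow> g' i = g i"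
  shows "ctype A g' \<sigma>' = ctype A g \<sigma>"
proof (rule ctype_conj[OF A, of "\<lambda>_. \<one>" id])
  fix i assume i: "i \<in> A"
  have "\<sigma> i \<in> A" using A i by (auto simp: bij_betw_def)
  thus "g' (id (\<sigma> i)) = \<one> \<otimes> g (\<sigma> i) \<otimes> inv \<one>" using assms by (auto simp: Pi_iff)
qed (use assms in auto)

lemma ctype_Un:
  assumes "finite A" "finite B" "A \<inter> B = {}" "bij_betw \<sigma> A A" "bij_betw \<sigma> B B"
  shows "ctype (A \<union> B) g \<sigma> = ctype A g \<sigma> + ctype B g \<sigma>"
proof -
  have "orbit \<sigma> ` A \<inter> orbit \<sigma> ` B = {}"
  proof -
    have "orbit \<sigma> i \<noteq> orbit \<sigma> j" if "i \<in> A" "j \<in> B" for i j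
      using orbit_bij(5,6)[OF assms(1,4) that(1)] orbit_bij(5)[OF assms(2,5) that(2)] assms(3) by auto
    thus ?thesis by auto
  qed
  thus ?thesis using assms by (simp add: ctype_def image_Un mset_set_Union)
qed

lemma ctype_single_orbit:
  assumes "finite A" "bij_betw \<sigma> A A" "g \<in> A \<rightarrow> carrier G" "i \<in> A" "orbit \<sigma> i = A"
  shows "ctype A g \<sigma> = {#cyc_label g \<sigma> i#}"
proof -
  have "orbit \<sigma> j = A" if "j \<in> A" for j using orbit_bij_eq[OF assms(1,2,4)] assms(5) that by simp
  hence "orbit \<sigma> ` A = {A}" using assms(4) by auto
  moreover have "(SOME i. i \<in> A) \<in> A" using assms(4) by (rule someI[of "\<lambda>x. x \<in> A"])
  ultimately show ?thesis
    using cyc_label_orbit[OF assms(1,2,4,3), of "SOME i. i \<in> A"] assms(5) by (simp add: ctype_def)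
qed

lemma ctype_empty [simp]: "ctype {} g \<sigma> = {#}"
  by (simp add: ctype_def)

text \<open>Single orbits with equal labels are conjugate: the conjugating elements are forced by the
  partial products once one of them is chosen at a base point.\<close>

lemma orbit_conjugate:
  assumes A: "finite A" "bij_betw \<sigma> A A" "g \<in> A \<rightarrow> carrier G" "s \<in> A"
    and B: "finite B" "bij_betw \<sigma>' B B" "g' \<in> B \<rightarrow> carrier G" "s' \<in> B"
    and lab: "cyc_label g' \<sigma>' s' = cyc_label g \<sigma> s"
  shows "\<exists>\<tau> h. bij_betw \<tau> (orbit \<sigma> s) (orbit \<sigma>' s') \<and> (\<forall>x\<in>orbit \<sigma> s. \<sigma>' (\<tau> x) = \<tau> (\<sigma> x) \<and>
    h x \<in> carrier G \<and> g' (\<tau> (\<sigma> x)) = h (\<sigma> x) \<otimes> g (\<sigma> x) \<otimes> inv (h x))"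
proof -
  define k where "k = card (orbit \<sigma> s)"
  have k': "card (orbit \<sigma>' s') = k" using lab by (simp add: cyc_label_def k_def)
  note oA = orbit_bij[OF A(1,2,4), folded k_def] and oB = orbit_bij[OF B(1,2,4), unfolded k']
  define q where "q = path_prod g \<sigma> s"
  define q' where "q' = path_prod g' \<sigma>' s'"
  have qc: "q n \<in> carrier G" "q' n \<in> carrier G" for n
    unfolding q_def q'_def by (rule path_prod_closed[OF A(2,4,3)], rule path_prod_closed[OF B(2,4,3)])
  have "q' k \<in> conj_class G (q k)"
  proof -
    have "conj_class G (q' k) = conj_class G (q k)"
      using lab by (simp add: cyc_label_path k' k_def[symmetric] q_def q'_def)
    thus ?thesis using conj_class_self[OF qc(2)[of k]] by simp
  qed
  then obtain u where u: "u \<in> carrier G" "q' k = u \<otimes> q k \<otimes> inv u" by (auto simp: conj_class_def)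
  define pos where "pos = inv_into {..<k} (\<lambda>j. (\<sigma> ^^ j) s)"
  have pos: "pos ((\<sigma> ^^ j) s) = j" if "j < k" for j
    unfolding pos_def using inv_into_f_f[OF oA(4), of j] that by simp
  define \<tau> where "\<tau> = (\<lambda>x. (\<sigma>' ^^ pos x) s')"
  \<comment> \<open>\<open>H\<close> solves the recursion H (n + 1) = g' H n g^-1 imposed by the
    conjugation, with H 0 = u. That it closes up after k steps is exactly the conjugacy of the two
    full cycle products.\<close>
  define H where "H = (\<lambda>n. q' n \<otimes> u \<otimes> inv (q n))"
  define h where "h = (\<lambda>x. H (Suc (pos x)))"
  have Hc: "H n \<in> carrier G" for n using qc u by (simp add: H_def)
  have Hk: "H k = H 0"
  proof -
    have "H k = u \<otimes> q k \<otimes> inv u \<otimes> (u \<otimes> inv (q k))" using u qc by (simp add: H_def m_assoc)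
    also have "\<dots> = u \<otimes> q k \<otimes> inv (q k)" using conj_telescope[of u "q k" u \<one> "q k"] u qc by simp
    also have "\<dots> = H 0" using u qc by (simp add: H_def q_def q'_def m_assoc)
    finally show ?thesis .
  qed
  have Hstep: "g' ((\<sigma>' ^^ n) s') = H (Suc n) \<otimes> g ((\<sigma> ^^ n) s) \<otimes> inv (H n)" for n
  proof -
    have gc: "g ((\<sigma> ^^ n) s) \<in> carrier G" "g' ((\<sigma>' ^^ n) s') \<in> carrier G"
      using bij_betw_funpow_mem[OF A(2,4)] bij_betw_funpow_mem[OF B(2,4)] A(3) B(3) by auto
    have "H (Suc n) = g' ((\<sigma>' ^^ n) s') \<otimes> H n \<otimes> inv (g ((\<sigma> ^^ n) s))"
      using gc qc[of n] u by (simp add: H_def q_def q'_def inv_mult_group m_assoc)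
    hence "H (Suc n) \<otimes> g ((\<sigma> ^^ n) s) = g' ((\<sigma>' ^^ n) s') \<otimes> H n"
      using gc Hc[of n] by (simp add: m_assoc)
    hence "H (Suc n) \<otimes> g ((\<sigma> ^^ n) s) \<otimes> inv (H n) = g' ((\<sigma>' ^^ n) s') \<otimes> (H n \<otimes> inv (H n))"
      using gc Hc[of n] by (simp add: m_assoc)
    thus ?thesis using gc Hc[of n] by simp
  qed
  have \<tau>: "\<tau> ((\<sigma> ^^ j) s) = (\<sigma>' ^^ j) s'" "h ((\<sigma> ^^ j) s) = H (Suc j)" if "j < k" for j
    using that by (simp_all add: \<tau>_def h_def pos)
  have bij: "bij_betw \<tau> (orbit \<sigma> s) (orbit \<sigma>' s')"
  proof -
    have 1: "bij_betw (\<lambda>j. (\<sigma> ^^ j) s) {..<k} (orbit \<sigma> s)" using oA(4) oA(3)[symmetric] by (rule bij_betw_imageI)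
    have 2: "bij_betw (\<lambda>j. (\<sigma>' ^^ j) s') {..<k} (orbit \<sigma>' s')" using oB(4) oB(3)[symmetric] by (rule bij_betw_imageI)
    have "bij_betw (\<tau> \<circ> (\<lambda>j. (\<sigma> ^^ j) s)) {..<k} (orbit \<sigma>' s')"
      using 2 by (subst bij_betw_cong[of _ _ "\<lambda>j. (\<sigma>' ^^ j) s'"]) (simp_all add: \<tau>)
    thus ?thesis using bij_betw_comp_iff[OF 1] by blast
  qed
  have "\<sigma>' (\<tau> x) = \<tau> (\<sigma> x) \<and> h x \<in> carrier G \<and> g' (\<tau> (\<sigma> x)) = h (\<sigma> x) \<otimes> g (\<sigma> x) \<otimes> inv (h x)"
    if x: "x \<in> orbit \<sigma> s" for x
  proof -
    obtain j where j: "j < k" "x = (\<sigma> ^^ j) s" using orbit_bij_power[OF A(1,2,4) x] k_def by metis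
    show ?thesis
    proof (cases "Suc j < k")
      case True
      thus ?thesis using Hstep[of "Suc j"] \<tau>[of j] \<tau>[of "Suc j"] j Hc by simp
    next
      case False
      hence k: "k = Suc j" using j by simp
      have "\<sigma> x = (\<sigma> ^^ 0) s" "\<sigma>' (\<tau> x) = (\<sigma>' ^^ 0) s'" using oA(2) oB(2) j \<tau>[of j] by (simp_all add: k)
      thus ?thesis using Hstep[of 0] \<tau>[of j] \<tau>[of 0] j Hc Hk by (simp add: k)
    qed
  qed
  with bij show ?thesis by (intro exI[of _ \<tau>] exI[of _ h] conjI ballI) simp_all
qed

text \<open>Equal multisets of labels yield a label-preserving bijection between the orbits, and the
  conjugations of single orbits are glued along it.\<close>

lemma ctype_eq_conjugate:
  assumes A: "finite A" "bij_betw \<sigma> A A" "g \<in> A \<rightarrow> carrier G"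
    and B: "finite B" "bij_betw \<sigma>' B B" "g' \<in> B \<rightarrow> carrier G"
    and eq: "ctype A g \<sigma> = ctype B g' \<sigma>'"
  shows "\<exists>\<tau> h. bij_betw \<tau> A B \<and> (\<forall>x\<in>A. \<sigma>' (\<tau> x) = \<tau> (\<sigma> x) \<and>
    h x \<in> carrier G \<and> g' (\<tau> (\<sigma> x)) = h (\<sigma> x) \<otimes> g (\<sigma> x) \<otimes> inv (h x))"
proof -
  define pt where "pt = (\<lambda>C :: nat set. SOME i. i \<in> C)"
  obtain F where F: "bij_betw F (orbit \<sigma> ` A) (orbit \<sigma>' ` B)"
    "\<forall>C\<in>orbit \<sigma> ` A. cyc_label g' \<sigma>' (pt (F C)) = cyc_label g \<sigma> (pt C)"
    using image_mset_eq_bij[OF _ _ eq[unfolded ctype_def]] A(1) B(1) by (auto simp: pt_def)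
  have ptA: "pt C \<in> A \<and> orbit \<sigma> (pt C) = C" if "C \<in> orbit \<sigma> ` A" for C
  proof -
    obtain i where i: "i \<in> A" "C = orbit \<sigma> i" using \<open>C \<in> orbit \<sigma> ` A\<close> by auto
    have "i \<in> C" using orbit_bij(6)[OF A(1,2) i(1)] i(2) by simp
    hence "pt C \<in> C" unfolding pt_def by (rule someI[of "\<lambda>x. x \<in> C"])
    thus ?thesis using orbit_bij_eq[OF A(1,2) i(1)] orbit_bij(5)[OF A(1,2) i(1)] i(2) by auto
  qed
  have ptB: "pt C \<in> B \<and> orbit \<sigma>' (pt C) = C" if "C \<in> orbit \<sigma>' ` B" for C
  proof -
    obtain i where i: "i \<in> B" "C = orbit \<sigma>' i" using \<open>C \<in> orbit \<sigma>' ` B\<close> by auto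
    have "i \<in> C" using orbit_bij(6)[OF B(1,2) i(1)] i(2) by simp
    hence "pt C \<in> C" unfolding pt_def by (rule someI[of "\<lambda>x. x \<in> C"])
    thus ?thesis using orbit_bij_eq[OF B(1,2) i(1)] orbit_bij(5)[OF B(1,2) i(1)] i(2) by auto
  qed
  have FB: "F C \<in> orbit \<sigma>' ` B" if "C \<in> orbit \<sigma> ` A" for C using F(1) that by (auto simp: bij_betw_def)
  define P where "P = (\<lambda>C \<tau> h. bij_betw \<tau> C (F C) \<and> (\<forall>x\<in>C. \<sigma>' (\<tau> x) = \<tau> (\<sigma> x) \<and>
    h x \<in> carrier G \<and> g' (\<tau> (\<sigma> x)) = h (\<sigma> x) \<otimes> g (\<sigma> x) \<otimes> inv (h x)))"
  have "\<exists>\<tau> h. P C \<tau> h" if C: "C \<in> orbit \<sigma> ` A" for C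
    unfolding P_def
    using orbit_conjugate[OF A _ B _, of "pt C" "pt (F C)"] ptA[OF C] ptB[OF FB[OF C]] F(2) C by simp
  hence "\<forall>C\<in>orbit \<sigma> ` A. \<exists>\<tau> h. P C \<tau> h" by blast
  then obtain t where "\<forall>C\<in>orbit \<sigma> ` A. \<exists>h. P C (t C) h" by (rule bchoice[THEN exE])
  then obtain hh where th: "\<forall>C\<in>orbit \<sigma> ` A. P C (t C) (hh C)" by (rule bchoice[THEN exE])
  have tb: "bij_betw (t (orbit \<sigma> w)) (orbit \<sigma> w) (F (orbit \<sigma> w))" if "w \<in> A" for w
  proof -
    have "P (orbit \<sigma> w) (t (orbit \<sigma> w)) (hh (orbit \<sigma> w))" using th that by simp
    thus ?thesis unfolding P_def by (rule conjunct1)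
  qed
  define \<tau> where "\<tau> = (\<lambda>x. t (orbit \<sigma> x) x)"
  define h where "h = (\<lambda>x. hh (orbit \<sigma> x) x)"
  have step: "\<sigma>' (\<tau> x) = \<tau> (\<sigma> x) \<and> h x \<in> carrier G \<and> g' (\<tau> (\<sigma> x)) = h (\<sigma> x) \<otimes> g (\<sigma> x) \<otimes> inv (h x)"
    if x: "x \<in> A" for x
  proof -
    have o: "orbit \<sigma> (\<sigma> x) = orbit \<sigma> x" using orbit_bij_eq[OF A(1,2) x, of "\<sigma> x"] by (simp add: orbit.base)
    have "x \<in> orbit \<sigma> x" by (rule orbit_bij(6)[OF A(1,2) x])
    moreover have "P (orbit \<sigma> x) (t (orbit \<sigma> x)) (hh (orbit \<sigma> x))" using th x by simp
    ultimately show ?thesis unfolding P_def \<tau>_def h_def o by simp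
  qed
  have surj: "\<tau> ` A = B"
  proof (intro equalityI subsetI)
    fix y assume "y \<in> \<tau> ` A"
    then obtain x where x: "x \<in> A" "y = \<tau> x" by auto
    have "bij_betw (t (orbit \<sigma> x)) (orbit \<sigma> x) (F (orbit \<sigma> x))" by (rule tb[OF x(1)])
    hence "y \<in> F (orbit \<sigma> x)" using orbit_bij(6)[OF A(1,2) x(1)] x by (auto simp: bij_betw_def \<tau>_def)
    moreover obtain j where "j \<in> B" "F (orbit \<sigma> x) = orbit \<sigma>' j" using FB[of "orbit \<sigma> x"] x by auto
    ultimately show "y \<in> B" using orbit_bij(5)[OF B(1,2), of j] by auto
  next
    fix y assume y: "y \<in> B"
    hence "orbit \<sigma>' y \<in> F ` (orbit \<sigma> ` A)" using F(1) by (simp add: bij_betw_def)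
    then obtain i where i: "i \<in> A" "F (orbit \<sigma> i) = orbit \<sigma>' y" by auto
    have "bij_betw (t (orbit \<sigma> i)) (orbit \<sigma> i) (orbit \<sigma>' y)" using tb[OF i(1)] i(2) by simp
    hence im: "t (orbit \<sigma> i) ` orbit \<sigma> i = orbit \<sigma>' y" by (simp add: bij_betw_def)
    have "y \<in> t (orbit \<sigma> i) ` orbit \<sigma> i" unfolding im by (rule orbit_bij(6)[OF B(1,2) y])
    then obtain x where x: "x \<in> orbit \<sigma> i" "t (orbit \<sigma> i) x = y" by (elim imageE) auto
    have "\<tau> x = y" using orbit_bij_eq[OF A(1,2) i(1) x(1)] x by (simp add: \<tau>_def)
    thus "y \<in> \<tau> ` A" using x orbit_bij(5)[OF A(1,2) i(1)] by auto
  qed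
  have inj: "inj_on \<tau> A"
  proof (rule inj_onI)
    fix x y assume xy: "x \<in> A" "y \<in> A" "\<tau> x = \<tau> y"
    have im: "\<tau> w \<in> F (orbit \<sigma> w)" if "w \<in> A" for w
    proof -
      have "bij_betw (t (orbit \<sigma> w)) (orbit \<sigma> w) (F (orbit \<sigma> w))" by (rule tb[OF that])
      thus ?thesis using orbit_bij(6)[OF A(1,2) that] by (auto simp: bij_betw_def \<tau>_def)
    qed
    obtain a b where ab: "a \<in> B" "F (orbit \<sigma> x) = orbit \<sigma>' a" "b \<in> B" "F (orbit \<sigma> y) = orbit \<sigma>' b"
      using FB[of "orbit \<sigma> x"] FB[of "orbit \<sigma> y"] xy by auto
    have "orbit \<sigma>' a = orbit \<sigma>' (\<tau> x)" "orbit \<sigma>' b = orbit \<sigma>' (\<tau> x)"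
    proof -
      have "\<tau> x \<in> orbit \<sigma>' a" "\<tau> x \<in> orbit \<sigma>' b" using ab im[OF xy(1)] im[OF xy(2)] xy(3) by simp_all
      thus "orbit \<sigma>' a = orbit \<sigma>' (\<tau> x)" "orbit \<sigma>' b = orbit \<sigma>' (\<tau> x)"
        using orbit_bij_eq[OF B(1,2) ab(1), of "\<tau> x"] orbit_bij_eq[OF B(1,2) ab(3), of "\<tau> x"] by simp_all
    qed
    hence "F (orbit \<sigma> x) = F (orbit \<sigma> y)" using ab by simp
    hence o: "orbit \<sigma> x = orbit \<sigma> y"
      by (rule inj_onD[OF bij_betw_imp_inj_on[OF F(1)] _ imageI[OF xy(1)] imageI[OF xy(2)]])
    have "bij_betw (t (orbit \<sigma> x)) (orbit \<sigma> x) (F (orbit \<sigma> x))" by (rule tb[OF xy(1)])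
    from bij_betw_imp_inj_on[OF this] show "x = y"
    proof (rule inj_onD)
      show "t (orbit \<sigma> x) x = t (orbit \<sigma> x) y" using xy(3) o by (simp add: \<tau>_def)
      show "x \<in> orbit \<sigma> x" by (rule orbit_bij(6)[OF A(1,2) xy(1)])
      show "y \<in> orbit \<sigma> x" unfolding o by (rule orbit_bij(6)[OF A(1,2) xy(2)])
    qed
  qed
  have "bij_betw \<tau> A B" using inj surj by (rule bij_betw_imageI)
  with step show ?thesis by (intro exI[of _ \<tau>] exI[of _ h] conjI ballI) simp_all
qed

end

section \<open>The sign of odd-order lifts\<close>

definition negf :: "(nat set \<Rightarrow> real) \<Rightarrow> nat set \<Rightarrow> real" where
  "negf f = (\<lambda>S. - f S)"

lemma negf_negf [simp]: "negf (negf f) = f"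
  by (simp add: negf_def)

lemma negf_neq: "negf \<noteq> id"
proof
  assume "negf = id"
  hence "negf (\<lambda>_. 1) {} = (1 :: real)" by simp
  thus False by (simp add: negf_def)
qed

lemma negf_funpow_odd: "odd M \<Longrightarrow> negf ^^ M = negf"
proof -
  assume "odd M"
  then obtain m where "M = Suc (2 * m)" by (auto elim: oddE)
  moreover have "(negf ^^ 2) ^^ m = id"
    by (induction m) (auto simp: fun_eq_iff numeral_2_eq_2)
  ultimately show ?thesis by (simp add: funpow_mult[symmetric] del: funpow_mult)
qed

lemma clif_zl: "clif_word (zl # u) = negf \<circ> clif_word u"
  by (simp add: fun_eq_iff negf_def)

lemma clif_letter_negf: "clif_letter l (negf f) = negf (clif_letter l f)"
proof -
  obtain x b where l: "l = (x, b)" by force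
  show ?thesis by (cases x; cases b) (auto simp: l negf_def clif_gen_minus)
qed

lemma clif_word_negf: "clif_word u (negf f) = negf (clif_word u f)"
  by (induction u) (auto simp: clif_letter_negf)

definition word_pow :: "spin_word \<Rightarrow> nat \<Rightarrow> spin_word" where
  "word_pow u M = concat (replicate M u)"

lemma word_pow_words: "u \<in> spin_words n \<Longrightarrow> word_pow u M \<in> spin_words n"
  by (induction M) (auto simp: word_pow_def)

lemma word_pow_invariants:
  "word_perm (word_pow u M) = word_perm u ^^ M" "clif_word (word_pow u M) = clif_word u ^^ M"
  "word_even (word_pow u M) \<longleftrightarrow> (even M \<or> word_even u)"
  by (induction M) (auto simp: word_pow_def)

lemma clif_pow_cases:
  assumes "u \<in> spin_words n" "word_perm u ^^ M = id"
  shows "clif_word u ^^ M = id \<or> clif_word u ^^ M = negf"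
proof -
  have "spin_sim n (word_pow u M) []"
    using assms by (simp add: spin_sim_iff word_pow_words word_pow_invariants(1))
  from spin_sim_clif[OF this] show ?thesis by (simp add: word_pow_invariants clif_zl del: clif_word_Cons)
qed

lemma word_even_sim:
  assumes "spin_sim n u v" shows "word_even u = word_even v"
proof -
  from assms have "spin_eq n u v \<or> spin_eq n u (zl # v)" by (simp add: spin_sim_def)
  thus ?thesis
  proof
    assume "spin_eq n u v" from spin_eq_invariants[OF this] show ?thesis by simp
  next
    assume "spin_eq n u (zl # v)" from spin_eq_invariants[OF this] show ?thesis by simp
  qed
qed

lemma odd_order_even:
  assumes "u \<in> spin_words n" "word_perm u ^^ M = id" "odd M"
  shows "word_even u"
proof -
  have "spin_sim n (word_pow u M) []"
    using assms by (simp add: spin_sim_iff word_pow_words word_pow_invariants(1))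
  from word_even_sim[OF this] show ?thesis using assms(3) by (simp add: word_pow_invariants(3))
qed

text \<open>Of the two lifts u and zu of a permutation of odd order exactly one has odd order, and
  the sign marks it. For permutations of even order the value -1 is a mere default. Being read off
  from orders, the sign involves no choice of lifts.\<close>

definition lift_sgn :: "spin_word \<Rightarrow> complex" where
  "lift_sgn u = (if \<exists>M. odd M \<and> word_perm u ^^ M = id \<and> clif_word u ^^ M = id then 1 else - 1)"

lemma lift_sgn_cong: "word_perm u = word_perm v \<Longrightarrow> clif_word u = clif_word v \<Longrightarrow> lift_sgn u = lift_sgn v"
  by (simp add: lift_sgn_def)

text \<open>Any odd exponent killing the permutation decides the sign: two such exponents that
  disagreed would make an odd power of -1 equal to 1.\<close>

lemma lift_sgn_pow:
  assumes u: "u \<in> spin_words n" and M: "odd M" "word_perm u ^^ M = id"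
  shows "lift_sgn u = (if clif_word u ^^ M = id then 1 else - 1)"
proof (cases "clif_word u ^^ M = id")
  case True
  thus ?thesis using M by (auto simp: lift_sgn_def)
next
  case False
  hence neg: "clif_word u ^^ M = negf" using clif_pow_cases[OF u M(2)] by simp
  have "\<not> (odd M' \<and> word_perm u ^^ M' = id \<and> clif_word u ^^ M' = id)" for M'
  proof
    assume *: "odd M' \<and> word_perm u ^^ M' = id \<and> clif_word u ^^ M' = id"
    have "clif_word u ^^ (M * M') = negf" using neg * by (simp add: negf_funpow_odd flip: funpow_mult)
    moreover have "clif_word u ^^ (M' * M) = id" using * by (simp add: id_funpow flip: funpow_mult)
    ultimately show False using negf_neq by (simp add: mult.commute)
  qed
  thus ?thesis using False by (simp add: lift_sgn_def)
qed

lemma lift_sgn_cases: "lift_sgn u = 1 \<or> lift_sgn u = - 1"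
  by (simp add: lift_sgn_def)

lemma lift_sgn_square [simp]: "lift_sgn u * lift_sgn u = 1"
  using lift_sgn_cases[of u] by auto

lemma funpow_comp_commute:
  fixes f g :: "'x \<Rightarrow> 'x"
  assumes "f \<circ> g = g \<circ> f" shows "(f \<circ> g) ^^ M = f ^^ M \<circ> g ^^ M"
proof
  fix x
  have c: "g (f x) = f (g x)" for x using fun_cong[OF assms, of x] by simp
  have 1: "g ((f ^^ M) x) = (f ^^ M) (g x)" for M x by (induction M) (simp_all add: c)
  show "((f \<circ> g) ^^ M) x = (f ^^ M \<circ> g ^^ M) x" by (induction M) (simp_all add: 1)
qed

lemma funpow_conj:
  assumes "\<And>x. a' (a x) = x" "\<And>x. a (a' x) = x" shows "(a \<circ> b \<circ> a') ^^ M = a \<circ> b ^^ M \<circ> a'"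
proof
  fix x
  show "((a \<circ> b \<circ> a') ^^ M) x = (a \<circ> b ^^ M \<circ> a') x" by (induction M) (simp_all add: assms)
qed

lemma clif_word_inv': "clif_word (inv_word v) (clif_word v f) = f"
proof (induction v arbitrary: f)
  case (Cons l v)
  obtain x b where l: "l = (x, b)" by force
  have "clif_letter (x, \<not> b) (clif_letter (x, b) g) = g" for g using clif_letter_flip'[of x "\<not> b" g] by simp
  thus ?case by (simp add: l Cons.IH)
qed simp

lemma clif_inv_comp: "clif_word v \<circ> clif_word (inv_word v) = id" "clif_word (inv_word v) \<circ> clif_word v = id"
  by (simp_all add: fun_eq_iff clif_word_inv clif_word_inv')

lemma word_perm_inv: "word_perm v (word_perm (inv_word v) i) = i"
proof (induction v arbitrary: i)
  case (Cons l v)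
  obtain x b where l: "l = (x, b)" by force
  show ?case by (simp add: l Cons.IH)
qed simp

lemma word_perm_inv': "word_perm (inv_word v) (word_perm v i) = i"
proof (induction v arbitrary: i)
  case (Cons l v)
  obtain x b where l: "l = (x, b)" by force
  have "letter_perm (x, \<not> b) (letter_perm (x, b) j) = j" for j using letter_perm_flip'[of x "\<not> b" j] by simp
  thus ?case by (simp add: l Cons.IH)
qed simp

lemma word_perm_inv_comp:
  "word_perm v \<circ> word_perm (inv_word v) = id" "word_perm (inv_word v) \<circ> word_perm v = id"
  by (simp_all add: fun_eq_iff word_perm_inv word_perm_inv')

lemma word_perm_inv_word: "word_perm (inv_word v) = inv_into UNIV (word_perm v)"
  using inv_unique_comp[OF word_perm_inv_comp(1) word_perm_inv_comp(2)] by simp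

lemma lift_sgn_z:
  assumes u: "u \<in> spin_words n" and M: "odd M" "word_perm u ^^ M = id"
  shows "lift_sgn (zl # u) = - lift_sgn u"
proof -
  have c: "negf \<circ> clif_word u = clif_word u \<circ> negf" by (simp add: fun_eq_iff clif_word_negf)
  have p: "clif_word (zl # u) ^^ M = negf \<circ> clif_word u ^^ M"
    unfolding clif_zl funpow_comp_commute[OF c] using M by (simp add: negf_funpow_odd)
  have "lift_sgn (zl # u) = (if negf \<circ> clif_word u ^^ M = id then 1 else - 1)"
    unfolding p[symmetric] by (rule lift_sgn_pow[of _ n]) (use u M in auto)
  moreover have "lift_sgn u = (if clif_word u ^^ M = id then 1 else - 1)" by (rule lift_sgn_pow[OF u M])
  moreover have "negf \<circ> negf = id" by (simp add: fun_eq_iff)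
  ultimately show ?thesis using clif_pow_cases[OF u M(2)] negf_neq by auto
qed

lemma lift_sgn_conj:
  assumes u: "u \<in> spin_words n" and v: "v \<in> spin_words n" and M: "odd M" "word_perm u ^^ M = id"
  shows "lift_sgn (v @ u @ inv_word v) = lift_sgn u"
proof -
  have p: "word_perm (v @ u @ inv_word v) ^^ M = word_perm v \<circ> word_perm u ^^ M \<circ> word_perm (inv_word v)"
    using funpow_conj[of "word_perm (inv_word v)" "word_perm v"] by (simp add: word_perm_inv word_perm_inv' o_assoc)
  have q: "clif_word (v @ u @ inv_word v) ^^ M = clif_word v \<circ> clif_word u ^^ M \<circ> clif_word (inv_word v)"
    using funpow_conj[of "clif_word (inv_word v)" "clif_word v"] by (simp add: clif_word_inv clif_word_inv' o_assoc)
  have "word_perm (v @ u @ inv_word v) ^^ M = id" unfolding p M(2) by (simp add: word_perm_inv_comp)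
  moreover have "v @ u @ inv_word v \<in> spin_words n" using u v by simp
  ultimately have "lift_sgn (v @ u @ inv_word v) = (if clif_word (v @ u @ inv_word v) ^^ M = id then 1 else - 1)"
    using M(1) by (metis lift_sgn_pow)
  moreover have "clif_word (v @ u @ inv_word v) ^^ M = id \<longleftrightarrow> clif_word u ^^ M = id"
  proof
    assume "clif_word (v @ u @ inv_word v) ^^ M = id"
    hence "clif_word (inv_word v) \<circ> (clif_word v \<circ> clif_word u ^^ M \<circ> clif_word (inv_word v)) \<circ> clif_word v = id"
      unfolding q by (simp add: clif_inv_comp)
    thus "clif_word u ^^ M = id" by (simp add: fun_eq_iff clif_word_inv')
  next
    assume "clif_word u ^^ M = id"
    thus "clif_word (v @ u @ inv_word v) ^^ M = id" unfolding q by (simp add: clif_inv_comp)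
  qed
  ultimately show ?thesis using lift_sgn_pow[OF u M] by simp
qed

lemma funpow_inverse:
  fixes f g :: "'x \<Rightarrow> 'x"
  assumes "f \<circ> g = id" "g \<circ> f = id" shows "f ^^ M \<circ> g ^^ M = id"
  using funpow_comp_commute[of f g M] assms by (simp add: id_funpow)

lemma lift_sgn_inv:
  assumes u: "u \<in> spin_words n" and M: "odd M" "word_perm u ^^ M = id"
  shows "lift_sgn (inv_word u) = lift_sgn u"
proof -
  have "word_perm (inv_word u) ^^ M = id" using funpow_inverse[OF word_perm_inv_comp(2)[of u] word_perm_inv_comp(1)[of u], of M] M by simp
  moreover have "inv_word u \<in> spin_words n" using u by simp
  ultimately have "lift_sgn (inv_word u) = (if clif_word (inv_word u) ^^ M = id then 1 else - 1)"
    using M(1) by (metis lift_sgn_pow)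
  moreover have "clif_word (inv_word u) ^^ M = id \<longleftrightarrow> clif_word u ^^ M = id"
  proof -
    have c: "clif_word u ^^ M \<circ> clif_word (inv_word u) ^^ M = id"
      by (rule funpow_inverse[OF clif_inv_comp(1) clif_inv_comp(2)])
    show ?thesis
    proof
      assume "clif_word (inv_word u) ^^ M = id" with c show "clif_word u ^^ M = id" by simp
    next
      assume "clif_word u ^^ M = id" with c show "clif_word (inv_word u) ^^ M = id" by simp
    qed
  qed
  ultimately show ?thesis using lift_sgn_pow[OF u M] by simp
qed

text \<open>The product of the two exponents is odd and kills both permutations, and commuting
  actions let a power of the product be taken factor by factor.\<close>

lemma lift_sgn_mult:
  assumes u: "u \<in> spin_words n" "odd M" "word_perm u ^^ M = id"
    and v: "v \<in> spin_words n" "odd M'" "word_perm v ^^ M' = id"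
    and c: "clif_word u \<circ> clif_word v = clif_word v \<circ> clif_word u"
       "word_perm u \<circ> word_perm v = word_perm v \<circ> word_perm u"
  shows "lift_sgn (u @ v) = lift_sgn u * lift_sgn v"
proof -
  let ?M = "M * M'"
  have 1: "word_perm u ^^ ?M = id" "odd ?M" using u v by (simp_all add: id_funpow flip: funpow_mult)
  have 2: "word_perm v ^^ ?M = id" using v by (simp add: mult.commute[of M] id_funpow flip: funpow_mult)
  have "word_perm (u @ v) ^^ ?M = id" using funpow_comp_commute[OF c(2), of ?M] 1 2 by simp
  moreover have "u @ v \<in> spin_words n" using u v by simp
  ultimately have 3: "lift_sgn (u @ v) = (if clif_word (u @ v) ^^ ?M = id then 1 else - 1)"
    using 1(2) by (metis lift_sgn_pow)
  have 4: "clif_word (u @ v) ^^ ?M = clif_word u ^^ ?M \<circ> clif_word v ^^ ?M"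
    using funpow_comp_commute[OF c(1), of ?M] by simp
  have nn: "negf \<circ> negf = id" by (simp add: fun_eq_iff)
  show ?thesis
    using clif_pow_cases[OF u(1) 1(1)] clif_pow_cases[OF v(1) 2] negf_neq
    unfolding 3 4 lift_sgn_pow[OF u(1) 1(2,1)] lift_sgn_pow[OF v(1) 1(2) 2] by (auto simp: nn)
qed

subsection \<open>Shifted words\<close>

definition shift_letter :: "nat \<Rightarrow> spin_gen \<times> bool \<Rightarrow> spin_gen \<times> bool" where
  "shift_letter m = (\<lambda>(x, b). (case x of Zgen \<Rightarrow> Zgen | Tgen i \<Rightarrow> Tgen (m + i), b))"

lemma shift_word_map: "shift_word m = map (shift_letter m)"
  by (simp add: shift_word_def shift_letter_def fun_eq_iff)

lemma shift_word_simps [simp]: "shift_word m [] = []" "shift_word m (l # u) = shift_letter m l # shift_word m u"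
  "shift_word m (u @ v) = shift_word m u @ shift_word m v"
  by (simp_all add: shift_word_map)

lemma shift_letter_gens: "fst l \<in> spin_gens n \<Longrightarrow> fst (shift_letter m l) \<in> spin_gens (m + n)"
  by (cases l) (auto simp: shift_letter_def spin_gens_def split: spin_gen.splits)

lemma shift_word_words: "u \<in> spin_words n \<Longrightarrow> shift_word m u \<in> spin_words (m + n)"
  by (induction u) (auto simp: shift_letter_gens)

lemma shift_rels: "(u, v) \<in> spin_rels n \<Longrightarrow> (shift_word m u, shift_word m v) \<in> spin_rels (m + n)"
  unfolding spin_rels_def
  by (elim UnE) (auto simp: shift_letter_def shift_word_map numeral_3_eq_3)

lemma spin_eq_shift: "spin_eq n u v \<Longrightarrow> spin_eq (m + n) (shift_word m u) (shift_word m v)"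
proof (induction rule: word_eq.induct)
  case (refl w) thus ?case by (intro word_eq.refl shift_word_words)
next
  case (sym u v) show ?case by (rule word_eq.sym[OF sym.IH])
next
  case (trans u v w) show ?case by (rule word_eq.trans[OF trans.IH])
next
  case (append u u' v v') show ?case unfolding shift_word_simps by (rule word_eq.append[OF append.IH])
next
  case (cancel x b)
  have *: "shift_word m [(x, b), (x, \<not> b)] = [(fst (shift_letter m (x, b)), b), (fst (shift_letter m (x, b)), \<not> b)]"
    by (simp add: shift_letter_def)
  have "fst (shift_letter m (x, b)) \<in> spin_gens (m + n)" using cancel by (intro shift_letter_gens) simp
  thus ?case unfolding * shift_word_simps(1) by (rule word_eq.cancel)
next
  case (relation u v)
  show ?case by (rule word_eq.relation) (use relation in \<open>auto intro: shift_rels shift_word_words\<close>)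
qed

lemma word_perm_shift: "word_perm (shift_word m u) i = (if i \<le> m then i else m + word_perm u (i - m))"
  if "u \<in> spin_words n" for i
  using that
proof (induction u arbitrary: i)
  case (Cons l u)
  obtain x b where l: "l = (x, b)" by force
  have IH: "word_perm (shift_word m u) i = (if i \<le> m then i else m + word_perm u (i - m))" for i
    using Cons by simp
  \<comment> \<open>Keeps 0 apart from the other points: i - m is 0 for every i up to m, and such
    points must not be moved by the shifted word.\<close>
  have 0: "word_perm u j = 0 \<longleftrightarrow> j = 0" for j
  proof -
    have p: "word_perm u permutes {1..n}" using Cons.prems by (intro word_perm_permutes) simp
    hence "word_perm u 0 = 0" by (simp add: permutes_def)
    thus ?thesis using permutes_inj[OF p] by (metis injD)
  qed
  show ?case
  proof (cases x)
    case Zgen thus ?thesis using IH by (simp add: l shift_letter_def)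
  next
    case (Tgen k)
    have "1 \<le> k" using Cons.prems by (simp add: l Tgen)
    thus ?thesis using IH 0[of "i - m"] by (auto simp: l Tgen shift_letter_def transpose_def)
  qed
qed simp

lemma word_even_shift [simp]: "word_even (shift_word m u) \<longleftrightarrow> word_even u"
proof (induction u)
  case (Cons l u)
  obtain x b where l: "l = (x, b)" by force
  show ?case using Cons by (cases x) (auto simp: l shift_letter_def)
qed simp

lemma shift_word_pow: "shift_word m (word_pow u M) = word_pow (shift_word m u) M"
  by (induction M) (auto simp: word_pow_def)

text \<open>The shifted word acts through other Clifford generators, so the two actions are not
  compared directly: by the relations the power of the word is 1 or \<open>z\<close>, and relations
  survive the shift.\<close>

lemma lift_sgn_shift:
  assumes u: "u \<in> spin_words n" and M: "odd M" "word_perm u ^^ M = id"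
  shows "lift_sgn (shift_word m u) = lift_sgn u" "word_perm (shift_word m u) ^^ M = id"
proof -
  have su: "shift_word m u \<in> spin_words (m + n)" by (rule shift_word_words[OF u])
  have "spin_sim n (word_pow u M) []"
    using assms by (simp add: spin_sim_iff word_pow_words word_pow_invariants(1))
  hence "spin_eq n (word_pow u M) [] \<or> spin_eq n (word_pow u M) [zl]" by (simp add: spin_sim_def)
  hence *: "word_perm (shift_word m u) ^^ M = id \<and>
    (clif_word u ^^ M = id \<and> clif_word (shift_word m u) ^^ M = id \<or>
     clif_word u ^^ M = negf \<and> clif_word (shift_word m u) ^^ M = negf)"
  proof
    assume "spin_eq n (word_pow u M) []"
    from spin_eq_invariants[OF this] spin_eq_invariants[OF spin_eq_shift[OF this, of m]]
    show ?thesis by (simp add: shift_word_pow word_pow_invariants)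
  next
    assume "spin_eq n (word_pow u M) [zl]"
    from spin_eq_invariants[OF this] spin_eq_invariants[OF spin_eq_shift[OF this, of m]]
    show ?thesis by (simp add: shift_word_pow word_pow_invariants clif_zl shift_letter_def del: clif_word_Cons)
  qed
  thus "word_perm (shift_word m u) ^^ M = id" by simp
  from * have p: "word_perm (shift_word m u) ^^ M = id" by simp
  show "lift_sgn (shift_word m u) = lift_sgn u"
    using * negf_neq unfolding lift_sgn_pow[OF u M] lift_sgn_pow[OF su M(1) p] by auto
qed

lemma clif_letter_distant:
  assumes "fst l \<in> spin_gens n" "fst l' \<in> spin_gens m"
  shows "clif_letter (shift_letter n l') (clif_letter l f) =
    (if fst l \<noteq> Zgen \<and> fst l' \<noteq> Zgen then negf else id) (clif_letter l (clif_letter (shift_letter n l') f))"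
proof -
  obtain x b x' b' where l: "l = (x, b)" "l' = (x', b')" by (metis surj_pair)
  show ?thesis
  proof (cases x; cases x')
    fix i j assume x: "x = Tgen i" "x' = Tgen j"
    hence "1 \<le> i" "i < n" "1 \<le> j" using assms by (auto simp: l)
    hence c: "clif_gen (n + j) (clif_gen i f) = (\<lambda>S. - clif_gen i (clif_gen (n + j) f) S)" for f
      by (intro clif_gen_anticommute) simp
    show ?thesis by (cases b; cases b') (auto simp: l x shift_letter_def c negf_def clif_gen_minus)
  qed (cases b; cases b'; auto simp: l shift_letter_def clif_gen_minus)+
qed

lemma clif_word_letter_distant:
  assumes "u \<in> spin_words n" "fst l' \<in> spin_gens m"
  shows "clif_letter (shift_letter n l') (clif_word u f) =
    (if \<not> word_even u \<and> fst l' \<noteq> Zgen then negf else id) (clif_word u (clif_letter (shift_letter n l') f))"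
  using assms(1)
proof (induction u)
  case (Cons l u)
  have "clif_letter (shift_letter n l') (clif_word (l # u) f) =
     (if fst l \<noteq> Zgen \<and> fst l' \<noteq> Zgen then negf else id)
       (clif_letter l (clif_letter (shift_letter n l') (clif_word u f)))"
    using clif_letter_distant[of l n l' m] Cons.prems assms(2) by simp
  also have "clif_letter (shift_letter n l') (clif_word u f) =
    (if \<not> word_even u \<and> fst l' \<noteq> Zgen then negf else id) (clif_word u (clif_letter (shift_letter n l') f))"
    using Cons by simp
  finally show ?case by (auto simp: clif_letter_negf)
qed simp

text \<open>Distant generators anticommute, so distant words commute up to a sign, which appears
  only if both are odd: the rule of a graded tensor product.\<close>

lemma clif_word_distant:
  assumes "u \<in> spin_words n" "v \<in> spin_words m"
  shows "clif_word (shift_word n v) (clif_word u f) =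
    (if \<not> word_even u \<and> \<not> word_even v then negf else id) (clif_word u (clif_word (shift_word n v) f))"
  using assms(2)
proof (induction v arbitrary: f)
  case (Cons l v)
  have "clif_word (shift_word n (l # v)) (clif_word u f) =
    clif_letter (shift_letter n l) ((if \<not> word_even u \<and> \<not> word_even v then negf else id) (clif_word u (clif_word (shift_word n v) f)))"
    using Cons by simp
  also have "\<dots> = (if \<not> word_even u \<and> \<not> word_even v then negf else id)
    (clif_letter (shift_letter n l) (clif_word u (clif_word (shift_word n v) f)))"
    by (simp add: clif_letter_negf)
  also have "clif_letter (shift_letter n l) (clif_word u (clif_word (shift_word n v) f)) =
    (if \<not> word_even u \<and> fst l \<noteq> Zgen then negf else id)
      (clif_word u (clif_letter (shift_letter n l) (clif_word (shift_word n v) f)))"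
    using clif_word_letter_distant[OF assms(1), of l m] Cons.prems by simp
  finally show ?case by auto
qed simp

lemma word_perm_distant:
  assumes "u \<in> spin_words n" "v \<in> spin_words m"
  shows "word_perm (shift_word n v) \<circ> word_perm u = word_perm u \<circ> word_perm (shift_word n v)"
proof
  fix i
  have p: "word_perm u permutes {1..n}" "word_perm v permutes {1..m}" using word_perm_permutes[OF assms(1)] word_perm_permutes[OF assms(2)] by simp_all
  have out: "word_perm u j = j" if "j \<notin> {1..n}" for j using p(1) that by (simp add: permutes_def)
  have v0: "word_perm v j > 0 \<longleftrightarrow> j > 0" for j
    using permutes_in_image[OF p(2), of j] p(2) by (cases "j \<in> {1..m}") (auto simp: permutes_def)
  show "(word_perm (shift_word n v) \<circ> word_perm u) i = (word_perm u \<circ> word_perm (shift_word n v)) i"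
  proof (cases "i \<le> n")
    case True
    have "word_perm u i \<le> n" using True permutes_in_image[OF p(1), of i] out[of i] by (cases "i \<in> {1..n}") auto
    thus ?thesis using True by (simp add: word_perm_shift[OF assms(2)])
  next
    case False
    have "n + word_perm v (i - n) > n" using False v0[of "i - n"] by simp
    thus ?thesis using False by (simp add: word_perm_shift[OF assms(2)] out)
  qed
qed

section \<open>The double cover as a group\<close>

declare One_nat_def [simp del]

lemma spin_class_eq:
  "w \<in> spin_words n \<Longrightarrow> spin_class n w = {v \<in> spin_words n. word_perm v = word_perm w \<and> clif_word v = clif_word w}"
  by (auto simp: spin_class_def word_class_def spin_eq_iff)

lemma spin_class_iff:
  assumes "u \<in> spin_words n" "v \<in> spin_words n"
  shows "spin_class n u = spin_class n v \<longleftrightarrow> word_perm u = word_perm v \<and> clif_word u = clif_word v"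
  using assms by (auto simp: spin_class_eq)

lemma spin_carrier: "carrier (spin_sym n) = spin_class n ` spin_words n"
  by (simp add: spin_sym_def presented_group_def spin_class_def)

lemma spin_class_carrier [simp]: "u \<in> spin_words n \<Longrightarrow> spin_class n u \<in> carrier (spin_sym n)"
  by (simp add: spin_carrier)

lemma spin_one: "\<one>\<^bsub>spin_sym n\<^esub> = spin_class n []"
  by (simp add: spin_sym_def presented_group_def spin_class_def)

lemma spin_class_rep:
  assumes "u \<in> spin_words n"
  shows "(SOME w. w \<in> spin_class n u) \<in> spin_class n u"
  using assms by (intro someI[of "\<lambda>w. w \<in> spin_class n u" u]) (simp add: spin_class_eq)

lemma spin_perm_class [simp]: "u \<in> spin_words n \<Longrightarrow> spin_perm (spin_class n u) = word_perm u"
  using spin_class_rep[of u n] by (simp add: spin_perm_def spin_class_eq)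

lemma spin_even_class [simp]:
  assumes "u \<in> spin_words n" shows "spin_even (spin_class n u) = word_even u"
proof -
  have "spin_sim n (SOME w. w \<in> spin_class n u) u"
    using spin_class_rep[OF assms] assms by (simp add: spin_sim_iff spin_class_eq)
  thus ?thesis unfolding spin_even_def by (rule word_even_sim)
qed

definition spin_sgn :: "spin_word set \<Rightarrow> complex" where
  "spin_sgn A = lift_sgn (SOME w. w \<in> A)"

lemma spin_sgn_class [simp]: "u \<in> spin_words n \<Longrightarrow> spin_sgn (spin_class n u) = lift_sgn u"
  using spin_class_rep[of u n] unfolding spin_sgn_def by (intro lift_sgn_cong) (auto simp: spin_class_eq)

lemma spin_mult:
  assumes "u \<in> spin_words n" "v \<in> spin_words n"
  shows "spin_class n u \<otimes>\<^bsub>spin_sym n\<^esub> spin_class n v = spin_class n (u @ v)"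
proof -
  have *: "spin_class n (u' @ v') = spin_class n (u @ v)" if "u' \<in> spin_class n u" "v' \<in> spin_class n v" for u' v'
    using that assms by (subst spin_class_iff) (auto simp: spin_class_eq)
  have "u \<in> spin_class n u" "v \<in> spin_class n v" using assms by (auto simp: spin_class_eq)
  hence "(\<Union>u'\<in>spin_class n u. \<Union>v'\<in>spin_class n v. spin_class n (u' @ v')) = spin_class n (u @ v)"
    using * by blast
  thus ?thesis by (simp add: spin_sym_def presented_group_def spin_class_def)
qed

text \<open>Each permutation has exactly two lifts: at most two by the normal forms, at least two by
  the Clifford action.\<close>

lemma spin_fibre:
  assumes "u \<in> spin_words n"
  shows "{A \<in> carrier (spin_sym n). spin_perm A = word_perm u} = {spin_class n u, spin_class n (zl # u)}"
    "spin_class n (zl # u) \<noteq> spin_class n u"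
proof -
  have z: "zl # u \<in> spin_words n" using assms by simp
  show "spin_class n (zl # u) \<noteq> spin_class n u"
    using clif_word_zl_neq[of u] by (simp only: spin_class_iff[OF z assms]) simp
  show "{A \<in> carrier (spin_sym n). spin_perm A = word_perm u} = {spin_class n u, spin_class n (zl # u)}"
  proof (intro equalityI subsetI)
    fix A assume "A \<in> {A \<in> carrier (spin_sym n). spin_perm A = word_perm u}"
    then obtain v where v: "v \<in> spin_words n" "A = spin_class n v" "word_perm v = word_perm u"
      by (auto simp: spin_carrier)
    have "spin_sim n v u" using v assms by (simp add: spin_sim_iff)
    from spin_sim_clif[OF this] show "A \<in> {spin_class n u, spin_class n (zl # u)}"
      using v spin_class_iff[OF v(1) assms] spin_class_iff[OF v(1) z] by (simp del: clif_word_Cons)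
  qed (use assms in auto)
qed

section \<open>The wreath product as a group\<close>

context finite_grp
begin

abbreviation W :: "nat \<Rightarrow> 'a wr_elt monoid" where "W \<equiv> spin_wreath G"

abbreviation CW :: "nat \<Rightarrow> 'a wr_elt set" where "CW n \<equiv> carrier (W n)"

abbreviation wconj :: "nat \<Rightarrow> 'a wr_elt \<Rightarrow> 'a wr_elt \<Rightarrow> 'a wr_elt" where
  "wconj n y x \<equiv> y \<otimes>\<^bsub>W n\<^esub> x \<otimes>\<^bsub>W n\<^esub> inv\<^bsub>W n\<^esub> y"

abbreviation wz :: "nat \<Rightarrow> 'a wr_elt \<Rightarrow> 'a wr_elt" where
  "wz n x \<equiv> wr_z G n \<otimes>\<^bsub>W n\<^esub> x"

abbreviation GP :: "nat \<Rightarrow> (nat \<Rightarrow> 'a) set" where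
  "GP n \<equiv> {1..n} \<rightarrow>\<^sub>E carrier G"

lemma wr_carrier_iff: "(g, A) \<in> CW n \<longleftrightarrow> g \<in> GP n \<and> A \<in> carrier (spin_sym n)"
  by (simp add: spin_wreath_def)

lemma wr_cases:
  assumes "x \<in> CW n"
  obtains g u where "x = (g, spin_class n u)" "g \<in> GP n" "u \<in> spin_words n"
  using assms by (cases x) (auto simp: wr_carrier_iff spin_carrier)

lemma wr_elI: "g \<in> GP n \<Longrightarrow> u \<in> spin_words n \<Longrightarrow> (g, spin_class n u) \<in> CW n"
  by (simp add: wr_carrier_iff)

lemma word_perm_range: "u \<in> spin_words n \<Longrightarrow> word_perm u i \<in> {1..n} \<longleftrightarrow> i \<in> {1..n}"
  using permutes_in_image[OF word_perm_permutes] .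

lemma wr_mult:
  assumes "u \<in> spin_words n" "v \<in> spin_words n"
  shows "(g, spin_class n u) \<otimes>\<^bsub>W n\<^esub> (h, spin_class n v) =
    ((\<lambda>i\<in>{1..n}. g i \<otimes> h (word_perm (inv_word u) i)), spin_class n (u @ v))"
  using assms by (simp add: spin_wreath_def spin_mult word_perm_inv_word)

lemma wr_one: "\<one>\<^bsub>W n\<^esub> = ((\<lambda>i\<in>{1..n}. \<one>), spin_class n [])"
  by (simp add: spin_wreath_def spin_one)

lemma PiE_closed: "g \<in> GP n \<Longrightarrow> i \<in> {1..n} \<Longrightarrow> g i \<in> carrier G"
  by auto

lemma PiE_Pi: "g \<in> GP n \<Longrightarrow> g \<in> {1..n} \<rightarrow> carrier G"
  by auto

lemma PiE_one_mult:
  assumes "g \<in> GP n"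
  shows "(\<lambda>i\<in>{1..n}. (\<lambda>i\<in>{1..n}. \<one>) i \<otimes> g i) = g"
proof
  fix i
  show "(\<lambda>i\<in>{1..n}. (\<lambda>i\<in>{1..n}. \<one>) i \<otimes> g i) i = g i"
    using PiE_closed[OF assms, of i] PiE_arb[OF assms, of i] by (cases "i \<in> {1..n}") auto
qed

lemma inv_word_append: "inv_word (u @ v) = inv_word v @ inv_word u"
  by (simp add: inv_word_def)

lemma wr_group: "group (W n)"
proof (rule groupI)
  fix x y assume "x \<in> CW n" "y \<in> CW n"
  then obtain g u h v where *: "x = (g, spin_class n u)" "g \<in> GP n" "u \<in> spin_words n"
    "y = (h, spin_class n v)" "h \<in> GP n" "v \<in> spin_words n" by (metis wr_cases)
  have "g i \<otimes> h (word_perm (inv_word u) i) \<in> carrier G" if "i \<in> {1..n}" for i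
    using PiE_closed[OF *(2) that] PiE_closed[OF *(5)] word_perm_range[of "inv_word u" n i] that *(3) by simp
  thus "x \<otimes>\<^bsub>W n\<^esub> y \<in> CW n" using * by (simp add: wr_mult wr_carrier_iff)
next
  show "\<one>\<^bsub>W n\<^esub> \<in> CW n" by (simp add: wr_one wr_carrier_iff)
next
  fix x y w assume "x \<in> CW n" "y \<in> CW n" "w \<in> CW n"
  then obtain g u h v k t where *: "x = (g, spin_class n u)" "g \<in> GP n" "u \<in> spin_words n"
    "y = (h, spin_class n v)" "h \<in> GP n" "v \<in> spin_words n"
    "w = (k, spin_class n t)" "k \<in> GP n" "t \<in> spin_words n" by (metis wr_cases)
  have "g i \<otimes> h (word_perm (inv_word u) i) \<otimes> k (word_perm (inv_word v) (word_perm (inv_word u) i)) =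
    g i \<otimes> (h (word_perm (inv_word u) i) \<otimes> k (word_perm (inv_word v) (word_perm (inv_word u) i)))"
    if "i \<in> {1..n}" for i
  proof (rule m_assoc)
    have 1: "word_perm (inv_word u) i \<in> {1..n}" using word_perm_range[of "inv_word u" n i] that *(3) by simp
    have 2: "word_perm (inv_word v) (word_perm (inv_word u) i) \<in> {1..n}"
      using word_perm_range[of "inv_word v" n "word_perm (inv_word u) i"] 1 *(6) by simp
    show "g i \<in> carrier G" "h (word_perm (inv_word u) i) \<in> carrier G"
      "k (word_perm (inv_word v) (word_perm (inv_word u) i)) \<in> carrier G"
      using PiE_closed[OF *(2) that] PiE_closed[OF *(5) 1] PiE_closed[OF *(8) 2] .
  qed
  moreover have "word_perm (inv_word u) i \<in> {1..n}" if "i \<in> {1..n}" for i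
    using word_perm_range[of "inv_word u" n i] that *(3) by simp
  ultimately show "x \<otimes>\<^bsub>W n\<^esub> y \<otimes>\<^bsub>W n\<^esub> w = x \<otimes>\<^bsub>W n\<^esub> (y \<otimes>\<^bsub>W n\<^esub> w)"
    using *(3,6,9) unfolding *(1,4,7) by (simp add: wr_mult inv_word_append restrict_def fun_eq_iff)
next
  fix x assume "x \<in> CW n"
  then obtain g u where *: "x = (g, spin_class n u)" "g \<in> GP n" "u \<in> spin_words n" by (rule wr_cases)
  have "(\<lambda>i\<in>{1..n}. (\<lambda>i\<in>{1..n}. \<one>) i \<otimes> g i) = g" by (rule PiE_one_mult[OF *(2)])
  thus "\<one>\<^bsub>W n\<^esub> \<otimes>\<^bsub>W n\<^esub> x = x" using *(3) by (simp add: * wr_one wr_mult)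
next
  fix x assume "x \<in> CW n"
  then obtain g u where *: "x = (g, spin_class n u)" "g \<in> GP n" "u \<in> spin_words n" by (rule wr_cases)
  define y where "y = ((\<lambda>i\<in>{1..n}. inv (g (word_perm u i))), spin_class n (inv_word u))"
  have r: "word_perm u i \<in> {1..n}" if "i \<in> {1..n}" for i using word_perm_range[OF *(3)] that by simp
  have y: "y \<in> CW n" unfolding y_def using * r by (intro wr_elI) auto
  have "inv_word (inv_word u) = u" by (induction u) (simp_all add: inv_word_append)
  hence "(\<lambda>i\<in>{1..n}. (\<lambda>i\<in>{1..n}. inv (g (word_perm u i))) i \<otimes> g (word_perm (inv_word (inv_word u)) i)) = (\<lambda>i\<in>{1..n}. \<one>)"
    using PiE_closed[OF *(2) r] by (auto simp: fun_eq_iff)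
  moreover have "spin_class n (inv_word u @ u) = spin_class n []"
    using *(3) by (subst spin_class_iff) (simp_all add: word_perm_inv_comp clif_inv_comp)
  ultimately have "y \<otimes>\<^bsub>W n\<^esub> x = \<one>\<^bsub>W n\<^esub>" using *(3) by (simp add: y_def *(1) wr_mult wr_one)
  with y show "\<exists>y\<in>CW n. y \<otimes>\<^bsub>W n\<^esub> x = \<one>\<^bsub>W n\<^esub>" by blast
qed

lemma inv_word_twice [simp]: "inv_word (inv_word u) = u"
  by (induction u) (simp_all add: inv_word_append)

lemma wr_inv:
  assumes "g \<in> GP n" "u \<in> spin_words n"
  shows "inv\<^bsub>W n\<^esub> (g, spin_class n u) = ((\<lambda>i\<in>{1..n}. inv (g (word_perm u i))), spin_class n (inv_word u))"
proof -
  interpret W: group "W n" by (rule wr_group)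
  let ?y = "((\<lambda>i\<in>{1..n}. inv (g (word_perm u i))), spin_class n (inv_word u))"
  have r: "word_perm u i \<in> {1..n}" if "i \<in> {1..n}" for i using word_perm_range[OF assms(2)] that by simp
  have y: "?y \<in> CW n" using assms PiE_closed[OF assms(1) r] by (intro wr_elI) auto
  have "(\<lambda>i\<in>{1..n}. (\<lambda>i\<in>{1..n}. inv (g (word_perm u i))) i \<otimes> g (word_perm (inv_word (inv_word u)) i)) = (\<lambda>i\<in>{1..n}. \<one>)"
    using PiE_closed[OF assms(1) r] by (auto simp: fun_eq_iff)
  moreover have "spin_class n (inv_word u @ u) = spin_class n []"
    using assms(2) by (subst spin_class_iff) (simp_all add: word_perm_inv_comp clif_inv_comp)
  ultimately have "?y \<otimes>\<^bsub>W n\<^esub> (g, spin_class n u) = \<one>\<^bsub>W n\<^esub>" using assms(2) by (simp add: wr_mult wr_one)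
  thus ?thesis by (rule W.inv_equality[OF _ wr_elI[OF assms] y])
qed

lemma wr_conj:
  assumes "g \<in> GP n" "u \<in> spin_words n" "h \<in> GP n" "v \<in> spin_words n"
  shows "(h, spin_class n v) \<otimes>\<^bsub>W n\<^esub> (g, spin_class n u) \<otimes>\<^bsub>W n\<^esub> inv\<^bsub>W n\<^esub> (h, spin_class n v) =
    ((\<lambda>i\<in>{1..n}. h i \<otimes> g (word_perm (inv_word v) i) \<otimes>
       inv (h (word_perm v (word_perm (inv_word u) (word_perm (inv_word v) i))))), spin_class n (v @ u @ inv_word v))"
proof -
  have "word_perm (inv_word u) (word_perm (inv_word v) i) \<in> {1..n}" if "i \<in> {1..n}" for i
    using that word_perm_range[of "inv_word u" n] word_perm_range[of "inv_word v" n] assms by simp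
  thus ?thesis using assms by (simp add: wr_inv wr_mult inv_word_append restrict_def fun_eq_iff)
qed

section \<open>Type and sign of an element of the spin wreath product\<close>

definition wtype :: "nat \<Rightarrow> 'a wr_elt \<Rightarrow> ('a set \<times> nat) multiset" where
  "wtype n x = ctype {1..n} (fst x) (spin_perm (snd x))"

definition otype :: "nat \<Rightarrow> 'a wr_elt \<Rightarrow> bool" where
  "otype n x \<longleftrightarrow> (\<forall>b\<in>#wtype n x. odd (snd b))"

definition cyc_sgn :: "nat \<Rightarrow> complex" where
  "cyc_sgn k = lift_sgn (map tl_at [1..<k])"

text \<open>The correction by \<open>cyc_sgn\<close> makes the elements of \<open>D_plus\<close>
  positive. It is not trivial: (t_1 t_2)^3 = z gives \<open>cyc_sgn 3\<close> the value -1.\<close>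

definition wsgn :: "nat \<Rightarrow> 'a wr_elt \<Rightarrow> complex" where
  "wsgn n x = spin_sgn (snd x) * (\<Prod>b\<in>#wtype n x. cyc_sgn (snd b))"

lemma word_perm_bij_betw: "u \<in> spin_words n \<Longrightarrow> bij_betw (word_perm u) {1..n} {1..n}"
  by (rule permutes_imp_bij[OF word_perm_permutes])

lemma wtype_conj:
  assumes "x \<in> CW n" "y \<in> CW n"
  shows "wtype n (wconj n y x) = wtype n x"
proof -
  obtain g u where x: "x = (g, spin_class n u)" "g \<in> GP n" "u \<in> spin_words n" using assms(1) by (rule wr_cases)
  obtain h v where y: "y = (h, spin_class n v)" "h \<in> GP n" "v \<in> spin_words n" using assms(2) by (rule wr_cases)
  have r: "word_perm u i \<in> {1..n}" "word_perm v i \<in> {1..n}" if "i \<in> {1..n}" for i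
    using word_perm_range x y that by simp_all
  have w: "v @ u @ inv_word v \<in> spin_words n" using x y by simp
  have "ctype {1..n} (\<lambda>i\<in>{1..n}. h i \<otimes> g (word_perm (inv_word v) i) \<otimes>
       inv (h (word_perm v (word_perm (inv_word u) (word_perm (inv_word v) i))))) (word_perm (v @ u @ inv_word v)) =
    ctype {1..n} g (word_perm u)"
  proof (rule ctype_conj[where h = "\<lambda>i. h (word_perm v i)" and \<tau> = "word_perm v"])
    fix i assume i: "i \<in> {1..n}"
    show "word_perm (v @ u @ inv_word v) (word_perm v i) = word_perm v (word_perm u i)" by (simp add: word_perm_inv')
    show "(\<lambda>i\<in>{1..n}. h i \<otimes> g (word_perm (inv_word v) i) \<otimes>
       inv (h (word_perm v (word_perm (inv_word u) (word_perm (inv_word v) i))))) (word_perm v (word_perm u i)) =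
      h (word_perm v (word_perm u i)) \<otimes> g (word_perm u i) \<otimes> inv (h (word_perm v i))"
      using r(2)[OF r(1)[OF i]] by (simp add: word_perm_inv')
  next
    show "(\<lambda>i. h (word_perm v i)) \<in> {1..n} \<rightarrow> carrier G" using PiE_closed[OF y(2) r(2)] by simp
  qed (simp_all add: word_perm_bij_betw x(3) y(3) PiE_Pi[OF x(2)])
  thus ?thesis using x y w by (simp add: wr_conj wtype_def del: word_perm_append)
qed

lemma set_ctype:
  assumes "finite A" "bij_betw \<sigma> A A" "g \<in> A \<rightarrow> carrier G"
  shows "set_mset (ctype A g \<sigma>) = cyc_label g \<sigma> ` A"
proof -
  have "cyc_label g \<sigma> (SOME j. j \<in> orbit \<sigma> i) = cyc_label g \<sigma> i" if "i \<in> A" for i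
    using that orbit_bij(6)[OF assms(1,2) that]
    by (intro cyc_label_orbit[OF assms(1,2) _ assms(3)] someI[of "\<lambda>j. j \<in> orbit \<sigma> i"])
  thus ?thesis using assms(1) by (auto simp: ctype_def image_image intro!: image_cong)
qed

text \<open>The exponent is the product of the orbit lengths: odd because all of them are, and a
  multiple of each.\<close>

lemma otype_order:
  assumes "g \<in> GP n" "u \<in> spin_words n" "otype n (g, spin_class n u)"
  obtains M where "odd M" "word_perm u ^^ M = id"
proof -
  define M where "M = (\<Prod>C\<in>orbit (word_perm u) ` {1..n}. card C)"
  note b = word_perm_bij_betw[OF assms(2)]
  have "odd (card (orbit (word_perm u) i))" if "i \<in> {1..n}" for i
  proof -
    have "cyc_label g (word_perm u) i \<in># wtype n (g, spin_class n u)"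
      using that assms(2) set_ctype[OF _ b PiE_Pi[OF assms(1)]] by (simp add: wtype_def)
    hence "odd (snd (cyc_label g (word_perm u) i))" using assms(3) unfolding otype_def by blast
    thus ?thesis by (simp add: cyc_label_def)
  qed
  hence "odd M" unfolding M_def by (auto simp: even_prod_iff)
  moreover have "(word_perm u ^^ M) i = i" for i
  proof (cases "i \<in> {1..n}")
    case True
    have "card (orbit (word_perm u) i) dvd M" unfolding M_def using True by (intro dvd_prodI) auto
    then obtain q where q: "M = card (orbit (word_perm u) i) * q" ..
    have "(word_perm u ^^ card (orbit (word_perm u) i)) i = i" by (rule orbit_bij(2)[OF _ b True]) simp
    hence "((word_perm u ^^ card (orbit (word_perm u) i)) ^^ q) i = i" by (induction q) simp_all
    thus ?thesis by (simp add: q funpow_mult)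
  next
    case False
    hence "word_perm u i = i" using word_perm_permutes[OF assms(2)] by (simp add: permutes_def)
    thus ?thesis by (induction M) simp_all
  qed
  hence "word_perm u ^^ M = id" by (simp add: fun_eq_iff)
  ultimately show ?thesis by (rule that)
qed

lemma otype_conj:
  assumes "x \<in> CW n" "y \<in> CW n"
  shows "otype n (wconj n y x) = otype n x"
  using wtype_conj[OF assms] by (simp add: otype_def)

lemma wsgn_conj:
  assumes "x \<in> CW n" "y \<in> CW n" "otype n x"
  shows "wsgn n (wconj n y x) = wsgn n x"
proof -
  obtain g u where x: "x = (g, spin_class n u)" "g \<in> GP n" "u \<in> spin_words n" using assms(1) by (rule wr_cases)
  obtain h v where y: "y = (h, spin_class n v)" "h \<in> GP n" "v \<in> spin_words n" using assms(2) by (rule wr_cases)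
  obtain M where M: "odd M" "word_perm u ^^ M = id" using otype_order[OF x(2,3)] assms(3) x(1) by metis
  have w: "v @ u @ inv_word v \<in> spin_words n" using x y by simp
  have "spin_sgn (snd (wconj n y x)) = spin_sgn (snd x)"
    using lift_sgn_conj[OF x(3) y(3) M] w x y by (simp add: wr_conj)
  thus ?thesis using wtype_conj[OF assms(1,2)] by (simp add: wsgn_def)
qed

lemma wr_z_mult:
  assumes "g \<in> GP n" "u \<in> spin_words n"
  shows "wz n (g, spin_class n u) = (g, spin_class n (zl # u))"
proof -
  have "(\<lambda>i\<in>{1..n}. (\<lambda>i\<in>{1..n}. \<one>) i \<otimes> g i) = g" by (rule PiE_one_mult[OF assms(1)])
  moreover have "[zl] \<in> spin_words n" by simp
  ultimately show ?thesis using wr_mult[of "[zl]" n u "\<lambda>i\<in>{1..n}. \<one>" g] assms(2) by (simp add: wr_z_def)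
qed

lemma wr_z_carrier: "wr_z G n \<in> CW n"
  unfolding wr_z_def by (rule wr_elI) auto

lemma wsgn_z:
  assumes "x \<in> CW n"
  shows "wtype n (wz n x) = wtype n x" "otype n (wz n x) = otype n x"
    "otype n x \<Longrightarrow> wsgn n (wz n x) = - wsgn n x"
    "wr_even (wz n x) = wr_even x"
proof -
  obtain g u where x: "x = (g, spin_class n u)" "g \<in> GP n" "u \<in> spin_words n" using assms(1) by (rule wr_cases)
  have z: "zl # u \<in> spin_words n" using x by simp
  have p: "word_perm (zl # u) = word_perm u" by simp
  show t: "wtype n (wz n x) = wtype n x"
    unfolding x(1) wr_z_mult[OF x(2,3)] wtype_def snd_conv fst_conv spin_perm_class[OF z] spin_perm_class[OF x(3)] p ..
  thus "otype n (wz n x) = otype n x" by (simp add: otype_def)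
  show "wsgn n (wz n x) = - wsgn n x" if o: "otype n x"
  proof -
    have "otype n (g, spin_class n u)" using o x(1) by simp
    then obtain M where M: "odd M" "word_perm u ^^ M = id" by (rule otype_order[OF x(2,3)])
    have "spin_sgn (snd (wz n x)) = - spin_sgn (snd x)"
      unfolding x(1) wr_z_mult[OF x(2,3)] snd_conv spin_sgn_class[OF z] spin_sgn_class[OF x(3)]
      by (rule lift_sgn_z[OF x(3) M])
    thus ?thesis using t by (simp add: wsgn_def)
  qed
  show "wr_even (wz n x) = wr_even x"
    using z x by (simp add: wr_z_mult wr_even_def)
qed

lemma otype_even: "x \<in> CW n \<Longrightarrow> otype n x \<Longrightarrow> wr_even x"
proof -
  assume c: "x \<in> CW n" and o: "otype n x"
  obtain g u where x: "x = (g, spin_class n u)" "g \<in> GP n" "u \<in> spin_words n" using c by (rule wr_cases)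
  have "otype n (g, spin_class n u)" using o x(1) by simp
  then obtain M where M: "odd M" "word_perm u ^^ M = id" by (rule otype_order[OF x(2,3)])
  show ?thesis using odd_order_even[OF x(3) M(2,1)] x by (simp add: wr_even_def)
qed

lemma cyc_sgn_square [simp]: "cyc_sgn k * cyc_sgn k = 1"
  by (simp add: cyc_sgn_def)

lemma wsgn_square: "x \<in> CW n \<Longrightarrow> wsgn n x * wsgn n x = 1"
proof -
  have "(\<Prod>b\<in>#m. cyc_sgn (snd b)) * (\<Prod>b\<in>#m. cyc_sgn (snd b)) = 1" for m :: "('a set \<times> nat) multiset"
    by (simp flip: prod_mset.distrib)
  moreover have "wsgn n x * wsgn n x = (spin_sgn (snd x) * spin_sgn (snd x)) *
    ((\<Prod>b\<in>#wtype n x. cyc_sgn (snd b)) * (\<Prod>b\<in>#wtype n x. cyc_sgn (snd b)))"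
    unfolding wsgn_def by (simp only: mult_ac)
  moreover have "spin_sgn A * spin_sgn A = 1" for A by (simp add: spin_sgn_def)
  ultimately show ?thesis by (simp only: mult_1_right)
qed

end

section \<open>Young subgroups\<close>

context finite_grp
begin

definition ycomb :: "nat \<Rightarrow> nat \<Rightarrow> 'a wr_elt \<Rightarrow> 'a wr_elt \<Rightarrow> 'a wr_elt" where
  "ycomb n m x y = embed_left G n m x \<otimes>\<^bsub>W (n + m)\<^esub> embed_right G n m y"

definition join :: "nat \<Rightarrow> nat \<Rightarrow> (nat \<Rightarrow> 'a) \<Rightarrow> (nat \<Rightarrow> 'a) \<Rightarrow> nat \<Rightarrow> 'a" where
  "join n m g h = (\<lambda>i\<in>{1..n + m}. if i \<le> n then g i else h (i - n))"

lemma right_index: "i \<in> {1..n + m} \<Longrightarrow> \<not> i \<le> n \<Longrightarrow> i - n \<in> {1..m}" for i n m :: nat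
  by (simp add: One_nat_def) linarith

lemma join_PiE:
  assumes "g \<in> GP n" "h \<in> GP m"
  shows "join n m g h \<in> GP (n + m)"
proof -
  have "(if i \<le> n then g i else h (i - n)) \<in> carrier G" if "i \<in> {1..n + m}" for i
    using PiE_closed[OF assms(1), of i] PiE_closed[OF assms(2), of "i - n"] that right_index[OF that] by auto
  thus ?thesis by (auto simp: join_def)
qed

lemma words_left: "u \<in> spin_words n \<Longrightarrow> u \<in> spin_words (n + m)"
  by (rule spin_words_mono[of n]) simp_all

lemma embed_left_eq:
  assumes "u \<in> spin_words n"
  shows "embed_left G n m (g, spin_class n u) = (join n m g (\<lambda>_. \<one>), spin_class (n + m) u)"
proof -
  have "spin_class (n + m) w = spin_class (n + m) u" if "w \<in> spin_class n u" for w
    using that assms words_left[of _ n m] by (simp add: spin_class_eq spin_class_iff)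
  moreover have "u \<in> spin_class n u" using assms by (simp add: spin_class_eq)
  ultimately have "(\<Union>w\<in>spin_class n u. spin_class (n + m) w) = spin_class (n + m) u" by blast
  thus ?thesis by (simp add: embed_left_def join_def)
qed

lemma embed_right_eq:
  assumes "v \<in> spin_words m"
  shows "embed_right G n m (h, spin_class m v) = (join n m (\<lambda>_. \<one>) h, spin_class (n + m) (shift_word n v))"
proof -
  have "spin_class (n + m) (shift_word n w) = spin_class (n + m) (shift_word n v)" if "w \<in> spin_class m v" for w
  proof -
    have "spin_eq m w v" using that assms by (simp add: spin_class_eq spin_eq_iff)
    from spin_eq_invariants[OF spin_eq_shift[OF this, of n]] show ?thesis by (simp add: spin_class_iff)
  qed
  moreover have "v \<in> spin_class m v" using assms by (simp add: spin_class_eq)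
  ultimately have "(\<Union>w\<in>spin_class m v. spin_class (n + m) (shift_word n w)) = spin_class (n + m) (shift_word n v)" by blast
  thus ?thesis by (simp add: embed_right_def join_def)
qed

lemma embed_closed:
  "x \<in> CW n \<Longrightarrow> embed_left G n m x \<in> CW (n + m)"
  "y \<in> CW m \<Longrightarrow> embed_right G n m y \<in> CW (n + m)"
proof -
  assume "x \<in> CW n"
  then obtain g u where x: "x = (g, spin_class n u)" "g \<in> GP n" "u \<in> spin_words n" by (rule wr_cases)
  show "embed_left G n m x \<in> CW (n + m)"
    unfolding x(1) embed_left_eq[OF x(3)]
  proof (intro wr_elI words_left[OF x(3)])
    have "(if i \<le> n then g i else \<one>) \<in> carrier G" if "i \<in> {1..n + m}" for i
      using PiE_closed[OF x(2), of i] that by auto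
    thus "join n m g (\<lambda>_. \<one>) \<in> GP (n + m)" by (auto simp: join_def)
  qed
next
  assume "y \<in> CW m"
  then obtain h v where y: "y = (h, spin_class m v)" "h \<in> GP m" "v \<in> spin_words m" by (rule wr_cases)
  have "join n m (\<lambda>_. \<one>) h \<in> GP (n + m)"
  proof -
    have "(if i \<le> n then \<one> else h (i - n)) \<in> carrier G" if "i \<in> {1..n + m}" for i
      using PiE_closed[OF y(2), of "i - n"] that right_index[OF that] by auto
    thus ?thesis by (auto simp: join_def)
  qed
  thus "embed_right G n m y \<in> CW (n + m)"
    unfolding y(1) embed_right_eq[OF y(3)] using shift_word_words[OF y(3)] by (intro wr_elI)
qed

lemma ycomb_closed: "x \<in> CW n \<Longrightarrow> y \<in> CW m \<Longrightarrow> ycomb n m x y \<in> CW (n + m)"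
  unfolding ycomb_def by (intro monoid.m_closed[OF group.is_monoid[OF wr_group]] embed_closed)

lemma word_perm_fix: "u \<in> spin_words n \<Longrightarrow> i > n \<Longrightarrow> word_perm u i = i"
  using word_perm_permutes[of u n] by (auto simp: permutes_def)

lemma ycomb_eq:
  assumes "g \<in> GP n" "u \<in> spin_words n" "h \<in> GP m" "v \<in> spin_words m"
  shows "ycomb n m (g, spin_class n u) (h, spin_class m v) = (join n m g h, spin_class (n + m) (u @ shift_word n v))"
proof -
  have "(\<lambda>i\<in>{1..n + m}. join n m g (\<lambda>_. \<one>) i \<otimes> join n m (\<lambda>_. \<one>) h (word_perm (inv_word u) i)) = join n m g h" (is "?u = ?v")
  proof
    fix i
    show "?u i = ?v i"
    proof (cases "i \<in> {1..n + m}")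
      case i: True
      show ?thesis
      proof (cases "i \<le> n")
        case True
        have "word_perm (inv_word u) i \<in> {1..n}" using word_perm_range[of "inv_word u" n i] assms(2) True i by simp
        thus ?thesis using True i PiE_closed[OF assms(1), of i] by (simp add: join_def)
      next
        case False
        have "word_perm (inv_word u) i = i" using word_perm_fix[of "inv_word u" n i] assms(2) False by simp
        thus ?thesis using False i PiE_closed[OF assms(3) right_index[OF i False]] by (simp add: join_def)
      qed
    next
      case False
      thus ?thesis by (simp add: join_def restrict_apply del: atLeastAtMost_iff)
    qed
  qed
  thus ?thesis unfolding ycomb_def embed_left_eq[OF assms(2)] embed_right_eq[OF assms(4)]
    using words_left[OF assms(2)] shift_word_words[OF assms(4), of n] by (simp add: wr_mult)
qed

lemma interval_split: "{1..n + m} = {1..n} \<union> {n + 1..n + m}" for n m :: nat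
  by auto

lemma shift_bij: "bij_betw (\<lambda>i. n + i) {1..m} {n + 1..n + m}" for n m :: nat
proof (rule bij_betw_imageI)
  show "(\<lambda>i. n + i) ` {1..m} = {n + 1..n + m}"
  proof (intro equalityI subsetI)
    fix i assume "i \<in> {n + 1..n + m}"
    thus "i \<in> (\<lambda>i. n + i) ` {1..m}" by (intro image_eqI[of _ _ "i - n"]) auto
  qed auto
qed simp

lemma ctype_join:
  assumes g: "g \<in> {1..n} \<rightarrow> carrier G" and h: "h \<in> {1..m} \<rightarrow> carrier G"
    and \<sigma>: "bij_betw \<sigma> {1..n} {1..n}" and \<rho>: "bij_betw \<rho> {1..m} {1..m}"
    and f: "\<And>i. i \<in> {1..n} \<Longrightarrow> f i = g i" "\<And>i. i \<in> {1..m} \<Longrightarrow> f (n + i) = h i"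
    and \<tau>: "\<And>i. i \<in> {1..n} \<Longrightarrow> \<tau> i = \<sigma> i" "\<And>i. i \<in> {1..m} \<Longrightarrow> \<tau> (n + i) = n + \<rho> i"
  shows "ctype {1..n + m} f \<tau> = ctype {1..n} g \<sigma> + ctype {1..m} h \<rho>"
proof -
  have 1: "bij_betw \<tau> {1..n} {1..n}" by (rule bij_betw_cong[THEN iffD1, OF \<tau>(1)[symmetric] \<sigma>])
  have 2: "bij_betw \<tau> {n + 1..n + m} {n + 1..n + m}"
  proof -
    have "bij_betw (\<tau> \<circ> (\<lambda>i. n + i)) {1..m} {n + 1..n + m}"
      using bij_betw_trans[OF \<rho> shift_bij[of n m]] by (rule bij_betw_cong[THEN iffD1, rotated]) (simp add: \<tau>)
    thus ?thesis using bij_betw_comp_iff[OF shift_bij[of n m], of \<tau>] by simp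
  qed
  have "ctype {1..n + m} f \<tau> = ctype {1..n} f \<tau> + ctype {n + 1..n + m} f \<tau>"
    unfolding interval_split by (rule ctype_Un) (use 1 2 in auto)
  also have "ctype {1..n} f \<tau> = ctype {1..n} g \<sigma>"
    by (rule ctype_cong[OF _ \<sigma> g]) (simp_all add: f \<tau>)
  also have "ctype {n + 1..n + m} f \<tau> = ctype {1..m} h \<rho>"
  proof (rule ctype_conj[OF _ \<rho> h, where h = "\<lambda>_. \<one>" and \<tau> = "\<lambda>i. n + i"])
    fix i assume i: "i \<in> {1..m}"
    have "\<rho> i \<in> {1..m}" using \<rho> i by (auto simp: bij_betw_def)
    hence "f (n + \<rho> i) = h (\<rho> i)" "h (\<rho> i) \<in> carrier G" using h f(2) by blast+
    thus "f (n + \<rho> i) = \<one> \<otimes> h (\<rho> i) \<otimes> inv \<one>" by simp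
    show "\<tau> (n + i) = n + \<rho> i" by (rule \<tau>(2)[OF i])
  qed (auto intro: shift_bij)
  finally show ?thesis .
qed

lemma word_perm_append_shift:
  assumes "u \<in> spin_words n" "v \<in> spin_words m"
  shows "i \<in> {1..n} \<Longrightarrow> word_perm (u @ shift_word n v) i = word_perm u i"
    "i \<in> {1..m} \<Longrightarrow> word_perm (u @ shift_word n v) (n + i) = n + word_perm v i"
proof -
  show "i \<in> {1..n} \<Longrightarrow> word_perm (u @ shift_word n v) i = word_perm u i"
    by (simp add: word_perm_shift[OF assms(2)])
  assume i: "i \<in> {1..m}"
  hence "word_perm v i \<in> {1..m}" using word_perm_range[OF assms(2)] by simp
  thus "word_perm (u @ shift_word n v) (n + i) = n + word_perm v i"
    using i by (simp add: word_perm_shift[OF assms(2)] word_perm_fix[OF assms(1)])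
qed

lemma wtype_ycomb:
  assumes "x \<in> CW n" "y \<in> CW m"
  shows "wtype (n + m) (ycomb n m x y) = wtype n x + wtype m y"
proof -
  obtain g u where x: "x = (g, spin_class n u)" "g \<in> GP n" "u \<in> spin_words n" using assms(1) by (rule wr_cases)
  obtain h v where y: "y = (h, spin_class m v)" "h \<in> GP m" "v \<in> spin_words m" using assms(2) by (rule wr_cases)
  have w: "u @ shift_word n v \<in> spin_words (n + m)" using words_left[OF x(3)] shift_word_words[OF y(3)] by simp
  have "ctype {1..n + m} (join n m g h) (word_perm (u @ shift_word n v)) = ctype {1..n} g (word_perm u) + ctype {1..m} h (word_perm v)"
  proof (rule ctype_join[OF PiE_Pi[OF x(2)] PiE_Pi[OF y(2)] word_perm_bij_betw[OF x(3)] word_perm_bij_betw[OF y(3)]])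
    fix i show "i \<in> {1..n} \<Longrightarrow> join n m g h i = g i" "i \<in> {1..m} \<Longrightarrow> join n m g h (n + i) = h i"
      by (auto simp: join_def)
  qed (rule word_perm_append_shift[OF x(3) y(3)], assumption)+
  thus ?thesis unfolding x(1) y(1) ycomb_eq[OF x(2,3) y(2,3)] wtype_def
    by (simp only: fst_conv snd_conv spin_perm_class[OF w] spin_perm_class[OF x(3)] spin_perm_class[OF y(3)])
qed

lemma otype_ycomb:
  assumes "x \<in> CW n" "y \<in> CW m"
  shows "otype (n + m) (ycomb n m x y) \<longleftrightarrow> otype n x \<and> otype m y"
  unfolding otype_def wtype_ycomb[OF assms] by auto

lemma clif_comp_distant_even:
  assumes "u \<in> spin_words n" "v \<in> spin_words m" "word_even u"
  shows "clif_word u \<circ> clif_word (shift_word n v) = clif_word (shift_word n v) \<circ> clif_word u"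
  using clif_word_distant[OF assms(1,2)] assms(3) by (simp add: fun_eq_iff)

text \<open>Words over permutations of odd order are even, so the left word commutes with the
  shifted one also in the Clifford action, and \<open>lift_sgn_mult\<close> applies.\<close>

lemma lift_sgn_join:
  assumes "u \<in> spin_words n" "odd M" "word_perm u ^^ M = id"
    and "v \<in> spin_words m" "odd M'" "word_perm v ^^ M' = id"
  shows "lift_sgn (u @ shift_word n v) = lift_sgn u * lift_sgn v"
proof -
  have "lift_sgn (u @ shift_word n v) = lift_sgn u * lift_sgn (shift_word n v)"
    by (rule lift_sgn_mult[OF words_left[OF assms(1)] assms(2,3) shift_word_words[OF assms(4)] assms(5)
          lift_sgn_shift(2)[OF assms(4-6)] clif_comp_distant_even[OF assms(1,4)]
          word_perm_distant[OF assms(1,4), symmetric]]) (rule odd_order_even[OF assms(1,3,2)])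
  thus ?thesis using lift_sgn_shift(1)[OF assms(4-6)] by simp
qed

lemma wsgn_ycomb:
  assumes "x \<in> CW n" "y \<in> CW m" "otype n x" "otype m y"
  shows "wsgn (n + m) (ycomb n m x y) = wsgn n x * wsgn m y"
proof -
  obtain g u where x: "x = (g, spin_class n u)" "g \<in> GP n" "u \<in> spin_words n" using assms(1) by (rule wr_cases)
  obtain h v where y: "y = (h, spin_class m v)" "h \<in> GP m" "v \<in> spin_words m" using assms(2) by (rule wr_cases)
  have w: "u @ shift_word n v \<in> spin_words (n + m)" using words_left[OF x(3)] shift_word_words[OF y(3)] by simp
  obtain M where M: "odd M" "word_perm u ^^ M = id" using otype_order[OF x(2,3) assms(3)[unfolded x(1)]] .
  obtain M' where M': "odd M'" "word_perm v ^^ M' = id" using otype_order[OF y(2,3) assms(4)[unfolded y(1)]] .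
  have "spin_sgn (snd (ycomb n m x y)) = spin_sgn (snd x) * spin_sgn (snd y)"
    unfolding x(1) y(1) ycomb_eq[OF x(2,3) y(2,3)] snd_conv
      spin_sgn_class[OF w] spin_sgn_class[OF x(3)] spin_sgn_class[OF y(3)]
    by (rule lift_sgn_join[OF x(3) M y(3) M'])
  thus ?thesis by (simp add: wsgn_def wtype_ycomb[OF assms(1,2)] mult_ac)
qed

lemma wr_even_ycomb:
  assumes "x \<in> CW n" "y \<in> CW m"
  shows "wr_even (ycomb n m x y) \<longleftrightarrow> (wr_even x \<longleftrightarrow> wr_even y)"
proof -
  obtain g u where x: "x = (g, spin_class n u)" "g \<in> GP n" "u \<in> spin_words n" using assms(1) by (rule wr_cases)
  obtain h v where y: "y = (h, spin_class m v)" "h \<in> GP m" "v \<in> spin_words m" using assms(2) by (rule wr_cases)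
  have w: "u @ shift_word n v \<in> spin_words (n + m)" using words_left[OF x(3)] shift_word_words[OF y(3)] by simp
  show ?thesis
    unfolding x(1) y(1) ycomb_eq[OF x(2,3) y(2,3)] wr_even_def snd_conv
      spin_even_class[OF w] spin_even_class[OF x(3)] spin_even_class[OF y(3)] by simp
qed

text \<open>Exchanging two odd factors that move disjoint sets of points costs one \<open>z\<close>,
  while their components in the base group commute because they occupy disjoint coordinates.\<close>

lemma ycomb_odd_odd:
  assumes "x \<in> CW n" "y \<in> CW m" "\<not> wr_even x" "\<not> wr_even y"
  shows "embed_right G n m y \<otimes>\<^bsub>W (n + m)\<^esub> embed_left G n m x = wz (n + m) (ycomb n m x y)"
proof -
  obtain g u where x: "x = (g, spin_class n u)" "g \<in> GP n" "u \<in> spin_words n" using assms(1) by (rule wr_cases)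
  obtain h v where y: "y = (h, spin_class m v)" "h \<in> GP m" "v \<in> spin_words m" using assms(2) by (rule wr_cases)
  have w1: "u \<in> spin_words (n + m)" and w2: "shift_word n v \<in> spin_words (n + m)"
    using words_left[OF x(3)] shift_word_words[OF y(3)] by simp_all
  have w: "u @ shift_word n v \<in> spin_words (n + m)" using w1 w2 by simp
  have odd: "\<not> word_even u" "\<not> word_even v" using assms(3,4) x y by (simp_all add: wr_even_def)
  have "spin_class (n + m) (shift_word n v @ u) = spin_class (n + m) (zl # u @ shift_word n v)"
  proof (subst spin_class_iff)
    have "clif_word (shift_word n v @ u) = negf \<circ> clif_word (u @ shift_word n v)"
      using clif_word_distant[OF x(3) y(3)] odd by (simp add: fun_eq_iff)
    hence "clif_word (shift_word n v @ u) = clif_word (zl # u @ shift_word n v)" by (simp only: clif_zl)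
    moreover have "word_perm (shift_word n v @ u) = word_perm (zl # u @ shift_word n v)"
      using word_perm_distant[OF x(3) y(3)] by simp
    ultimately show "word_perm (shift_word n v @ u) = word_perm (zl # u @ shift_word n v) \<and>
      clif_word (shift_word n v @ u) = clif_word (zl # u @ shift_word n v)" by simp
  qed (use w1 w2 in simp_all)
  moreover have "(\<lambda>i\<in>{1..n + m}. join n m (\<lambda>_. \<one>) h i \<otimes> join n m g (\<lambda>_. \<one>) (word_perm (inv_word (shift_word n v)) i)) = join n m g h" (is "?u = ?v")
  proof
    fix i
    have sv: "inv_word (shift_word n v) = shift_word n (inv_word v)"
      by (simp add: inv_word_def shift_word_def rev_map split_beta comp_def)
    have iv: "inv_word v \<in> spin_words m" using y(3) by simp
    show "?u i = ?v i"
    proof (cases "i \<in> {1..n + m}")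
      case i: True
      show ?thesis
      proof (cases "i \<le> n")
        case True
        thus ?thesis using i PiE_closed[OF x(2), of i] by (simp add: join_def sv word_perm_shift[OF iv])
      next
        case False
        have "word_perm (inv_word v) (i - n) \<in> {1..m}"
          using word_perm_range[OF iv, of "i - n"] right_index[OF i False] by simp
        thus ?thesis using False i PiE_closed[OF y(2) right_index[OF i False]] by (simp add: join_def sv word_perm_shift[OF iv])
      qed
    next
      case False
      thus ?thesis by (simp add: join_def restrict_apply del: atLeastAtMost_iff)
    qed
  qed
  ultimately show ?thesis
    unfolding x(1) y(1) ycomb_eq[OF x(2,3) y(2,3)] embed_left_eq[OF x(3)] embed_right_eq[OF y(3)]
      wr_mult[OF w2 w1] wr_z_mult[OF join_PiE[OF x(2) y(2)] w] by simp
qed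

lemma ycomb_young: "x \<in> CW n \<Longrightarrow> y \<in> CW m \<Longrightarrow> ycomb n m x y \<in> young_sub G n m"
proof -
  assume a: "x \<in> CW n" "y \<in> CW m"
  obtain g u where x: "x = (g, spin_class n u)" "g \<in> GP n" "u \<in> spin_words n" using a(1) by (rule wr_cases)
  obtain h v where y: "y = (h, spin_class m v)" "h \<in> GP m" "v \<in> spin_words m" using a(2) by (rule wr_cases)
  have w: "u @ shift_word n v \<in> spin_words (n + m)" using words_left[OF x(3)] shift_word_words[OF y(3)] by simp
  have "word_perm (u @ shift_word n v) ` {1..n} = word_perm u ` {1..n}"
    by (rule image_cong[OF HOL.refl word_perm_append_shift(1)[OF x(3) y(3)]])
  also have "\<dots> = {1..n}" by (rule permutes_image[OF word_perm_permutes[OF x(3)]])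
  finally show ?thesis using ycomb_closed[OF a]
    unfolding young_sub_def x(1) y(1) ycomb_eq[OF x(2,3) y(2,3)] by (simp add: spin_perm_class[OF w] del: word_perm_append)
qed

text \<open>A permutation preserving the first n points splits into two parts, and lifts of the
  parts multiply to the given element up to \<open>z\<close>.\<close>

lemma young_ycomb:
  assumes "w \<in> young_sub G n m"
  shows "\<exists>x\<in>CW n. \<exists>y\<in>CW m. w = ycomb n m x y"
proof -
  have wc: "w \<in> CW (n + m)" and im: "spin_perm (snd w) ` {1..n} = {1..n}"
    using assms by (auto simp: young_sub_def)
  obtain f t where w: "w = (f, spin_class (n + m) t)" "f \<in> GP (n + m)" "t \<in> spin_words (n + m)"
    using wc by (rule wr_cases)
  define \<sigma> where "\<sigma> = word_perm t"
  have \<sigma>: "\<sigma> permutes {1..n + m}" unfolding \<sigma>_def by (rule word_perm_permutes[OF w(3)])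
  have im1: "\<sigma> ` {1..n} = {1..n}" using im w by (simp add: \<sigma>_def)
  have im2: "\<sigma> ` {n + 1..n + m} = {n + 1..n + m}"
  proof -
    have d: "{n + 1..n + m} = {1..n + m} - {1..n}" by auto
    show ?thesis unfolding d using permutes_image[OF \<sigma>] im1 image_set_diff[OF permutes_inj[OF \<sigma>]] by simp
  qed
  define \<sigma>1 where "\<sigma>1 = (\<lambda>i. if i \<in> {1..n} then \<sigma> i else i)"
  define \<sigma>2 where "\<sigma>2 = (\<lambda>i. if i \<in> {1..m} then \<sigma> (n + i) - n else i)"
  have "bij_betw \<sigma> {1..n} {1..n}" using im1 permutes_inj[OF \<sigma>] by (intro bij_betw_imageI) (auto intro: inj_on_subset)
  hence "bij_betw \<sigma>1 {1..n} {1..n}" by (rule bij_betw_cong[THEN iffD1, rotated]) (simp add: \<sigma>1_def)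
  hence "\<sigma>1 permutes {1..n}" by (rule bij_imp_permutes) (simp only: \<sigma>1_def if_False)
  then obtain u where u: "u \<in> spin_words n" "word_perm u = \<sigma>1" using word_perm_surj by blast
  have s2: "\<sigma> (n + i) \<in> {n + 1..n + m}" if "i \<in> {1..m}" for i using im2 that by auto
  have "inj_on \<sigma>2 {1..m}"
  proof (rule inj_onI)
    fix i j assume ij: "i \<in> {1..m}" "j \<in> {1..m}" "\<sigma>2 i = \<sigma>2 j"
    hence "\<sigma> (n + i) = \<sigma> (n + j)" using s2[OF ij(1)] s2[OF ij(2)] by (auto simp: \<sigma>2_def)
    from injD[OF permutes_inj[OF \<sigma>] this] show "i = j" by simp
  qed
  moreover have "\<sigma>2 i \<in> {1..m}" if i: "i \<in> {1..m}" for i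
    using right_index[of "\<sigma> (n + i)" n m] s2[OF i] i by (simp add: \<sigma>2_def)
  hence "\<sigma>2 ` {1..m} \<subseteq> {1..m}" by blast
  ultimately have "bij_betw \<sigma>2 {1..m} {1..m}" by (simp add: bij_betw_def endo_inj_surj)
  hence "\<sigma>2 permutes {1..m}" by (rule bij_imp_permutes) (simp only: \<sigma>2_def if_False)
  then obtain v where v: "v \<in> spin_words m" "word_perm v = \<sigma>2" using word_perm_surj by blast
  have us: "u @ shift_word n v \<in> spin_words (n + m)" using words_left[OF u(1)] shift_word_words[OF v(1)] by simp
  have "word_perm t = word_perm (u @ shift_word n v)"
  proof
    fix i
    consider "i \<in> {1..n}" | j where "j \<in> {1..m}" "i = n + j" | "i \<notin> {1..n + m}"
    proof -
      have "i \<in> {1..n} \<or> (\<exists>j\<in>{1..m}. i = n + j) \<or> i \<notin> {1..n + m}"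
      proof (cases "i \<le> n")
        case False
        have "i = n + (i - n)" using False by simp
        thus ?thesis using right_index[of i n m, OF _ False] by blast
      qed auto
      thus ?thesis using that by blast
    qed
    thus "word_perm t i = word_perm (u @ shift_word n v) i"
    proof cases
      case 1
      thus ?thesis using word_perm_append_shift(1)[OF u(1) v(1) 1] by (simp add: u \<sigma>1_def \<sigma>_def)
    next
      case 2
      have "word_perm (u @ shift_word n v) i = n + \<sigma>2 j"
        unfolding 2(2) word_perm_append_shift(2)[OF u(1) v(1) 2(1)] v(2) ..
      also have "\<dots> = \<sigma> (n + j)" using s2[OF 2(1)] 2(1) by (simp add: \<sigma>2_def)
      finally show ?thesis by (simp only: 2(2) \<sigma>_def)
    next
      case 3
      have "word_perm t i = i" "word_perm (u @ shift_word n v) i = i"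
        using word_perm_permutes[OF w(3)] word_perm_permutes[OF us] 3 unfolding permutes_def by blast+
      thus ?thesis by simp
    qed
  qed
  hence "spin_sim (n + m) t (u @ shift_word n v)" using w(3) us by (simp only: spin_sim_iff simp_thms)
  hence "clif_word t = clif_word (u @ shift_word n v) \<or> clif_word t = clif_word (zl # u @ shift_word n v)"
    by (rule spin_sim_clif)
  \<comment> \<open>A missing \<open>z\<close> is absorbed into the left factor.\<close>
  then obtain u' where u': "u' = u \<or> u' = zl # u" "clif_word t = clif_word (u' @ shift_word n v)"
    by (metis append_Cons)
  have u'w: "u' \<in> spin_words n" using u' u by auto
  have wp: "word_perm (u' @ shift_word n v) = word_perm (u @ shift_word n v)" using u'(1) by auto
  have us': "u' @ shift_word n v \<in> spin_words (n + m)" using words_left[OF u'w] shift_word_words[OF v(1)] by simp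
  define g where "g = (\<lambda>i\<in>{1..n}. f i)"
  define h where "h = (\<lambda>i\<in>{1..m}. f (n + i))"
  have gh: "g \<in> GP n" "h \<in> GP m"
    using PiE_closed[OF w(2)] by (auto simp: g_def h_def)
  have "join n m g h = f"
  proof
    fix i show "join n m g h i = f i"
      using PiE_arb[OF w(2), of i] by (auto simp: join_def g_def h_def)
  qed
  moreover have "spin_class (n + m) t = spin_class (n + m) (u' @ shift_word n v)"
    unfolding spin_class_iff[OF w(3) us'] using \<open>word_perm t = word_perm (u @ shift_word n v)\<close> u'(2) wp by simp
  ultimately have "w = ycomb n m (g, spin_class n u') (h, spin_class m v)"
    unfolding w(1) ycomb_eq[OF gh(1) u'w gh(2) v(1)] by simp
  thus ?thesis using wr_elI[OF gh(1) u'w] wr_elI[OF gh(2) v(1)] by blast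
qed

lemma ycomb_z:
  assumes "x \<in> CW n" "y \<in> CW m"
  shows "ycomb n m (wz n x) y = wz (n + m) (ycomb n m x y)"
    "ycomb n m (wz n x) (wz m y) = ycomb n m x y"
    "ycomb n m x (wz m y) = wz (n + m) (ycomb n m x y)"
    "wz (n + m) (ycomb n m x y) \<noteq> ycomb n m x y"
proof -
  obtain g u where x: "x = (g, spin_class n u)" "g \<in> GP n" "u \<in> spin_words n" using assms(1) by (rule wr_cases)
  obtain h v where y: "y = (h, spin_class m v)" "h \<in> GP m" "v \<in> spin_words m" using assms(2) by (rule wr_cases)
  have w: "u @ shift_word n v \<in> spin_words (n + m)" using words_left[OF x(3)] shift_word_words[OF y(3)] by simp
  have zu: "zl # u \<in> spin_words n" and zv: "zl # v \<in> spin_words m" using x y by simp_all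
  have sz: "shift_word n (zl # v) = zl # shift_word n v" by (simp add: shift_letter_def)
  have w1: "zl # u @ shift_word n v \<in> spin_words (n + m)" "zl # u @ zl # shift_word n v \<in> spin_words (n + m)"
    "u @ zl # shift_word n v \<in> spin_words (n + m)"
    using w by simp_all
  note eqs = x(1) y(1) wr_z_mult[OF x(2,3)] wr_z_mult[OF y(2,3)] ycomb_eq[OF x(2,3) y(2,3)]
    ycomb_eq[OF x(2) zu y(2) zv] ycomb_eq[OF x(2) zu y(2,3)] ycomb_eq[OF x(2,3) y(2) zv] wr_z_mult[OF join_PiE[OF x(2) y(2)] w] append_Cons sz
  show "ycomb n m (wz n x) y = wz (n + m) (ycomb n m x y)"
    unfolding eqs ..
  have "clif_word (zl # u @ zl # shift_word n v) = clif_word (u @ shift_word n v)"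
    by (simp add: fun_eq_iff clif_word_negf[unfolded negf_def])
  thus "ycomb n m (wz n x) (wz m y) = ycomb n m x y"
    unfolding eqs prod.inject spin_class_iff[OF w1(2) w] by simp
  have "clif_word (u @ zl # shift_word n v) = clif_word (zl # u @ shift_word n v)"
    by (simp add: fun_eq_iff clif_word_negf[unfolded negf_def])
  thus "ycomb n m x (wz m y) = wz (n + m) (ycomb n m x y)"
    unfolding eqs prod.inject spin_class_iff[OF w1(3) w1(1)] by simp
  show "wz (n + m) (ycomb n m x y) \<noteq> ycomb n m x y"
    unfolding eqs prod.inject using spin_fibre(2)[OF w] by blast
qed

text \<open>The coordinates and permutation of the product determine each factor up to
  \<open>z\<close>. Changing just one factor by \<open>z\<close> would change the product, so either
  none or both are changed.\<close>

lemma ycomb_inj: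
  assumes "x \<in> CW n" "y \<in> CW m" "x' \<in> CW n" "y' \<in> CW m"
    and eq: "ycomb n m x y = ycomb n m x' y'"
  shows "(x' = x \<and> y' = y) \<or> (x' = wz n x \<and> y' = wz m y)"
proof -
  obtain g u where x: "x = (g, spin_class n u)" "g \<in> GP n" "u \<in> spin_words n" using assms(1) by (rule wr_cases)
  obtain h v where y: "y = (h, spin_class m v)" "h \<in> GP m" "v \<in> spin_words m" using assms(2) by (rule wr_cases)
  obtain g' u' where x': "x' = (g', spin_class n u')" "g' \<in> GP n" "u' \<in> spin_words n" using assms(3) by (rule wr_cases)
  obtain h' v' where y': "y' = (h', spin_class m v')" "h' \<in> GP m" "v' \<in> spin_words m" using assms(4) by (rule wr_cases)
  have w: "u @ shift_word n v \<in> spin_words (n + m)" using words_left[OF x(3)] shift_word_words[OF y(3)] by simp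
  have w': "u' @ shift_word n v' \<in> spin_words (n + m)" using words_left[OF x'(3)] shift_word_words[OF y'(3)] by simp
  have j: "join n m g h = join n m g' h'" and
    p: "word_perm (u @ shift_word n v) = word_perm (u' @ shift_word n v')"
    using eq unfolding x(1) y(1) x'(1) y'(1) ycomb_eq[OF x(2,3) y(2,3)] ycomb_eq[OF x'(2,3) y'(2,3)] prod.inject
      spin_class_iff[OF w w'] by simp_all
  have "g i = g' i" for i
    using fun_cong[OF j, of i] PiE_arb[OF x(2), of i] PiE_arb[OF x'(2), of i]
    by (cases "i \<in> {1..n}") (auto simp: join_def)
  hence g: "g' = g" by (simp add: fun_eq_iff)
  have "h i = h' i" for i
    using fun_cong[OF j, of "n + i"] PiE_arb[OF y(2), of i] PiE_arb[OF y'(2), of i]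
    by (cases "i \<in> {1..m}") (auto simp: join_def)
  hence h: "h' = h" by (simp add: fun_eq_iff)
  have "word_perm u i = word_perm u' i" for i
  proof (cases "i \<in> {1..n}")
    case True
    thus ?thesis using fun_cong[OF p, of i] word_perm_append_shift(1)[OF x(3) y(3) True] word_perm_append_shift(1)[OF x'(3) y'(3) True] by simp
  next
    case False
    thus ?thesis using word_perm_permutes[OF x(3)] word_perm_permutes[OF x'(3)] by (simp add: permutes_def)
  qed
  hence u: "spin_sim n u' u" using x x' by (simp add: spin_sim_iff fun_eq_iff)
  have "word_perm v i = word_perm v' i" for i
  proof (cases "i \<in> {1..m}")
    case True
    thus ?thesis using fun_cong[OF p, of "n + i"] word_perm_append_shift(2)[OF x(3) y(3) True] word_perm_append_shift(2)[OF x'(3) y'(3) True] by simp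
  next
    case False
    thus ?thesis using word_perm_permutes[OF y(3)] word_perm_permutes[OF y'(3)] by (simp add: permutes_def)
  qed
  hence v: "spin_sim m v' v" using y y' by (simp add: spin_sim_iff fun_eq_iff)
  have zu: "zl # u \<in> spin_words n" and zv: "zl # v \<in> spin_words m" using x y by simp_all
  have cx: "x' = x \<or> x' = wz n x"
    using spin_sim_clif[OF u] spin_sim_perm[OF u]
    unfolding x(1) x'(1) g wr_z_mult[OF x(2,3)] prod.inject spin_class_iff[OF x'(3) x(3)] spin_class_iff[OF x'(3) zu] by simp
  have cy: "y' = y \<or> y' = wz m y"
    using spin_sim_clif[OF v] spin_sim_perm[OF v]
    unfolding y(1) y'(1) h wr_z_mult[OF y(2,3)] prod.inject spin_class_iff[OF y'(3) y(3)] spin_class_iff[OF y'(3) zv] by simp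
  note z = ycomb_z[OF assms(1,2)]
  have "\<not> (x' = x \<and> y' = wz m y)"
  proof
    assume "x' = x \<and> y' = wz m y"
    hence "ycomb n m x' y' = wz (n + m) (ycomb n m x y)" using z(3) by simp
    from notE[OF z(4) HOL.sym[OF HOL.trans[OF eq this]]] show False .
  qed
  moreover have "\<not> (x' = wz n x \<and> y' = y)"
  proof
    assume "x' = wz n x \<and> y' = y"
    hence "ycomb n m x' y' = wz (n + m) (ycomb n m x y)" using z(1) by simp
    from notE[OF z(4) HOL.sym[OF HOL.trans[OF eq this]]] show False .
  qed
  ultimately show ?thesis using cx cy by argo
qed

end

section \<open>Values of spin class functions on types\<close>

lemma word_perm_cycle:
  "a \<le> b \<Longrightarrow> word_perm (map tl_at [a..<b]) i = (if a \<le> i \<and> i < b then i + 1 else if i = b then a else i)"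
proof (induction "b - a" arbitrary: a)
  case 0
  thus ?case by simp
next
  case (Suc d)
  have "word_perm (map tl_at [a..<b]) i = transpose a (a + 1) (word_perm (map tl_at [a + 1..<b]) i)"
  proof -
    have "[a..<b] = a # [a + 1..<b]" using upt_conv_Cons[of a b] Suc.hyps(2) by (simp add: Suc_eq_plus1)
    thus ?thesis by simp
  qed
  also have "word_perm (map tl_at [a + 1..<b]) i = (if a + 1 \<le> i \<and> i < b then i + 1 else if i = b then a + 1 else i)"
    by (rule Suc.hyps(1)) (use Suc.hyps(2) in auto)
  finally show ?case using Suc.hyps(2) by (auto simp: transpose_def)
qed

lemma cycle_words: "map tl_at [1..<k] \<in> spin_words k"
  by (auto simp: gwords_def)

lemma word_even_cycle: "word_even (map tl_at [a..<b]) \<longleftrightarrow> even (b - a)"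
  by (simp add: word_even_def filter_map comp_def)

lemma cycle_funpow:
  assumes "j < k"
  shows "(word_perm (map tl_at [1..<k]) ^^ j) 1 = 1 + j"
  using assms
proof (induction j)
  case (Suc j)
  thus ?case using word_perm_cycle[of 1 k "1 + j"] by simp
qed simp

lemma cycle_orbit:
  assumes "0 < k"
  shows "orbit (word_perm (map tl_at [1..<k])) 1 = {1..k}"
proof -
  let ?c = "word_perm (map tl_at [1..<k])"
  have "(?c ^^ k) 1 = ?c ((?c ^^ (k - 1)) 1)" using assms by (cases k) simp_all
  hence k: "(?c ^^ k) 1 = 1" using assms cycle_funpow[of "k - 1" k] word_perm_cycle[of 1 k k] by simp
  have b: "bij_betw ?c {1..k} {1..k}" by (rule permutes_imp_bij[OF word_perm_permutes[OF cycle_words]])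
  have 1: "1 \<in> {1..k}" using assms by simp
  show ?thesis
  proof (intro equalityI subsetI)
    fix i assume "i \<in> orbit ?c 1"
    thus "i \<in> {1..k}" using orbit_bij(5)[OF _ b 1] by auto
  next
    fix i assume i: "i \<in> {1..k}"
    show "i \<in> orbit ?c 1"
    proof (cases "i = 1")
      case True
      thus ?thesis using k assms by (auto simp: orbit_altdef intro!: exI[of _ k])
    next
      case False
      hence "(?c ^^ (i - 1)) 1 = i" "0 < i - 1" using i cycle_funpow[of "i - 1" k] by auto
      thus ?thesis by (auto simp: orbit_altdef intro!: exI[of _ "i - 1"])
    qed
  qed
qed

lemma map_plus_upt: "map (\<lambda>i. i + m) [a..<b] = [a + m..<b + m]" for m a b :: nat
  by (induction b) auto

lemma block_start_snoc: "j < length ks \<Longrightarrow> block_start (ks @ [k]) j = block_start ks j"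
  by (simp add: block_start_def)

text \<open>Splitting off the last interval leaves the earlier positions in place and shows the word
  as a left factor times a shifted standard cycle, the shape for which types and signs are
  multiplicative.\<close>

lemma block_word_snoc:
  "block_word (ks @ [k]) = block_word ks @ shift_word (sum_list ks) (map tl_at [1..<k])"
proof -
  have 1: "map (\<lambda>j. map tl_at [block_start (ks @ [k]) j ..< block_start (ks @ [k]) j + (ks @ [k]) ! j - 1]) [0..<length ks] =
     map (\<lambda>j. map tl_at [block_start ks j ..< block_start ks j + ks ! j - 1]) [0..<length ks]"
    by (rule map_cong) (auto simp: block_start_snoc nth_append)
  have 2: "shift_word (sum_list ks) (map tl_at [1..<k]) = map tl_at [1 + sum_list ks..<1 + sum_list ks + k - 1]"
    using map_plus_upt[of "sum_list ks" 1 k, symmetric]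
    by (simp add: shift_word_map shift_letter_def comp_def add.commute)
  have 3: "[0..<length (ks @ [k])] = [0..<length ks] @ [length ks]" by simp
  show ?thesis unfolding block_word_def 3 map_append concat_append 1 by (simp add: 2 block_start_def)
qed

lemma block_word_words: "block_word ks \<in> spin_words (sum_list ks)"
proof (induction ks rule: rev_induct)
  case Nil thus ?case by (simp add: block_word_def)
next
  case (snoc k ks)
  have "block_word ks \<in> spin_words (sum_list ks + k)" by (rule spin_words_mono[OF _ snoc]) simp
  moreover have "shift_word (sum_list ks) (map tl_at [1..<k]) \<in> spin_words (sum_list ks + k)"
    by (rule shift_word_words[OF cycle_words])
  ultimately show ?case by (simp add: block_word_snoc)
qed

context finite_grp
begin

section \<open>The standard elements in \<open>D_plus\<close>\<close>

lemma cycle_product_cong: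
  "(\<And>i. i \<in> set is \<Longrightarrow> g i = g' i) \<Longrightarrow> cycle_product G g is = cycle_product G g' is"
  unfolding cycle_product_def by (rule foldr_cong) auto

lemma cycle_product_snoc: "cycle_product G g (is @ [i]) = g i \<otimes> cycle_product G g is"
  by (simp add: cycle_product_def)

lemma cycle_product_map: "cycle_product G g (map f is) = cycle_product G (\<lambda>i. g (f i)) is"
  by (simp add: cycle_product_def rev_map foldr_map comp_def)

definition block_ok :: "(nat \<Rightarrow> 'a) \<Rightarrow> ('a set \<times> nat) list \<Rightarrow> bool" where
  "block_ok g bs \<longleftrightarrow> (\<forall>j<length bs. cycle_product G g
     [block_start (map snd bs) j ..< block_start (map snd bs) j + map snd bs ! j] \<in> fst (bs ! j))"

lemma block_ok_snoc:
  "block_ok g (bs @ [(c, k)]) \<longleftrightarrow> block_ok g bs \<and>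
     cycle_product G (\<lambda>i. g (sum_list (map snd bs) + i)) [1..<1 + k] \<in> c"
proof -
  have "[1 + sum_list (map snd bs)..<1 + sum_list (map snd bs) + k] = map (\<lambda>i. i + sum_list (map snd bs)) [1..<1 + k]"
    by (simp add: map_plus_upt add_ac)
  hence l: "cycle_product G g [1 + sum_list (map snd bs)..<1 + sum_list (map snd bs) + k] =
    cycle_product G (\<lambda>i. g (sum_list (map snd bs) + i)) [1..<1 + k]"
    by (simp only: cycle_product_map add.commute)
  have "block_ok g (bs @ [(c, k)]) \<longleftrightarrow> (\<forall>j<length bs. cycle_product G g
     [block_start (map snd bs @ [k]) j ..< block_start (map snd bs @ [k]) j + (map snd bs @ [k]) ! j] \<in> fst ((bs @ [(c, k)]) ! j)) \<and>
     cycle_product G g [block_start (map snd bs @ [k]) (length bs) ..< block_start (map snd bs @ [k]) (length bs) + (map snd bs @ [k]) ! length bs] \<in> fst ((bs @ [(c, k)]) ! length bs)"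
    by (simp add: block_ok_def All_less_Suc) (rule conj_commute)
  also have "\<dots> \<longleftrightarrow> block_ok g bs \<and> cycle_product G (\<lambda>i. g (sum_list (map snd bs) + i)) [1..<1 + k] \<in> c"
  proof (intro arg_cong2[of _ _ _ _ "(\<and>)"])
    show "(\<forall>j<length bs. cycle_product G g
     [block_start (map snd bs @ [k]) j ..< block_start (map snd bs @ [k]) j + (map snd bs @ [k]) ! j] \<in> fst ((bs @ [(c, k)]) ! j)) = block_ok g bs"
      unfolding block_ok_def by (intro all_cong1 imp_cong HOL.refl) (simp add: block_start_snoc nth_append)
    have "(map snd bs @ [k]) ! length bs = k" "(bs @ [(c, k)]) ! length bs = (c, k)"
      "block_start (map snd bs @ [k]) (length bs) = 1 + sum_list (map snd bs)"
      by (simp_all add: nth_append block_start_def)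
    thus "(cycle_product G g [block_start (map snd bs @ [k]) (length bs) ..< block_start (map snd bs @ [k]) (length bs) + (map snd bs @ [k]) ! length bs] \<in> fst ((bs @ [(c, k)]) ! length bs)) =
      (cycle_product G (\<lambda>i. g (sum_list (map snd bs) + i)) [1..<1 + k] \<in> c)" by (simp only: l fst_conv)
  qed
  finally show ?thesis .
qed

lemma cyc_label_cycle:
  assumes "0 < k"
  shows "cyc_label h (word_perm (map tl_at [1..<k])) 1 = (conj_class G (cycle_product G h [1..<1 + k]), k)"
proof -
  let ?c = "word_perm (map tl_at [1..<k])"
  have c: "card (orbit ?c 1) = k" by (simp add: cycle_orbit[OF assms])
  have "cycle_from ?c 1 = map (\<lambda>j. j + 1) [0..<k]"
    unfolding cycle_from_def c by (rule map_cong) (simp_all add: cycle_funpow del: funpow_swap1)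
  also have "\<dots> = [1..<1 + k]" by (simp add: map_plus_upt add.commute)
  finally show ?thesis by (simp add: cyc_label_def c)
qed

lemma conj_classes_eq: "c \<in> Cls \<Longrightarrow> x \<in> c \<Longrightarrow> x \<in> carrier G \<and> conj_class G x = c"
  unfolding conj_classes_def using conj_class_eq conj_class_subset by blast

lemma conj_class_in: "x \<in> carrier G \<Longrightarrow> conj_class G x \<in> Cls"
  by (simp add: conj_classes_def)

lemma ctype_blocks:
  assumes "\<And>b. b \<in> set bs \<Longrightarrow> fst b \<in> Cls \<and> 0 < snd b"
    and "g \<in> {1..sum_list (map snd bs)} \<rightarrow> carrier G" "block_ok g bs"
  shows "ctype {1..sum_list (map snd bs)} g (word_perm (block_word (map snd bs))) = mset bs"
  using assms
proof (induction bs arbitrary: g rule: rev_induct)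
  case Nil
  thus ?case by simp
next
  case (snoc b bs)
  obtain c k where b: "b = (c, k)" by force
  let ?N = "sum_list (map snd bs)" and ?h = "\<lambda>i. g (sum_list (map snd bs) + i)"
  have ck: "c \<in> Cls" "0 < k" using snoc.prems(1)[of b] by (auto simp: b)
  have g: "g \<in> {1..?N} \<rightarrow> carrier G" "?h \<in> {1..k} \<rightarrow> carrier G" using snoc.prems(2) by (auto simp: b Pi_iff)
  have ok: "block_ok g bs" "cycle_product G ?h [1..<1 + k] \<in> c"
    using snoc.prems(3) unfolding b block_ok_snoc by simp_all
  have bb: "bij_betw (word_perm (map tl_at [1..<k])) {1..k} {1..k}" by (rule word_perm_bij_betw[OF cycle_words])
  have "ctype {1..?N + k} g (word_perm (block_word (map snd bs) @ shift_word ?N (map tl_at [1..<k]))) =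
    ctype {1..?N} g (word_perm (block_word (map snd bs))) + ctype {1..k} ?h (word_perm (map tl_at [1..<k]))"
    by (rule ctype_join[OF g word_perm_bij_betw[OF block_word_words] bb])
       (use word_perm_append_shift[OF block_word_words cycle_words] in simp_all)
  also have "ctype {1..?N} g (word_perm (block_word (map snd bs))) = mset bs"
    using snoc.prems(1) by (intro snoc.IH g ok) simp
  also have "ctype {1..k} ?h (word_perm (map tl_at [1..<k])) = {#cyc_label ?h (word_perm (map tl_at [1..<k])) 1#}"
    by (rule ctype_single_orbit[OF _ bb g(2)]) (use ck in \<open>simp_all add: cycle_orbit\<close>)
  also have "cyc_label ?h (word_perm (map tl_at [1..<k])) 1 = (c, k)"
    using conj_classes_eq[OF ck(1) ok(2)] by (simp only: cyc_label_cycle[OF ck(2)])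
  finally show ?case by (simp add: b block_word_snoc del: word_perm_append)
qed

text \<open>With trivial components a full cycle of odd length is an element of odd type, and
  \<open>otype_order\<close> provides the exponent.\<close>

lemma cycle_odd_order:
  assumes "odd k"
  shows "\<exists>M. odd M \<and> word_perm (map tl_at [1..<k]) ^^ M = id"
proof -
  let ?u = "map tl_at [1..<k]" and ?h = "\<lambda>i\<in>{1..k}. \<one>"
  have k: "0 < k" using assms by (cases k) auto
  have b: "bij_betw (word_perm ?u) {1..k} {1..k}" by (rule word_perm_bij_betw[OF cycle_words])
  have h: "?h \<in> GP k" by simp
  have "ctype {1..k} ?h (word_perm ?u) = {#cyc_label ?h (word_perm ?u) 1#}"
    by (rule ctype_single_orbit[OF _ b PiE_Pi[OF h]]) (use k in \<open>simp_all add: cycle_orbit\<close>)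
  hence "otype k (?h, spin_class k ?u)"
    using assms cycle_words[of k] by (simp add: otype_def wtype_def cyc_label_cycle[OF k])
  from otype_order[OF h cycle_words this] show ?thesis by metis
qed

lemma block_word_sgn:
  assumes "\<And>k. k \<in> set ks \<Longrightarrow> odd k"
  shows "lift_sgn (block_word ks) = (\<Prod>k\<leftarrow>ks. cyc_sgn k) \<and> (\<exists>M. odd M \<and> word_perm (block_word ks) ^^ M = id)"
  using assms
proof (induction ks rule: rev_induct)
  case Nil
  have "odd (1 :: nat) \<and> word_perm [] ^^ 1 = id \<and> clif_word [] ^^ 1 = id" by simp
  hence "lift_sgn [] = 1" "\<exists>M. odd M \<and> word_perm [] ^^ M = id" unfolding lift_sgn_def by (metis, blast)
  moreover have "block_word [] = []" by (simp add: block_word_def)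
  ultimately show ?case by (simp only: list.map prod_list.Nil simp_thms)
next
  case (snoc k ks)
  obtain M where M: "lift_sgn (block_word ks) = (\<Prod>k\<leftarrow>ks. cyc_sgn k)" "odd M" "word_perm (block_word ks) ^^ M = id"
  proof -
    have "lift_sgn (block_word ks) = (\<Prod>k\<leftarrow>ks. cyc_sgn k) \<and> (\<exists>M. odd M \<and> word_perm (block_word ks) ^^ M = id)"
      by (rule snoc.IH) (use snoc.prems in simp)
    thus ?thesis by (elim conjE exE) (rule that)
  qed
  have "odd k" using snoc.prems by simp
  from cycle_odd_order[OF this] obtain M' where M': "odd M'" "word_perm (map tl_at [1..<k]) ^^ M' = id"
    by (elim conjE exE) (rule that)
  let ?s = "shift_word (sum_list ks) (map tl_at [1..<k])"
  have "lift_sgn (block_word ks @ ?s) = lift_sgn (block_word ks) * cyc_sgn k"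
    unfolding cyc_sgn_def by (rule lift_sgn_join[OF block_word_words M(2,3) cycle_words M'])
  moreover have "word_perm (block_word ks @ ?s) ^^ (M * M') = id"
  proof -
    have "word_perm ?s ^^ M' = id" by (rule lift_sgn_shift(2)[OF cycle_words M'])
    hence "word_perm ?s ^^ (M * M') = id" by (simp add: mult.commute[of M] id_funpow flip: funpow_mult)
    moreover have "word_perm (block_word ks) ^^ (M * M') = id" using M(3) by (simp add: id_funpow flip: funpow_mult)
    ultimately show ?thesis
      using funpow_comp_commute[OF word_perm_distant[OF block_word_words[of ks] cycle_words[of k], symmetric], of "M * M'"] by simp
  qed
  moreover have "odd (M * M')" using M(2) M'(1) by simp
  ultimately show ?case unfolding block_word_snoc using M(1)
    by (intro conjI exI[of _ "M * M'"]) (simp_all only: map_append list.map prod_list.append prod_list.Cons prod_list.Nil mult_1_right not_False_eq_True simp_thms)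
qed

lemma block_ok_exists:
  assumes "\<And>b. b \<in> set bs \<Longrightarrow> fst b \<in> Cls \<and> 0 < snd b"
  shows "\<exists>g\<in>{1..sum_list (map snd bs)} \<rightarrow>\<^sub>E carrier G. block_ok g bs"
  using assms
proof (induction bs rule: rev_induct)
  case Nil
  show ?case by (simp add: block_ok_def)
next
  case (snoc b bs)
  obtain c k where b: "b = (c, k)" by force
  let ?N = "sum_list (map snd bs)"
  have ck: "c \<in> Cls" "0 < k" using snoc.prems[of b] by (auto simp: b)
  obtain g where g: "g \<in> {1..?N} \<rightarrow>\<^sub>E carrier G" "block_ok g bs" using snoc by auto
  obtain r where r: "r \<in> carrier G" "c = conj_class G r" using ck(1) by (auto simp: conj_classes_def)
  \<comment> \<open>A representative of the class sits at the first point of the interval and 1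
    elsewhere, so the cycle product is this representative.\<close>
  define h where "h = (\<lambda>i\<in>{1..k}. if i = 1 then r else \<one>)"
  have h: "h \<in> GP k" using r by (auto simp: h_def)
  have J: "join ?N k g h \<in> {1..?N + k} \<rightarrow>\<^sub>E carrier G" by (rule join_PiE[OF g(1) h])
  have hp: "cycle_product G h [1..<1 + m] = (if m = 0 then \<one> else r)" if "m \<le> k" for m
    using that
  proof (induction m)
    case 0
    show ?case by (simp add: cycle_product_def)
  next
    case (Suc m)
    have "[1..<1 + Suc m] = [1..<1 + m] @ [1 + m]" by simp
    hence "cycle_product G h [1..<1 + Suc m] = h (1 + m) \<otimes> cycle_product G h [1..<1 + m]"
      by (simp only: cycle_product_snoc)
    also have "\<dots> = h (1 + m) \<otimes> (if m = 0 then \<one> else r)" using Suc by simp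
    also have "h (1 + m) = (if m = 0 then r else \<one>)" using Suc.prems by (auto simp: h_def)
    finally show ?case using r by auto
  qed
  have "cycle_product G h [1..<1 + k] \<in> c" using hp[of k] ck(2) r conj_class_self by simp
  moreover have "cycle_product G (\<lambda>i. join ?N k g h (?N + i)) [1..<1 + k] = cycle_product G h [1..<1 + k]"
    by (rule cycle_product_cong) (auto simp: join_def)
  moreover have "block_ok (join ?N k g h) bs"
  proof -
    have "cycle_product G (join ?N k g h) [block_start (map snd bs) j ..< block_start (map snd bs) j + map snd bs ! j] =
      cycle_product G g [block_start (map snd bs) j ..< block_start (map snd bs) j + map snd bs ! j]" if j: "j < length bs" for j
    proof (rule cycle_product_cong)
      fix i assume i: "i \<in> set [block_start (map snd bs) j ..< block_start (map snd bs) j + map snd bs ! j]"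
      have "sum_list (take (Suc j) (map snd bs)) \<le> ?N"
        by (metis append_take_drop_id le_add1 sum_list_append)
      hence "block_start (map snd bs) j + map snd bs ! j \<le> 1 + ?N"
        using j by (simp add: block_start_def take_Suc_conv_app_nth)
      thus "join ?N k g h i = g i" using i by (auto simp: join_def block_start_def)
    qed
    thus ?thesis using g(2) by (simp add: block_ok_def)
  qed
  ultimately have "block_ok (join ?N k g h) (bs @ [b])" unfolding b block_ok_snoc by simp
  thus ?case using J by (intro bexI[of _ "join ?N k g h"]) (simp_all add: b)
qed

text \<open>\<open>pm\<close> and \<open>pv\<close> pass between partition-valued functions and
  multisets of pairs (class, part), the form in which types and weighted sums are handled.\<close>

definition pm :: "('a set \<Rightarrow> nat multiset) \<Rightarrow> ('a set \<times> nat) multiset" where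
  "pm \<rho> = (\<Sum>c\<in>Cls. image_mset (Pair c) (\<rho> c))"

definition pv :: "('a set \<times> nat) multiset \<Rightarrow> 'a set \<Rightarrow> nat multiset" where
  "pv \<mu> c = image_mset snd (filter_mset (\<lambda>b. fst b = c) \<mu>)"

lemma finite_conj_classes: "finite (Cls)"
  using finite_carrier by (simp add: conj_classes_def)

lemma mset_blocks:
  assumes "class_order G cs" shows "mset (blocks cs \<rho>) = pm \<rho>"
proof -
  have "mset (blocks cs \<rho>) = (\<Sum>c\<leftarrow>cs. image_mset (Pair c) (\<rho> c))"
    unfolding blocks_def by (simp add: mset_concat comp_def)
  also have "\<dots> = (\<Sum>c\<in>set cs. image_mset (Pair c) (\<rho> c))"
    using assms by (simp add: class_order_def sum_list_distinct_conv_sum_set)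
  finally show ?thesis using assms by (simp add: pm_def class_order_def)
qed

text \<open>What is used of \<open>D_plus\<close>: it has elements, and each has the prescribed type
  and sign 1. The sign of t^\<rho> is the product of the signs of its cycles, which is also the
  correction in \<open>wsgn\<close>, and the two square to 1.\<close>

lemma D_plus_eq:
  assumes cs: "class_order G cs" and \<rho>: "\<rho> \<in> OP G n"
  shows "D_plus G cs n \<rho> \<noteq> {}"
    "x \<in> D_plus G cs n \<rho> \<Longrightarrow> x \<in> CW n \<and> wtype n x = pm \<rho> \<and> wsgn n x = 1 \<and> otype n x"
proof -
  interpret W: group "W n" by (rule wr_group)
  define bs where "bs = blocks cs \<rho>"
  have m: "mset bs = pm \<rho>" unfolding bs_def by (rule mset_blocks[OF cs])
  have mem: "fst b \<in> Cls \<and> 0 < snd b \<and> odd (snd b)" if "b \<in> set bs" for b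
  proof -
    have "b \<in># pm \<rho>" using that m by (metis set_mset_mset)
    then obtain c where c: "c \<in> Cls" "b \<in># image_mset (Pair c) (\<rho> c)"
      using finite_conj_classes by (auto simp: pm_def set_mset_sum)
    hence "odd (snd b)" using \<rho> by (auto simp: OP_def)
    thus ?thesis using c by (auto simp: odd_pos)
  qed
  have N: "sum_list (map snd bs) = n"
  proof -
    have "sum_list (map snd bs) = sum_mset (image_mset snd (pm \<rho>))" by (simp flip: m sum_mset_sum_list)
    also have "\<dots> = (\<Sum>c\<in>Cls. sum_mset (\<rho> c))"
      unfolding pm_def using finite_conj_classes by (induction rule: finite_induct) (simp_all add: image_mset.compositionality comp_def)
    finally show ?thesis using \<rho> by (simp add: OP_def)
  qed
  let ?w = "block_word (map snd bs)"
  have w: "?w \<in> spin_words n" using block_word_words[of "map snd bs"] N by simp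
  have D: "D_plus G cs n \<rho> = \<Union> {conj_class (W n) (g, spin_class n ?w) | g.
            g \<in> GP n \<and> block_ok g bs}"
    by (simp add: D_plus_def Let_def bs_def block_ok_def)
  obtain g where g: "g \<in> GP n" "block_ok g bs" using block_ok_exists[of bs] mem N by auto
  have "(g, spin_class n ?w) \<in> conj_class (W n) (g, spin_class n ?w)"
    unfolding conj_class_def using wr_elI[OF g(1) w] by (intro CollectI exI[of _ "\<one>\<^bsub>W n\<^esub>"]) simp
  thus "D_plus G cs n \<rho> \<noteq> {}" unfolding D using g by blast
  assume "x \<in> D_plus G cs n \<rho>"
  then obtain g y where g: "g \<in> GP n" "block_ok g bs" and y: "y \<in> CW n"
    "x = wconj n y (g, spin_class n ?w)"
    unfolding D conj_class_def by auto
  note c = wr_elI[OF g(1) w]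
  have t: "wtype n (g, spin_class n ?w) = pm \<rho>"
    using ctype_blocks[of bs g] mem g w PiE_Pi[OF g(1)] by (simp add: wtype_def N m)
  have o: "otype n (g, spin_class n ?w)" using mem by (auto simp: otype_def t simp flip: m)
  have "(\<Prod>b\<in>#mset bs. cyc_sgn (snd b)) = (\<Prod>k\<leftarrow>map snd bs. cyc_sgn k)"
    by (simp add: comp_def flip: prod_mset_prod_list)
  moreover have "lift_sgn ?w = (\<Prod>k\<leftarrow>map snd bs. cyc_sgn k)"   proof -
    have *: "odd k" if "k \<in> set (map snd bs)" for k using mem that by auto
    show ?thesis by (rule conjunct1[OF block_word_sgn[of "map snd bs", OF *]])
  qed
  ultimately have "wsgn n (g, spin_class n ?w) = lift_sgn ?w * lift_sgn ?w" using w by (simp add: wsgn_def t m)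
  hence s: "wsgn n (g, spin_class n ?w) = 1" by simp
  show "x \<in> CW n \<and> wtype n x = pm \<rho> \<and> wsgn n x = 1 \<and> otype n x"
    unfolding y(2) wtype_conj[OF c y(1)] wsgn_conj[OF c y(1) o] otype_conj[OF c y(1)]
    using y(1) c t s o by simp
qed

end

locale ordered_grp = finite_grp +
  fixes cs :: "'a set list"
  assumes class_order: "class_order G cs"

context finite_grp
begin

section \<open>Conjugacy up to \<open>z\<close>, and vanishing at cycles of even length\<close>

lemma weight_ctype:
  assumes "finite A" "bij_betw \<sigma> A A"
  shows "(\<Sum>b\<in>#ctype A g \<sigma>. snd b) = card A"
proof -
  have "(\<Sum>b\<in>#ctype A g \<sigma>. snd b) = (\<Sum>C\<in>#mset_set (orbit \<sigma> ` A). card (orbit \<sigma> (SOME i. i \<in> C)))"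
    by (simp add: ctype_def image_mset.compositionality comp_def cyc_label_def)
  also have "\<dots> = (\<Sum>C\<in>orbit \<sigma> ` A. card (orbit \<sigma> (SOME i. i \<in> C)))" by (rule sum_unfold_sum_mset[symmetric])
  also have "\<dots> = (\<Sum>C\<in>orbit \<sigma> ` A. card C)"
  proof (rule sum_cong)
    fix C assume "C \<in> orbit \<sigma> ` A"
    then obtain i where i: "i \<in> A" "C = orbit \<sigma> i" by auto
    have "i \<in> C" using orbit_bij(6)[OF assms i(1)] i(2) by simp
    hence "(SOME i. i \<in> C) \<in> C" by (rule someI[of "\<lambda>i. i \<in> C"])
    thus "card (orbit \<sigma> (SOME i. i \<in> C)) = card C" using orbit_bij_eq[OF assms i(1)] i(2) by simp
  qed
  also have "\<dots> = card (\<Union> (orbit \<sigma> ` A))"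
  proof (rule card_Union_disjoint[symmetric])
    show "pairwise disjnt (orbit \<sigma> ` A)"
    proof (rule pairwiseI)
      fix C D assume CD: "C \<in> orbit \<sigma> ` A" "D \<in> orbit \<sigma> ` A" "C \<noteq> D"
      then obtain i j where ij: "i \<in> A" "C = orbit \<sigma> i" "j \<in> A" "D = orbit \<sigma> j" by auto
      have "x \<notin> D" if "x \<in> C" for x
        using orbit_bij_eq[OF assms ij(1), of x] orbit_bij_eq[OF assms ij(3), of x] ij that CD(3) by auto
      thus "disjnt C D" by (auto simp: disjnt_def)
    qed
    show "finite C" if "C \<in> orbit \<sigma> ` A" for C
      using that orbit_bij(5)[OF assms] finite_subset[OF _ assms(1)] by auto
  qed
  also have "\<Union> (orbit \<sigma> ` A) = A"
    using orbit_bij(5,6)[OF assms] by auto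
  finally show ?thesis .
qed

text \<open>\<open>ctype_eq_conjugate\<close> supplies the permutation and the base component of a
  conjugating element. Any lift of the permutation will do, since the claim leaves a factor
  \<open>z\<close> open.\<close>

lemma wr_conj_of_type:
  assumes "x \<in> CW n" "x' \<in> CW n" "wtype n x = wtype n x'"
  shows "\<exists>y\<in>CW n. wconj n y x = x' \<or>
    wconj n y x = wz n x'"
proof -
  obtain g u where x: "x = (g, spin_class n u)" "g \<in> GP n" "u \<in> spin_words n" using assms(1) by (rule wr_cases)
  obtain g' u' where x': "x' = (g', spin_class n u')" "g' \<in> GP n" "u' \<in> spin_words n" using assms(2) by (rule wr_cases)
  have "ctype {1..n} g (word_perm u) = ctype {1..n} g' (word_perm u')"
    using assms(3) x x' by (simp add: wtype_def)
  from ctype_eq_conjugate[OF finite_atLeastAtMost word_perm_bij_betw[OF x(3)] PiE_Pi[OF x(2)] finite_atLeastAtMost word_perm_bij_betw[OF x'(3)] PiE_Pi[OF x'(2)] this]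
  obtain \<tau>0 h where \<tau>0: "bij_betw \<tau>0 {1..n} {1..n}"
    and st: "\<forall>i\<in>{1..n}. word_perm u' (\<tau>0 i) = \<tau>0 (word_perm u i) \<and> h i \<in> carrier G \<and>
      g' (\<tau>0 (word_perm u i)) = h (word_perm u i) \<otimes> g (word_perm u i) \<otimes> inv (h i)"
    by (elim exE conjE) (rule that)
  define \<tau> where "\<tau> = (\<lambda>i. if i \<in> {1..n} then \<tau>0 i else i)"
  have "bij_betw \<tau> {1..n} {1..n}" by (rule bij_betw_cong[THEN iffD1, OF _ \<tau>0]) (simp add: \<tau>_def)
  hence "\<tau> permutes {1..n}" by (rule bij_imp_permutes) (simp only: \<tau>_def if_False)
  then obtain v where v: "v \<in> spin_words n" "word_perm v = \<tau>" using word_perm_surj by blast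
  have iv: "inv_word v \<in> spin_words n" and iu: "inv_word u \<in> spin_words n" using v x by simp_all
  \<comment> \<open>The elements h are attached to points before the renaming by \<tau>, the
    components of a wreath element to points after it; hence the inverse permutation.\<close>
  define H where "H = (\<lambda>i\<in>{1..n}. h (word_perm (inv_word v) i))"
  have H: "H \<in> GP n" using word_perm_range[OF iv] st by (auto simp: H_def)
  let ?y = "(H, spin_class n v)" and ?w = "v @ u @ inv_word v"
  have y: "?y \<in> CW n" by (rule wr_elI[OF H v(1)])
  have w: "?w \<in> spin_words n" using v x by simp
  have key: "\<exists>j\<in>{1..n}. i = word_perm v (word_perm u j) \<and> word_perm (inv_word v) i = word_perm u j \<and>
      word_perm (inv_word u) (word_perm (inv_word v) i) = j" if i: "i \<in> {1..n}" for i
  proof -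
    let ?j = "word_perm (inv_word u) (word_perm (inv_word v) i)"
    have "?j \<in> {1..n}" using i word_perm_range[OF iv] word_perm_range[OF iu] by simp
    thus ?thesis by (intro bexI[of _ ?j]) (simp_all add: word_perm_inv word_perm_inv')
  qed
  have "(\<lambda>i\<in>{1..n}. H i \<otimes> g (word_perm (inv_word v) i) \<otimes>
       inv (H (word_perm v (word_perm (inv_word u) (word_perm (inv_word v) i))))) = g'" (is "?u = ?v")
  proof
    fix i
    show "?u i = ?v i"
    proof (cases "i \<in> {1..n}")
      case True
      from key[OF True] obtain j where j: "j \<in> {1..n}" "i = word_perm v (word_perm u j)"
        "word_perm (inv_word v) i = word_perm u j" "word_perm (inv_word u) (word_perm (inv_word v) i) = j" by blast
      have uj: "word_perm u j \<in> {1..n}" and vj: "word_perm v j \<in> {1..n}" using j word_perm_range[OF x(3)] word_perm_range[OF v(1)] by simp_all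
      have 1: "H i = h (word_perm u j)" using True j(3) by (simp add: H_def)
      have 2: "H (word_perm v j) = h j" using vj by (simp add: H_def word_perm_inv')
      have 3: "i = \<tau>0 (word_perm u j)" using j(2) uj by (simp add: v(2) \<tau>_def)
      have "H i \<otimes> g (word_perm (inv_word v) i) \<otimes>
          inv (H (word_perm v (word_perm (inv_word u) (word_perm (inv_word v) i)))) =
        h (word_perm u j) \<otimes> g (word_perm u j) \<otimes> inv (h j)"
        by (simp only: 1 2 j(4)) (simp only: j(3))
      also have "\<dots> = g' (\<tau>0 (word_perm u j))" using st j(1) by simp
      also have "\<dots> = g' i" by (simp only: 3[symmetric])
      finally show ?thesis using True by (simp only: restrict_apply if_True)
    next
      case False
      thus ?thesis using PiE_arb[OF x'(2) False] by (simp add: restrict_apply del: atLeastAtMost_iff)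
    qed
  qed
  hence e: "wconj n ?y x = (g', spin_class n ?w)"
    unfolding x(1) wr_conj[OF x(2,3) H v(1)] by simp
  have "word_perm ?w i = word_perm u' i" for i
  proof (cases "i \<in> {1..n}")
    case True
    let ?j = "word_perm (inv_word v) i"
    have j: "?j \<in> {1..n}" "word_perm v ?j = i" using True word_perm_range[OF iv] by (simp_all add: word_perm_inv)
    have "word_perm u ?j \<in> {1..n}" using j word_perm_range[OF x(3)] by simp
    moreover have "\<tau>0 ?j = i" using j by (simp add: v(2) \<tau>_def)
    moreover have "word_perm u' (\<tau>0 ?j) = \<tau>0 (word_perm u ?j)" using st j(1) by blast
    moreover have "word_perm ?w i = word_perm v (word_perm u ?j)" by simp
    ultimately show ?thesis by (simp only: v(2) \<tau>_def if_True)
  next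
    case False
    thus ?thesis using word_perm_permutes[OF w] word_perm_permutes[OF x'(3)] by (simp add: permutes_def)
  qed
  hence s: "spin_sim n ?w u'" using w x' by (simp add: spin_sim_iff fun_eq_iff)
  have z: "zl # u' \<in> spin_words n" using x' by simp
  have "spin_class n ?w = spin_class n u' \<or> spin_class n ?w = spin_class n (zl # u')"
    using spin_sim_clif[OF s] spin_sim_perm[OF s] unfolding spin_class_iff[OF w x'(3)] spin_class_iff[OF w z] by simp
  thus ?thesis using e y unfolding x'(1) wr_z_mult[OF x'(2,3)] by (intro bexI[of _ ?y]) auto
qed

lemma word_even_inv [simp]: "word_even (inv_word v) = word_even v"
  by (induction v) auto

lemma wr_even_conj:
  assumes "x \<in> CW n" "y \<in> CW n"
  shows "wr_even (wconj n y x) = wr_even x"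
proof -
  obtain g u where x: "x = (g, spin_class n u)" "g \<in> GP n" "u \<in> spin_words n" using assms(1) by (rule wr_cases)
  obtain h v where y: "y = (h, spin_class n v)" "h \<in> GP n" "v \<in> spin_words n" using assms(2) by (rule wr_cases)
  have w: "v @ u @ inv_word v \<in> spin_words n" using x y by simp
  show ?thesis unfolding x(1) y(1) wr_conj[OF x(2,3) y(2,3)] wr_even_def snd_conv
      spin_even_class[OF w] spin_even_class[OF x(3)] by auto
qed

lemma R_minusD:
  assumes "f \<in> R_minus G n"
  shows "x \<notin> CW n \<Longrightarrow> f x = 0"
    "x \<in> CW n \<Longrightarrow> y \<in> CW n \<Longrightarrow> f (wconj n y x) = f x"
    "x \<in> CW n \<Longrightarrow> f (wz n x) = - f x"
    "x \<in> CW n \<Longrightarrow> \<not> wr_even x \<Longrightarrow> f x = 0"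
proof -
  show "x \<notin> CW n \<Longrightarrow> f x = 0" using assms by (cases x) (auto simp: R_minus_def class_functions_def)
qed (use assms in \<open>auto simp: R_minus_def class_functions_def\<close>)

text \<open>Conjugation by the right factor exchanges the two factors, which multiplies the element
  by \<open>z\<close>; a class function that changes sign under \<open>z\<close> must vanish
  there.\<close>

lemma R_minus_odd_odd:
  assumes f: "f \<in> R_minus G (n + m)" and x: "x \<in> CW n" "\<not> wr_even x" and y: "y \<in> CW m" "\<not> wr_even y"
  shows "f (ycomb n m x y) = 0"
proof -
  interpret W: group "W (n + m)" by (rule wr_group)
  let ?L = "embed_left G n m x" and ?R = "embed_right G n m y"
  have c: "?L \<in> CW (n + m)" "?R \<in> CW (n + m)" "ycomb n m x y \<in> CW (n + m)"
    using embed_closed x y ycomb_closed by blast+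
  have "?R \<otimes>\<^bsub>W (n + m)\<^esub> ycomb n m x y \<otimes>\<^bsub>W (n + m)\<^esub> inv\<^bsub>W (n + m)\<^esub> ?R = ?R \<otimes>\<^bsub>W (n + m)\<^esub> ?L"
    unfolding ycomb_def using c by (simp add: W.m_assoc)
  also have "\<dots> = wz (n + m) (ycomb n m x y)" by (rule ycomb_odd_odd[OF x(1) y(1) x(2) y(2)])
  finally have "f (ycomb n m x y) = f (wz (n + m) (ycomb n m x y))"
    using R_minusD(2)[OF f c(3,2)] by simp
  thus ?thesis using R_minusD(3)[OF f c(3)] by simp
qed

lemma path_prod_one:
  assumes "bij_betw \<sigma> {1..k} {1..k}" "i \<in> {1..k}"
  shows "path_prod (\<lambda>i\<in>{1..k}. \<one>) \<sigma> i n = \<one>"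
  by (induction n) (use bij_betw_funpow_mem[OF assms] in \<open>auto simp del: atLeastAtMost_iff\<close>)

text \<open>Parity is invariant under conjugation and under \<open>z\<close>, so every lift of a
  full cycle has the parity of the standard one, which has k - 1 letters. Trivial base components
  make the two types agree.\<close>

lemma even_cycle_odd:
  assumes u: "u \<in> spin_words k" and k: "0 < k" "even k" and o: "orbit (word_perm u) 1 = {1..k}"
  shows "\<not> word_even u"
proof -
  let ?h = "\<lambda>i\<in>{1..k}. \<one>" and ?c = "map tl_at [1..<k]"
  have h: "?h \<in> GP k" by simp
  have 1: "1 \<in> {1..k}" using k by simp
  have t: "wtype k (?h, spin_class k w) = {#(conj_class G \<one>, k)#}"
    if w: "w \<in> spin_words k" "orbit (word_perm w) 1 = {1..k}" for w
    using ctype_single_orbit[OF _ word_perm_bij_betw[OF w(1)] PiE_Pi[OF h] 1 w(2)] w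
      path_prod_one[OF word_perm_bij_betw[OF w(1)] 1]
    by (simp add: wtype_def cyc_label_path)
  have c: "(?h, spin_class k u) \<in> CW k" "(?h, spin_class k ?c) \<in> CW k"
    using wr_elI[OF h] u cycle_words by auto
  obtain y where y: "y \<in> CW k"
    "wconj k y (?h, spin_class k u) = (?h, spin_class k ?c) \<or>
     wconj k y (?h, spin_class k u) = wz k (?h, spin_class k ?c)"
    using wr_conj_of_type[OF c] t[OF u o] t[OF cycle_words cycle_orbit[OF k(1)]] by auto
  have "wr_even (?h, spin_class k u) = wr_even (?h, spin_class k ?c)"
    using wr_even_conj[OF c(1) y(1)] y(2) wsgn_z(4)[OF c(2)] by auto
  hence "word_even u = word_even ?c" using u cycle_words[of k] by (simp add: wr_even_def)
  thus ?thesis using k by (simp add: word_even_cycle)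
qed

lemma permutes_onto_initial:
  assumes "C \<subseteq> {1..n}" "card C = k"
  shows "\<exists>\<tau>. \<tau> permutes {1..n} \<and> \<tau> ` C = {1..k}"
proof -
  have fC: "finite C" using assms(1) by (rule finite_subset) simp
  have "k \<le> n" using card_mono[OF _ assms(1)] assms(2) by simp
  obtain f where f: "bij_betw f C {1..k}" using finite_same_card_bij[OF fC, of "{1..k}"] assms(2) by auto
  have "card ({1..n} - C) = card ({1..n} - {1..k})"
    using assms \<open>k \<le> n\<close> by (simp add: card_Diff_subset[OF fC] card_Diff_subset)
  then obtain g where g: "bij_betw g ({1..n} - C) ({1..n} - {1..k})"
    using finite_same_card_bij[of "{1..n} - C" "{1..n} - {1..k}"] by auto
  define \<tau> where "\<tau> = (\<lambda>i. if i \<in> C then f i else if i \<in> {1..n} then g i else i)"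
  have 1: "bij_betw \<tau> C {1..k}" by (rule bij_betw_cong[THEN iffD1, OF _ f]) (simp add: \<tau>_def)
  have 2: "bij_betw \<tau> ({1..n} - C) ({1..n} - {1..k})" by (rule bij_betw_cong[THEN iffD1, OF _ g]) (simp add: \<tau>_def)
  have "bij_betw \<tau> (C \<union> ({1..n} - C)) ({1..k} \<union> ({1..n} - {1..k}))"
    by (rule bij_betw_combine[OF 1 2]) auto
  moreover have "C \<union> ({1..n} - C) = {1..n}" "{1..k} \<union> ({1..n} - {1..k}) = {1..n}" using assms(1) \<open>k \<le> n\<close> by auto
  ultimately have "bij_betw \<tau> {1..n} {1..n}" by simp
  moreover have "\<tau> i = i" if "i \<notin> {1..n}" for i using that assms(1) unfolding \<tau>_def by (metis subsetD)
  ultimately have "\<tau> permutes {1..n}" by (rule bij_imp_permutes)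
  thus ?thesis using 1 by (auto simp: bij_betw_def)
qed

text \<open>An even cycle is conjugated onto an initial interval, which puts the element into a
  Young subgroup. The left factor is odd by \<open>even_cycle_odd\<close>; as the whole is even, the
  right factor is odd as well, and \<open>R_minus_odd_odd\<close> applies.\<close>

lemma R_minus_vanish:
  assumes f: "f \<in> R_minus G n" and x: "x \<in> CW n" and o: "\<not> otype n x"
  shows "f x = 0"
proof (cases "wr_even x")
  case False
  thus ?thesis using R_minusD(4)[OF f x] by simp
next
  case even: True
  obtain g u where xg: "x = (g, spin_class n u)" "g \<in> GP n" "u \<in> spin_words n" using x by (rule wr_cases)
  define \<sigma> where "\<sigma> = word_perm u"
  have b: "bij_betw \<sigma> {1..n} {1..n}" unfolding \<sigma>_def by (rule word_perm_bij_betw[OF xg(3)])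
  have "\<exists>b\<in>#ctype {1..n} g \<sigma>. even (snd b)" using o xg by (simp add: otype_def wtype_def \<sigma>_def)
  then obtain i where i: "i \<in> {1..n}" "even (card (orbit \<sigma> i))"
    unfolding set_ctype[OF finite_atLeastAtMost b PiE_Pi[OF xg(2)]] by (auto simp: cyc_label_def)
  define C k where "C = orbit \<sigma> i" and "k = card (orbit \<sigma> i)"
  note ob = orbit_bij[OF finite_atLeastAtMost b i(1)]
  have C: "C \<subseteq> {1..n}" "card C = k" "i \<in> C" "0 < k" "even k" using ob(1,5,6) i by (simp_all add: C_def k_def)
  have kn: "k \<le> n" using card_mono[OF _ C(1)] C(2) by simp
  obtain \<tau> where \<tau>: "\<tau> permutes {1..n}" "\<tau> ` C = {1..k}" using permutes_onto_initial[OF C(1,2)] by blast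
  obtain v where v: "v \<in> spin_words n" "word_perm v = \<tau>" using word_perm_surj[OF \<tau>(1)] by blast
  let ?y = "((\<lambda>i\<in>{1..n}. \<one>), spin_class n v)" and ?w = "v @ u @ inv_word v"
  define x' where "x' = wconj n ?y x"
  have one: "(\<lambda>i\<in>{1..n}. \<one>) \<in> GP n" by simp
  have y: "?y \<in> CW n" by (rule wr_elI[OF one v(1)])
  interpret W: group "W n" by (rule wr_group)
  have x'c: "x' \<in> CW n" unfolding x'_def using x y by simp
  have w: "?w \<in> spin_words n" using v xg by simp
  have sx': "snd x' = spin_class n ?w" unfolding x'_def xg(1) wr_conj[OF xg(2,3) one v(1)] by simp
  have wp: "word_perm ?w (\<tau> j) = \<tau> (\<sigma> j)" for j
    using word_perm_inv'[of v j] by (simp add: v(2)[symmetric] \<sigma>_def)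
  have \<sigma>C: "\<sigma> ` C = C"
  proof -
    have "\<sigma> j \<in> C" if "j \<in> C" for j using that unfolding C_def by (rule orbit.step)
    hence "\<sigma> ` C \<subseteq> C" by blast
    moreover have "finite C" using C(1) by (rule finite_subset) simp
    moreover have "inj_on \<sigma> C" using b C(1) by (auto simp: bij_betw_def intro: inj_on_subset)
    ultimately show ?thesis by (simp add: endo_inj_surj)
  qed
  have "word_perm ?w ` {1..k} = {1..k}"
  proof -
    have "word_perm ?w ` {1..k} = (\<lambda>j. word_perm ?w (\<tau> j)) ` C" unfolding \<tau>(2)[symmetric] by (rule image_image)
    also have "\<dots> = \<tau> ` (\<sigma> ` C)" by (simp only: wp image_image)
    finally show ?thesis by (simp only: \<sigma>C \<tau>(2))
  qed
  hence "x' \<in> young_sub G k (n - k)" using x'c kn by (simp add: young_sub_def sx' spin_perm_class[OF w] del: word_perm_append)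
  then obtain x1 x2 where x12: "x1 \<in> CW k" "x2 \<in> carrier (W (n - k))" "x' = ycomb k (n - k) x1 x2"
    using young_ycomb by blast
  obtain g1 u1 where x1: "x1 = (g1, spin_class k u1)" "g1 \<in> GP k" "u1 \<in> spin_words k" using x12(1) by (rule wr_cases)
  obtain g2 u2 where x2: "x2 = (g2, spin_class (n - k) u2)" "g2 \<in> {1..n - k} \<rightarrow>\<^sub>E carrier G" "u2 \<in> spin_words (n - k)" using x12(2) by (rule wr_cases)
  have w12: "u1 @ shift_word k u2 \<in> spin_words n"
    using words_left[OF x1(3), of "n - k"] shift_word_words[OF x2(3), of k] kn by simp
  have "spin_class n ?w = spin_class n (u1 @ shift_word k u2)"
    using sx' x12(3) kn unfolding x1(1) x2(1) ycomb_eq[OF x1(2,3) x2(2,3)] by simp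
  hence wpe: "word_perm ?w = word_perm (u1 @ shift_word k u2)" unfolding spin_class_iff[OF w w12] by simp
  have u1: "word_perm u1 j = word_perm ?w j" if "j \<in> {1..k}" for j
    unfolding wpe by (rule word_perm_append_shift(1)[OF x1(3) x2(3) that, symmetric])
  have b1: "bij_betw (word_perm u1) {1..k} {1..k}" by (rule word_perm_bij_betw[OF x1(3)])
  obtain i0 where i0: "i0 \<in> C" "\<tau> i0 = 1" using \<tau>(2) C(4) by (metis atLeastAtMost_iff imageE less_eq_Suc_le One_nat_def order_refl)
  have oi0: "orbit \<sigma> i0 = C" using orbit_bij_eq[OF finite_atLeastAtMost b i(1)] i0(1) by (simp add: C_def)
  \<comment> \<open>The left factor follows the chosen cycle as transported by \<tau>, so its orbit
    of 1 fills the whole initial interval.\<close>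
  have pw: "(word_perm u1 ^^ j) 1 = \<tau> ((\<sigma> ^^ j) i0)" for j
  proof (induction j)
    case (Suc j)
    have "(word_perm u1 ^^ j) 1 \<in> {1..k}" by (rule bij_betw_funpow_mem[OF b1]) (use C(4) in simp)
    hence "(word_perm u1 ^^ Suc j) 1 = word_perm ?w ((word_perm u1 ^^ j) 1)" using u1 by simp
    also have "\<dots> = \<tau> ((\<sigma> ^^ Suc j) i0)" unfolding Suc.IH by (simp only: wp funpow.simps o_apply)
    finally show ?case .
  qed (simp add: i0)
  have "orbit (word_perm u1) 1 = \<tau> ` orbit \<sigma> i0" by (auto simp: orbit_altdef pw)
  hence "orbit (word_perm u1) 1 = {1..k}" by (simp only: oi0 \<tau>(2))
  hence "\<not> word_even u1" by (rule even_cycle_odd[OF x1(3) C(4,5)])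
  hence odd1: "\<not> wr_even x1" using x1 by (simp add: wr_even_def)
  have "wr_even x'" unfolding x'_def wr_even_conj[OF x y] by (rule even)
  hence "\<not> wr_even x2" using wr_even_ycomb[OF x12(1,2)] odd1 by (simp add: x12(3))
  hence "f x' = 0" using R_minus_odd_odd[of f k "n - k", OF _ x12(1) odd1 x12(2)] f kn by (simp add: x12(3))
  thus ?thesis unfolding x'_def R_minusD(2)[OF f x y] .
qed

section \<open>Weights of types, and the class functions indexed by them\<close>

lemma centralizer_class:
  assumes c: "c \<in> Cls"
  shows "card c * centralizer_order G c = card (carrier G)"
proof -
  define x where "x = (SOME x. x \<in> c)"
  obtain w where "w \<in> carrier G" "c = conj_class G w" using c by (auto simp: conj_classes_def)
  hence "w \<in> c" using conj_class_self by simp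
  hence "x \<in> c" unfolding x_def by (rule someI[of "\<lambda>x. x \<in> c"])
  hence x: "x \<in> carrier G" "conj_class G x = c" using conj_classes_eq[OF c] by auto
  define Z where "Z = {y \<in> carrier G. y \<otimes> x = x \<otimes> y}"
  have Zc: "centralizer_order G c = card Z" by (simp add: centralizer_order_def Let_def Z_def x_def)
  have fib: "card {y \<in> carrier G. y \<otimes> x \<otimes> inv y = w} = card Z" if w: "w \<in> c" for w
  proof -
    obtain v where v: "v \<in> carrier G" "w = v \<otimes> x \<otimes> inv v" using w x(2) by (auto simp: conj_class_def)
    have "bij_betw (\<lambda>y. v \<otimes> y) Z {y \<in> carrier G. y \<otimes> x \<otimes> inv y = w}"
    proof (rule bij_betw_byWitness[where f' = "\<lambda>y. inv v \<otimes> y"])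
      show "\<forall>a\<in>Z. inv v \<otimes> (v \<otimes> a) = a" using v by (auto simp: Z_def m_assoc[symmetric])
      show "\<forall>a'\<in>{y \<in> carrier G. y \<otimes> x \<otimes> inv y = w}. v \<otimes> (inv v \<otimes> a') = a'" using v by (auto simp: m_assoc[symmetric])
      show "(\<otimes>) v ` Z \<subseteq> {y \<in> carrier G. y \<otimes> x \<otimes> inv y = w}"
      proof
        fix a assume "a \<in> (\<otimes>) v ` Z"
        then obtain y where y: "y \<in> carrier G" "y \<otimes> x = x \<otimes> y" "a = v \<otimes> y" by (auto simp: Z_def)
        have 1: "(y \<otimes> x) \<otimes> inv y = x" using y(1) x(1) unfolding y(2) by (simp add: m_assoc)
        have "a \<otimes> x \<otimes> inv a = v \<otimes> ((y \<otimes> x) \<otimes> inv y) \<otimes> inv v" using y(1,3) x(1) v(1) by (simp add: m_assoc inv_mult_group)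
        also have "\<dots> = w" unfolding 1 v(2) ..
        finally show "a \<in> {y \<in> carrier G. y \<otimes> x \<otimes> inv y = w}" using y v by simp
      qed
      show "(\<lambda>y. inv v \<otimes> y) ` {y \<in> carrier G. y \<otimes> x \<otimes> inv y = w} \<subseteq> Z"
      proof
        fix a assume "a \<in> (\<lambda>y. inv v \<otimes> y) ` {y \<in> carrier G. y \<otimes> x \<otimes> inv y = w}"
        then obtain y where y: "y \<in> carrier G" "y \<otimes> x \<otimes> inv y = v \<otimes> x \<otimes> inv v" "a = inv v \<otimes> y" using v by auto
        have "y \<otimes> x = y \<otimes> x \<otimes> inv y \<otimes> y" using y(1) x(1) by (simp add: m_assoc)
        hence "y \<otimes> x = v \<otimes> x \<otimes> inv v \<otimes> y" unfolding y(2) .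
        hence "inv v \<otimes> (y \<otimes> x) = inv v \<otimes> (v \<otimes> x \<otimes> inv v \<otimes> y)" by simp
        also have "\<dots> = (inv v \<otimes> v) \<otimes> (x \<otimes> (inv v \<otimes> y))" using y(1) x(1) v(1) by (simp only: m_assoc m_closed inv_closed)
        also have "\<dots> = x \<otimes> (inv v \<otimes> y)" using y(1) x(1) v(1) by simp
        finally show "a \<in> Z" using y(1,3) x(1) v(1) by (simp add: Z_def m_assoc)
      qed
    qed
    thus ?thesis by (rule bij_betw_same_card[symmetric])
  qed
  have "card (carrier G) = (\<Sum>y\<in>carrier G. 1)" by simp
  also have "\<dots> = (\<Sum>w\<in>c. \<Sum>y\<in>{y \<in> carrier G. y \<otimes> x \<otimes> inv y = w}. 1)"
  proof (rule sum.group[symmetric])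
    show "finite c" using conj_class_subset[OF x(1)] x(2) finite_carrier finite_subset by auto
    show "(\<lambda>y. y \<otimes> x \<otimes> inv y) ` carrier G \<subseteq> c" using x by (auto simp: conj_class_def)
  qed (rule finite_carrier)
  also have "\<dots> = card c * card Z" by (simp add: fib)
  finally show ?thesis by (simp add: Zc)
qed

lemma centralizer_pos: "c \<in> Cls \<Longrightarrow> 0 < centralizer_order G c"
proof -
  assume c: "c \<in> Cls"
  have "card (carrier G) \<noteq> 0" using finite_carrier by auto
  thus ?thesis using centralizer_class[OF c] by (intro Nat.gr0I) auto
qed

definition lab_r :: "'a set \<times> nat \<Rightarrow> complex" where
  "lab_r b = of_nat (snd b * centralizer_order G (fst b))"

text \<open>All lengths occur when group elements are counted by type, while functions in
  \<open>R_minus\<close> take values on odd types only. Both label sets carry the same weight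
  formula.\<close>

definition labels_all :: "('a set \<times> nat) set" where "labels_all = Cls \<times> {k. 0 < k}"
definition labels_odd :: "('a set \<times> nat) set" where "labels_odd = Cls \<times> {k. odd k}"

lemma labels_finite: "finite {b \<in> labels_all. snd b \<le> N}" "finite {b \<in> labels_odd. snd b \<le> N}"
proof -
  have "finite (Cls \<times> {..N})" using finite_conj_classes by simp
  thus "finite {b \<in> labels_all. snd b \<le> N}" "finite {b \<in> labels_odd. snd b \<le> N}"
    by (rule finite_subset[rotated], force simp: labels_all_def)
       (rule finite_subset[OF _ \<open>finite (Cls \<times> {..N})\<close>], force simp: labels_odd_def)
qed

lemma labels_odd_all: "labels_odd \<subseteq> labels_all"
  by (auto simp: labels_odd_def labels_all_def odd_pos)

sublocale all: weighted_labels labels_all snd lab_r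
proof
  show "finite {b \<in> labels_all. snd b \<le> N}" for N by (rule labels_finite)
  show "b \<in> labels_all \<Longrightarrow> 0 < snd b" for b by (auto simp: labels_all_def)
  show "b \<in> labels_all \<Longrightarrow> lab_r b \<noteq> 0" for b using centralizer_pos by (auto simp: labels_all_def lab_r_def)
qed

sublocale odd: weighted_labels labels_odd snd lab_r
proof
  show "finite {b \<in> labels_odd. snd b \<le> N}" for N by (rule labels_finite)
  show "b \<in> labels_odd \<Longrightarrow> 0 < snd b" "b \<in> labels_odd \<Longrightarrow> lab_r b \<noteq> 0" for b
    using labels_odd_all all.size_pos all.r_nz by blast+
qed

lemma count_pm: "count (pm \<rho>) (c, k) = (if c \<in> Cls then count (\<rho> c) k else 0)"
proof -
  have 1: "count (image_mset (Pair c') M) (c, k) = (if c' = c then count M k else 0)" for c' and M :: "nat multiset"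
    by (induction M) auto
  have "count (pm \<rho>) (c, k) = (\<Sum>c'\<in>Cls. if c' = c then count (\<rho> c) k else 0)"
    unfolding pm_def count_sum by (intro sum.cong HOL.refl) (simp add: 1)
  thus ?thesis using finite_conj_classes by simp
qed

lemma count_pv: "count (pv \<mu> c) k = count \<mu> (c, k)"
  unfolding pv_def by (induction \<mu>) (auto split: prod.splits)

lemma pv_pm: "\<rho> \<in> OP G n \<Longrightarrow> pv (pm \<rho>) = \<rho>"
proof
  fix c assume \<rho>: "\<rho> \<in> OP G n"
  show "pv (pm \<rho>) c = \<rho> c"
  proof (rule multiset_eqI)
    fix k show "count (pv (pm \<rho>) c) k = count (\<rho> c) k" using \<rho> by (auto simp: count_pv count_pm OP_def)
  qed
qed

lemma pm_pv:
  assumes "set_mset \<mu> \<subseteq> labels_all" shows "pm (pv \<mu>) = \<mu>"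
proof (rule multiset_eqI)
  fix b :: "'a set \<times> nat"
  obtain c k where b: "b = (c, k)" by force
  have "count \<mu> (c, k) = 0" if "c \<notin> Cls" using assms that by (auto simp: labels_all_def count_eq_zero_iff)
  thus "count (pm (pv \<mu>)) b = count \<mu> b" by (simp add: b count_pm count_pv)
qed

lemma pm_prod: "(\<Prod>b\<in>#pm \<rho>. h b) = (\<Prod>c\<in>Cls. \<Prod>k\<in>#\<rho> c. h (c, k))" for h :: "'a set \<times> nat \<Rightarrow> 'v :: comm_monoid_mult"
  unfolding pm_def using finite_conj_classes by (induction rule: finite_induct) (simp_all add: image_mset.compositionality comp_def)

lemma pm_sum: "(\<Sum>b\<in>#pm \<rho>. h b) = (\<Sum>c\<in>Cls. \<Sum>k\<in>#\<rho> c. h (c, k))" for h :: "'a set \<times> nat \<Rightarrow> 'v :: comm_monoid_add"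
  unfolding pm_def using finite_conj_classes by (induction rule: finite_induct) (simp_all add: image_mset.compositionality comp_def)

lemma pm_size: "size (pm \<rho>) = pv_length G \<rho>"
  using pm_sum[of "\<lambda>_. 1 :: nat" \<rho>] by (simp only: pv_length_def size_eq_sum_mset)

lemma set_pm: "set_mset (pm \<rho>) = Sigma (Cls) (\<lambda>c. set_mset (\<rho> c))"
proof -
  have "b \<in># pm \<rho> \<longleftrightarrow> b \<in> Sigma (Cls) (\<lambda>c. set_mset (\<rho> c))" for b
  proof -
    obtain c k where b: "b = (c, k)" by force
    show ?thesis unfolding b count_greater_zero_iff[symmetric] count_pm by auto
  qed
  thus ?thesis by blast
qed

lemma pm_in: "\<rho> \<in> OP G n \<Longrightarrow> pm \<rho> \<in> odd.msets n"
  using pm_sum[of snd \<rho>] unfolding odd.msets_def odd.weight_def by (auto simp: set_pm OP_def labels_odd_def)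

lemma pv_in:
  assumes "\<mu> \<in> odd.msets n" shows "pv \<mu> \<in> OP G n" "pm (pv \<mu>) = \<mu>"
proof -
  have s: "set_mset \<mu> \<subseteq> labels_odd" "(\<Sum>b\<in>#\<mu>. snd b) = n" using assms by (auto simp: odd.msets_def odd.weight_def)
  show p: "pm (pv \<mu>) = \<mu>" using s(1) labels_odd_all by (intro pm_pv) blast
  have "(\<Sum>c\<in>Cls. sum_mset (pv \<mu> c)) = n" using pm_sum[of snd "pv \<mu>"] p s(2) by simp
  moreover have "pv \<mu> c = {#}" if "c \<notin> Cls" for c
  proof (rule multiset_eqI)
    fix k show "count (pv \<mu> c) k = count {#} k"
      using s(1) that by (auto simp: count_pv count_eq_zero_iff labels_odd_def)
  qed
  moreover have "odd k" if "k \<in># pv \<mu> c" for c k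
  proof -
    have "(c, k) \<in># \<mu>" using that by (simp add: count_pv flip: count_greater_zero_iff)
    thus ?thesis using s(1) by (auto simp: labels_odd_def)
  qed
  ultimately show "pv \<mu> \<in> OP G n" by (auto simp: OP_def)
qed

lemma sum_OP: "(\<Sum>\<rho>\<in>OP G n. F \<rho>) = (\<Sum>\<mu>\<in>odd.msets n. F (pv \<mu>))"
  by (rule sum.reindex_bij_witness[of _ pv pm]) (auto simp: pm_in pv_in pv_pm)

text \<open>The powers of a part and of the centralizer order in Z combine to powers of
  \<open>lab_r\<close>; the factorials are those of \<open>wt\<close>.\<close>

lemma wt_pm: "odd.wt (pm \<rho>) = 1 / of_nat (pv_Z G \<rho>)"
proof -
  have "odd.wt (pm \<rho>) = (\<Prod>c\<in>Cls. \<Prod>k\<in>set_mset (\<rho> c).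
      1 / (fact (count (\<rho> c) k) * lab_r (c, k) ^ count (\<rho> c) k))"
  proof -
    have "(\<Prod>c\<in>Cls. \<Prod>k\<in>set_mset (\<rho> c). 1 / (fact (count (\<rho> c) k) * lab_r (c, k) ^ count (\<rho> c) k)) =
      (\<Prod>(c, k)\<in>Sigma (Cls) (\<lambda>c. set_mset (\<rho> c)). 1 / (fact (count (\<rho> c) k) * lab_r (c, k) ^ count (\<rho> c) k))"
      by (rule prod.Sigma) (simp_all add: finite_conj_classes)
    also have "\<dots> = odd.wt (pm \<rho>)" unfolding odd.wt_def set_pm
      by (rule prod.cong) (auto simp: count_pm)
    finally show ?thesis by simp
  qed
  also have "\<dots> = (\<Prod>c\<in>Cls. 1 / of_nat (part_z (\<rho> c) * centralizer_order G c ^ size (\<rho> c)))"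
  proof (rule prod.cong[OF HOL.refl])
    fix c
    have "centralizer_order G c ^ size (\<rho> c) = (\<Prod>k\<in>set_mset (\<rho> c). centralizer_order G c ^ count (\<rho> c) k)"
      by (simp add: size_multiset_overloaded_eq power_sum)
    thus "(\<Prod>k\<in>set_mset (\<rho> c). 1 / (fact (count (\<rho> c) k) * lab_r (c, k) ^ count (\<rho> c) k)) =
      1 / of_nat (part_z (\<rho> c) * centralizer_order G c ^ size (\<rho> c))"
      by (simp add: part_z_def lab_r_def prod_dividef power_mult_distrib prod.distrib mult_ac)
  qed
  also have "\<dots> = 1 / of_nat (pv_Z G \<rho>)" by (simp add: pv_Z_def prod_dividef)
  finally show ?thesis .
qed

lemma wtype_in:
  assumes "x \<in> CW n"
  shows "wtype n x \<in> all.msets n" "otype n x \<Longrightarrow> wtype n x \<in> odd.msets n"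
proof -
  obtain g u where x: "x = (g, spin_class n u)" "g \<in> GP n" "u \<in> spin_words n" using assms by (rule wr_cases)
  note b = word_perm_bij_betw[OF x(3)]
  have w: "(\<Sum>b\<in>#wtype n x. snd b) = n" using weight_ctype[OF finite_atLeastAtMost b, of g] x by (simp add: wtype_def)
  have s: "set_mset (wtype n x) \<subseteq> labels_all"
  proof -
    have "cyc_label g (word_perm u) i \<in> labels_all" if i: "i \<in> {1..n}" for i
      using orbit_bij(1)[OF finite_atLeastAtMost b i] path_prod_closed[OF b i PiE_Pi[OF x(2)]]
      by (simp add: cyc_label_path labels_all_def conj_class_in)
    thus ?thesis using set_ctype[OF finite_atLeastAtMost b PiE_Pi[OF x(2)]] x by (auto simp: wtype_def simp del: atLeastAtMost_iff)
  qed
  show "wtype n x \<in> all.msets n" using w s by (simp add: all.msets_def all.weight_def)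
  show "wtype n x \<in> odd.msets n" if "otype n x"
    using w s that unfolding odd.msets_def odd.weight_def by (auto simp: otype_def labels_all_def labels_odd_def)
qed

text \<open>The inverse of reading off values: by \<open>R_minus_mk_class\<close> and
  \<open>at_D_mk_class\<close> the degree n piece of R^- is identified with the functions on
  \<open>odd.msets n\<close>.\<close>

definition mk_class :: "nat \<Rightarrow> (('a set \<times> nat) multiset \<Rightarrow> complex) \<Rightarrow> 'a wr_elt \<Rightarrow> complex" where
  "mk_class n v = (\<lambda>x. if x \<in> CW n \<and> otype n x then wsgn n x * v (wtype n x) else 0)"

lemma mk_class_R_minus: "mk_class n v \<in> R_minus G n"
proof -
  interpret W: group "W n" by (rule wr_group)
  have "mk_class n v (wconj n y x) = mk_class n v x"
    if "x \<in> CW n" "y \<in> CW n" for x y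
    using that wsgn_conj[OF that] by (simp add: mk_class_def wtype_conj otype_conj)
  moreover have "mk_class n v (wz n x) = - mk_class n v x" if "x \<in> CW n" for x
    using that wsgn_z[OF that] wr_z_carrier by (simp add: mk_class_def)
  moreover have "mk_class n v x = 0" if "x \<in> CW n" "\<not> wr_even x" for x
    using otype_even[OF that(1)] that by (auto simp: mk_class_def)
  moreover have "mk_class n v x = 0" if "x \<notin> CW n" for x using that by (simp add: mk_class_def)
  ultimately show ?thesis unfolding R_minus_def class_functions_def by blast
qed

end

context ordered_grp
begin

text \<open>\<open>at_D\<close> evaluates at an element picked from \<open>D_plus\<close>; the pick
  is the same for all functions f.\<close>

lemma at_D_rep:
  assumes "\<mu> \<in> odd.msets n"
  obtains d where "d \<in> CW n" "wtype n d = \<mu>" "wsgn n d = 1" "otype n d"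
    "\<And>f. at_D G cs n f (pv \<mu>) = f d"
proof -
  note p = pv_in[OF assms]
  define d where "d = (SOME x. x \<in> D_plus G cs n (pv \<mu>))"
  have "d \<in> D_plus G cs n (pv \<mu>)"
    unfolding d_def using D_plus_eq(1)[OF class_order p(1)] by (intro someI_ex[of "\<lambda>x. x \<in> D_plus G cs n (pv \<mu>)"]) blast
  from D_plus_eq(2)[OF class_order p(1) this] show ?thesis
    by (intro that[of d]) (simp_all add: p(2) at_D_def at_class_def d_def)
qed

text \<open>An element of odd type is conjugate to the picked representative or to its product with
  \<open>z\<close>; in the second case f and the sign both change.\<close>

lemma f_value:
  assumes f: "f \<in> R_minus G n" and x: "x \<in> CW n" and o: "otype n x"
  shows "f x = wsgn n x * at_D G cs n f (pv (wtype n x))"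
proof -
  obtain d where d: "d \<in> CW n" "wtype n d = wtype n x" "wsgn n d = 1" "otype n d"
    "\<And>f. at_D G cs n f (pv (wtype n x)) = f d" using at_D_rep[OF wtype_in(2)[OF x o]] by metis
  obtain y where y: "y \<in> CW n" "wconj n y x = d \<or>
    wconj n y x = wz n d"
    using wr_conj_of_type[OF x d(1) d(2)[symmetric]] by blast
  have 1: "f (wconj n y x) = f x" by (rule R_minusD(2)[OF f x y(1)])
  have 2: "wsgn n (wconj n y x) = wsgn n x" by (rule wsgn_conj[OF x y(1) o])
  from y(2) show ?thesis
  proof
    assume "wconj n y x = d"
    hence "f x = f d" "wsgn n x = 1" using 1 2 d(3) by simp_all
    thus ?thesis by (simp add: d(5))
  next
    assume "wconj n y x = wz n d"
    hence "f x = - f d" "wsgn n x = - 1" using 1 2 d(3) R_minusD(3)[OF f d(1)] wsgn_z(3)[OF d(1,4)] by simp_all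
    thus ?thesis by (simp add: d(5))
  qed
qed

lemma R_minus_mk_class:
  assumes f: "f \<in> R_minus G n"
  shows "f = mk_class n (\<lambda>\<mu>. at_D G cs n f (pv \<mu>))"
proof
  fix x
  show "f x = mk_class n (\<lambda>\<mu>. at_D G cs n f (pv \<mu>)) x"
    by (cases "x \<in> CW n"; cases "otype n x")
       (simp_all only: mk_class_def R_minusD(1)[OF f] R_minus_vanish[OF f] f_value[OF f] HOL.simp_thms if_True if_False)
qed

lemma at_D_mk_class: "\<mu> \<in> odd.msets n \<Longrightarrow> at_D G cs n (mk_class n v) (pv \<mu>) = v \<mu>"
proof -
  assume "\<mu> \<in> odd.msets n"
  then obtain d where "d \<in> CW n" "wtype n d = \<mu>" "wsgn n d = 1" "otype n d"
    "\<And>f. at_D G cs n f (pv \<mu>) = f d" by (rule at_D_rep) blast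
  thus ?thesis by (simp add: mk_class_def)
qed

lemma mk_class_cong: "(\<And>\<mu>. \<mu> \<in> odd.msets n \<Longrightarrow> v \<mu> = v' \<mu>) \<Longrightarrow> mk_class n v = mk_class n v'"
  using wtype_in(2) by (auto simp: mk_class_def fun_eq_iff)

lemma two_powr_half: "complex_of_real (2 powr (real l / 2)) = of_real (sqrt 2) ^ l"
proof -
  have "2 powr (real l / 2) = (2 powr (1 / 2)) ^ l" by (simp add: powr_power)
  thus ?thesis by (simp add: powr_half_sqrt)
qed

text \<open>The description by values under \<open>THE\<close> is unique because values on
  \<open>D_plus\<close> determine a function in \<open>R_minus\<close>. The powers of 2 that depend
  on the parity of n cancel, which leaves sqrt 2 per part and makes the value a product over
  labels.\<close>

lemma scaled_chi_eq:
  "scaled_chi G cs n \<gamma> = mk_class n (\<lambda>\<mu>. \<Prod>b\<in>#\<mu>. of_real (sqrt 2) * at_class \<gamma> (fst b))"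
proof -
  define v where "v = (\<lambda>\<mu> :: ('a set \<times> nat) multiset. of_real (2 powr ((real (size \<mu>) - real (n mod 2)) / 2)) * (\<Prod>b\<in>#\<mu>. at_class \<gamma> (fst b)) :: complex)"
  have pr: "(\<Prod>c\<in>Cls. at_class \<gamma> c ^ size (\<rho> c)) = (\<Prod>b\<in>#pm \<rho>. at_class \<gamma> (fst b))" for \<rho>
    unfolding pm_prod by (rule prod.cong) (simp_all add: prod_mset_constant)
  have chi: "chi G cs n \<gamma> = mk_class n v"
    unfolding chi_def
  proof (rule the_equality)
    show "mk_class n v \<in> R_minus G n \<and> (\<forall>\<rho>\<in>OP G n. at_D G cs n (mk_class n v) \<rho> =
       of_real (2 powr ((real (pv_length G \<rho>) - real (n mod 2)) / 2)) * (\<Prod>c\<in>Cls. at_class \<gamma> c ^ size (\<rho> c)))"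
    proof (intro conjI ballI mk_class_R_minus)
      fix \<rho> assume \<rho>: "\<rho> \<in> OP G n"
      have "at_D G cs n (mk_class n v) (pv (pm \<rho>)) = v (pm \<rho>)" by (rule at_D_mk_class[OF pm_in[OF \<rho>]])
      thus "at_D G cs n (mk_class n v) \<rho> =
       of_real (2 powr ((real (pv_length G \<rho>) - real (n mod 2)) / 2)) * (\<Prod>c\<in>Cls. at_class \<gamma> c ^ size (\<rho> c))"
        by (simp only: pv_pm[OF \<rho>] v_def pm_size pr)
    qed
  next
    fix f assume f: "f \<in> R_minus G n \<and> (\<forall>\<rho>\<in>OP G n. at_D G cs n f \<rho> =
       of_real (2 powr ((real (pv_length G \<rho>) - real (n mod 2)) / 2)) * (\<Prod>c\<in>Cls. at_class \<gamma> c ^ size (\<rho> c)))"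
    have "f = mk_class n (\<lambda>\<mu>. at_D G cs n f (pv \<mu>))" using f by (intro R_minus_mk_class) simp
    also have "\<dots> = mk_class n v"
    proof (rule mk_class_cong)
      fix \<mu> assume \<mu>: "\<mu> \<in> odd.msets n"
      have "at_D G cs n f (pv \<mu>) = of_real (2 powr ((real (size (pm (pv \<mu>))) - real (n mod 2)) / 2)) * (\<Prod>b\<in>#pm (pv \<mu>). at_class \<gamma> (fst b))"
        using f pv_in(1)[OF \<mu>] by (simp only: pm_size pr)
      thus "at_D G cs n f (pv \<mu>) = v \<mu>" unfolding pv_in(2)[OF \<mu>] v_def .
    qed
    finally show "f = mk_class n v" .
  qed
  have sc: "of_real (2 powr (real (n mod 2) / 2)) * v \<mu> = (\<Prod>b\<in>#\<mu>. of_real (sqrt 2) * at_class \<gamma> (fst b))" for \<mu> :: "('a set \<times> nat) multiset"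
  proof -
    have "(2 powr (real (n mod 2) / 2)) * (2 powr ((real (size \<mu>) - real (n mod 2)) / 2)) = 2 powr (real (size \<mu>) / 2)"
      by (simp add: powr_add[symmetric] add_divide_distrib[symmetric])
    hence "complex_of_real ((2 powr (real (n mod 2) / 2)) * (2 powr ((real (size \<mu>) - real (n mod 2)) / 2))) = of_real (sqrt 2) ^ size \<mu>"
      by (simp only: two_powr_half)
    hence "complex_of_real (2 powr (real (n mod 2) / 2)) * of_real (2 powr ((real (size \<mu>) - real (n mod 2)) / 2)) = of_real (sqrt 2) ^ size \<mu>"
      by (simp only: of_real_mult)
    hence 1: "complex_of_real (2 powr (real (n mod 2) / 2)) * v \<mu> = of_real (sqrt 2) ^ size \<mu> * (\<Prod>b\<in>#\<mu>. at_class \<gamma> (fst b))"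
      unfolding v_def mult.assoc[symmetric] by simp
    have 2: "of_real (sqrt 2) ^ size \<mu> = (\<Prod>b\<in>#\<mu>. complex_of_real (sqrt 2))" by (simp add: image_mset_const_eq)
    show ?thesis unfolding 1 2 by (rule prod_mset.distrib[symmetric])
  qed
  show ?thesis
  proof (rule ext)
    fix x
    show "scaled_chi G cs n \<gamma> x = mk_class n (\<lambda>\<mu>. \<Prod>b\<in>#\<mu>. of_real (sqrt 2) * at_class \<gamma> (fst b)) x"
      unfolding scaled_chi_def chi mk_class_def sc[symmetric] by simp
  qed
qed

end

context finite_grp
begin

section \<open>Counting group elements by type\<close>

lemma ctype_insert_fixed:
  assumes A: "finite A" "a \<notin> A" "\<sigma> permutes A" "g \<in> A \<rightarrow> carrier G" and w: "w \<in> carrier G"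
  shows "ctype (insert a A) (g(a := w)) \<sigma> = add_mset (conj_class G w, 1) (ctype A g \<sigma>)"
proof -
  have b: "bij_betw \<sigma> A A" using A(3) by (rule permutes_imp_bij)
  have sa: "\<sigma> a = a" using A(2,3) by (simp add: permutes_def)
  have ba: "bij_betw \<sigma> {a} {a}" using sa by (simp add: bij_betw_def)
  have oa: "orbit \<sigma> a = {a}" using orbit_bij(5,6)[OF _ ba, of a] by auto
  have "ctype ({a} \<union> A) (g(a := w)) \<sigma> = ctype {a} (g(a := w)) \<sigma> + ctype A (g(a := w)) \<sigma>"
    by (rule ctype_Un) (use A b ba in auto)
  also have "ctype A (g(a := w)) \<sigma> = ctype A g \<sigma>" by (rule ctype_cong) (use A b in auto)
  also have "ctype {a} (g(a := w)) \<sigma> = {#cyc_label (g(a := w)) \<sigma> a#}"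
    by (rule ctype_single_orbit) (use ba oa w in auto)
  also have "cyc_label (g(a := w)) \<sigma> a = (conj_class G w, 1)"
    using w by (simp add: cyc_label_path oa One_nat_def)
  finally show ?thesis by (simp only: insert_is_Un[of a A] add_mset_add_single[of _ "ctype A g \<sigma>"] add.commute)
qed

text \<open>Composing with the transposition inserts \<open>a\<close> into the cycle just before
  \<open>b\<close>. Read from \<open>b\<close>, the old points come in the old order and
  \<open>a\<close> comes last, so the new component \<open>w\<close> is the leftmost factor of the
  product.\<close>

lemma ctype_insert_cycle:
  assumes A: "finite A" "a \<notin> A" "\<sigma> permutes A" "g \<in> A \<rightarrow> carrier G" and w: "w \<in> carrier G" and b: "b \<in> A"
  shows "ctype (insert a A) (g(a := w)) (transpose a b \<circ> \<sigma>) =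
    add_mset (conj_class G (w \<otimes> path_prod g \<sigma> b (card (orbit \<sigma> b))), Suc (card (orbit \<sigma> b)))
      (ctype A g \<sigma> - {#cyc_label g \<sigma> b#})"
proof -
  define C k where "C = orbit \<sigma> b" and "k = card (orbit \<sigma> b)"
  define \<tau> g' where "\<tau> = transpose a b \<circ> \<sigma>" and "g' = g(a := w)"
  have \<sigma>: "bij_betw \<sigma> A A" using A(3) by (rule permutes_imp_bij)
  note ob = orbit_bij[OF A(1) \<sigma> b]
  have C: "C \<subseteq> A" "b \<in> C" "0 < k" "a \<notin> C" "finite C" "card C = k"
    using ob(1,5,6) A(1,2) finite_subset by (auto simp: C_def k_def)
  have \<sigma>inj: "inj_on \<sigma> A" using \<sigma> by (simp add: bij_betw_def)
  have \<sigma>C: "\<sigma> ` C = C"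
  proof -
    have "\<sigma> ` C \<subseteq> C" unfolding C_def by (auto intro: orbit.step)
    thus ?thesis using C(5) inj_on_subset[OF \<sigma>inj C(1)] by (simp add: endo_inj_surj)
  qed
  have \<sigma>D: "\<sigma> ` (A - C) = A - C"
    using \<sigma> \<sigma>C C(1) by (simp add: inj_on_image_set_diff[OF \<sigma>inj] bij_betw_def)
  have bC: "bij_betw \<sigma> C C" and bD: "bij_betw \<sigma> (A - C) (A - C)"
    using \<sigma>C \<sigma>D inj_on_subset[OF \<sigma>inj] C(1) by (auto simp: bij_betw_def)
  have oC: "orbit \<sigma> b = C" by (simp add: C_def)
  have "ctype (C \<union> (A - C)) g \<sigma> = ctype C g \<sigma> + ctype (A - C) g \<sigma>"
    by (rule ctype_Un) (use A C bC bD in auto)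
  moreover have "C \<union> (A - C) = A" using C(1) by auto
  moreover have "ctype C g \<sigma> = {#cyc_label g \<sigma> b#}"
    by (rule ctype_single_orbit[OF C(5) bC _ C(2) oC]) (use A(4) C(1) in auto)
  ultimately have split: "ctype A g \<sigma> = add_mset (cyc_label g \<sigma> b) (ctype (A - C) g \<sigma>)" by simp
  have D: "ctype (A - C) g' \<tau> = ctype (A - C) g \<sigma>"
  proof (rule ctype_cong)
    fix i assume i: "i \<in> A - C"
    hence "\<sigma> i \<in> A - C" using \<sigma>D by blast
    hence "\<sigma> i \<noteq> a" "\<sigma> i \<noteq> b" using A(2) C(2) by auto
    thus "\<tau> i = \<sigma> i" by (simp add: \<tau>_def)
    show "g' i = g i" using i A(2) by (auto simp: g'_def)
  qed (use A bD in auto)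
  have pw: "(\<tau> ^^ j) b = (\<sigma> ^^ j) b" if "j < k" for j
    using that
  proof (induction j)
    case (Suc j)
    have "(\<sigma> ^^ Suc j) b \<noteq> (\<sigma> ^^ 0) b"
    proof
      assume "(\<sigma> ^^ Suc j) b = (\<sigma> ^^ 0) b"
      with ob(4) have "Suc j = 0" by (rule inj_onD) (use Suc.prems in \<open>auto simp: k_def\<close>)
      thus False by simp
    qed
    moreover have "(\<sigma> ^^ Suc j) b \<noteq> a" using bij_betw_funpow_mem[OF \<sigma> b, of "Suc j"] A(2) by auto
    ultimately have "transpose a b ((\<sigma> ^^ Suc j) b) = (\<sigma> ^^ Suc j) b" by simp
    thus ?case using Suc by (simp add: \<tau>_def)
  qed simp
  \<comment> \<open>After the k points of the old cycle the walk reaches \<open>a\<close> where it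
    used to return to \<open>b\<close>.\<close>
  have pk: "(\<tau> ^^ k) b = a"
  proof -
    obtain j where j: "k = Suc j" using C(3) by (cases k) auto
    have "(\<tau> ^^ k) b = transpose a b ((\<sigma> ^^ k) b)" using pw[of j] j by (simp add: \<tau>_def)
    thus ?thesis using ob(2) by (simp add: k_def)
  qed
  have bt: "bij_betw \<tau> (insert a C) (insert a C)"
  proof -
    have "bij_betw \<sigma> (insert a C) (insert a C)"
      using bC C(4) A(2,3) by (simp add: bij_betw_def permutes_def)
    moreover have "bij_betw (transpose a b) (insert a C) (insert a C)"
      using C(2) by (intro permutes_imp_bij permutes_swap_id) auto
    ultimately show ?thesis unfolding \<tau>_def by (rule bij_betw_trans)
  qed
  have C_alt: "C = (\<lambda>j. (\<sigma> ^^ j) b) ` {..<k}" unfolding C_def k_def by (rule ob(3))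
  have bo: "b \<in> orbit \<tau> b" using orbit_bij(6)[OF _ bt, of b] C(2,5) by simp
  have pwo: "(\<tau> ^^ j) b \<in> orbit \<tau> b" for j
    by (induction j) (use bo in \<open>auto intro: orbit.step\<close>)
  have ot: "orbit \<tau> b = insert a C"
  proof
    show "orbit \<tau> b \<subseteq> insert a C" using orbit_bij(5)[OF _ bt, of b] C(2,5) by simp
    show "insert a C \<subseteq> orbit \<tau> b"
    proof
      fix i assume "i \<in> insert a C"
      then consider "i = a" | j where "j < k" "i = (\<sigma> ^^ j) b" using C_alt by auto
      thus "i \<in> orbit \<tau> b"
      proof cases
        case 1 thus ?thesis using pwo[of k] pk by simp
      next
        case (2 j) thus ?thesis using pwo[of j] pw[of j] by simp
      qed
    qed
  qed
  have pp: "path_prod g' \<tau> b j = path_prod g \<sigma> b j" if "j \<le> k" for j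
    using that
  proof (induction j)
    case (Suc j)
    have "(\<sigma> ^^ j) b \<noteq> a" using bij_betw_funpow_mem[OF \<sigma> b, of j] A(2) by auto
    thus ?case using Suc pw[of j] by (simp add: g'_def)
  qed simp
  have "path_prod g' \<tau> b (Suc k) = w \<otimes> path_prod g \<sigma> b k"
    using pp[of k] pk by (simp add: g'_def)
  moreover have "card (insert a C) = Suc k" using C by simp
  ultimately have lab: "cyc_label g' \<tau> b = (conj_class G (w \<otimes> path_prod g \<sigma> b k), Suc k)"
    by (simp only: cyc_label_path ot)
  have "ctype (insert a C \<union> (A - C)) g' \<tau> = ctype (insert a C) g' \<tau> + ctype (A - C) g' \<tau>"
  proof (rule ctype_Un)
    have "\<sigma> i \<noteq> a \<and> \<sigma> i \<noteq> b" if "i \<in> A - C" for i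
      using that \<sigma>D A(2) C(2) by blast
    thus "bij_betw \<tau> (A - C) (A - C)"
      by (intro bij_betw_cong[THEN iffD1, OF _ bD]) (simp add: \<tau>_def)
  qed (use A C bt in auto)
  moreover have "insert a C \<union> (A - C) = insert a A" using C(1) by auto
  moreover have "ctype (insert a C) g' \<tau> = {#cyc_label g' \<tau> b#}"
    by (rule ctype_single_orbit[OF _ bt]) (use C ot A(4) w in \<open>auto simp: g'_def\<close>)
  ultimately have "ctype (insert a A) g' \<tau> = add_mset (cyc_label g' \<tau> b) (ctype (A - C) g \<sigma>)" using D by simp
  thus ?thesis unfolding split lab by (simp add: \<tau>_def g'_def k_def)
qed

lemma sum_mset_count_mult: "(\<Sum>l\<in>#M. h l) = (\<Sum>l\<in>set_mset M. of_nat (count M l) * h l)"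
  for h :: "'c \<Rightarrow> 'd :: comm_semiring_1"
proof (induction M)
  case (add x M)
  have "(\<Sum>l\<in>set_mset M. of_nat (count M l) * h l) = (\<Sum>l\<in>insert x (set_mset M). of_nat (count M l) * h l)"
    by (rule sum.mono_neutral_left) (auto simp: not_in_iff)
  moreover have "(\<Sum>l\<in>insert x (set_mset M). of_nat (count (add_mset x M) l) * h l) =
      (\<Sum>l\<in>insert x (set_mset M). of_nat (count M l) * h l + (if l = x then h x else 0))"
    by (rule sum.cong) (auto simp: distrib_right add.commute)
  ultimately show ?case using add by (simp add: sum.distrib add.commute)
qed simp

text \<open>A cycle of length k is met once for each of its k points.\<close>

lemma sum_cyc_labels:
  fixes H :: "'a set \<times> nat \<Rightarrow> complex"
  assumes A: "finite A" "bij_betw \<sigma> A A" "g \<in> A \<rightarrow> carrier G"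
  shows "(\<Sum>b\<in>A. H (cyc_label g \<sigma> b)) = (\<Sum>l\<in>#ctype A g \<sigma>. of_nat (snd l) * H l)"
proof -
  let ?lab = "\<lambda>C. cyc_label g \<sigma> (SOME i. i \<in> C)"
  have "(\<Sum>l\<in>#ctype A g \<sigma>. of_nat (snd l) * H l) = (\<Sum>C\<in>orbit \<sigma> ` A. of_nat (snd (?lab C)) * H (?lab C))"
    unfolding ctype_def by (simp add: image_mset.compositionality comp_def sum_unfold_sum_mset)
  also have "\<dots> = (\<Sum>C\<in>orbit \<sigma> ` A. \<Sum>b\<in>{b \<in> A. orbit \<sigma> b = C}. H (cyc_label g \<sigma> b))" (is "sum ?l _ = sum ?r _")
  proof (rule sum_cong)
    fix C assume "C \<in> orbit \<sigma> ` A"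
    then obtain i where i: "i \<in> A" "C = orbit \<sigma> i" by auto
    have C: "{b \<in> A. orbit \<sigma> b = C} = C"
      using orbit_bij(5,6)[OF A(1,2)] orbit_bij_eq[OF A(1,2) i(1)] i by blast
    have "(SOME j. j \<in> C) \<in> C" using orbit_bij(6)[OF A(1,2) i(1)] unfolding i(2) by (rule someI[of "\<lambda>j. j \<in> _"])
    hence l: "?lab C = cyc_label g \<sigma> i" using cyc_label_orbit[OF A(1,2) i(1) A(3)] i(2) by simp
    have "(\<Sum>b\<in>C. H (cyc_label g \<sigma> b)) = (\<Sum>b\<in>C. H (cyc_label g \<sigma> i))"
      by (rule sum_cong) (use cyc_label_orbit[OF A(1,2) i(1) A(3)] i(2) in simp)
    also have "\<dots> = of_nat (snd (?lab C)) * H (?lab C)" unfolding l by (simp add: cyc_label_def i(2))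
    finally show "?l C = ?r C"
      unfolding C by simp
  qed
  also have "\<dots> = (\<Sum>b\<in>A. H (cyc_label g \<sigma> b))" by (rule sum.group) (use A in auto)
  finally show ?thesis by simp
qed

lemma card_G_nonzero: "of_nat (card (carrier G)) \<noteq> (0 :: complex)"
  using finite_carrier by auto

text \<open>By \<open>centralizer_class\<close> the proportion of group elements lying in a class is
  one over the centralizer order.\<close>

lemma sum_classes:
  fixes X :: "'a set \<Rightarrow> complex"
  shows "(\<Sum>w\<in>carrier G. X (conj_class G w)) =
    of_nat (card (carrier G)) * (\<Sum>c\<in>Cls. X c / of_nat (centralizer_order G c))"
proof -
  have "(\<Sum>w\<in>carrier G. X (conj_class G w)) =
    (\<Sum>c\<in>Cls. \<Sum>w\<in>{w \<in> carrier G. conj_class G w = c}. X (conj_class G w))"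
    by (rule sum.group[symmetric]) (use finite_carrier finite_conj_classes in \<open>auto simp: conj_class_in\<close>)
  also have "\<dots> = (\<Sum>c\<in>Cls. of_nat (card (carrier G)) * (X c / of_nat (centralizer_order G c)))" (is "sum ?l _ = sum ?r _")
  proof (rule sum_cong)
    fix c assume c: "c \<in> Cls"
    have "{w \<in> carrier G. conj_class G w = c} = c" using conj_classes_eq[OF c] conj_class_self by auto
    hence "(\<Sum>w\<in>{w \<in> carrier G. conj_class G w = c}. X (conj_class G w)) = of_nat (card c) * X c"
      using conj_classes_eq[OF c] by simp
    thus "?l c = ?r c"
      using centralizer_pos[OF c] unfolding centralizer_class[OF c, symmetric] by simp
  qed
  finally show ?thesis by (simp only: sum_distrib_left)
qed

lemma sum_labels:
  fixes X :: "'a set \<times> nat \<Rightarrow> complex"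
  shows "of_nat (card (carrier G)) * (\<Sum>b\<in>{b \<in> labels_all. snd b \<le> N}. of_nat (snd b) / lab_r b * X b) =
    (\<Sum>k\<in>{1..N}. \<Sum>w\<in>carrier G. X (conj_class G w, k))"
proof -
  have "{b \<in> labels_all. snd b \<le> N} = Cls \<times> {1..N}" by (auto simp: labels_all_def One_nat_def)
  hence "(\<Sum>b\<in>{b \<in> labels_all. snd b \<le> N}. of_nat (snd b) / lab_r b * X b) =
    (\<Sum>c\<in>Cls. \<Sum>k\<in>{1..N}. of_nat k / lab_r (c, k) * X (c, k))"
    by (simp add: sum.cartesian_product split_def)
  also have "\<dots> = (\<Sum>k\<in>{1..N}. \<Sum>c\<in>Cls. of_nat k / lab_r (c, k) * X (c, k))" by (rule sum.swap)
  also have "\<dots> = (\<Sum>k\<in>{1..N}. \<Sum>c\<in>Cls. X (c, k) / of_nat (centralizer_order G c))"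
    by (intro sum.cong HOL.refl) (auto simp: lab_r_def)
  finally show ?thesis by (simp add: sum_distrib_left sum_classes[of "\<lambda>c. X (c, k)" for k])
qed

text \<open>Removing one point of the underlying set turns a weighted count of types into one of
  smaller types; the two sides below are the effects of this on the two descriptions.\<close>

lemma wt_insert_point:
  fixes F :: "('a set \<times> nat) multiset \<Rightarrow> complex"
  defines "K \<equiv> \<lambda>k M. \<Sum>w\<in>carrier G. F (add_mset (conj_class G w, k) M)"
  shows "(\<Sum>\<mu>\<in>all.msets N. all.wt \<mu> * (K 1 \<mu> + (\<Sum>l\<in>#\<mu>. of_nat (snd l) * K (Suc (snd l)) (\<mu> - {#l#})))) =
    of_nat (Suc N) * of_nat (card (carrier G)) * (\<Sum>\<mu>\<in>all.msets (Suc N). all.wt \<mu> * F \<mu>)"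
proof -
  let ?B = "\<lambda>N. {b \<in> labels_all. snd b \<le> N}" and ?g = "of_nat (card (carrier G)) :: complex"
  let ?D = "\<lambda>\<mu>. \<Sum>l\<in>#\<mu>. of_nat (snd l) * K (Suc (snd l)) (\<mu> - {#l#})"
  \<comment> \<open>The weighted total over types of size N to which one cycle of length k is added,
    its product running over the whole group. Both sides of the identity become sums of such
    totals.\<close>
  define S where "S = (\<lambda>k N. \<Sum>\<mu>\<in>all.msets N. all.wt \<mu> * K k \<mu>)"
  have S: "(\<Sum>w\<in>carrier G. \<Sum>\<mu>\<in>all.msets N. all.wt \<mu> * F (add_mset (conj_class G w, k) \<mu>)) = S k N" for k N
    unfolding S_def K_def sum_distrib_left by (rule sum.swap)
  have "of_nat (Suc N) * (\<Sum>\<mu>\<in>all.msets (Suc N). all.wt \<mu> * F \<mu>) =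
    (\<Sum>b\<in>?B (Suc N). of_nat (snd b) / lab_r b * (\<Sum>\<mu>\<in>all.msets (Suc N - snd b). all.wt \<mu> * F (add_mset b \<mu>)))"
    by (rule all.msets_recursion[of "\<lambda>x. x"]) simp_all
  hence "?g * (of_nat (Suc N) * (\<Sum>\<mu>\<in>all.msets (Suc N). all.wt \<mu> * F \<mu>)) =
    (\<Sum>k\<in>{1..Suc N}. \<Sum>w\<in>carrier G. \<Sum>\<mu>\<in>all.msets (Suc N - k). all.wt \<mu> * F (add_mset (conj_class G w, k) \<mu>))"
    by (simp only: sum_labels snd_conv)
  hence R: "?g * (of_nat (Suc N) * (\<Sum>\<mu>\<in>all.msets (Suc N). all.wt \<mu> * F \<mu>)) = (\<Sum>k\<in>{1..Suc N}. S k (Suc N - k))"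
    by (simp only: S)
  have "(\<Sum>\<mu>\<in>all.msets N. all.wt \<mu> * ?D \<mu>) =
    (\<Sum>\<mu>\<in>all.msets N. \<Sum>l\<in>?B N. of_nat (count \<mu> l * snd l) * all.wt \<mu> * K (Suc (snd l)) (\<mu> - {#l#}))"
  proof (rule sum_cong)
    fix \<mu> assume \<mu>: "\<mu> \<in> all.msets N"
    have sub: "set_mset \<mu> \<subseteq> ?B N" using \<mu> all.weight_ge[of _ \<mu>] by (auto simp: all.msets_def)
    have "?D \<mu> =
      (\<Sum>l\<in>set_mset \<mu>. of_nat (count \<mu> l) * (of_nat (snd l) * K (Suc (snd l)) (\<mu> - {#l#})))"
      by (rule sum_mset_count_mult)
    also have "\<dots> = (\<Sum>l\<in>?B N. of_nat (count \<mu> l) * (of_nat (snd l) * K (Suc (snd l)) (\<mu> - {#l#})))"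
      using sub labels_finite(1)[of N] by (intro sum.mono_neutral_left) (auto simp: not_in_iff)
    finally show "all.wt \<mu> * ?D \<mu> =
      (\<Sum>l\<in>?B N. of_nat (count \<mu> l * snd l) * all.wt \<mu> * K (Suc (snd l)) (\<mu> - {#l#}))"
      by (simp add: sum_distrib_left mult_ac)
  qed
  also have "\<dots> = (\<Sum>l\<in>?B N. \<Sum>\<mu>\<in>all.msets N. of_nat (count \<mu> l * snd l) * all.wt \<mu> * K (Suc (snd l)) (\<mu> - {#l#}))"
    by (rule sum.swap)
  also have "\<dots> = (\<Sum>l\<in>?B N. of_nat (snd l) / lab_r l * S (Suc (snd l)) (N - snd l))" (is "sum ?l _ = sum ?r _")
  proof (rule sum_cong)
    fix l assume "l \<in> ?B N"
    from all.msets_shift[of "\<lambda>x. x", OF _ this, of "\<lambda>\<mu>. K (Suc (snd l)) (\<mu> - {#l#})"]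
    show "?l l = ?r l"
      by (simp add: S_def sum_distrib_left mult.assoc)
  qed
  finally have 1: "(\<Sum>\<mu>\<in>all.msets N. all.wt \<mu> * ?D \<mu>) =
    (\<Sum>l\<in>?B N. of_nat (snd l) / lab_r l * S (Suc (snd l)) (N - snd l))" .
  have "?g * (\<Sum>\<mu>\<in>all.msets N. all.wt \<mu> * ?D \<mu>) =
    ?g * (\<Sum>k\<in>{1..N}. S (Suc k) (N - k))"
    unfolding 1 sum_labels by (simp add: sum_distrib_left)
  hence 2: "(\<Sum>\<mu>\<in>all.msets N. all.wt \<mu> * ?D \<mu>) =
    (\<Sum>k\<in>{1..N}. S (Suc k) (N - k))" using card_G_nonzero by (simp only: mult_left_cancel HOL.simp_thms)
  \<comment> \<open>A new cycle of length 1 is a new fixed point; one of length k + 1 arises by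
    insertion into a cycle of length k.\<close>
  have "{1..Suc N} = insert 1 (Suc ` {1..N})" by (auto simp: image_iff One_nat_def)
  moreover have "1 \<notin> Suc ` {1..N}" by (auto simp: One_nat_def)
  ultimately have "(\<Sum>k\<in>{1..Suc N}. S k (Suc N - k)) = S 1 N + (\<Sum>k\<in>{1..N}. S (Suc k) (N - k))"
    using sum.reindex[of Suc "{1..N}" "\<lambda>k. S k (Suc N - k)"] by (simp only: sum.insert finite_imageI finite_atLeastAtMost not_False_eq_True if_False HOL.simp_thms) (simp add: comp_def One_nat_def del: image_Suc_atLeastAtMost)
  with R 2 show ?thesis by (simp add: S_def sum.distrib distrib_left mult_ac)
qed

text \<open>Induction on the points: every permutation of the larger set is (a b) \<circ> \<sigma>
  for a unique b and \<sigma>, with b = a for a fixed point. The same step on the side of weights is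
  \<open>wt_insert_point\<close>, so the weights are the proportions of the types.\<close>

lemma sum_types:
  fixes F :: "('a set \<times> nat) multiset \<Rightarrow> complex"
  assumes "finite A"
  shows "(\<Sum>\<sigma> | \<sigma> permutes A. \<Sum>g\<in>A \<rightarrow>\<^sub>E carrier G. F (ctype A g \<sigma>)) =
    fact (card A) * of_nat (card (carrier G)) ^ card A * (\<Sum>\<mu>\<in>all.msets (card A). all.wt \<mu> * F \<mu>)"
  using assms
proof (induction A arbitrary: F rule: finite_induct)
  case empty
  have "ctype {} g \<sigma> = {#}" for g \<sigma> by (simp add: ctype_def)
  thus ?case by (simp add: all.msets_zero)
next
  case (insert a A)
  define K where "K = (\<lambda>k M. \<Sum>w\<in>carrier G. F (add_mset (conj_class G w, k) M))"
  let ?c = "\<lambda>b \<sigma> g w. ctype (insert a A) (g(a := w)) (transpose a b \<circ> \<sigma>)" and ?d = "\<lambda>b \<sigma> g. ctype (insert a A) g (transpose a b \<circ> \<sigma>)"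
  let ?L = "\<lambda>M. \<Sum>l\<in>#M. of_nat (snd l) * K (Suc (snd l)) (M - {#l#})"
  have "(\<Sum>\<sigma> | \<sigma> permutes insert a A. \<Sum>g\<in>insert a A \<rightarrow>\<^sub>E carrier G. F (ctype (insert a A) g \<sigma>)) =
    (\<Sum>b\<in>insert a A. \<Sum>\<sigma> | \<sigma> permutes A. \<Sum>g\<in>insert a A \<rightarrow>\<^sub>E carrier G. F (?d b \<sigma> g))"
    by (rule sum_over_permutations_insert[OF insert.hyps])
  also have "\<dots> = (\<Sum>b\<in>insert a A. \<Sum>\<sigma> | \<sigma> permutes A. \<Sum>g\<in>A \<rightarrow>\<^sub>E carrier G. \<Sum>w\<in>carrier G.
      F (?c b \<sigma> g w))"
  proof (rule sum_cong, rule sum_cong)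
    fix b and \<sigma> :: "nat \<Rightarrow> nat"
    have "inj_on (\<lambda>(w, g). g(a := w)) (carrier G \<times> (A \<rightarrow>\<^sub>E carrier G))" by (rule inj_combinator) (rule insert.hyps)
    hence "(\<Sum>g\<in>insert a A \<rightarrow>\<^sub>E carrier G. F (?d b \<sigma> g)) =
      (\<Sum>(w, g)\<in>carrier G \<times> (A \<rightarrow>\<^sub>E carrier G). F (?c b \<sigma> g w))"
      by (simp add: PiE_insert_eq sum.reindex split_def)
    also have "\<dots> = (\<Sum>w\<in>carrier G. \<Sum>g\<in>A \<rightarrow>\<^sub>E carrier G. F (?c b \<sigma> g w))"
      by (rule sum.cartesian_product[symmetric])
    also have "\<dots> = (\<Sum>g\<in>A \<rightarrow>\<^sub>E carrier G. \<Sum>w\<in>carrier G. F (?c b \<sigma> g w))"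
      by (rule sum.swap)
    finally show "(\<Sum>g\<in>insert a A \<rightarrow>\<^sub>E carrier G. F (?d b \<sigma> g)) =
      (\<Sum>g\<in>A \<rightarrow>\<^sub>E carrier G. \<Sum>w\<in>carrier G. F (?c b \<sigma> g w))" .
  qed
  also have "\<dots> = (\<Sum>\<sigma> | \<sigma> permutes A. \<Sum>b\<in>insert a A. \<Sum>g\<in>A \<rightarrow>\<^sub>E carrier G. \<Sum>w\<in>carrier G.
      F (?c b \<sigma> g w))" by (rule sum.swap)
  also have "\<dots> = (\<Sum>\<sigma> | \<sigma> permutes A. \<Sum>g\<in>A \<rightarrow>\<^sub>E carrier G. \<Sum>b\<in>insert a A. \<Sum>w\<in>carrier G.
      F (?c b \<sigma> g w))" by (rule sum_cong, rule sum.swap)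
  also have "\<dots> = (\<Sum>\<sigma> | \<sigma> permutes A. \<Sum>g\<in>A \<rightarrow>\<^sub>E carrier G.
      K 1 (ctype A g \<sigma>) + ?L (ctype A g \<sigma>))"
  proof (rule sum_cong, rule sum_cong)
    fix \<sigma> g assume s: "\<sigma> \<in> {\<sigma>. \<sigma> permutes A}" and g: "g \<in> A \<rightarrow>\<^sub>E carrier G"
    have s': "\<sigma> permutes A" "bij_betw \<sigma> A A" and g': "g \<in> A \<rightarrow> carrier G"
      using s g permutes_imp_bij by auto
    have 1: "(\<Sum>w\<in>carrier G. F (ctype (insert a A) (g(a := w)) (transpose a a \<circ> \<sigma>))) = K 1 (ctype A g \<sigma>)"
      unfolding K_def by (rule sum_cong) (simp add: ctype_insert_fixed[OF insert.hyps s'(1) g'])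
    have 2: "(\<Sum>w\<in>carrier G. F (?c b \<sigma> g w)) =
      K (Suc (snd (cyc_label g \<sigma> b))) (ctype A g \<sigma> - {#cyc_label g \<sigma> b#})" if b: "b \<in> A" for b
    proof -
      let ?P = "path_prod g \<sigma> b (card (orbit \<sigma> b))" and ?k = "Suc (card (orbit \<sigma> b))"
      have P: "?P \<in> carrier G" by (rule path_prod_closed[OF s'(2) b g'])
      have "(\<Sum>w\<in>carrier G. F (?c b \<sigma> g w)) =
        (\<Sum>w\<in>carrier G. F (add_mset (conj_class G (w \<otimes> ?P), ?k) (ctype A g \<sigma> - {#cyc_label g \<sigma> b#})))"
        by (rule sum_cong) (simp add: ctype_insert_cycle[OF insert.hyps s'(1) g' _ b])
      \<comment> \<open>The new component runs over the whole group, so the old cycle product can be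
        absorbed into it.\<close>
      also have "\<dots> = (\<Sum>w\<in>carrier G. F (add_mset (conj_class G w, ?k) (ctype A g \<sigma> - {#cyc_label g \<sigma> b#})))"
        by (rule sum.reindex_bij_witness[of _ "\<lambda>w. w \<otimes> inv ?P" "\<lambda>w. w \<otimes> ?P"]) (use P in \<open>simp_all add: m_assoc\<close>)
      finally show ?thesis by (simp add: K_def cyc_label_def)
    qed
    have "(\<Sum>b\<in>A. K (Suc (snd (cyc_label g \<sigma> b))) (ctype A g \<sigma> - {#cyc_label g \<sigma> b#})) =
      ?L (ctype A g \<sigma>)"
      by (rule sum_cyc_labels[OF insert.hyps(1) s'(2) g'])
    thus "(\<Sum>b\<in>insert a A. \<Sum>w\<in>carrier G. F (?c b \<sigma> g w)) =
      K 1 (ctype A g \<sigma>) + ?L (ctype A g \<sigma>)"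
      unfolding sum.insert[OF insert.hyps] 1 by (simp only: 2 cong: sum.cong)
  qed
  also have "\<dots> = fact (card A) * of_nat (card (carrier G)) ^ card A * (\<Sum>\<mu>\<in>all.msets (card A). all.wt \<mu> *
      (K 1 \<mu> + (\<Sum>l\<in>#\<mu>. of_nat (snd l) * K (Suc (snd l)) (\<mu> - {#l#}))))" by (rule insert.IH)
  also have "\<dots> = fact (card A) * of_nat (card (carrier G)) ^ card A * (of_nat (Suc (card A)) * of_nat (card (carrier G)) *
      (\<Sum>\<mu>\<in>all.msets (Suc (card A)). all.wt \<mu> * F \<mu>))" unfolding K_def by (simp only: wt_insert_point)
  finally show ?case using insert.hyps by (simp add: mult_ac)
qed

lemma sum_spin_perm:
  fixes F :: "(nat \<Rightarrow> nat) \<Rightarrow> complex"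
  shows "finite (carrier (spin_sym n))" "(\<Sum>A\<in>carrier (spin_sym n). F (spin_perm A)) = 2 * (\<Sum>\<sigma> | \<sigma> permutes {1..n}. F \<sigma>)"
proof -
  have im: "spin_perm A permutes {1..n}" if A: "A \<in> carrier (spin_sym n)" for A
  proof -
    obtain u where "u \<in> spin_words n" "A = spin_class n u" using A by (auto simp: spin_carrier)
    thus ?thesis using word_perm_permutes by simp
  qed
  have fib: "finite {A \<in> carrier (spin_sym n). spin_perm A = \<sigma>} \<and> card {A \<in> carrier (spin_sym n). spin_perm A = \<sigma>} = 2"
    if \<sigma>: "\<sigma> permutes {1..n}" for \<sigma>
  proof -
    obtain u where "u \<in> spin_words n" "word_perm u = \<sigma>" using word_perm_surj[OF \<sigma>] by blast
    thus ?thesis using spin_fibre[of u n] by (simp add: card_2_iff)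
  qed
  have U: "carrier (spin_sym n) = (\<Union>\<sigma>\<in>{\<sigma>. \<sigma> permutes {1..n}}. {A \<in> carrier (spin_sym n). spin_perm A = \<sigma>})"
    using im by auto
  have fp: "finite {\<sigma>. \<sigma> permutes {1..n}}" by (rule finite_permutations) simp
  show f: "finite (carrier (spin_sym n))" by (subst U, rule finite_UN_I[OF fp]) (use fib in simp)
  have "(\<Sum>A\<in>carrier (spin_sym n). F (spin_perm A)) =
    (\<Sum>\<sigma> | \<sigma> permutes {1..n}. \<Sum>A\<in>{A \<in> carrier (spin_sym n). spin_perm A = \<sigma>}. F (spin_perm A))"
    by (rule sum.group[OF f fp, symmetric]) (use im in auto)
  also have "\<dots> = (\<Sum>\<sigma> | \<sigma> permutes {1..n}. 2 * F \<sigma>)"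
  proof (rule sum_cong)
    fix \<sigma> assume s: "\<sigma> \<in> {\<sigma>. \<sigma> permutes {1..n}}"
    have "(\<Sum>A\<in>{A \<in> carrier (spin_sym n). spin_perm A = \<sigma>}. F (spin_perm A)) = (\<Sum>A\<in>{A \<in> carrier (spin_sym n). spin_perm A = \<sigma>}. F \<sigma>)"
      by (rule sum.cong) auto
    thus "(\<Sum>A\<in>{A \<in> carrier (spin_sym n). spin_perm A = \<sigma>}. F (spin_perm A)) = 2 * F \<sigma>" using fib s by simp
  qed
  finally show "(\<Sum>A\<in>carrier (spin_sym n). F (spin_perm A)) = 2 * (\<Sum>\<sigma> | \<sigma> permutes {1..n}. F \<sigma>)"
    by (simp add: sum_distrib_left)
qed

lemma wr_carrier: "CW n = (GP n) \<times> carrier (spin_sym n)"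
  using wr_carrier_iff by auto

lemma wr_finite: "finite (CW n)"
  unfolding wr_carrier using sum_spin_perm(1) finite_carrier by (simp add: finite_PiE)

lemma card_wr: "of_nat (card (CW n)) = (2 * fact n * of_nat (card (carrier G)) ^ n :: complex)"
proof -
  have "of_nat (card (carrier (spin_sym n))) = (2 * of_nat (card {\<sigma>. \<sigma> permutes {1..n}}) :: complex)"
    using sum_spin_perm(2)[of "\<lambda>_. 1" n] by simp
  also have "\<dots> = 2 * fact n" using card_permutations[of "{1..n}" n] by simp
  finally show ?thesis by (simp add: wr_carrier card_cartesian_product card_PiE)
qed

lemma card_wr_nonzero: "of_nat (card (CW n)) \<noteq> (0 :: complex)"
  using card_G_nonzero by (simp add: card_wr)

lemma sum_wtype:
  fixes F :: "('a set \<times> nat) multiset \<Rightarrow> complex"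
  shows "(\<Sum>x\<in>CW n. F (wtype n x)) = of_nat (card (CW n)) * (\<Sum>\<mu>\<in>all.msets n. all.wt \<mu> * F \<mu>)"
proof -
  have "(\<Sum>x\<in>CW n. F (wtype n x)) =
    (\<Sum>g\<in>GP n. \<Sum>A\<in>carrier (spin_sym n). F (ctype {1..n} g (spin_perm A)))"
    unfolding wr_carrier sum.cartesian_product by (simp add: wtype_def split_def)
  also have "\<dots> = (\<Sum>g\<in>GP n. 2 * (\<Sum>\<sigma> | \<sigma> permutes {1..n}. F (ctype {1..n} g \<sigma>)))"
    by (rule sum_cong) (rule sum_spin_perm(2))
  also have "\<dots> = 2 * (\<Sum>\<sigma> | \<sigma> permutes {1..n}. \<Sum>g\<in>GP n. F (ctype {1..n} g \<sigma>))"
    unfolding sum_distrib_left[symmetric] by (subst sum.swap) (rule HOL.refl)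
  also have "\<dots> = of_nat (card (CW n)) * (\<Sum>\<mu>\<in>all.msets n. all.wt \<mu> * F \<mu>)"
    by (simp add: sum_types card_wr)
  finally show ?thesis .
qed

lemma card_wtype:
  assumes "\<mu> \<in> all.msets n"
  shows "of_nat (card {x \<in> CW n. wtype n x = \<mu>}) = of_nat (card (CW n)) * all.wt \<mu>"
proof -
  have "of_nat (card {x \<in> CW n. wtype n x = \<mu>}) = (\<Sum>x\<in>CW n. if wtype n x = \<mu> then 1 else 0 :: complex)"
    using wr_finite by (simp add: sum.If_cases Int_def)
  also have "\<dots> = of_nat (card (CW n)) * (\<Sum>\<nu>\<in>all.msets n. all.wt \<nu> * (if \<nu> = \<mu> then 1 else 0))"
    by (rule sum_wtype)
  also have "(\<Sum>\<nu>\<in>all.msets n. all.wt \<nu> * (if \<nu> = \<mu> then 1 else 0)) = all.wt \<mu>"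
    using assms all.msets_finite by (simp add: if_distrib[of "(*) _"] cong: if_cong)
  finally show ?thesis .
qed

section \<open>The scalar product as a sum over conjugacy classes\<close>

lemma at_class_eq:
  assumes f: "f \<in> class_functions G" and c: "c \<in> Cls" "x \<in> c"
  shows "at_class f c = f x"
proof -
  have "(SOME x. x \<in> c) \<in> c" using c(2) by (rule someI[of "\<lambda>x. x \<in> c"])
  moreover have x: "x \<in> carrier G" "c = conj_class G x" using conj_classes_eq[OF c] by auto
  ultimately obtain y where "y \<in> carrier G" "(SOME x. x \<in> c) = y \<otimes> x \<otimes> inv y" by (auto simp: conj_class_def)
  thus ?thesis using f x(1) by (simp add: at_class_def class_functions_def)
qed

lemma at_conj_class: "f \<in> class_functions G \<Longrightarrow> x \<in> carrier G \<Longrightarrow> at_class f (conj_class G x) = f x"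
  by (rule at_class_eq) (simp_all add: conj_class_in conj_class_self)

lemma class_inv_conj: "x \<in> carrier G \<Longrightarrow> class_inv G (conj_class G x) = conj_class G (inv x)"
proof -
  assume x: "x \<in> carrier G"
  have "inv (y \<otimes> x \<otimes> inv y) = y \<otimes> inv x \<otimes> inv y" if "y \<in> carrier G" for y
    using x that by (simp add: inv_mult_group m_assoc)
  thus ?thesis by (auto simp: class_inv_def conj_class_def image_iff)+
qed

lemma inner_classes:
  assumes "f \<in> class_functions G" "g \<in> class_functions G"
  shows "inner f g = (\<Sum>c\<in>Cls. at_class f c * at_class g (class_inv G c) / of_nat (centralizer_order G c))"
proof -
  have "(\<Sum>x\<in>carrier G. f x * g (inv x)) =
      (\<Sum>x\<in>carrier G. at_class f (conj_class G x) * at_class g (class_inv G (conj_class G x)))"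
    by (rule sum_cong) (simp add: at_conj_class[OF assms(1)] at_conj_class[OF assms(2)] class_inv_conj)
  thus ?thesis unfolding sum_classes[of "\<lambda>c. at_class f c * at_class g (class_inv G c)"]
    using card_G_nonzero by (simp add: inner_def)
qed

section \<open>Exponential series in the class variables\<close>

definition av :: "'a set \<times> nat \<Rightarrow> 'a fpoly" where
  "av b = a_neg_class G (snd b) (fst b)"

definition avm :: "('a set \<times> nat) multiset \<Rightarrow> 'a fpoly" where
  "avm \<mu> = (\<Prod>b\<in>#\<mu>. av b)"

lemma avm_simps [simp]: "avm {#} = 1" "avm (add_mset b \<mu>) = av b * avm \<mu>" "avm (\<mu> + \<nu>) = avm \<mu> * avm \<nu>"
  by (simp_all add: avm_def)

text \<open>This is the characteristic map, expressed through the values \<open>u \<mu> = 2\<^bsup>l(\<mu>)/2\<^esup> f(\<mu>)\<close>.\<close>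

definition gen :: "nat \<Rightarrow> (('a set \<times> nat) multiset \<Rightarrow> complex) \<Rightarrow> 'a fpoly" where
  "gen n u = (\<Sum>\<mu>\<in>odd.msets n. fconst (odd.wt \<mu>) * (fconst (u \<mu>) * avm \<mu>))"

lemma gen_cong: "(\<And>\<mu>. \<mu> \<in> odd.msets n \<Longrightarrow> u \<mu> = v \<mu>) \<Longrightarrow> gen n u = gen n v"
  by (simp add: gen_def)

lemma gen_add: "gen n (\<lambda>\<mu>. u \<mu> + v \<mu>) = gen n u + gen n v"
  by (simp add: gen_def fconst_add algebra_simps sum.distrib)

lemma gen_zero [simp]: "gen n (\<lambda>_. 0) = 0"
  by (simp add: gen_def)

lemma gen_scale: "gen n (\<lambda>\<mu>. c * u \<mu>) = fconst c * gen n u"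
  unfolding gen_def sum_distrib_left by (rule sum.cong) (simp_all add: fconst_mult mult_ac)

lemma gen_sum: "gen n (\<lambda>\<mu>. \<Sum>i\<in>I. u i \<mu>) = (\<Sum>i\<in>I. gen n (u i))"
  by (induction I rule: infinite_finite_induct) (simp_all add: gen_add)

lemma sum_odd_labels:
  fixes X :: "'a set \<times> nat \<Rightarrow> 'd :: comm_monoid_add"
  shows "(\<Sum>b\<in>{b \<in> labels_odd. snd b \<le> N}. X b) = (\<Sum>n\<le>N. if odd n then \<Sum>c\<in>Cls. X (c, n) else 0)"
proof -
  have "{b \<in> labels_odd. snd b \<le> N} = Cls \<times> {n \<in> {..N}. odd n}" by (auto simp: labels_odd_def)
  hence "(\<Sum>b\<in>{b \<in> labels_odd. snd b \<le> N}. X b) = (\<Sum>c\<in>Cls. \<Sum>n\<in>{n \<in> {..N}. odd n}. X (c, n))"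
    by (simp add: sum.cartesian_product split_def)
  also have "\<dots> = (\<Sum>n\<in>{n \<in> {..N}. odd n}. \<Sum>c\<in>Cls. X (c, n))" by (rule sum.swap)
  also have "\<dots> = (\<Sum>n\<le>N. if odd n then \<Sum>c\<in>Cls. X (c, n) else 0)"
    by (rule sum.inter_filter) simp
  finally show ?thesis .
qed

lemma lab_r_pair: "lab_r (c, n) = of_nat n * of_nat (centralizer_order G c)"
  by (simp add: lab_r_def)

text \<open>\<gamma> is expanded in irreducible characters and each scalar product over classes. The
  exponent becomes linear in the class variables with coefficients 2 \<gamma>(c) / r, the shape met
  in the recursion over multisets.\<close>

lemma a_neg_classes:
  assumes \<gamma>: "\<gamma> \<in> class_functions G" and n: "odd n"
  shows "fconst (2 / of_nat n) * a_neg G n \<gamma> = (\<Sum>c\<in>Cls. fconst (2 * at_class \<gamma> c / lab_r (c, n)) * av (c, n))"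
proof -
  have "fconst (2 / of_nat n) * a_neg G n \<gamma> = (\<Sum>\<beta>\<in>irr_chars G. fconst (2 / of_nat n * inner \<gamma> \<beta>) * fvar (n, \<beta>))"
    unfolding a_neg_def sum_distrib_left
    by (rule sum.cong) (simp_all only: fconst_mult mult.assoc irr_coords_inner[OF \<gamma>])
  also have "\<dots> = (\<Sum>\<beta>\<in>irr_chars G. (\<Sum>c\<in>Cls. fconst (2 * at_class \<gamma> c / lab_r (c, n)) *
      (fconst (at_class \<beta> (class_inv G c)) * fvar (n, \<beta>))))"
  proof (rule sum_cong)
    fix \<beta> assume \<beta>: "\<beta> \<in> irr_chars G"
    have "2 / of_nat n * inner \<gamma> \<beta> = (\<Sum>c\<in>Cls. 2 * at_class \<gamma> c / lab_r (c, n) * at_class \<beta> (class_inv G c))"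
      unfolding inner_classes[OF \<gamma> irr_class_function[OF \<beta>]] sum_distrib_left by (simp add: lab_r_pair mult_ac)
    thus "fconst (2 / of_nat n * inner \<gamma> \<beta>) * fvar (n, \<beta>) = (\<Sum>c\<in>Cls. fconst (2 * at_class \<gamma> c / lab_r (c, n)) *
      (fconst (at_class \<beta> (class_inv G c)) * fvar (n, \<beta>)))"
      by (simp only: fconst_sum fconst_mult sum_distrib_right mult.assoc)
  qed
  also have "\<dots> = (\<Sum>c\<in>Cls. fconst (2 * at_class \<gamma> c / lab_r (c, n)) * av (c, n))"
    by (subst sum.swap) (simp add: av_def a_neg_class_def sum_distrib_left)
  finally show ?thesis .
qed

text \<open>The left side satisfies the recursion of \<open>ops_exp_unique\<close>: since its values
  are products over labels, \<open>msets_recursion\<close> splits off one class variable at a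
  time.\<close>

lemma gen_exp_left:
  assumes \<gamma>: "\<gamma> \<in> class_functions G"
  shows "gen N (\<lambda>\<mu>. \<Prod>b\<in>#\<mu>. 2 * at_class \<gamma> (fst b)) * p =
    ops_exp (\<lambda>n q. if odd n then fconst (2 / of_nat n) * (a_neg G n \<gamma> * q) else 0) N p"
proof -
  let ?S = "\<lambda>b :: 'a set \<times> nat. 2 * at_class \<gamma> (fst b)" and ?X = "\<lambda>N. gen N (\<lambda>\<mu>. \<Prod>b\<in>#\<mu>. 2 * at_class \<gamma> (fst b))"
  define A where "A = (\<lambda>n q. if odd n then fconst (2 / of_nat n) * (a_neg G n \<gamma> * q) else 0)"
  interpret commuting_series A by standard (auto simp: A_def algebra_simps)
  have rec: "of_nat N * ?X N = (\<Sum>n\<le>N. of_nat n * A n (?X (N - n)))" for N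
  proof -
    have "of_nat N * ?X N = (\<Sum>b\<in>{b \<in> labels_odd. snd b \<le> N}. fconst (of_nat (snd b) / lab_r b) *
      (\<Sum>\<mu>\<in>odd.msets (N - snd b). fconst (odd.wt \<mu>) * (fconst (\<Prod>b\<in>#add_mset b \<mu>. ?S b) * avm (add_mset b \<mu>))))"
      unfolding gen_def by (rule odd.msets_recursion) (simp_all add: fconst_mult)
    also have "\<dots> = (\<Sum>b\<in>{b \<in> labels_odd. snd b \<le> N}. of_nat (snd b) * (fconst (?S b / lab_r b) * av b * ?X (N - snd b)))" (is "sum ?l _ = sum ?r _")
    proof (rule sum_cong)
      fix b
      have k: "fconst (of_nat (snd b) / lab_r b) * fconst (?S b) = (of_nat (snd b) * fconst (?S b / lab_r b) :: 'a fpoly)"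
        by (simp flip: fconst_mult fconst_simps(3))
      have t: "fconst (of_nat (snd b) / lab_r b) * (fconst w * (fconst (?S b * P) * (av b * a))) =
        of_nat (snd b) * (fconst (?S b / lab_r b) * av b * (fconst w * (fconst P * a)))" for w P a
      proof -
        have "fconst (of_nat (snd b) / lab_r b) * (fconst w * (fconst (?S b * P) * (av b * a))) =
          (fconst (of_nat (snd b) / lab_r b) * fconst (?S b)) * (av b * (fconst w * (fconst P * a)))"
          unfolding fconst_mult[of "?S b" P] by (simp only: mult_ac)
        thus ?thesis unfolding k by (simp only: mult_ac)
      qed
      show "?l b = ?r b"
        unfolding gen_def sum_distrib_left image_mset_add_mset prod_mset.add_mset avm_simps t ..
    qed
    also have "\<dots> = (\<Sum>n\<le>N. of_nat n * A n (?X (N - n)))"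
      unfolding sum_odd_labels
    proof (rule sum_cong)
      fix n
      show "(if odd n then \<Sum>c\<in>Cls. of_nat (snd (c, n)) * (fconst (?S (c, n) / lab_r (c, n)) * av (c, n) * ?X (N - snd (c, n))) else 0) =
        of_nat n * A n (?X (N - n))"
        by (simp add: A_def mult.assoc[symmetric] a_neg_classes[OF \<gamma>] sum_distrib_left sum_distrib_right)
    qed
    finally show ?thesis .
  qed
  have "?X N * p = ops_exp A N p"
  proof (rule ops_exp_unique)
    show "?X 0 * p = p" by (simp add: gen_def odd.msets_zero)
    fix N
    have "A n (q * p) = A n q * p" for n q by (simp add: A_def mult_ac)
    thus "of_nat N * (?X N * p) = (\<Sum>n\<le>N. of_nat n * A n (?X (N - n) * p))"
      by (simp only: mult.assoc[symmetric] rec sum_distrib_right)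
  qed
  thus ?thesis by (simp only: A_def)
qed

text \<open>The form pairs a value at x with one at x^-1. With the inverse moved onto the first
  function, \<xi> and \<gamma> are evaluated at inverse classes, which is also what a_n(\<gamma>)
  produces on a_(-n)(c).\<close>

definition dual_val :: "('a \<Rightarrow> complex) \<Rightarrow> ('a \<Rightarrow> complex) \<Rightarrow> 'a set \<times> nat \<Rightarrow> complex" where
  "dual_val \<xi> \<gamma> b = at_class \<xi> (class_inv G (fst b)) * at_class \<gamma> (class_inv G (fst b))"

definition a_der :: "('a \<Rightarrow> complex) \<Rightarrow> ('a \<Rightarrow> complex) \<Rightarrow> nat \<Rightarrow> 'a fpoly \<Rightarrow> 'a fpoly" where
  "a_der \<xi> \<gamma> n q = (if odd n then fconst (2 / of_nat n) * a_pos G \<xi> n \<gamma> q else 0)"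

lemma a_der_series: "commuting_series (a_der \<xi> \<gamma>)"
proof
  fix n m p
  have "a_pos G \<xi> n \<gamma> (a_pos G \<xi> m \<gamma> p) = a_pos G \<xi> m \<gamma> (a_pos G \<xi> n \<gamma> p)"
    unfolding a_pos_def by (rule derivation_comm; rule exI; rule case_prod_beta)
  moreover have "a_pos G \<xi> n \<gamma> (fconst c * p) = fconst c * a_pos G \<xi> n \<gamma> p" for n c p
    unfolding a_pos_def by (rule derivation_scale)
  moreover have "a_pos G \<xi> n \<gamma> 0 = 0" for n unfolding a_pos_def by simp
  ultimately show "a_der \<xi> \<gamma> n (a_der \<xi> \<gamma> m p) = a_der \<xi> \<gamma> m (a_der \<xi> \<gamma> n p)"
    by (simp add: a_der_def mult_ac)
qed (simp_all add: a_der_def a_pos_def derivation_add derivation_scale distrib_left mult.left_commute)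

text \<open>The 2/n of the exponent cancels the n/2 of the commutation rule, and the sum over
  irreducible characters is the expansion of the product of \<xi> and \<gamma> at the class
  c^-1.\<close>

lemma a_der_av:
  assumes \<xi>: "\<xi> \<in> class_functions G" and \<gamma>: "\<gamma> \<in> class_functions G" and b: "b \<in> labels_odd" and n: "odd n"
  shows "fconst (2 / of_nat n) * a_pos G \<xi> n \<gamma> (av b) = (if snd b = n then fconst (dual_val \<xi> \<gamma> b) else 0)"
proof -
  let ?f = "\<lambda>x. \<xi> x * \<gamma> x"
  have f: "?f \<in> class_functions G" using \<xi> \<gamma> by (simp add: class_functions_def)
  have bf: "base_form G \<xi> \<gamma> \<beta> = inner ?f \<beta>" for \<beta> by (simp add: base_form_def inner_def)
  obtain c k where bk: "b = (c, k)" "c \<in> Cls" using b by (auto simp: labels_odd_def)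
  have "a_pos G \<xi> n \<gamma> (av b) = (\<Sum>\<beta>\<in>irr_chars G. fconst (at_class \<beta> (class_inv G c)) *
      fconst (if n = k then of_nat n / 2 * inner ?f \<beta> else 0))"
    unfolding a_pos_def av_def a_neg_class_def by (simp add: derivation_sum derivation_scale bf bk cong: if_cong)
  also have "\<dots> = fconst (if n = k then of_nat n / 2 * (\<Sum>\<beta>\<in>irr_chars G. inner ?f \<beta> * at_class \<beta> (class_inv G c)) else 0)"
    by (simp add: fconst_mult[symmetric] fconst_sum[symmetric] sum_distrib_left mult_ac)
  also have "(\<Sum>\<beta>\<in>irr_chars G. inner ?f \<beta> * at_class \<beta> (class_inv G c)) = dual_val \<xi> \<gamma> b"
    using fun_cong[OF irr_expansion[OF f], of "SOME x. x \<in> class_inv G c"] by (simp add: at_class_def dual_val_def bk)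
  finally show ?thesis using n by (auto simp: bk fconst_mult[symmetric] odd_pos)
qed

text \<open>The derivation removes one label of size n from a monomial, counted with multiplicity;
  \<open>msets_shift\<close> turns the multiplicity and the weight into the weight of the smaller
  multiset.\<close>

lemma a_der_gen:
  assumes \<xi>: "\<xi> \<in> class_functions G" and \<gamma>: "\<gamma> \<in> class_functions G" and n: "odd n"
  shows "a_der \<xi> \<gamma> n (gen m u) = (if n \<le> m then \<Sum>c\<in>Cls. fconst (dual_val \<xi> \<gamma> (c, n) / lab_r (c, n)) *
    gen (m - n) (\<lambda>\<nu>. u (add_mset (c, n) \<nu>)) else 0)"
proof -
  interpret D: commuting_series "a_der \<xi> \<gamma>" by (rule a_der_series)
  let ?S = "dual_val \<xi> \<gamma>" and ?B = "{b \<in> labels_odd. snd b \<le> m}"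
  let ?T = "\<lambda>b \<mu>. fconst (u \<mu>) * (of_nat (count \<mu> b) * (fconst (?S b) * avm (\<mu> - {#b#})))"
  have avm: "a_der \<xi> \<gamma> n (avm \<mu>) = (\<Sum>b\<in>?B. if snd b = n then of_nat (count \<mu> b) * (fconst (?S b) * avm (\<mu> - {#b#})) else 0)"
    if \<mu>: "\<mu> \<in> odd.msets m" for \<mu>
  proof -
    have s: "set_mset \<mu> \<subseteq> ?B" using \<mu> odd.weight_ge[of _ \<mu>] by (auto simp: odd.msets_def)
    have "a_der \<xi> \<gamma> n (avm \<mu>) = (\<Sum>b\<in>#\<mu>. fconst (2 / of_nat n) * a_pos G \<xi> n \<gamma> (av b) * avm (\<mu> - {#b#}))"
      using n unfolding a_der_def a_pos_def avm_def derivation_prod_mset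
      by (simp add: sum_mset_distrib_left mult.assoc image_mset.compositionality comp_def)
    also have "\<dots> = (\<Sum>b\<in>#\<mu>. if snd b = n then fconst (?S b) * avm (\<mu> - {#b#}) else 0)"
    proof (rule arg_cong[of _ _ sum_mset], rule image_mset_cong)
      fix b assume "b \<in># \<mu>"
      hence "b \<in> labels_odd" using s by auto
      thus "fconst (2 / of_nat n) * a_pos G \<xi> n \<gamma> (av b) * avm (\<mu> - {#b#}) = (if snd b = n then fconst (?S b) * avm (\<mu> - {#b#}) else 0)"
        by (simp add: a_der_av[OF \<xi> \<gamma> _ n])
    qed
    also have "\<dots> = (\<Sum>b\<in>set_mset \<mu>. of_nat (count \<mu> b) * (if snd b = n then fconst (?S b) * avm (\<mu> - {#b#}) else 0))"
      by (rule sum_mset_count_mult)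
    also have "\<dots> = (\<Sum>b\<in>?B. of_nat (count \<mu> b) * (if snd b = n then fconst (?S b) * avm (\<mu> - {#b#}) else 0))"
      using s labels_finite(2)[of m] by (intro sum.mono_neutral_left) (auto simp: not_in_iff)
    finally show ?thesis by (simp add: if_distrib[of "\<lambda>x. _ * x"] cong: if_cong)
  qed
  have "a_der \<xi> \<gamma> n (gen m u) = (\<Sum>\<mu>\<in>odd.msets m. \<Sum>b\<in>?B. if snd b = n then
      fconst (odd.wt \<mu>) * ?T b \<mu> else 0)"
    unfolding gen_def D.A_sum
  proof (rule sum_cong)
    fix \<mu> assume "\<mu> \<in> odd.msets m"
    thus "a_der \<xi> \<gamma> n (fconst (odd.wt \<mu>) * (fconst (u \<mu>) * avm \<mu>)) = (\<Sum>b\<in>?B. if snd b = n then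
      fconst (odd.wt \<mu>) * ?T b \<mu> else 0)"
      by (simp add: D.A_scale avm sum_distrib_left if_distrib[of "\<lambda>x. _ * x"] cong: if_cong)
  qed
  also have "\<dots> = (\<Sum>b\<in>?B. if snd b = n then \<Sum>\<mu>\<in>odd.msets m.
      fconst (odd.wt \<mu>) * ?T b \<mu> else 0)"
    by (subst sum.swap) (rule sum.cong, simp_all)
  also have "\<dots> = (\<Sum>b\<in>?B. if snd b = n then fconst (?S b / lab_r b) * gen (m - snd b) (\<lambda>\<nu>. u (add_mset b \<nu>)) else 0)" (is "sum ?l _ = sum ?r _")
  proof (rule sum_cong)
    fix b assume b: "b \<in> ?B"
    hence k: "0 < snd b" using odd.size_pos by auto
    \<comment> \<open>\<open>msets_shift\<close> counts a copy of \<open>b\<close> with its size as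
      a factor; the size is introduced here and divided out again by \<open>k2\<close>.\<close>
    have k1: "of_nat (snd b) * fconst (?S b / of_nat (snd b)) = (fconst (?S b) :: 'a fpoly)"
      using k by (simp flip: fconst_mult fconst_simps(3))
    have k2: "fconst (of_nat (snd b) / lab_r b) * fconst (?S b / of_nat (snd b)) = (fconst (?S b / lab_r b) :: 'a fpoly)"
      using k by (simp flip: fconst_mult)
    have "(\<Sum>\<mu>\<in>odd.msets m. fconst (odd.wt \<mu>) * ?T b \<mu>) =
      (\<Sum>\<mu>\<in>odd.msets m. fconst (of_nat (count \<mu> b * snd b) * odd.wt \<mu>) * (fconst (?S b / of_nat (snd b)) * (fconst (u \<mu>) * avm (\<mu> - {#b#}))))"
      by (rule sum_cong, subst k1[symmetric]) (simp add: fconst_mult mult_ac del: of_nat_mult, simp add: mult_ac)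
    also have "\<dots> = (\<Sum>\<nu>\<in>odd.msets (m - snd b). fconst (of_nat (snd b) / lab_r b * odd.wt \<nu>) *
      (fconst (?S b / of_nat (snd b)) * (fconst (u (add_mset b \<nu>)) * avm (add_mset b \<nu> - {#b#}))))"
      by (rule odd.msets_shift) (use b in simp_all)
    also have "\<dots> = fconst (?S b / lab_r b) * gen (m - snd b) (\<lambda>\<nu>. u (add_mset b \<nu>))"
    proof -
      have "fconst (of_nat (snd b) / lab_r b * w) * (fconst (?S b / of_nat (snd b)) * (x * y)) =
        fconst (?S b / lab_r b) * (fconst w * (x * y))" for w and x y :: "'a fpoly"
        unfolding k2[symmetric] fconst_mult by (simp only: mult_ac)
      thus ?thesis unfolding gen_def sum_distrib_left by (simp only: add_mset_remove_trivial)
    qed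
    finally show "?l b = ?r b" by simp
  qed
  also have "\<dots> = (\<Sum>j\<le>m. if j = n then \<Sum>c\<in>Cls. fconst (?S (c, n) / lab_r (c, n)) * gen (m - n) (\<lambda>\<nu>. u (add_mset (c, n) \<nu>)) else 0)"
    unfolding sum_odd_labels by (rule sum.cong) (use n in auto)
  also have "\<dots> = (if n \<le> m then \<Sum>c\<in>Cls. fconst (?S (c, n) / lab_r (c, n)) * gen (m - n) (\<lambda>\<nu>. u (add_mset (c, n) \<nu>)) else 0)"
    by simp
  finally show ?thesis .
qed

text \<open>This is \<open>H\<^sub>N\<close>, in the normalisation of \<^term>\<open>gen\<close>.\<close>

definition skew :: "('a set \<times> nat \<Rightarrow> complex) \<Rightarrow> nat \<Rightarrow> (('a set \<times> nat) multiset \<Rightarrow> complex) \<Rightarrow> ('a set \<times> nat) multiset \<Rightarrow> complex" where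
  "skew S N u \<tau> = (\<Sum>\<sigma>\<in>odd.msets N. odd.wt \<sigma> * ((\<Prod>b\<in>#\<sigma>. S b) * u (\<sigma> + \<tau>)))"

lemma skew_zero [simp]: "skew S N (\<lambda>_. 0) \<tau> = 0"
  by (simp add: skew_def)

lemma skew_0: "skew S 0 u = u"
  by (rule ext) (simp add: skew_def odd.msets_zero)

text \<open>One label is removed from the part \<sigma> that is split off and joins \<tau>; the
  argument of u stays the same multiset.\<close>

lemma skew_recursion:
  "of_nat N * skew S N u \<tau> = (\<Sum>n\<le>N. if odd n then \<Sum>c\<in>Cls. of_nat n * (S (c, n) / lab_r (c, n) *
    skew S (N - n) u (add_mset (c, n) \<tau>)) else 0)"
proof -
  have "of_nat N * skew S N u \<tau> = (\<Sum>b\<in>{b \<in> labels_odd. snd b \<le> N}. of_nat (snd b) / lab_r b *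
    (\<Sum>\<sigma>\<in>odd.msets (N - snd b). odd.wt \<sigma> * ((\<Prod>b\<in>#add_mset b \<sigma>. S b) * u (add_mset b \<sigma> + \<tau>))))"
    unfolding skew_def by (rule odd.msets_recursion[of "\<lambda>x. x"]) simp_all
  also have "\<dots> = (\<Sum>b\<in>{b \<in> labels_odd. snd b \<le> N}. of_nat (snd b) * (S b / lab_r b * skew S (N - snd b) u (add_mset b \<tau>)))" (is "sum ?l _ = sum ?r _")
  proof (rule sum_cong)
    fix b
    have "(\<Sum>\<sigma>\<in>odd.msets (N - snd b). odd.wt \<sigma> * ((\<Prod>b\<in>#add_mset b \<sigma>. S b) * u (add_mset b \<sigma> + \<tau>))) =
      S b * skew S (N - snd b) u (add_mset b \<tau>)"
      by (simp add: skew_def sum_distrib_left mult_ac)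
    thus "?l b = ?r b" by simp
  qed
  finally show ?thesis by (simp add: sum_odd_labels cong: if_cong)
qed

text \<open>By \<open>a_der_gen\<close> one derivation adds a label to the argument of
  \<open>skew\<close>, which is the step of \<open>skew_recursion\<close>; so
  \<open>ops_exp_unique\<close> applies. A single bound \<open>M\<close> serves for all N, because
  splitting off only lowers the degree.\<close>

lemma gen_exp_skew:
  assumes \<xi>: "\<xi> \<in> class_functions G" and \<gamma>: "\<gamma> \<in> class_functions G" and u: "\<And>m. M \<le> m \<Longrightarrow> u m = (\<lambda>_. 0)"
  shows "(\<Sum>k<M. gen k (skew (dual_val \<xi> \<gamma>) N (u (N + k)))) = ops_exp (a_der \<xi> \<gamma>) N (\<Sum>k<M. gen k (u k))"
proof -
  interpret D: commuting_series "a_der \<xi> \<gamma>" by (rule a_der_series)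
  let ?S = "dual_val \<xi> \<gamma>"
  define X where "X = (\<lambda>N. \<Sum>k<M. gen k (skew ?S N (u (N + k))))"
  have "X N = ops_exp (a_der \<xi> \<gamma>) N (\<Sum>k<M. gen k (u k))"
  proof (rule D.ops_exp_unique)
    show "X 0 = (\<Sum>k<M. gen k (u k))" by (simp add: X_def skew_0)
  next
    fix N
    have step: "a_der \<xi> \<gamma> n (X (N - n)) = (\<Sum>k<M. \<Sum>c\<in>Cls. fconst (?S (c, n) / lab_r (c, n)) *
        gen k (\<lambda>\<tau>. skew ?S (N - n) (u (N + k)) (add_mset (c, n) \<tau>)))" if n: "odd n" "n \<le> N" for n
    proof -
      define g where "g = (\<lambda>j. \<Sum>c\<in>Cls. fconst (?S (c, n) / lab_r (c, n)) *
        gen j (\<lambda>\<tau>. skew ?S (N - n) (u (N + j)) (add_mset (c, n) \<tau>)))"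
      have "a_der \<xi> \<gamma> n (X (N - n)) = (\<Sum>k<M. if n \<le> k then g (k - n) else 0)"
        unfolding X_def D.A_sum
      proof (rule sum_cong)
        fix k
        show "a_der \<xi> \<gamma> n (gen k (skew ?S (N - n) (u (N - n + k)))) = (if n \<le> k then g (k - n) else 0)"
          unfolding a_der_gen[OF \<xi> \<gamma> n(1)] g_def using n(2) by (cases "n \<le> k") (simp_all add: add.commute)
      qed
      also have "\<dots> = (\<Sum>k\<in>{n..<M}. g (k - n))" by (rule sum.mono_neutral_cong_right) auto
      also have "\<dots> = (\<Sum>j\<in>{..<M - n}. g j)"
        by (rule sum.reindex_bij_witness[of _ "\<lambda>j. j + n" "\<lambda>k. k - n"]) auto
      \<comment> \<open>For j at least M - n the degree N + j is at least M, as n \<le> N, so the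
        added terms vanish.\<close>
      also have "\<dots> = (\<Sum>j<M. g j)"
      proof (rule sum.mono_neutral_left)
        have "u (N + j) = (\<lambda>_. 0)" if "j \<in> {..<M} - {..<M - n}" for j using u[of "N + j"] that n(2) by auto
        thus "\<forall>j\<in>{..<M} - {..<M - n}. g j = 0" by (simp add: g_def)
      qed auto
      finally show ?thesis by (simp only: g_def)
    qed
    have "of_nat N * X N = (\<Sum>k<M. gen k (\<lambda>\<tau>. of_nat N * skew ?S N (u (N + k)) \<tau>))"
      by (simp add: X_def gen_scale sum_distrib_left)
    also have "\<dots> = (\<Sum>k<M. \<Sum>n\<le>N. if odd n then \<Sum>c\<in>Cls. of_nat n * (fconst (?S (c, n) / lab_r (c, n)) *
        gen k (\<lambda>\<tau>. skew ?S (N - n) (u (N + k)) (add_mset (c, n) \<tau>))) else 0)" (is "sum ?l _ = sum ?r _")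
    proof (rule sum_cong)
      fix k
      have i: "gen k (\<lambda>\<tau>. if odd n then F \<tau> else 0) = (if odd n then gen k F else 0)" for n F by simp
      show "?l k = ?r k"
        unfolding skew_recursion gen_sum i gen_scale fconst_simps ..
    qed
    also have "\<dots> = (\<Sum>n\<le>N. \<Sum>k<M. if odd n then \<Sum>c\<in>Cls. of_nat n * (fconst (?S (c, n) / lab_r (c, n)) *
        gen k (\<lambda>\<tau>. skew ?S (N - n) (u (N + k)) (add_mset (c, n) \<tau>))) else 0)" by (rule sum.swap)
    also have "\<dots> = (\<Sum>n\<le>N. of_nat n * a_der \<xi> \<gamma> n (X (N - n)))" (is "sum ?l _ = sum ?r _")
    proof (rule sum_cong)
      fix n assume n: "n \<in> {..N}"
      show "?l n = ?r n"
      proof (cases "odd n")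
        case True
        thus ?thesis using n by (simp add: step sum_distrib_left)
      qed (simp add: a_der_def)
    qed
    finally show "of_nat N * X N = (\<Sum>n\<le>N. of_nat n * a_der \<xi> \<gamma> n (X (N - n)))" .
  qed
  thus ?thesis by (simp only: X_def)
qed

section \<open>The class function to average against, and sums over Young subgroups\<close>

definition Psi :: "nat \<Rightarrow> 'a wr_elt \<Rightarrow> 'a fpoly" where
  "Psi n x = (if otype n x then fconst (wsgn n x * of_real (sqrt 2) ^ size (wtype n x)) * avm (wtype n x) else 0)"

lemma Psi_conj:
  assumes "x \<in> CW n" "y \<in> CW n"
  shows "Psi n (wconj n y x) = Psi n x"
  using assms by (simp add: Psi_def wtype_conj otype_conj wsgn_conj)

lemma Psi_ycomb:
  assumes "x \<in> CW n" "y \<in> CW m"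
  shows "Psi (n + m) (ycomb n m x y) = Psi n x * Psi m y"
  using assms by (simp add: Psi_def wtype_ycomb otype_ycomb wsgn_ycomb power_add fconst_mult mult_ac)

lemma wr_z_left: 
  assumes "x \<in> CW n" "y \<in> CW n"
  shows "wconj n y (wz n x) =
    wz n (wconj n y x)"
proof -
  obtain g u where x: "x = (g, spin_class n u)" "g \<in> GP n" "u \<in> spin_words n" using assms(1) by (rule wr_cases)
  obtain h v where y: "y = (h, spin_class n v)" "h \<in> GP n" "v \<in> spin_words n" using assms(2) by (rule wr_cases)
  have zu: "zl # u \<in> spin_words n" using x(3) by simp
  have w: "v @ (zl # u) @ inv_word v \<in> spin_words n" "zl # v @ u @ inv_word v \<in> spin_words n" using x(3) y(3) by simp_all
  interpret W: group "W n" by (rule wr_group)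
  have c: "wconj n y x \<in> CW n" using assms by simp
  then obtain g' where g': "wconj n y x = (g', spin_class n (v @ u @ inv_word v))" "g' \<in> GP n"
    unfolding x(1) y(1) wr_conj[OF x(2,3) y(2,3)] wr_carrier_iff by blast
  have e: "spin_class n (v @ (zl # u) @ inv_word v) = spin_class n (zl # v @ u @ inv_word v)"
    unfolding spin_class_iff[OF w]
  proof (rule conjI)
    show "clif_word (v @ (zl # u) @ inv_word v) = clif_word (zl # v @ u @ inv_word v)"
      by (rule ext) (simp only: clif_word_append clif_zl append_Cons o_apply clif_word_negf)
  qed simp
  have "wconj n y (wz n x) = (g', spin_class n (v @ (zl # u) @ inv_word v))"
    using g'(1) unfolding x(1) y(1) wr_z_mult[OF x(2,3)] wr_conj[OF x(2,3) y(2,3)] wr_conj[OF x(2) zu y(2,3)] by simp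
  thus ?thesis unfolding e g'(1) using wr_z_mult[OF g'(2), of "v @ u @ inv_word v"] x(3) y(3) by simp
qed

lemma tens_z:
  assumes "f \<in> R_minus G n" "g \<in> R_minus G m" "x \<in> CW n" "y \<in> CW m"
  shows "tens f g (wz n x, wz m y) = tens f g (x, y)"
    "tens f g (wz n x, y) = - tens f g (x, y)"
  using R_minusD(3)[OF assms(1,3)] R_minusD(3)[OF assms(2,4)] by (simp_all add: tens_def)

text \<open>\<open>phi\<close> picks some factorisation. By \<open>ycomb_inj\<close> the only other
  one multiplies both factors by \<open>z\<close>, so its value is well defined on tensors with this
  invariance; parity is unaffected by \<open>z\<close>.\<close>

lemma phi_ycomb:
  assumes x: "x \<in> CW n" and y: "y \<in> CW m"
    and T: "T (wz n x, wz m y) = T (x, y)"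
  shows "phi G n m T (ycomb n m x y) = (if wr_even x \<and> wr_even y then T (x, y) else 0)"
proof -
  define P where "P = (\<lambda>(x', y'). x' \<in> CW n \<and> y' \<in> CW m \<and> ycomb n m x y = ycomb n m x' y')"
  have "P (x, y)" using x y by (simp add: P_def)
  hence P: "P (SOME p. P p)" by (rule someI)
  obtain x' y' where p: "(SOME p. P p) = (x', y')" by (rule prod.exhaust)
  have "(x' = x \<and> y' = y) \<or> (x' = wz n x \<and> y' = wz m y)"
    using P unfolding p by (intro ycomb_inj[OF x y]) (simp_all only: P_def prod.case)
  hence "(if wr_even x' \<and> wr_even y' then T (x', y') else 0) = (if wr_even x \<and> wr_even y then T (x, y) else 0)"
    using T wsgn_z(4)[OF x] wsgn_z(4)[OF y] by (elim disjE conjE) simp_all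
  moreover have "phi G n m T (ycomb n m x y) = (let (x, y) = (SOME p. P p) in if wr_even x \<and> wr_even y then T (x, y) else 0)"
    using ycomb_young[OF x y] unfolding phi_def P_def ycomb_def by simp
  ultimately show ?thesis by (simp add: p)
qed

text \<open>Multiplication maps pairs two to one onto the Young subgroup, as (x, y) and (zx, zy)
  have the same product.\<close>

lemma sum_young:
  fixes F :: "'a wr_elt \<Rightarrow> 'd :: comm_ring_1"
  shows "(\<Sum>x\<in>CW n. \<Sum>y\<in>CW m. F (ycomb n m x y)) = 2 * (\<Sum>w\<in>young_sub G n m. F w)"
proof -
  let ?X = "CW n \<times> CW m" and ?p = "\<lambda>(x, y). ycomb n m x y"
  have fin: "finite ?X" "finite (young_sub G n m)"
    using wr_finite by (auto simp: young_sub_def)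
  have fib: "{q \<in> ?X. ?p q = ycomb n m x y} = {(x, y), (wz n x, wz m y)}"
    and ne: "(x, y) \<noteq> (wz n x, wz m y)"
    if "x \<in> CW n" "y \<in> CW m" for x y
  proof -
    interpret n: group "W n" by (rule wr_group)
    interpret m: group "W m" by (rule wr_group)
    have z: "wz n x \<in> CW n" "wz m y \<in> CW m" using that wr_z_carrier by simp_all
    show "{q \<in> ?X. ?p q = ycomb n m x y} = {(x, y), (wz n x, wz m y)}"
    proof (rule Set.set_eqI)
      fix q :: "'a wr_elt \<times> 'a wr_elt"
      obtain x' y' where q: "q = (x', y')" by (rule prod.exhaust)
      have "x' \<in> CW n \<and> y' \<in> CW m \<and> ycomb n m x' y' = ycomb n m x y \<longleftrightarrow>
        (x' = x \<and> y' = y) \<or> (x' = wz n x \<and> y' = wz m y)"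
      proof
        assume "x' \<in> CW n \<and> y' \<in> CW m \<and> ycomb n m x' y' = ycomb n m x y"
        thus "(x' = x \<and> y' = y) \<or> (x' = wz n x \<and> y' = wz m y)"
          by (intro ycomb_inj[OF that]) simp_all
      next
        assume "(x' = x \<and> y' = y) \<or> (x' = wz n x \<and> y' = wz m y)"
        thus "x' \<in> CW n \<and> y' \<in> CW m \<and> ycomb n m x' y' = ycomb n m x y"
          using that z ycomb_z(2)[OF that] by (elim disjE conjE) simp_all
      qed
      thus "q \<in> {q \<in> ?X. ?p q = ycomb n m x y} \<longleftrightarrow> q \<in> {(x, y), (wz n x, wz m y)}"
        unfolding q by (simp only: mem_Collect_eq mem_Sigma_iff prod.case insert_iff empty_iff prod.inject conj_assoc HOL.simp_thms)
    qed
    show "(x, y) \<noteq> (wz n x, wz m y)"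
      using ycomb_z(1,4)[OF that] by auto
  qed
  have "(\<Sum>x\<in>CW n. \<Sum>y\<in>CW m. F (ycomb n m x y)) = (\<Sum>q\<in>?X. F (?p q))"
    by (simp add: sum.cartesian_product split_def)
  also have "\<dots> = (\<Sum>w\<in>young_sub G n m. \<Sum>q\<in>{q \<in> ?X. ?p q = w}. F (?p q))"
    by (rule sum.group[OF fin, symmetric]) (use ycomb_young in auto)
  also have "\<dots> = (\<Sum>w\<in>young_sub G n m. 2 * F w)" (is "sum ?l _ = sum ?r _")
  proof (rule sum_cong)
    fix w assume "w \<in> young_sub G n m"
    then obtain x y where xy: "x \<in> CW n" "y \<in> CW m" "w = ycomb n m x y" using young_ycomb by blast
    have "(\<Sum>q\<in>{q \<in> ?X. ?p q = w}. F (?p q)) = (\<Sum>q\<in>{q \<in> ?X. ?p q = w}. F w)" by (rule sum.cong) auto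
    also have "\<dots> = 2 * F w" using ne[OF xy(1,2)] unfolding xy(3) fib[OF xy(1,2)] by simp
    finally show "?l w = ?r w" .
  qed
  finally show ?thesis by (simp add: sum_distrib_left)
qed

lemma card_young: "of_nat (card (CW n)) * of_nat (card (CW m)) = (2 * of_nat (card (young_sub G n m)) :: 'd :: comm_ring_1)"
  using sum_young[of "\<lambda>_. 1 :: 'd" n m] by simp

lemma young_z: "w \<in> CW (n + m) \<Longrightarrow> wz (n + m) w \<in> young_sub G n m \<longleftrightarrow> w \<in> young_sub G n m"
proof -
  assume w: "w \<in> CW (n + m)"
  then obtain g u where gu: "w = (g, spin_class (n + m) u)" "g \<in> GP (n + m)" "u \<in> spin_words (n + m)" by (rule wr_cases)
  have z: "zl # u \<in> spin_words (n + m)" using gu by simp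
  have "(g, spin_class (n + m) (zl # u)) \<in> CW (n + m)" by (rule wr_elI[OF gu(2) z])
  thus ?thesis using w gu(3) z unfolding gu(1) wr_z_mult[OF gu(2,3)]
    by (simp add: young_sub_def spin_perm_class[OF z] del: spin_perm_class) (simp add: spin_perm_class)
qed

end

context ordered_grp
begin

section \<open>Multiplicativity of the characteristic map\<close>

lemma ch_deg_gen: "ch_deg G cs n f = gen n (\<lambda>\<mu>. of_real (sqrt 2) ^ size \<mu> * at_D G cs n f (pv \<mu>))"
  unfolding ch_deg_def sum_OP gen_def
proof (rule sum_cong)
  fix \<mu> assume \<mu>: "\<mu> \<in> odd.msets n"
  note p = pv_in[OF \<mu>]
  have "a_neg_pv G (pv \<mu>) = avm (pm (pv \<mu>))"
    unfolding avm_def pm_prod by (simp add: a_neg_pv_def av_def)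
  hence 1: "a_neg_pv G (pv \<mu>) = avm \<mu>" by (simp add: p)
  have 2: "1 / of_nat (pv_Z G (pv \<mu>)) = odd.wt \<mu>" using wt_pm[of "pv \<mu>"] by (simp add: p)
  have 3: "pv_length G (pv \<mu>) = size \<mu>" using pm_size[of "pv \<mu>"] by (simp add: p)
  have "of_real (2 powr (real (pv_length G (pv \<mu>)) / 2)) / of_nat (pv_Z G (pv \<mu>)) * at_D G cs n f (pv \<mu>) =
    odd.wt \<mu> * (of_real (sqrt 2) ^ size \<mu> * at_D G cs n f (pv \<mu>))"
    unfolding 3 two_powr_half 2[symmetric] by simp
  thus "fconst (of_real (2 powr (real (pv_length G (pv \<mu>)) / 2)) / of_nat (pv_Z G (pv \<mu>)) * at_D G cs n f (pv \<mu>)) * a_neg_pv G (pv \<mu>) =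
    fconst (odd.wt \<mu>) * (fconst (of_real (sqrt 2) ^ size \<mu> * at_D G cs n f (pv \<mu>)) * avm \<mu>)"
    by (simp only: 1 fconst_mult[of "odd.wt \<mu>"] mult.assoc)
qed

lemma ch_deg_mk_class: "ch_deg G cs n (mk_class n v) = gen n (\<lambda>\<mu>. of_real (sqrt 2) ^ size \<mu> * v \<mu>)"
  unfolding ch_deg_gen by (rule gen_cong) (simp add: at_D_mk_class)

lemma odd_msets: "odd.msets n = {\<mu> \<in> all.msets n. \<forall>b\<in>#\<mu>. odd (snd b)}"
proof -
  have "set_mset \<mu> \<subseteq> labels_odd \<longleftrightarrow> set_mset \<mu> \<subseteq> labels_all \<and> (\<forall>b\<in>#\<mu>. odd (snd b))" for \<mu> :: "('a set \<times> nat) multiset"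
    by (auto simp: labels_odd_def labels_all_def odd_pos)
  thus ?thesis unfolding odd.msets_def all.msets_def by blast
qed

text \<open>The group sum is grouped by type, and \<open>card_wtype\<close> counts the elements of
  each type. As in \<open>msets_shift\<close>, \<open>e\<close> transports the weights to the ring
  of values.\<close>

lemma sum_otype:
  fixes e :: "complex \<Rightarrow> 'v :: comm_ring_1" and Q :: "('a set \<times> nat) multiset \<Rightarrow> 'v"
  assumes e: "\<And>x y. e (x * y) = e x * e y" "\<And>n. e (of_nat n) = of_nat n"
  shows "(\<Sum>x\<in>CW n. if otype n x then Q (wtype n x) else 0) =
    of_nat (card (CW n)) * (\<Sum>\<mu>\<in>odd.msets n. e (odd.wt \<mu>) * Q \<mu>)"
proof -
  define R where "R = (\<lambda>\<mu>. if \<forall>b\<in>#\<mu>. odd (snd b) then Q \<mu> else 0)"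
  have "(\<Sum>x\<in>CW n. if otype n x then Q (wtype n x) else 0) = (\<Sum>x\<in>CW n. R (wtype n x))"
    by (simp add: R_def otype_def)
  also have "\<dots> = (\<Sum>\<mu>\<in>all.msets n. \<Sum>x\<in>{x \<in> CW n. wtype n x = \<mu>}. R (wtype n x))"
    by (rule sum.group[symmetric]) (use wr_finite all.msets_finite wtype_in(1) in auto)
  also have "\<dots> = (\<Sum>\<mu>\<in>all.msets n. of_nat (card {x \<in> CW n. wtype n x = \<mu>}) * R \<mu>)"
    by (rule sum.cong) auto
  also have "\<dots> = (\<Sum>\<mu>\<in>all.msets n. of_nat (card (CW n)) * (e (all.wt \<mu>) * R \<mu>))"
  proof (rule sum_cong)
    fix \<mu> assume "\<mu> \<in> all.msets n"
    from arg_cong[OF card_wtype[OF this], of e]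
    have c: "of_nat (card {x \<in> CW n. wtype n x = \<mu>}) = (of_nat (card (CW n)) * e (all.wt \<mu>))"
      by (simp only: e)
    show "of_nat (card {x \<in> CW n. wtype n x = \<mu>}) * R \<mu> = of_nat (card (CW n)) * (e (all.wt \<mu>) * R \<mu>)"
      unfolding c mult.assoc ..
  qed
  also have "\<dots> = (\<Sum>\<mu>\<in>odd.msets n. of_nat (card (CW n)) * (e (odd.wt \<mu>) * Q \<mu>))"
    by (rule sum.mono_neutral_cong_right) (auto simp: all.msets_finite odd_msets R_def)
  finally show ?thesis by (simp only: sum_distrib_left)
qed

text \<open>The sign in \<open>Psi\<close> cancels the sign of f, so the product depends on the type
  only, and \<open>sum_otype\<close> turns the group sum into the weighted sum that defines
  \<open>ch\<close>.\<close>

lemma ch_average: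
  assumes f: "f \<in> R_minus G n"
  shows "of_nat (card (CW n)) * ch_deg G cs n f = (\<Sum>x\<in>CW n. fconst (f x) * Psi n x)"
proof -
  define Q where "Q = (\<lambda>\<mu>. fconst (of_real (sqrt 2) ^ size \<mu> * at_D G cs n f (pv \<mu>)) * avm \<mu>)"
  have "(\<Sum>x\<in>CW n. fconst (f x) * Psi n x) = (\<Sum>x\<in>CW n. if otype n x then Q (wtype n x) else 0)" (is "sum ?l _ = sum ?r _")
  proof (rule sum_cong)
    fix x assume x: "x \<in> CW n"
    show "?l x = ?r x"
    proof (cases "otype n x")
      case True
      have "f x * (wsgn n x * of_real (sqrt 2) ^ size (wtype n x)) =
        (wsgn n x * wsgn n x) * (of_real (sqrt 2) ^ size (wtype n x) * at_D G cs n f (pv (wtype n x)))"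
        unfolding f_value[OF f x True] by (simp only: mult_ac)
      hence "fconst (f x) * fconst (wsgn n x * of_real (sqrt 2) ^ size (wtype n x)) =
        (fconst (of_real (sqrt 2) ^ size (wtype n x) * at_D G cs n f (pv (wtype n x))) :: 'a fpoly)"
        by (simp only: wsgn_square[OF x] fconst_mult[symmetric] mult_1)
      thus ?thesis using True by (simp add: Psi_def Q_def mult.assoc[symmetric])
    qed (simp add: Psi_def)
  qed
  hence 1: "(\<Sum>x\<in>CW n. fconst (f x) * Psi n x) = of_nat (card (CW n)) * (\<Sum>\<mu>\<in>odd.msets n. fconst (odd.wt \<mu>) * Q \<mu>)"
    by (simp only: sum_otype[of fconst] fconst_mult fconst_simps)
  show ?thesis unfolding 1 ch_deg_gen gen_def Q_def ..
qed

definition ind_prod :: "nat \<Rightarrow> nat \<Rightarrow> ('a wr_elt \<Rightarrow> complex) \<Rightarrow> ('a wr_elt \<Rightarrow> complex) \<Rightarrow> 'a wr_elt \<Rightarrow> complex" where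
  "ind_prod n m f g = ind_fun (W (n + m)) (young_sub G n m) (phi G n m (tens f g))"

lemma phi_tens_z:
  assumes f: "f \<in> R_minus G n" "g \<in> R_minus G m" and w: "w \<in> CW (n + m)"
  shows "res_fun (young_sub G n m) (phi G n m (tens f g)) (wz (n + m) w) =
    - res_fun (young_sub G n m) (phi G n m (tens f g)) w"
    "\<not> wr_even w \<Longrightarrow> res_fun (young_sub G n m) (phi G n m (tens f g)) w = 0"
proof -
  have "res_fun (young_sub G n m) (phi G n m (tens f g)) (wz (n + m) w) =
    - res_fun (young_sub G n m) (phi G n m (tens f g)) w \<and>
    (\<not> wr_even w \<longrightarrow> res_fun (young_sub G n m) (phi G n m (tens f g)) w = 0)"
  proof (cases "w \<in> young_sub G n m")
    case True
    then obtain x y where xy: "x \<in> CW n" "y \<in> CW m" "w = ycomb n m x y" using young_ycomb by blast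
    interpret n: group "W n" by (rule wr_group)
    have zx: "wz n x \<in> CW n" using xy wr_z_carrier by simp
    note t = tens_z[OF f]
    have 1: "phi G n m (tens f g) w = (if wr_even x \<and> wr_even y then tens f g (x, y) else 0)"
      unfolding xy(3) by (rule phi_ycomb[OF xy(1,2) t(1)[OF xy(1,2)]])
    have "phi G n m (tens f g) (ycomb n m (wz n x) y) =
      (if wr_even (wz n x) \<and> wr_even y then tens f g (wz n x, y) else 0)"
      by (rule phi_ycomb[OF zx xy(2) t(1)[OF zx xy(2)]])
    hence 2: "phi G n m (tens f g) (wz (n + m) w) = (if wr_even x \<and> wr_even y then - tens f g (x, y) else 0)"
      by (simp only: ycomb_z(1)[OF xy(1,2)] xy(3)[symmetric] wsgn_z(4)[OF xy(1)] t(2)[OF xy(1,2)])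
    have 3: "wr_even w \<longleftrightarrow> (wr_even x \<longleftrightarrow> wr_even y)" unfolding xy(3) by (rule wr_even_ycomb[OF xy(1,2)])
    show ?thesis unfolding res_fun_def young_z[OF w] 1 2 3 using True by simp
  next
    case False
    thus ?thesis by (simp add: res_fun_def young_z[OF w])
  qed
  thus "res_fun (young_sub G n m) (phi G n m (tens f g)) (wz (n + m) w) =
    - res_fun (young_sub G n m) (phi G n m (tens f g)) w"
    "\<not> wr_even w \<Longrightarrow> res_fun (young_sub G n m) (phi G n m (tens f g)) w = 0" by blast+
qed

text \<open>Induction averages over conjugates, and conjugation preserves parity and commutes with
  multiplication by \<open>z\<close>. So it is enough that the inducing function changes sign under
  \<open>z\<close> and vanishes on odd elements, which is \<open>phi_tens_z\<close>.\<close>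

lemma ind_prod_R_minus:
  assumes f: "f \<in> R_minus G n" "g \<in> R_minus G m"
  shows "ind_prod n m f g \<in> R_minus G (n + m)"
proof -
  let ?K = "W (n + m)"
  let ?j = "\<lambda>y x. inv\<^bsub>?K\<^esub> y \<otimes>\<^bsub>?K\<^esub> x \<otimes>\<^bsub>?K\<^esub> y"
  define \<theta> where "\<theta> = res_fun (young_sub G n m) (phi G n m (tens f g))"
  interpret K: group ?K by (rule wr_group)
  have v: "ind_prod n m f g x = 1 / of_nat (card (young_sub G n m)) * (\<Sum>y\<in>carrier ?K. \<theta> (?j y x))"
    if "x \<in> carrier ?K" for x using that by (simp add: ind_prod_def ind_fun_def \<theta>_def)
  have "ind_prod n m f g (k \<otimes>\<^bsub>?K\<^esub> x \<otimes>\<^bsub>?K\<^esub> inv\<^bsub>?K\<^esub> k) = ind_prod n m f g x" if x: "x \<in> carrier ?K" and k: "k \<in> carrier ?K" for x k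
  proof -
    have "(\<Sum>y\<in>carrier ?K. \<theta> (inv\<^bsub>?K\<^esub> y \<otimes>\<^bsub>?K\<^esub> (k \<otimes>\<^bsub>?K\<^esub> x \<otimes>\<^bsub>?K\<^esub> inv\<^bsub>?K\<^esub> k) \<otimes>\<^bsub>?K\<^esub> y)) = (\<Sum>y\<in>carrier ?K. \<theta> (?j y x))"
    proof (rule sum.reindex_bij_witness[of _ "\<lambda>y. k \<otimes>\<^bsub>?K\<^esub> y" "\<lambda>y. inv\<^bsub>?K\<^esub> k \<otimes>\<^bsub>?K\<^esub> y"])
      fix y assume y: "y \<in> carrier ?K"
      show "k \<otimes>\<^bsub>?K\<^esub> (inv\<^bsub>?K\<^esub> k \<otimes>\<^bsub>?K\<^esub> y) = y" "inv\<^bsub>?K\<^esub> k \<otimes>\<^bsub>?K\<^esub> (k \<otimes>\<^bsub>?K\<^esub> y) = y"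
        using k y by (simp_all add: K.m_assoc[symmetric])
      show "\<theta> (inv\<^bsub>?K\<^esub> (inv\<^bsub>?K\<^esub> k \<otimes>\<^bsub>?K\<^esub> y) \<otimes>\<^bsub>?K\<^esub> x \<otimes>\<^bsub>?K\<^esub> (inv\<^bsub>?K\<^esub> k \<otimes>\<^bsub>?K\<^esub> y)) = \<theta> (inv\<^bsub>?K\<^esub> y \<otimes>\<^bsub>?K\<^esub> (k \<otimes>\<^bsub>?K\<^esub> x \<otimes>\<^bsub>?K\<^esub> inv\<^bsub>?K\<^esub> k) \<otimes>\<^bsub>?K\<^esub> y)"
        using k x y by (simp add: K.m_assoc K.inv_mult_group)
    qed (use k in auto)
    thus ?thesis using x k by (simp add: v)
  qed
  moreover have "ind_prod n m f g (wz (n + m) x) = - ind_prod n m f g x" if x: "x \<in> carrier ?K" for x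
  proof -
    have "\<theta> (inv\<^bsub>?K\<^esub> y \<otimes>\<^bsub>?K\<^esub> (wz (n + m) x) \<otimes>\<^bsub>?K\<^esub> y) = - \<theta> (?j y x)" if y: "y \<in> carrier ?K" for y
      using wr_z_left[OF x, of "inv\<^bsub>?K\<^esub> y"] x y phi_tens_z(1)[OF f, of "?j y x"] by (simp add: \<theta>_def)
    thus ?thesis using x wr_z_carrier by (simp add: v sum_negf)
  qed
  moreover have "ind_prod n m f g x = 0" if x: "x \<in> carrier ?K" and o: "\<not> wr_even x" for x
  proof -
    have "\<theta> (?j y x) = 0" if y: "y \<in> carrier ?K" for y
      using wr_even_conj[OF x, of "inv\<^bsub>?K\<^esub> y"] x y o phi_tens_z(2)[OF f, of "?j y x"] by (simp add: \<theta>_def)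
    thus ?thesis using x by (simp add: v)
  qed
  moreover have "ind_prod n m f g x = 0" if "x \<notin> carrier ?K" for x using that by (simp add: ind_prod_def ind_fun_def)
  ultimately show ?thesis unfolding R_minus_def class_functions_def by blast
qed

text \<open>Frobenius reciprocity against the class function \<^term>\<open>Psi\<close>, which is multiplicative on
  Young subgroups.\<close>

lemma ch_ind_prod:
  assumes f: "f \<in> R_minus G n" "g \<in> R_minus G m"
  shows "ch_deg G cs (n + m) (ind_prod n m f g) = ch_deg G cs n f * ch_deg G cs m g"
proof -
  let ?K = "W (n + m)" and ?Y = "young_sub G n m"
  let ?j = "\<lambda>y x. inv\<^bsub>?K\<^esub> y \<otimes>\<^bsub>?K\<^esub> x \<otimes>\<^bsub>?K\<^esub> y" and ?P = "Psi (n + m)" and ?S = "\<Sum>w\<in>?Y. fconst (phi G n m (tens f g) w) * Psi (n + m) w"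
  define \<theta> where "\<theta> = res_fun ?Y (phi G n m (tens f g))"
  define c :: complex where "c = 1 / of_nat (card ?Y)"
  interpret K: group ?K by (rule wr_group)
  have Y0: "of_nat (card ?Y) \<noteq> (0 :: complex)"
    using card_young[of n m, where 'd = complex] card_wr_nonzero[of n] card_wr_nonzero[of m] by (auto simp del: of_nat_eq_0_iff)
  have "of_nat (card (carrier ?K)) * ch_deg G cs (n + m) (ind_prod n m f g) = (\<Sum>x\<in>carrier ?K. fconst (ind_prod n m f g x) * ?P x)"
    by (rule ch_average[OF ind_prod_R_minus[OF f]])
  also have "\<dots> = (\<Sum>x\<in>carrier ?K. \<Sum>y\<in>carrier ?K. fconst c * (fconst (\<theta> (?j y x)) * ?P (?j y x)))" (is "sum ?F _ = sum ?G _")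
  proof (rule sum_cong)
    fix x assume x: "x \<in> carrier ?K"
    have "fconst (ind_prod n m f g x) * ?P x = (\<Sum>y\<in>carrier ?K. fconst c * (fconst (\<theta> (?j y x)) * ?P x))"
      using x by (simp add: ind_prod_def ind_fun_def c_def \<theta>_def fconst_mult fconst_sum sum_distrib_left sum_distrib_right mult.assoc flip: c_def)
    also have "\<dots> = (\<Sum>y\<in>carrier ?K. fconst c * (fconst (\<theta> (?j y x)) * ?P (?j y x)))" (is "sum ?l _ = sum ?r _")
    proof (rule sum_cong)
      fix y assume "y \<in> carrier ?K"
      thus "?l y = ?r y"
        using Psi_conj[OF x, of "inv\<^bsub>?K\<^esub> y"] by simp
    qed
    finally show "?F x = ?G x" .
  qed
  also have "\<dots> = (\<Sum>y\<in>carrier ?K. \<Sum>x\<in>carrier ?K. fconst c * (fconst (\<theta> (?j y x)) * ?P (?j y x)))"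
    by (rule sum.swap)
  \<comment> \<open>\<open>Psi\<close> was conjugated along with the argument of \<theta>; for each
    y the conjugation is now a change of variable, and all inner sums coincide.\<close>
  also have "\<dots> = (\<Sum>y\<in>carrier ?K. \<Sum>x\<in>carrier ?K. fconst c * (fconst (\<theta> x) * ?P x))" (is "sum ?l _ = sum ?r _")
  proof (rule sum_cong)
    fix y assume y: "y \<in> carrier ?K"
    show "?l y = ?r y"
    proof (rule sum.reindex_bij_witness[of _ "\<lambda>x. y \<otimes>\<^bsub>?K\<^esub> x \<otimes>\<^bsub>?K\<^esub> inv\<^bsub>?K\<^esub> y" "\<lambda>x. inv\<^bsub>?K\<^esub> y \<otimes>\<^bsub>?K\<^esub> x \<otimes>\<^bsub>?K\<^esub> y"])
      fix x assume x: "x \<in> carrier ?K"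
      have "y \<otimes>\<^bsub>?K\<^esub> (?j y x) \<otimes>\<^bsub>?K\<^esub> inv\<^bsub>?K\<^esub> y = (y \<otimes>\<^bsub>?K\<^esub> inv\<^bsub>?K\<^esub> y) \<otimes>\<^bsub>?K\<^esub> x \<otimes>\<^bsub>?K\<^esub> (y \<otimes>\<^bsub>?K\<^esub> inv\<^bsub>?K\<^esub> y)"
        using x y by (simp only: K.m_assoc K.m_closed K.inv_closed)
      thus "y \<otimes>\<^bsub>?K\<^esub> (?j y x) \<otimes>\<^bsub>?K\<^esub> inv\<^bsub>?K\<^esub> y = x" using x y by simp
      have "inv\<^bsub>?K\<^esub> y \<otimes>\<^bsub>?K\<^esub> (y \<otimes>\<^bsub>?K\<^esub> x \<otimes>\<^bsub>?K\<^esub> inv\<^bsub>?K\<^esub> y) \<otimes>\<^bsub>?K\<^esub> y = (inv\<^bsub>?K\<^esub> y \<otimes>\<^bsub>?K\<^esub> y) \<otimes>\<^bsub>?K\<^esub> x \<otimes>\<^bsub>?K\<^esub> (inv\<^bsub>?K\<^esub> y \<otimes>\<^bsub>?K\<^esub> y)"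
        using x y by (simp only: K.m_assoc K.m_closed K.inv_closed)
      thus "inv\<^bsub>?K\<^esub> y \<otimes>\<^bsub>?K\<^esub> (y \<otimes>\<^bsub>?K\<^esub> x \<otimes>\<^bsub>?K\<^esub> inv\<^bsub>?K\<^esub> y) \<otimes>\<^bsub>?K\<^esub> y = x" using x y by simp
    qed (use y in auto)
  qed
  also have "\<dots> = of_nat (card (carrier ?K)) * (fconst c * (\<Sum>x\<in>carrier ?K. fconst (\<theta> x) * ?P x))"
    by (simp add: sum_distrib_left)
  finally have "ch_deg G cs (n + m) (ind_prod n m f g) = fconst c * (\<Sum>x\<in>carrier ?K. fconst (\<theta> x) * ?P x)"
    by (rule of_nat_cancel_fpoly[rotated]) (use card_wr_nonzero[of "n + m"] in simp)
  also have "(\<Sum>x\<in>carrier ?K. fconst (\<theta> x) * ?P x) = ?S"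
    by (rule sum.mono_neutral_cong_right) (auto simp: wr_finite young_sub_def \<theta>_def res_fun_def)
  finally have 1: "ch_deg G cs (n + m) (ind_prod n m f g) = fconst c * ?S" .
  have "(\<Sum>x\<in>CW n. fconst (f x) * Psi n x) * (\<Sum>y\<in>CW m. fconst (g y) * Psi m y) =
    (\<Sum>x\<in>CW n. \<Sum>y\<in>CW m. fconst (phi G n m (tens f g) (ycomb n m x y)) * ?P (ycomb n m x y))"
    unfolding sum_product
  proof (rule sum_cong, rule sum_cong)
    fix x y assume xy: "x \<in> CW n" "y \<in> CW m"
    \<comment> \<open>\<open>phi\<close> puts zero unless both factors are even. \<open>Psi\<close>
      vanishes there as well, because elements of odd type are even, so the missing terms are zero
      on both sides.\<close>
    have "Psi n x * Psi m y = 0" if "\<not> (wr_even x \<and> wr_even y)"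
      using that otype_even[OF xy(1)] otype_even[OF xy(2)] by (auto simp: Psi_def)
    thus "fconst (f x) * Psi n x * (fconst (g y) * Psi m y) =
      fconst (phi G n m (tens f g) (ycomb n m x y)) * ?P (ycomb n m x y)"
      unfolding phi_ycomb[OF xy tens_z(1)[OF f xy]] Psi_ycomb[OF xy]
      by (cases "wr_even x \<and> wr_even y") (auto simp: tens_def fconst_mult mult_ac)
  qed
  also have "\<dots> = 2 * ?S" by (rule sum_young)
  finally have "of_nat (card (CW n)) * ch_deg G cs n f * (of_nat (card (CW m)) * ch_deg G cs m g) =
    2 * ?S" by (simp only: ch_average f)
  moreover have "of_nat (card (CW n)) * of_nat (card (CW m)) = (2 * of_nat (card ?Y) :: 'a fpoly)"
    by (rule card_young)
  ultimately have "of_nat 2 * (of_nat (card ?Y) * (ch_deg G cs n f * ch_deg G cs m g)) =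
    of_nat 2 * ?S"
    by (simp add: mult_ac)
  hence "of_nat (card ?Y) * (ch_deg G cs n f * ch_deg G cs m g) = ?S"
    by (rule of_nat_cancel_fpoly[rotated]) simp
  hence "ch_deg G cs (n + m) (ind_prod n m f g) = fconst c * of_nat (card ?Y) * (ch_deg G cs n f * ch_deg G cs m g)"
    unfolding 1 by (simp add: mult.assoc)
  moreover have "fconst c * of_nat (card ?Y) = (1 :: 'a fpoly)"
    unfolding fconst_simps(3)[symmetric] fconst_mult[symmetric] using Y0 by (simp add: c_def)
  ultimately show ?thesis by simp
qed

end

context finite_grp
begin

section \<open>Types and signs of inverse elements\<close>

lemma orbit_inverse_subset:
  assumes A: "finite A" "bij_betw \<sigma> A A" and \<tau>: "\<And>i. i \<in> A \<Longrightarrow> \<tau> (\<sigma> i) = i" and w: "w \<in> A"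
  shows "orbit \<tau> w \<subseteq> orbit \<sigma> w"
proof -
  define C where "C = orbit \<sigma> w"
  note ob = orbit_bij(5,6)[OF A w]
  have CA: "C \<subseteq> A" "w \<in> C" using ob by (simp_all add: C_def)
  have "\<sigma> ` C \<subseteq> C" unfolding C_def by (auto intro: orbit.step)
  moreover have "finite C" using CA(1) A(1) by (rule finite_subset)
  moreover have "inj_on \<sigma> C" using A(2) CA(1) by (auto simp: bij_betw_def intro: inj_on_subset)
  ultimately have \<sigma>C: "\<sigma> ` C = C" by (simp add: endo_inj_surj)
  have cl: "\<tau> y \<in> C" if "y \<in> C" for y
  proof -
    have "y \<in> \<sigma> ` C" using that unfolding \<sigma>C .
    then obtain y' where "y' \<in> C" "y = \<sigma> y'" by blast
    thus ?thesis using \<tau>[of y'] CA(1) by auto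
  qed
  have "y \<in> C" if "y \<in> orbit \<tau> w" for y using that by (induction rule: orbit.induct) (use cl CA in auto)
  thus ?thesis by (auto simp: C_def)
qed

lemma bij_inverse:
  assumes "bij_betw \<sigma> A A" "\<And>i. i \<in> A \<Longrightarrow> \<tau> (\<sigma> i) = i"
  shows "bij_betw \<tau> A A" "i \<in> A \<Longrightarrow> \<sigma> (\<tau> i) = i"
proof -
  have s: "\<sigma> ` A = A" using assms(1) by (simp add: bij_betw_def)
  have "\<exists>j\<in>A. i = \<sigma> j" if "i \<in> A" for i using that s by auto
  thus 1: "\<sigma> (\<tau> i) = i" if "i \<in> A" for i using assms(2) that by metis
  have m: "\<tau> i \<in> A" if "i \<in> A" for i
  proof -
    have "i \<in> \<sigma> ` A" using that unfolding s .
    then obtain j where "j \<in> A" "i = \<sigma> j" by blast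
    thus ?thesis using assms(2) by simp
  qed
  show "bij_betw \<tau> A A"
    by (rule bij_betw_byWitness[where f' = \<sigma>]) (use 1 m assms(2) s in auto)
qed

text \<open>Walking back meets the same factors inverted and in reverse order. The shift by two
  comes from the index in g' and from the walk stopping before w; labels are constant on orbits, so
  it does no harm.\<close>

lemma path_prod_inverse:
  assumes \<sigma>: "bij_betw \<sigma> A A" "\<And>i. i \<in> A \<Longrightarrow> \<tau> (\<sigma> i) = i" and w: "w \<in> A" and g: "g \<in> A \<rightarrow> carrier G"
    and g': "\<And>i. i \<in> A \<Longrightarrow> g' i = inv (g (\<sigma> i))"
  shows "path_prod g' \<tau> ((\<sigma> ^^ n) w) n = inv (path_prod g \<sigma> (\<sigma> (\<sigma> w)) n)"
proof (induction n)
  case (Suc n)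
  note bt = bij_inverse[OF \<sigma>]
  have sA: "\<sigma> i \<in> A" if "i \<in> A" for i using \<sigma>(1) that by (auto simp: bij_betw_def)
  have i: "(\<sigma> ^^ n) w \<in> A" "(\<sigma> ^^ Suc n) w \<in> A" by (rule bij_betw_funpow_mem[OF \<sigma>(1) w])+
  have gc: "g' \<in> A \<rightarrow> carrier G" using g g' sA by (auto simp: Pi_iff)
  have t: "\<tau> ((\<sigma> ^^ Suc n) w) = (\<sigma> ^^ n) w" using \<sigma>(2)[OF i(1)] by simp
  have "path_prod g' \<tau> ((\<sigma> ^^ Suc n) w) (Suc n) = path_prod g' \<tau> ((\<sigma> ^^ n) w) n \<otimes> g' ((\<sigma> ^^ Suc n) w)"
    using path_prod_shift[OF bt(1) i(2) gc, of n] unfolding t by (rule HOL.sym)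
  also have "\<dots> = inv (path_prod g \<sigma> (\<sigma> (\<sigma> w)) n) \<otimes> inv (g (\<sigma> ((\<sigma> ^^ Suc n) w)))"
    by (simp only: Suc.IH g'[OF i(2)])
  also have "\<dots> = inv (g (\<sigma> ((\<sigma> ^^ Suc n) w)) \<otimes> path_prod g \<sigma> (\<sigma> (\<sigma> w)) n)"
    by (rule inv_mult_group[symmetric]) (use g sA[OF i(2)] path_prod_closed[OF \<sigma>(1) sA[OF sA[OF w]] g] in auto)
  also have "\<sigma> ((\<sigma> ^^ Suc n) w) = (\<sigma> ^^ n) (\<sigma> (\<sigma> w))" by (simp add: funpow_swap1)
  finally show ?case by simp
qed simp

definition lab_inv :: "'a set \<times> nat \<Rightarrow> 'a set \<times> nat" where
  "lab_inv b = (class_inv G (fst b), snd b)"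

text \<open>Inverse permutations have the same orbits, and the cycle products become inverse up to
  conjugation.\<close>

lemma ctype_inverse:
  assumes A: "finite A" "bij_betw \<sigma> A A" and \<tau>: "\<And>i. i \<in> A \<Longrightarrow> \<tau> (\<sigma> i) = i" and g: "g \<in> A \<rightarrow> carrier G"
    and g': "\<And>i. i \<in> A \<Longrightarrow> g' i = inv (g (\<sigma> i))"
  shows "ctype A g' \<tau> = image_mset lab_inv (ctype A g \<sigma>)"
proof -
  have orb: "orbit \<tau> w = orbit \<sigma> w" if w: "w \<in> A" for w
  proof
    show "orbit \<tau> w \<subseteq> orbit \<sigma> w" by (rule orbit_inverse_subset[OF A \<tau> w])
    show "orbit \<sigma> w \<subseteq> orbit \<tau> w"
      by (rule orbit_inverse_subset[OF A(1) bij_inverse(1)[OF A(2) \<tau>] bij_inverse(2)[OF A(2) \<tau>] w])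
  qed
  have sA: "\<sigma> i \<in> A" if "i \<in> A" for i using A(2) that by (auto simp: bij_betw_def)
  have lab: "cyc_label g' \<tau> w = lab_inv (cyc_label g \<sigma> w)" if w: "w \<in> A" for w
  proof -
    let ?k = "card (orbit \<sigma> w)" and ?w = "\<sigma> (\<sigma> w)"
    have 1: "path_prod g' \<tau> w ?k = inv (path_prod g \<sigma> ?w ?k)"
      using path_prod_inverse[OF A(2) \<tau> w g g', of ?k] orbit_bij(2)[OF A w] by simp
    have c: "path_prod g \<sigma> ?w ?k \<in> carrier G" by (rule path_prod_closed[OF A(2) sA[OF sA[OF w]] g])
    have e: "cyc_label g \<sigma> ?w = cyc_label g \<sigma> w"
      using cyc_label_step[OF A w g] cyc_label_step[OF A sA[OF w] g] by simp
    hence "card (orbit \<sigma> ?w) = ?k" by (simp add: cyc_label_def)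
    hence 2: "cyc_label g \<sigma> w = (conj_class G (path_prod g \<sigma> ?w ?k), ?k)"
      unfolding e[symmetric] by (simp add: cyc_label_path)
    show ?thesis unfolding cyc_label_path[of g' \<tau> w] orb[OF w] 1 2 by (simp add: lab_inv_def class_inv_conj[OF c])
  qed
  have o: "orbit \<tau> ` A = orbit \<sigma> ` A" using orb by (rule image_cong[OF HOL.refl])
  have l: "cyc_label g' \<tau> (SOME i. i \<in> C) = lab_inv (cyc_label g \<sigma> (SOME i. i \<in> C))" if C: "C \<in> orbit \<sigma> ` A" for C
  proof -
    obtain w where w: "w \<in> A" "C = orbit \<sigma> w" using C by auto
    have "(SOME i. i \<in> C) \<in> C" using orbit_bij(6)[OF A w(1)] unfolding w(2) by (rule someI[of "\<lambda>i. i \<in> _"])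
    thus ?thesis using orbit_bij(5)[OF A w(1)] w(2) by (intro lab) auto
  qed
  show ?thesis unfolding ctype_def o multiset.map_comp comp_def
    by (rule image_mset_cong, rule l) (use A(1) in simp)
qed

lemma wr_inverse:
  assumes x: "x \<in> CW n"
  shows "wtype n (inv\<^bsub>W n\<^esub> x) = image_mset lab_inv (wtype n x)" "otype n (inv\<^bsub>W n\<^esub> x) = otype n x"
    "otype n x \<Longrightarrow> wsgn n (inv\<^bsub>W n\<^esub> x) = wsgn n x"
proof -
  obtain g u where gu: "x = (g, spin_class n u)" "g \<in> GP n" "u \<in> spin_words n" using x by (rule wr_cases)
  have iu: "inv_word u \<in> spin_words n" using gu by simp
  show t: "wtype n (inv\<^bsub>W n\<^esub> x) = image_mset lab_inv (wtype n x)"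
    unfolding gu(1) wr_inv[OF gu(2,3)] wtype_def fst_conv snd_conv spin_perm_class[OF iu] spin_perm_class[OF gu(3)]
    by (rule ctype_inverse[OF _ word_perm_bij_betw[OF gu(3)] _ PiE_Pi[OF gu(2)]]) (simp_all add: word_perm_inv')
  show o: "otype n (inv\<^bsub>W n\<^esub> x) = otype n x" by (simp add: otype_def t lab_inv_def)
  assume ox: "otype n x"
  obtain M where M: "odd M" "word_perm u ^^ M = id" using otype_order[OF gu(2,3)] ox gu(1) by auto
  have "spin_sgn (snd (inv\<^bsub>W n\<^esub> x)) = spin_sgn (snd x)"
    unfolding gu(1) wr_inv[OF gu(2,3)] snd_conv spin_sgn_class[OF iu] spin_sgn_class[OF gu(3)] by (rule lift_sgn_inv[OF gu(3) M])
  thus "wsgn n (inv\<^bsub>W n\<^esub> x) = wsgn n x"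
    by (simp add: wsgn_def t image_mset.compositionality comp_def lab_inv_def)
qed

lemma prod_filter_size:
  fixes h :: "'x \<Rightarrow> complex"
  assumes "finite S" "fst ` set_mset M \<subseteq> S"
  shows "(\<Prod>c\<in>S. h c ^ size (filter_mset (\<lambda>b. fst b = c) M)) = (\<Prod>b\<in>#M. h (fst b))"
  using assms(2)
proof (induction M)
  case (add b M)
  have "(\<Prod>c\<in>S. h c ^ size (filter_mset (\<lambda>b. fst b = c) (add_mset b M))) =
    (\<Prod>c\<in>S. (if c = fst b then h (fst b) else 1) * h c ^ size (filter_mset (\<lambda>b. fst b = c) M))"
    by (rule prod.cong) auto
  thus ?case using add assms(1) by (simp add: prod.distrib)
qed simp

text \<open>\<open>wr_type\<close> counts a cycle for \<open>c\<close> if some starting point has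
  its product in \<open>c\<close>. The class of the product does not depend on the starting point,
  so it is the class in the label of the cycle.\<close>

lemma size_wr_type:
  assumes x: "x \<in> CW n" and c: "c \<in> Cls"
  shows "size (wr_type G n x c) = size (filter_mset (\<lambda>b. fst b = c) (wtype n x))"
proof -
  obtain g u where gu: "x = (g, spin_class n u)" "g \<in> GP n" "u \<in> spin_words n" using x by (rule wr_cases)
  define \<sigma> where "\<sigma> = word_perm u"
  have b: "bij_betw \<sigma> {1..n} {1..n}" unfolding \<sigma>_def by (rule word_perm_bij_betw[OF gu(3)])
  note g = PiE_Pi[OF gu(2)]
  let ?lab = "\<lambda>C. cyc_label g \<sigma> (SOME i. i \<in> C)"
  have iff: "(\<exists>i\<in>C. cycle_product G g (cycle_from \<sigma> i) \<in> c) \<longleftrightarrow> fst (?lab C) = c" if C: "C \<in> orbit \<sigma> ` {1..n}" for C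
  proof -
    obtain w where w: "w \<in> {1..n}" "C = orbit \<sigma> w" using C by auto
    have l: "cyc_label g \<sigma> i = cyc_label g \<sigma> w" if "i \<in> C" for i
      using cyc_label_orbit[OF finite_atLeastAtMost b w(1) g] that w(2) by simp
    have "(SOME i. i \<in> C) \<in> C" using orbit_bij(6)[OF finite_atLeastAtMost b w(1)] unfolding w(2) by (rule someI[of "\<lambda>i. i \<in> _"])
    hence lw: "?lab C = cyc_label g \<sigma> w" by (rule l)
    have "cycle_product G g (cycle_from \<sigma> i) \<in> c \<longleftrightarrow> fst (cyc_label g \<sigma> w) = c" if i: "i \<in> C" for i
    proof -
      have "i \<in> {1..n}" using orbit_bij(5)[OF finite_atLeastAtMost b w(1)] i w(2) by blast
      hence "path_prod g \<sigma> i (card (orbit \<sigma> i)) \<in> carrier G" by (rule path_prod_closed[OF b _ g])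
      hence p: "cycle_product G g (cycle_from \<sigma> i) \<in> carrier G" by (simp add: path_prod_def cycle_from_def)
      have "fst (cyc_label g \<sigma> w) = conj_class G (cycle_product G g (cycle_from \<sigma> i))"
        using l[OF i] by (simp add: cyc_label_def)
      thus ?thesis using conj_class_self[OF p] conj_classes_eq[OF c] by auto
    qed
    thus ?thesis using orbit_bij(6)[OF finite_atLeastAtMost b w(1)] w(2) lw by auto
  qed
  have "wr_type G n x c = image_mset card (mset_set {C \<in> orbit \<sigma> ` {1..n}. \<exists>i\<in>C. cycle_product G g (cycle_from \<sigma> i) \<in> c})"
    using gu(3) by (simp add: wr_type_def gu(1) \<sigma>_def Let_def)
  also have "{C \<in> orbit \<sigma> ` {1..n}. \<exists>i\<in>C. cycle_product G g (cycle_from \<sigma> i) \<in> c} = {C \<in> orbit \<sigma> ` {1..n}. fst (?lab C) = c}"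
    using iff by (intro Collect_cong conj_cong HOL.refl)
  finally have "size (wr_type G n x c) = size (filter_mset (\<lambda>C. fst (?lab C) = c) (mset_set (orbit \<sigma> ` {1..n})))"
    by simp
  moreover have "wtype n x = image_mset ?lab (mset_set (orbit \<sigma> ` {1..n}))"
    using gu(3) by (simp add: wtype_def ctype_def gu(1) \<sigma>_def)
  ultimately show ?thesis by (simp add: filter_mset_image_mset)
qed

lemma eta_eq:
  assumes x: "x \<in> CW n"
  shows "eta G \<xi> n x = (\<Prod>b\<in>#wtype n x. at_class \<xi> (fst b))"
proof -
  have "fst ` set_mset (wtype n x) \<subseteq> Cls"
    using wtype_in(1)[OF x] unfolding all.msets_def by (auto simp: labels_all_def)
  from prod_filter_size[OF finite_conj_classes this, of "at_class \<xi>"] show ?thesis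
    by (simp add: eta_def size_wr_type[OF x] cong: prod.cong)
qed

end

context ordered_grp
begin

section \<open>The coproduct and the two families of operators on values\<close>

definition co_fun :: "nat \<Rightarrow> nat \<Rightarrow> ('a wr_elt \<Rightarrow> complex) \<Rightarrow> 'a tensor" where
  "co_fun n m f = (\<lambda>(x, y). if x \<in> CW n \<and> y \<in> CW m \<and> otype n x \<and> otype m y
     then wsgn n x * wsgn m y * at_D G cs (n + m) f (pv (wtype n x + wtype m y)) else 0)"

lemma R_tensor_facts:
  assumes T: "T \<in> R_tensor G n m"
  shows "x \<in> CW n \<Longrightarrow> y \<in> CW m \<Longrightarrow> T (wz n x, wz m y) = T (x, y)"
    "\<not> (x \<in> CW n \<and> y \<in> CW m \<and> wr_even x \<and> wr_even y) \<Longrightarrow> T (x, y) = 0"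
proof -
  obtain k f g where T: "T = (\<lambda>p. \<Sum>i<k. tens (f i) (g i) p)" and fg: "\<And>i. i < (k :: nat) \<Longrightarrow> f i \<in> R_minus G n \<and> g i \<in> R_minus G m"
    using T unfolding R_tensor_def by blast
  show "T (wz n x, wz m y) = T (x, y)" if "x \<in> CW n" "y \<in> CW m"
    unfolding T by (rule sum_cong, rule tens_z) (use fg that in auto)
  assume n: "\<not> (x \<in> CW n \<and> y \<in> CW m \<and> wr_even x \<and> wr_even y)"
  have "tens (f i) (g i) (x, y) = 0" if i: "i < k" for i
  proof -
    have "f i x = 0 \<or> g i y = 0"
      using n fg[OF i] R_minusD(1,4)[of "f i" n x] R_minusD(1,4)[of "g i" m y] by blast
    thus ?thesis by (auto simp: tens_def)
  qed
  thus "T (x, y) = 0" unfolding T by simp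
qed

text \<open>\<open>coproduct\<close> inverts \<open>phi\<close> on finite sums of tensors, so its
  candidate must be exhibited as one: a sum over the odd types of the second factor, with the
  indicator of the type in the second place.\<close>

lemma co_fun_tensor:
  shows "co_fun n m f \<in> R_tensor G n m"
proof -
  obtain h where h: "bij_betw h {0..<card (odd.msets m)} (odd.msets m)"
    using ex_bij_betw_nat_finite[OF odd.msets_finite] by blast
  let ?k = "card (odd.msets m)"
  let ?v = "\<lambda>\<mu>. at_D G cs (n + m) f (pv \<mu>)"
  define F where "F = (\<lambda>i. mk_class n (\<lambda>\<sigma>. ?v (\<sigma> + h i)))"
  define g where "g = (\<lambda>i. mk_class m (\<lambda>\<tau>. if \<tau> = h i then 1 else 0))"
  have "co_fun n m f p = (\<Sum>i<?k. tens (F i) (g i) p)" for p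
  proof -
    obtain x y where p: "p = (x, y)" by (rule prod.exhaust)
    show ?thesis
    proof (cases "x \<in> CW n \<and> y \<in> CW m \<and> otype n x \<and> otype m y")
      case True
      have "(\<Sum>i<?k. tens (F i) (g i) p) = (\<Sum>i\<in>{0..<?k}. wsgn n x * ?v (wtype n x + h i) * (wsgn m y * (if wtype m y = h i then 1 else 0)))"
        unfolding lessThan_atLeast0 p using True by (simp add: tens_def F_def g_def mk_class_def)
      also have "\<dots> = (\<Sum>\<tau>\<in>odd.msets m. wsgn n x * ?v (wtype n x + \<tau>) * (wsgn m y * (if wtype m y = \<tau> then 1 else 0)))"
        by (rule sum.reindex_bij_betw[OF h])
      also have "\<dots> = (\<Sum>\<tau>\<in>odd.msets m. if wtype m y = \<tau> then wsgn n x * wsgn m y * ?v (wtype n x + \<tau>) else 0)"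
        by (rule sum.cong) auto
      also have "\<dots> = wsgn n x * wsgn m y * ?v (wtype n x + wtype m y)"
        using True wtype_in(2)[of y m] odd.msets_finite[of m] by simp
      finally show ?thesis using True by (simp add: p co_fun_def)
    next
      case False
      hence "tens (F i) (g i) p = 0" for i unfolding p by (auto simp: tens_def F_def g_def mk_class_def)
      thus ?thesis using False by (simp add: p co_fun_def del: de_Morgan_conj)
    qed
  qed
  hence "co_fun n m f = (\<lambda>p. \<Sum>i<?k. tens (F i) (g i) p)" by (rule ext)
  moreover have "F i \<in> R_minus G n" "g i \<in> R_minus G m" for i unfolding F_def g_def by (rule mk_class_R_minus)+
  ultimately show ?thesis unfolding R_tensor_def by blast
qed

lemma phi_co_fun:
  assumes f: "f \<in> R_minus G (n + m)"
  shows "phi G n m (co_fun n m f) = res_fun (young_sub G n m) f"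
proof
  fix w
  show "phi G n m (co_fun n m f) w = res_fun (young_sub G n m) f w"
  proof (cases "w \<in> young_sub G n m")
    case True
    then obtain x y where xy: "x \<in> CW n" "y \<in> CW m" "w = ycomb n m x y" using young_ycomb by blast
    have p: "phi G n m (co_fun n m f) w = (if wr_even x \<and> wr_even y then co_fun n m f (x, y) else 0)"
      unfolding xy(3) by (rule phi_ycomb[OF xy(1,2) R_tensor_facts(1)[OF co_fun_tensor xy(1,2)]])
    have "(if wr_even x \<and> wr_even y then co_fun n m f (x, y) else 0) = f w"
    proof (cases "otype n x \<and> otype m y")
      case True
      have "f w = wsgn n x * wsgn m y * at_D G cs (n + m) f (pv (wtype n x + wtype m y))"
        using f_value[OF f ycomb_closed[OF xy(1,2)]] True xy
        by (simp add: otype_ycomb wsgn_ycomb wtype_ycomb)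
      thus ?thesis using True xy(1,2) otype_even[OF xy(1)] otype_even[OF xy(2)] by (simp add: co_fun_def)
    next
      case False
      hence "f w = 0" using R_minus_vanish[OF f ycomb_closed[OF xy(1,2)]] xy by (simp add: otype_ycomb)
      thus ?thesis using False by (auto simp: co_fun_def)
    qed
    thus ?thesis using True by (simp add: p res_fun_def)
  next
    case False
    thus ?thesis by (simp add: phi_def res_fun_def)
  qed
qed

text \<open>A tensor vanishes unless both arguments are even, and its values at pairs of even
  elements are recovered from \<open>phi\<close> at their products.\<close>

lemma phi_inj: "inj_on (phi G n m) (R_tensor G n m)"
proof (rule inj_onI)
  fix T T' assume T: "T \<in> R_tensor G n m" "T' \<in> R_tensor G n m" and e: "phi G n m T = phi G n m T'"
  show "T = T'"
  proof
    fix p :: "'a wr_elt \<times> 'a wr_elt"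
    obtain x y where p: "p = (x, y)" by (rule prod.exhaust)
    show "T p = T' p"
    proof (cases "x \<in> CW n \<and> y \<in> CW m \<and> wr_even x \<and> wr_even y")
      case True
      hence xy: "x \<in> CW n" "y \<in> CW m" by simp_all
      have "phi G n m T (ycomb n m x y) = phi G n m T' (ycomb n m x y)" using e by simp
      thus ?thesis unfolding p phi_ycomb[OF xy R_tensor_facts(1)[OF T(1) xy]] phi_ycomb[OF xy R_tensor_facts(1)[OF T(2) xy]]
        using True by simp
    next
      case False
      show ?thesis unfolding p R_tensor_facts(2)[OF T(1) False] R_tensor_facts(2)[OF T(2) False] ..
    qed
  qed
qed

lemma coproduct_eq:
  assumes f: "f \<in> R_minus G (n + m)" shows "coproduct G n m f = co_fun n m f"
  unfolding coproduct_def
proof (rule inv_into_f_eq)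
  show "phi G n m (co_fun n m f) = res_fun (young_sub G n m) f" by (rule phi_co_fun[OF f])
qed (rule phi_inj co_fun_tensor)+

text \<open>After replacing x by its inverse the two signs of x square to 1, \<xi> and \<gamma>
  appear at inverse classes, and the sum over the group becomes a weighted sum over odd
  types.\<close>

lemma H_minus_value:
  assumes f: "f \<in> R_minus G (N + k)"
  shows "(\<lambda>y. wr_form G \<xi> N (scaled_chi G cs N \<gamma>) (\<lambda>x. coproduct G N k f (x, y))) =
    mk_class k (\<lambda>\<tau>. \<Sum>\<sigma>\<in>odd.msets N. odd.wt \<sigma> * ((\<Prod>b\<in>#\<sigma>. of_real (sqrt 2) * dual_val \<xi> \<gamma> b) * at_D G cs (N + k) f (pv (\<sigma> + \<tau>))))"
proof
  fix y
  let ?g = "of_nat (card (CW N)) :: complex" and ?v = "\<lambda>\<mu>. at_D G cs (N + k) f (pv \<mu>)"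
  interpret W: group "W N" by (rule wr_group)
  \<comment> \<open>The sign of y, set to 0 where the coproduct vanishes, so that all cases share
    one formula.\<close>
  define c where "c = (if y \<in> CW k \<and> otype k y then wsgn k y else 0)"
  define Q where "Q = (\<lambda>\<sigma>. (\<Prod>b\<in>#\<sigma>. of_real (sqrt 2) * dual_val \<xi> \<gamma> b) * ?v (\<sigma> + wtype k y))"
  have "(\<Sum>x\<in>CW N. eta G \<xi> N x * scaled_chi G cs N \<gamma> x * co_fun N k f (inv\<^bsub>W N\<^esub> x, y)) =
    (\<Sum>x\<in>CW N. eta G \<xi> N (inv\<^bsub>W N\<^esub> x) * scaled_chi G cs N \<gamma> (inv\<^bsub>W N\<^esub> x) * co_fun N k f (x, y))"
    by (rule sum.reindex_bij_witness[of _ "\<lambda>x. inv\<^bsub>W N\<^esub> x" "\<lambda>x. inv\<^bsub>W N\<^esub> x"]) auto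
  also have "\<dots> = (\<Sum>x\<in>CW N. c * (if otype N x then Q (wtype N x) else 0))" (is "sum ?l _ = sum ?r _")
  proof (rule sum_cong)
    fix x assume x: "x \<in> CW N"
    note i = wr_inverse[OF x]
    have xi: "inv\<^bsub>W N\<^esub> x \<in> CW N" using x by simp
    show "?l x = ?r x"
    proof (cases "otype N x \<and> y \<in> CW k \<and> otype k y")
      case True
      have e: "eta G \<xi> N (inv\<^bsub>W N\<^esub> x) = (\<Prod>b\<in>#wtype N x. at_class \<xi> (class_inv G (fst b)))"
        unfolding eta_eq[OF xi] i(1) by (simp add: image_mset.compositionality comp_def lab_inv_def)
      have s: "scaled_chi G cs N \<gamma> (inv\<^bsub>W N\<^esub> x) = wsgn N x * (\<Prod>b\<in>#wtype N x. of_real (sqrt 2) * at_class \<gamma> (class_inv G (fst b)))"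
        unfolding scaled_chi_eq mk_class_def i(1) using True xi i(2,3)
        by (simp add: image_mset.compositionality comp_def lab_inv_def)
      have p: "(\<Prod>b\<in>#wtype N x. at_class \<xi> (class_inv G (fst b))) * (\<Prod>b\<in>#wtype N x. of_real (sqrt 2) * at_class \<gamma> (class_inv G (fst b))) =
        (\<Prod>b\<in>#wtype N x. of_real (sqrt 2) * dual_val \<xi> \<gamma> b)"
        unfolding prod_mset.distrib[symmetric] by (simp add: dual_val_def mult_ac)
      have "eta G \<xi> N (inv\<^bsub>W N\<^esub> x) * scaled_chi G cs N \<gamma> (inv\<^bsub>W N\<^esub> x) * co_fun N k f (x, y) =
        (wsgn N x * wsgn N x) * (wsgn k y * (((\<Prod>b\<in>#wtype N x. at_class \<xi> (class_inv G (fst b))) *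
          (\<Prod>b\<in>#wtype N x. of_real (sqrt 2) * at_class \<gamma> (class_inv G (fst b)))) * ?v (wtype N x + wtype k y)))"
        unfolding e s using True x by (simp add: co_fun_def mult_ac)
      thus ?thesis using True by (simp only: p wsgn_square[OF x] mult_1 c_def Q_def HOL.simp_thms if_True)
    next
      case False
      thus ?thesis by (auto simp: co_fun_def c_def)
    qed
  qed
  also have "\<dots> = c * (?g * (\<Sum>\<sigma>\<in>odd.msets N. odd.wt \<sigma> * Q \<sigma>))"
    unfolding sum_distrib_left[symmetric] by (subst sum_otype[of "\<lambda>x. x"]) simp_all
  finally have "wr_form G \<xi> N (scaled_chi G cs N \<gamma>) (\<lambda>x. coproduct G N k f (x, y)) = c * (\<Sum>\<sigma>\<in>odd.msets N. odd.wt \<sigma> * Q \<sigma>)"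
    using card_wr_nonzero[of N] by (simp add: wr_form_def Let_def coproduct_eq[OF f])
  thus "wr_form G \<xi> N (scaled_chi G cs N \<gamma>) (\<lambda>x. coproduct G N k f (x, y)) =
    mk_class k (\<lambda>\<tau>. \<Sum>\<sigma>\<in>odd.msets N. odd.wt \<sigma> * ((\<Prod>b\<in>#\<sigma>. of_real (sqrt 2) * dual_val \<xi> \<gamma> b) * at_D G cs (N + k) f (pv (\<sigma> + \<tau>)))) y"
    by (simp add: mk_class_def c_def Q_def)
qed

lemma ch_deg_zero [simp]: "ch_deg G cs n (\<lambda>x. 0) = 0"
  by (simp add: ch_deg_def at_D_def at_class_def)

lemma ch_eq:
  assumes "\<And>k. M \<le> k \<Longrightarrow> F k = (\<lambda>x. 0)"
  shows "ch G cs F = (\<Sum>k<M. ch_deg G cs k (F k))"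
  unfolding ch_def
proof (rule sum.mono_neutral_left)
  show "{n. F n \<noteq> (\<lambda>x. 0)} \<subseteq> {..<M}" using assms by (force simp: not_less)
  show "\<forall>i\<in>{..<M} - {n. F n \<noteq> (\<lambda>x. 0)}. ch_deg G cs i (F i) = 0" by simp
qed simp

lemma R_total_bound:
  assumes "F \<in> R_total G"
  obtains M where "\<And>k. M \<le> k \<Longrightarrow> F k = (\<lambda>x. 0)" "\<And>k. F k \<in> R_minus G k"
proof -
  have "finite {n. F n \<noteq> (\<lambda>x. 0)}" using assms by (simp add: R_total_def)
  then obtain M where M: "\<And>k. k \<in> {n. F n \<noteq> (\<lambda>x. 0)} \<Longrightarrow> k < M" using finite_nat_set_iff_bounded by auto
  have "F k = (\<lambda>x. 0)" if "M \<le> k" for k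
    using M[of k] that by (cases "F k = (\<lambda>x. 0)") auto
  moreover have "F k \<in> R_minus G k" for k using assms by (simp add: R_total_def)
  ultimately show ?thesis by (rule that)
qed

text \<open>The factor sqrt 2 per part of \<sigma> from \<open>chi\<close> and the one per part of
  \<tau> from \<open>ch\<close> together are the normalisation of F at \<sigma> + \<tau>. In this
  normalisation the operator is \<open>skew\<close>, with no further constants.\<close>

lemma ch_H_minus:
  assumes \<xi>: "\<xi> \<in> class_functions G" and \<gamma>: "\<gamma> \<in> class_functions G" and F: "F \<in> R_total G"
  shows "ch G cs (H_minus G cs \<xi> \<gamma> N F) = ops_exp (a_der \<xi> \<gamma>) N (ch G cs F)"
proof -
  obtain M where M: "\<And>k. M \<le> k \<Longrightarrow> F k = (\<lambda>x. 0)" "\<And>k. F k \<in> R_minus G k" using R_total_bound[OF F] by blast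
  define u where "u = (\<lambda>m \<mu>. of_real (sqrt 2) ^ size \<mu> * at_D G cs m (F m) (pv \<mu>))"
  have u0: "u m = (\<lambda>_. 0)" if "M \<le> m" for m using M(1)[OF that] by (simp add: u_def at_D_def at_class_def)
  have H: "H_minus G cs \<xi> \<gamma> N F k = mk_class k (\<lambda>\<tau>. \<Sum>\<sigma>\<in>odd.msets N. odd.wt \<sigma> *
      ((\<Prod>b\<in>#\<sigma>. of_real (sqrt 2) * dual_val \<xi> \<gamma> b) * at_D G cs (N + k) (F (N + k)) (pv (\<sigma> + \<tau>))))" for k
    unfolding H_minus_def by (rule H_minus_value[OF M(2)])
  have d: "ch_deg G cs k (H_minus G cs \<xi> \<gamma> N F k) = gen k (skew (dual_val \<xi> \<gamma>) N (u (N + k)))" for k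
    unfolding H ch_deg_mk_class
  proof (rule gen_cong)
    fix \<tau>
    have p: "(\<Prod>b\<in>#\<sigma>. of_real (sqrt 2) * dual_val \<xi> \<gamma> b) = of_real (sqrt 2) ^ size \<sigma> * (\<Prod>b\<in>#\<sigma>. dual_val \<xi> \<gamma> b)" for \<sigma> :: "('a set \<times> nat) multiset"
      unfolding prod_mset.distrib by (simp add: image_mset_const_eq)
    show "of_real (sqrt 2) ^ size \<tau> * (\<Sum>\<sigma>\<in>odd.msets N. odd.wt \<sigma> * ((\<Prod>b\<in>#\<sigma>. of_real (sqrt 2) * dual_val \<xi> \<gamma> b) *
        at_D G cs (N + k) (F (N + k)) (pv (\<sigma> + \<tau>)))) = skew (dual_val \<xi> \<gamma>) N (u (N + k)) \<tau>"
      unfolding skew_def u_def p sum_distrib_left by (rule sum.cong) (simp_all add: power_add mult_ac)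
  qed
  have z: "H_minus G cs \<xi> \<gamma> N F k = (\<lambda>x. 0)" if "M \<le> k" for k
    unfolding H using M(1)[of "N + k"] that by (simp add: at_D_def at_class_def mk_class_def cong: if_cong)
  have "ch G cs F = (\<Sum>k<M. gen k (u k))" using ch_eq[of M F, OF M(1)] by (simp add: ch_deg_gen u_def)
  moreover have "ch G cs (H_minus G cs \<xi> \<gamma> N F) = (\<Sum>k<M. gen k (skew (dual_val \<xi> \<gamma>) N (u (N + k))))"
    unfolding d[symmetric] by (rule ch_eq[OF z])
  ultimately show ?thesis using gen_exp_skew[OF \<xi> \<gamma>, of M u N, OF u0] by simp
qed

lemma ind_prod_zero:
  "ind_fun K H (phi G n m (tens (\<lambda>x. 0) g)) = (\<lambda>x. 0)" "ind_fun K H (phi G n m (tens f (\<lambda>x. 0))) = (\<lambda>x. 0)"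
proof -
  have p: "phi G n m (tens (\<lambda>x. 0) g) = (\<lambda>x. 0)" "phi G n m (tens f (\<lambda>x. 0)) = (\<lambda>x. 0)"
    by (simp_all add: phi_def tens_def fun_eq_iff split_def Let_def)
  have "ind_fun K H (\<lambda>x. 0) = (\<lambda>x. 0)" by (simp add: ind_fun_def res_fun_def fun_eq_iff)
  thus "ind_fun K H (phi G n m (tens (\<lambda>x. 0) g)) = (\<lambda>x. 0)" "ind_fun K H (phi G n m (tens f (\<lambda>x. 0))) = (\<lambda>x. 0)"
    unfolding p by simp_all
qed

lemma H_plus_value: "H_plus G cs \<gamma> N F L = (if N \<le> L then ind_prod N (L - N) (scaled_chi G cs N \<gamma>) (F (L - N)) else (\<lambda>x. 0))"
proof
  fix x
  have "H_plus G cs \<gamma> N F L x = (\<Sum>i\<le>L. if i = N then ind_prod N (L - N) (scaled_chi G cs N \<gamma>) (F (L - N)) x else 0)"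
    unfolding H_plus_def R_mult_def
  proof (rule sum_cong)
    fix i assume i: "i \<in> {..L}"
    show "ind_fun (W L) (young_sub G i (L - i)) (phi G i (L - i) (tens (if i = N then scaled_chi G cs N \<gamma> else (\<lambda>x. 0)) (F (L - i)))) x =
      (if i = N then ind_prod N (L - N) (scaled_chi G cs N \<gamma>) (F (L - N)) x else 0)"
    proof (cases "i = N")
      case True
      hence "N + (L - N) = L" using i by simp
      thus ?thesis using True by (simp add: ind_prod_def)
    qed (simp add: ind_prod_zero)
  qed
  thus "H_plus G cs \<gamma> N F L x = (if N \<le> L then ind_prod N (L - N) (scaled_chi G cs N \<gamma>) (F (L - N)) else (\<lambda>x. 0)) x" by simp
qed

text \<open>By multiplicativity of \<open>ch\<close> only the image of the scaled class function
  matters; there sqrt 2 from \<open>chi\<close> and sqrt 2 from \<open>ch\<close> give the 2 per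
  label in \<open>gen_exp_left\<close>.\<close>

lemma ch_H_plus:
  assumes \<gamma>: "\<gamma> \<in> class_functions G" and F: "F \<in> R_total G"
  shows "ch G cs (H_plus G cs \<gamma> N F) =
    ops_exp (\<lambda>n q. if odd n then fconst (2 / of_nat n) * (a_neg G n \<gamma> * q) else 0) N (ch G cs F)"
proof -
  obtain M where M: "\<And>k. M \<le> k \<Longrightarrow> F k = (\<lambda>x. 0)" "\<And>k. F k \<in> R_minus G k" using R_total_bound[OF F] by blast
  let ?s = "scaled_chi G cs N \<gamma>"
  have s: "?s \<in> R_minus G N" unfolding scaled_chi_eq by (rule mk_class_R_minus)
  have z: "H_plus G cs \<gamma> N F L = (\<lambda>x. 0)" if "N + M \<le> L" for L
  proof -
    have "F (L - N) = (\<lambda>x. 0)" using that by (intro M(1)) simp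
    thus ?thesis using that by (simp add: H_plus_value ind_prod_def ind_prod_zero)
  qed
  have "ch G cs (H_plus G cs \<gamma> N F) = (\<Sum>L<N + M. ch_deg G cs L (H_plus G cs \<gamma> N F L))" by (rule ch_eq[OF z])
  also have "\<dots> = (\<Sum>L\<in>{N..<N + M}. ch_deg G cs L (H_plus G cs \<gamma> N F L))"
    by (rule sum.mono_neutral_right) (auto simp: H_plus_value)
  also have "\<dots> = (\<Sum>k<M. ch_deg G cs (N + k) (H_plus G cs \<gamma> N F (N + k)))"
    by (rule sum.reindex_bij_witness[of _ "\<lambda>k. N + k" "\<lambda>L. L - N"]) auto
  also have "\<dots> = ch_deg G cs N ?s * (\<Sum>k<M. ch_deg G cs k (F k))"
    by (simp add: H_plus_value ch_ind_prod[OF s M(2)] sum_distrib_left)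
  also have "(\<Sum>k<M. ch_deg G cs k (F k)) = ch G cs F" by (rule ch_eq[OF M(1), symmetric])
  also have "ch_deg G cs N ?s = gen N (\<lambda>\<mu>. \<Prod>b\<in>#\<mu>. 2 * at_class \<gamma> (fst b))"
    unfolding scaled_chi_eq ch_deg_mk_class
  proof (rule gen_cong)
    fix \<mu>
    have "complex_of_real (sqrt 2) * of_real (sqrt 2) = 2" by (simp flip: of_real_mult)
    hence "(\<Prod>b\<in>#\<mu>. 2 * at_class \<gamma> (fst b)) = (\<Prod>b\<in>#\<mu>. of_real (sqrt 2) * (of_real (sqrt 2) * at_class \<gamma> (fst b)))"
      by (simp only: mult.assoc[symmetric])
    also have "\<dots> = (\<Prod>b\<in>#\<mu>. of_real (sqrt 2)) * (\<Prod>b\<in>#\<mu>. of_real (sqrt 2) * at_class \<gamma> (fst b))"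
      by (rule prod_mset.distrib)
    finally show "of_real (sqrt 2) ^ size \<mu> * (\<Prod>b\<in>#\<mu>. of_real (sqrt 2) * at_class \<gamma> (fst b)) = (\<Prod>b\<in>#\<mu>. 2 * at_class \<gamma> (fst b))"
      by (simp add: image_mset_const_eq)
  qed
  finally show ?thesis by (simp only: gen_exp_left[OF \<gamma>])
qed

section \<open>Surjectivity onto Fock space\<close>

definition gen_span :: "'a fpoly set" where
  "gen_span = {\<Sum>k<M. gen k (u k) | (M :: nat) u. True}"

lemma gen_spanI: "gen n u \<in> gen_span"
proof -
  have "(\<Sum>k<Suc n. gen k (if k = n then u else (\<lambda>_. 0))) = gen n u" by (simp add: if_distrib[of "gen _"])
  thus ?thesis unfolding gen_span_def by (intro CollectI exI[of _ "Suc n"] exI[of _ "\<lambda>k. if k = n then u else (\<lambda>_. 0)"]) simp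
qed

lemma gen_span_add: "p \<in> gen_span \<Longrightarrow> q \<in> gen_span \<Longrightarrow> p + q \<in> gen_span"
proof -
  assume "p \<in> gen_span" "q \<in> gen_span"
  then obtain M u M' u' where pq: "p = (\<Sum>k<(M :: nat). gen k (u k))" "q = (\<Sum>k<(M' :: nat). gen k (u' k))" unfolding gen_span_def by auto
  define v where "v = (\<lambda>k \<mu>. (if k < M then u k \<mu> else 0) + (if k < M' then u' k \<mu> else 0))"
  have i: "gen k (\<lambda>\<mu>. if b then f \<mu> else 0) = (if b then gen k f else 0)" for k b f by simp
  have "(\<Sum>k<M + M'. gen k (v k)) = (\<Sum>k<M + M'. if k < M then gen k (u k) else 0) + (\<Sum>k<M + M'. if k < M' then gen k (u' k) else 0)"
    unfolding v_def gen_add i sum.distrib ..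
  also have "(\<Sum>k<M + M'. if k < M then gen k (u k) else 0) = p" unfolding pq by (rule sum.mono_neutral_cong_right) auto
  also have "(\<Sum>k<M + M'. if k < M' then gen k (u' k) else 0) = q" unfolding pq by (rule sum.mono_neutral_cong_right) auto
  finally have "p + q = (\<Sum>k<M + M'. gen k (v k))" by simp
  thus ?thesis unfolding gen_span_def by blast
qed

lemma gen_span_scale: "p \<in> gen_span \<Longrightarrow> fconst c * p \<in> gen_span"
proof -
  assume "p \<in> gen_span"
  then obtain M u where p: "p = (\<Sum>k<(M :: nat). gen k (u k))" unfolding gen_span_def by auto
  have "fconst c * p = (\<Sum>k<M. gen k (\<lambda>\<mu>. c * u k \<mu>))" unfolding p sum_distrib_left by (simp add: gen_scale)
  thus ?thesis unfolding gen_span_def by auto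
qed

lemma gen_span_zero: "0 \<in> gen_span"
  using gen_spanI[of 0 "\<lambda>_. 0"] by simp

lemma gen_span_sum: "(\<And>i. i \<in> I \<Longrightarrow> f i \<in> gen_span) \<Longrightarrow> (\<Sum>i\<in>I. f i) \<in> gen_span"
  by (induction I rule: infinite_finite_induct) (simp_all add: gen_span_zero gen_span_add)

lemma wt_nonzero: "set_mset \<mu> \<subseteq> labels_odd \<Longrightarrow> odd.wt \<mu> \<noteq> 0"
  using odd.r_nz by (auto simp: odd.wt_def)

text \<open>The coefficient function is the indicator of \<mu> divided by its weight, which is not
  zero.\<close>

lemma avm_span:
  assumes "set_mset \<mu> \<subseteq> labels_odd" shows "avm \<mu> \<in> gen_span"
proof -
  have \<mu>: "\<mu> \<in> odd.msets (odd.weight \<mu>)" unfolding odd.msets_def using assms by simp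
  have "gen (odd.weight \<mu>) (\<lambda>\<nu>. if \<nu> = \<mu> then 1 / odd.wt \<mu> else 0) =
    (\<Sum>\<nu>\<in>odd.msets (odd.weight \<mu>). if \<nu> = \<mu> then fconst (odd.wt \<mu>) * (fconst (1 / odd.wt \<mu>) * avm \<mu>) else 0)"
    unfolding gen_def by (rule sum.cong) auto
  also have "\<dots> = fconst (odd.wt \<mu> * (1 / odd.wt \<mu>)) * avm \<mu>"
    using \<mu> odd.msets_finite by (simp add: fconst_mult mult.assoc del: mult_divide_mult_cancel_left_if times_divide_eq_right)
  also have "\<dots> = avm \<mu>" using wt_nonzero[OF assms] by simp
  finally show ?thesis using gen_spanI by metis
qed

lemma av_mult_span:
  assumes b: "b \<in> labels_odd" and p: "p \<in> gen_span" shows "av b * p \<in> gen_span"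
proof -
  obtain M u where p: "p = (\<Sum>k<(M :: nat). gen k (u k))" using p unfolding gen_span_def by auto
  have "av b * p = (\<Sum>k<M. \<Sum>\<mu>\<in>odd.msets k. fconst (odd.wt \<mu>) * (fconst (u k \<mu>) * avm (add_mset b \<mu>)))"
    unfolding p gen_def sum_distrib_left by (simp add: mult.left_commute)
  also have "\<dots> \<in> gen_span"
    by (intro gen_span_sum gen_span_scale avm_span) (use b in \<open>auto simp: odd.msets_def\<close>)
  finally show ?thesis .
qed

text \<open>Orthonormality of the irreducible characters inverts the definition of the class
  variables, so these generate every variable of Fock space.\<close>

lemma fvar_av:
  assumes \<beta>: "\<beta> \<in> irr_chars G"
  shows "fvar (k, \<beta>) = (\<Sum>c\<in>Cls. fconst (at_class \<beta> c / of_nat (centralizer_order G c)) * av (c, k))"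
proof -
  have "(\<Sum>c\<in>Cls. fconst (at_class \<beta> c / of_nat (centralizer_order G c)) * av (c, k)) =
    (\<Sum>c\<in>Cls. \<Sum>\<beta>'\<in>irr_chars G. fconst (at_class \<beta> c * at_class \<beta>' (class_inv G c) / of_nat (centralizer_order G c)) * fvar (k, \<beta>'))"
    by (simp add: av_def a_neg_class_def sum_distrib_left mult.assoc[symmetric] fconst_mult[symmetric])
  also have "\<dots> = (\<Sum>\<beta>'\<in>irr_chars G. \<Sum>c\<in>Cls. fconst (at_class \<beta> c * at_class \<beta>' (class_inv G c) / of_nat (centralizer_order G c)) * fvar (k, \<beta>'))"
    by (rule sum.swap)
  also have "\<dots> = (\<Sum>\<beta>'\<in>irr_chars G. fconst (inner \<beta> \<beta>') * fvar (k, \<beta>'))"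
  proof (rule sum_cong)
    fix \<beta>' assume "\<beta>' \<in> irr_chars G"
    thus "(\<Sum>c\<in>Cls. fconst (at_class \<beta> c * at_class \<beta>' (class_inv G c) / of_nat (centralizer_order G c)) * fvar (k, \<beta>')) = fconst (inner \<beta> \<beta>') * fvar (k, \<beta>')"
      by (simp only: inner_classes[OF irr_class_function[OF \<beta>] irr_class_function] fconst_sum sum_distrib_right)
  qed
  also have "\<dots> = (\<Sum>\<beta>'\<in>irr_chars G. if \<beta>' = \<beta> then fvar (k, \<beta>) else 0)"
    by (rule sum.cong) (auto simp: inner_irr[OF \<beta>])
  also have "\<dots> = fvar (k, \<beta>)" using \<beta> finite_irr_chars by simp
  finally show ?thesis by simp
qed

lemma fock_space_span: "p \<in> fock_space G \<Longrightarrow> p \<in> gen_span"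
proof (rule fpoly_add_induct[where p = p])
  fix \<mu> c assume p: "p \<in> fock_space G" and \<mu>: "\<mu> \<in> mkeys p"
  show "psing \<mu> c \<in> gen_span"
  proof (rule monomial_induct)
    have "gen 0 (\<lambda>_. c) = fconst c" by (simp add: gen_def odd.msets_zero)
    thus "fconst c \<in> gen_span" using gen_spanI by metis
  next
    fix v q assume v: "v \<in> mkeys \<mu>" and q: "q \<in> gen_span"
    obtain k \<beta> where kb: "v = (k, \<beta>)" by (rule prod.exhaust)
    have k: "odd k" "\<beta> \<in> irr_chars G" using p \<mu> v unfolding fock_space_def kb by auto
    show "fvar v * q \<in> gen_span"
      unfolding kb fvar_av[OF k(2)] sum_distrib_right mult.assoc
      by (intro gen_span_sum gen_span_scale av_mult_span q) (use k(1) in \<open>auto simp: labels_odd_def\<close>)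
  qed
qed (auto intro: gen_span_zero gen_span_add)

text \<open>Dividing the prescribed values by sqrt 2 per part undoes the normalisation of
  \<open>ch\<close>.\<close>

lemma gen_span_ch: "gen_span \<subseteq> ch G cs ` R_total G"
proof
  fix p assume "p \<in> gen_span"
  then obtain M u where p: "p = (\<Sum>k<(M :: nat). gen k (u k))" unfolding gen_span_def by auto
  define F where "F = (\<lambda>k. if k < M then mk_class k (\<lambda>\<mu>. u k \<mu> / of_real (sqrt 2) ^ size \<mu>) else (\<lambda>x. 0))"
  have z: "F k = (\<lambda>x. 0)" if "M \<le> k" for k using that by (simp add: F_def)
  have "mk_class k (\<lambda>_. 0) = (\<lambda>x. 0)" for k by (simp add: mk_class_def fun_eq_iff)
  hence "F k \<in> R_minus G k" for k using mk_class_R_minus[of k] mk_class_R_minus[of k "\<lambda>_. 0"] by (simp add: F_def)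
  moreover have "finite {n. F n \<noteq> (\<lambda>x. 0)}" by (rule finite_subset[of _ "{..<M}"]) (auto simp: F_def split: if_splits)
  ultimately have "F \<in> R_total G" by (simp add: R_total_def)
  moreover have "ch G cs F = p"
  proof -
    have "ch G cs F = (\<Sum>k<M. ch_deg G cs k (F k))" by (rule ch_eq[OF z])
    also have "\<dots> = p" unfolding p by (rule sum.cong) (simp_all add: F_def ch_deg_mk_class)
    finally show ?thesis .
  qed
  ultimately show "p \<in> ch G cs ` R_total G" by blast
qed

text \<open>\<open>ch_op\<close> works with some preimage of \<open>p\<close>. In
  \<open>ch_H_plus\<close> and \<open>ch_H_minus\<close> the right side depends on F only through
  \<open>ch G cs F\<close>, so any preimage serves once one exists.\<close>

lemma ch_surj:
  assumes "p \<in> fock_space G"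
  shows "inv_into (R_total G) (ch G cs) p \<in> R_total G" "ch G cs (inv_into (R_total G) (ch G cs) p) = p"
proof -
  have "p \<in> ch G cs ` R_total G" using fock_space_span[OF assms] gen_span_ch by blast
  thus "inv_into (R_total G) (ch G cs) p \<in> R_total G" "ch G cs (inv_into (R_total G) (ch G cs) p) = p"
    by (rule inv_into_into, rule f_inv_into_f)
qed

lemma virtual_character_class: "virtual_character G f \<Longrightarrow> f \<in> class_functions G"
proof -
  assume "virtual_character G f"
  then obtain k :: "('a \<Rightarrow> complex) \<Rightarrow> int" where k: "f = (\<lambda>x. \<Sum>\<beta>\<in>irr_chars G. of_int (k \<beta>) * \<beta> x)"
    unfolding virtual_character_def by blast
  have "\<beta> x = 0" if "\<beta> \<in> irr_chars G" "x \<notin> carrier G" for \<beta> x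
    using irr_class_function[OF that(1)] that(2) by (simp add: class_functions_def)
  hence "f x = 0" if "x \<notin> carrier G" for x using that by (simp add: k)
  moreover have "f (y \<otimes> x \<otimes> inv y) = f x" if "x \<in> carrier G" "y \<in> carrier G" for x y
    unfolding k
  proof (rule sum_cong)
    fix \<beta> assume "\<beta> \<in> irr_chars G"
    thus "of_int (k \<beta>) * \<beta> (y \<otimes> x \<otimes> inv y) = of_int (k \<beta>) * \<beta> x"
      using irr_class_function that by (simp add: class_functions_def)
  qed
  ultimately show ?thesis by (simp add: class_functions_def)
qed

end

theorem theorem7p3:
  fixes G :: "('a, 'b) monoid_scheme"
    and cs :: "'a set list"
    and \<xi> \<gamma> :: "'a \<Rightarrow> complex"
  assumes "group G" and "finite (carrier G)"
    and "class_order G cs"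
    and "virtual_character G \<xi>" and "self_dual G \<xi>"
    and "\<gamma> \<in> class_functions G"
  shows "(\<forall>N. \<forall>p\<in>fock_space G.
            ch_op G cs (H_plus G cs \<gamma> N) p =
            ops_exp (\<lambda>n q. if odd n then fconst (2 / of_nat n) * (a_neg G n \<gamma> * q) else 0) N p) \<and>
         (\<forall>N. \<forall>p\<in>fock_space G.
            ch_op G cs (H_minus G cs \<xi> \<gamma> N) p =
            ops_exp (\<lambda>n q. if odd n then fconst (2 / of_nat n) * a_pos G \<xi> n \<gamma> q else 0) N p)"
proof -
  interpret group G by fact
  interpret ordered_grp G cs by standard (use assms in auto)
  have "a_der \<xi> \<gamma> = (\<lambda>n q. if odd n then fconst (2 / of_nat n) * a_pos G \<xi> n \<gamma> q else 0)"
    by (simp add: fun_eq_iff a_der_def)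
  thus ?thesis
    using ch_H_plus[OF assms(6) ch_surj(1)] ch_H_minus[OF virtual_character_class[OF assms(4)] assms(6) ch_surj(1)]
    by (simp add: ch_op_def ch_surj(2))
qed

end
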